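(* Let $k$ be an algebraically closed field, and let $p:=\operatorname{char}k$ if this is positive and $p:=\infty$ otherwise. Let $G$ be a finite group with $|G|$ invertible in $k$. Let $$\ell:=\inf\{\dim W\mid W\text{ a simple }G\text{-module over }k,\ \dim W>1\}\in[2,\infty].$$ Assume $p\ge\frac{\beta_k(G)}{\ell}+1$. Then the regular representation $R$ of $G$ over $k$ has weakly universal invariants. In particular, $\beta_k(G)=\beta(k[R]^G)$.
   Context: Conventions: $\inf\emptyset=\infty$, and $\frac{\beta_k(G)}{\ell}=0$ if $\ell=\infty$; if $\operatorname{char}k=0$ the inequality on $p=\infty$ always holds. For an $\mathbb N$-graded commutative ring $A=\bigoplus_{d\ge0}A_d$ put $\beta(A):=\inf\{n\in\mathbb N\mid A\text{ is generated as a ring by }\bigoplus_{d=0}^nA_d\}$. $\beta_k(G):=\sup_A\beta(A^G)\in\mathbb N\cup\{\infty\}$, where $A$ runs through all $\mathbb N$-graded commutative $k$-algebras with a $G$-action (by degree-preserving $k$-algebra automorphisms) and with $\beta(A)\le1$. $k[W]$ denotes the ring of polynomial functions on a finite dimensional $G$-module $W$ over $k$, graded by degree. Generalized polarization: let $W=\bigoplus_iM_i^{\oplus m_i}$ be the isotypic decomposition of a finite dimensional $G$-module $W$ ($M_i$ pairwise non-isomorphic simple modules). Let $\overline{\mathcal P}_W\subseteq\operatorname{End}_k k[W]$ be the subalgebra generated by the following operators: for each $i$ with $\dim M_i>1$, the group $GL(m_i)=GL_{m_i}(k)$ acting on $M_i^{\oplus m_i}=M_i\otimes k^{m_i}$ via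 $k^{m_i}$; for each $i$ with $\dim M_i=1$, the algebra $\overline{\mathcal P}_{m_i}:=\operatorname{End}^{GL(M_i)}(k[M_i^{\oplus m_i}])$ of all $k$-linear endomorphisms of $k[M_i^{\oplus m_i}]$ commuting with $GL(M_i)$, where all these operators act on the corresponding tensor factor of $k[W]=\bigotimes_ik[M_i^{\oplus m_i}]$ and as the identity on the others. For $S\subseteq k[W]$ put $\overline{\mathrm{Pol}}^W(S):=\overline{\mathcal P}_W(S)$ (the $\overline{\mathcal P}_W$-submodule generated by $S$). If $V\subseteq W$ is a submodule, $\operatorname{Res}_V(S)$ is the set of restrictions to $V$ of the elements of $S\subseteq k[W]$. If $U$ is a quotient of $W$, $\operatorname{Ext}_U^W(S)$ is the set of pullbacks to $W$ of the elements of $S\subseteq k[U]$. A finite dimensional $G$-module $U$ has weakly universal invariants if for every finite dimensional $G$-module $V$ and every generating set $S$ of the $k$-algebra $k[U]^G$, the set $\operatorname{Res}_V\overline{\mathrm{Pol}}^{U\oplus V}\operatorname{Ext}_U^{U\oplus V}(S)$ generates the $k$-algebra $k[V]^G$. *)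

theory Defs
  imports
    "HOL-Algebra.Algebraic_Closure_Type"
    "HOL-Algebra.Group_Action"
    "HOL-Algebra.Generated_Rings"
    "HOL-Library.Function_Algebras"
    "HOL-Library.Product_Plus"
    "HOL-Library.Extended_Real"
    "Jordan_Normal_Form.Matrix"
begin

section \<open>Modules over a group\<close>

text \<open>
  The underlying vector space of a module is a subspace \<open>space M\<close> of an ambient vector space
  structure \<open>scal M\<close> on the additive group \<open>'v\<close>.  Following \<^locale>\<open>group_action\<close>, every
  \<open>act M g\<close> is extensional on \<open>space M\<close>.
\<close>

record ('k, 'g, 'v) gmod =
  space :: "'v set"
  scal :: "'k \<Rightarrow> 'v \<Rightarrow> 'v"
  act :: "'g \<Rightarrow> 'v \<Rightarrow> 'v"

definition is_gmod :: "('g, 'b) monoid_scheme \<Rightarrow> ('k::field, 'g, 'v::ab_group_add) gmod \<Rightarrow> bool" where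
  "is_gmod G M \<longleftrightarrow>
     vector_space (scal M) \<and> Modules.module.subspace (scal M) (space M) \<and>
     group_action G (space M) (act M) \<and>
     (\<forall>g\<in>carrier G. \<forall>x\<in>space M. \<forall>y\<in>space M. act M g (x + y) = act M g x + act M g y) \<and>
     (\<forall>g\<in>carrier G. \<forall>c. \<forall>x\<in>space M. act M g (scal M c x) = scal M c (act M g x))"

definition fin_dim :: "('k::field, 'g, 'v::ab_group_add) gmod \<Rightarrow> bool" where
  "fin_dim M \<longleftrightarrow> (\<exists>B. finite B \<and> space M \<subseteq> Modules.module.span (scal M) B)"

definition gdim :: "('k::field, 'g, 'v::ab_group_add) gmod \<Rightarrow> nat" where
  "gdim M = vector_space.dim (scal M) (space M)"

definition gsubmodule ::
    "('g, 'b) monoid_scheme \<Rightarrow> ('k::field, 'g, 'v::ab_group_add) gmod \<Rightarrow> 'v set \<Rightarrow> bool" where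
  "gsubmodule G M N \<longleftrightarrow> Modules.module.subspace (scal M) N \<and> N \<subseteq> space M \<and>
     (\<forall>g\<in>carrier G. \<forall>x\<in>N. act M g x \<in> N)"

definition subgmod :: "('k, 'g, 'v) gmod \<Rightarrow> 'v set \<Rightarrow> ('k, 'g, 'v) gmod" where
  "subgmod M N = M\<lparr>space := N, act := \<lambda>g. restrict (act M g) N\<rparr>"

definition simple_gmod ::
    "('g, 'b) monoid_scheme \<Rightarrow> ('k::field, 'g, 'v::ab_group_add) gmod \<Rightarrow> bool" where
  "simple_gmod G M \<longleftrightarrow> is_gmod G M \<and> space M \<noteq> {0} \<and>
     (\<forall>N. gsubmodule G M N \<longrightarrow> N = {0} \<or> N = space M)"

definition gmod_iso ::
    "('g, 'b) monoid_scheme \<Rightarrow> ('k::field, 'g, 'v::ab_group_add) gmod \<Rightarrow>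
     ('k, 'g, 'w::ab_group_add) gmod \<Rightarrow> ('v \<Rightarrow> 'w) \<Rightarrow> bool" where
  "gmod_iso G M N f \<longleftrightarrow> bij_betw f (space M) (space N) \<and>
     (\<forall>x\<in>space M. \<forall>y\<in>space M. f (x + y) = f x + f y) \<and>
     (\<forall>c. \<forall>x\<in>space M. f (scal M c x) = scal N c (f x)) \<and>
     (\<forall>g\<in>carrier G. \<forall>x\<in>space M. f (act M g x) = act N g (f x))"

definition regular_rep :: "('g, 'b) monoid_scheme \<Rightarrow> ('k::field, 'g, 'g \<Rightarrow> 'k) gmod" where
  "regular_rep G =
     \<lparr>space = {f. \<forall>h. h \<notin> carrier G \<longrightarrow> f h = 0},
      scal = (\<lambda>c f h. c * f h),
      act = (\<lambda>g. \<lambda>f\<in>{f. \<forall>h. h \<notin> carrier G \<longrightarrow> f h = 0}.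
                 \<lambda>h. if h \<in> carrier G then f (inv\<^bsub>G\<^esub> g \<otimes>\<^bsub>G\<^esub> h) else 0)\<rparr>"

definition gsum :: "('k, 'g, 'u) gmod \<Rightarrow> ('k, 'g, 'v) gmod \<Rightarrow> ('k, 'g, 'u \<times> 'v) gmod" where
  "gsum U V =
     \<lparr>space = space U \<times> space V,
      scal = (\<lambda>c (u, v). (scal U c u, scal V c v)),
      act = (\<lambda>g. \<lambda>(u, v)\<in>space U \<times> space V. (act U g u, act V g v))\<rparr>"

text \<open>\<open>dsum n N\<close> is \<open>N 0 \<oplus> \<dots> \<oplus> N (n - 1)\<close>; its elements are sequences vanishing from index \<open>n\<close> on.\<close>

definition dsum_space :: "nat \<Rightarrow> (nat \<Rightarrow> ('k, 'g, 'v::zero) gmod) \<Rightarrow> (nat \<Rightarrow> 'v) set" where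
  "dsum_space n N = {x. \<forall>i. if i < n then x i \<in> space (N i) else x i = 0}"

definition dsum ::
    "nat \<Rightarrow> (nat \<Rightarrow> ('k, 'g, 'v::zero) gmod) \<Rightarrow> ('k, 'g, nat \<Rightarrow> 'v) gmod" where
  "dsum n N =
     \<lparr>space = dsum_space n N,
      scal = (\<lambda>c x i. scal (N i) c (x i)),
      act = (\<lambda>g. \<lambda>x\<in>dsum_space n N. \<lambda>i. if i < n then act (N i) g (x i) else 0)\<rparr>"

abbreviation gpow :: "('k, 'g, 'v::zero) gmod \<Rightarrow> nat \<Rightarrow> ('k, 'g, nat \<Rightarrow> 'v) gmod" where
  "gpow M m \<equiv> dsum m (\<lambda>_. M)"


section \<open>Graded algebras and \<open>\<beta>\<close>\<close>

abbreviation base_field :: "'k::field ring" where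
  "base_field \<equiv> ring_of_type_algebra"

text \<open>\<open>A d\<close> is the homogeneous component of degree \<open>d\<close>.\<close>

definition graded_algebra :: "('k::field, 'a) module \<Rightarrow> (nat \<Rightarrow> 'a set) \<Rightarrow> bool" where
  "graded_algebra R A \<longleftrightarrow>
     algebra base_field R \<and> cring R \<and>
     (\<forall>d. A d \<subseteq> carrier R \<and> \<zero>\<^bsub>R\<^esub> \<in> A d \<and>
          (\<forall>a\<in>A d. \<forall>b\<in>A d. a \<oplus>\<^bsub>R\<^esub> b \<in> A d) \<and> (\<forall>c. \<forall>a\<in>A d. c \<odot>\<^bsub>R\<^esub> a \<in> A d)) \<and>
     \<one>\<^bsub>R\<^esub> \<in> A 0 \<and>
     (\<forall>d e. \<forall>a\<in>A d. \<forall>b\<in>A e. a \<otimes>\<^bsub>R\<^esub> b \<in> A (d + e)) \<and>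
     (\<forall>a\<in>carrier R. \<exists>!x. (\<forall>d. x d \<in> A d) \<and> finite {d. x d \<noteq> \<zero>\<^bsub>R\<^esub>} \<and>
                          a = finsum R x {d. x d \<noteq> \<zero>\<^bsub>R\<^esub>})"

definition graded_G_action ::
    "('g, 'b) monoid_scheme \<Rightarrow> ('k::field, 'a) module \<Rightarrow> (nat \<Rightarrow> 'a set) \<Rightarrow> ('g \<Rightarrow> 'a \<Rightarrow> 'a) \<Rightarrow> bool" where
  "graded_G_action G R A \<phi> \<longleftrightarrow>
     group_action G (carrier R) \<phi> \<and>
     (\<forall>g\<in>carrier G. \<phi> g \<in> Ring.ring_hom R R \<and>
        (\<forall>c. \<forall>a\<in>carrier R. \<phi> g (c \<odot>\<^bsub>R\<^esub> a) = c \<odot>\<^bsub>R\<^esub> \<phi> g a) \<and>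
        (\<forall>d. \<forall>a\<in>A d. \<phi> g a \<in> A d))"

definition fixed_alg ::
    "('g, 'b) monoid_scheme \<Rightarrow> ('k, 'a) module \<Rightarrow> ('g \<Rightarrow> 'a \<Rightarrow> 'a) \<Rightarrow> ('k, 'a) module" where
  "fixed_alg G R \<phi> = R\<lparr>carrier := {a \<in> carrier R. \<forall>g\<in>carrier G. \<phi> g a = a}\<rparr>"

definition comp_upto :: "('k, 'a) module \<Rightarrow> (nat \<Rightarrow> 'a set) \<Rightarrow> nat \<Rightarrow> 'a set" where
  "comp_upto R A n = {finsum R x {..n} | x. \<forall>d\<le>n. x d \<in> A d}"

definition beta :: "('k, 'a) module \<Rightarrow> (nat \<Rightarrow> 'a set) \<Rightarrow> enat" where
  "beta R A = Inf {enat n | n. generate_ring R (comp_upto R A n) = carrier R}"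

definition beta_fixed ::
    "('g, 'b) monoid_scheme \<Rightarrow> ('k, 'a) module \<Rightarrow> (nat \<Rightarrow> 'a set) \<Rightarrow> ('g \<Rightarrow> 'a \<Rightarrow> 'a) \<Rightarrow> enat" where
  "beta_fixed G R A \<phi> =
     beta (fixed_alg G R \<phi>) (\<lambda>d. A d \<inter> carrier (fixed_alg G R \<phi>))"

text \<open>
  The supremum ranges over the algebras whose carrier is contained in \<open>'a\<close>, which serves as the
  universe of algebras; it must not be too small (see \<open>large_universe\<close>).
\<close>

definition beta_grp ::
    "'k::field itself \<Rightarrow> 'a itself \<Rightarrow> ('g, 'b) monoid_scheme \<Rightarrow> enat" where
  "beta_grp _ _ G =
     Sup {beta_fixed G R A \<phi> | (R :: ('k, 'a) module) A \<phi>.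
            graded_algebra R A \<and> graded_G_action G R A \<phi> \<and> beta R A \<le> 1}"

text \<open>
  For infinite \<open>'k\<close>, every finitely generated \<open>'k\<close>-algebra has an isomorphic copy with carrier in a
  type \<open>'a\<close> into which \<open>'k\<close> embeds, and the supremum in \<open>beta_grp\<close> is not changed by restricting
  it to these algebras.
\<close>

definition large_universe :: "'k itself \<Rightarrow> 'a itself \<Rightarrow> bool" where
  "large_universe _ _ \<longleftrightarrow> (\<exists>f :: 'k \<Rightarrow> 'a. inj f)"

text \<open>
  Simple modules over a finite group are finite dimensional, hence isomorphic to modules whose
  underlying space is a subspace of \<open>nat \<Rightarrow> 'k\<close>.
\<close>

definition ell :: "'k::field itself \<Rightarrow> ('g, 'b) monoid_scheme \<Rightarrow> enat" where
  "ell _ G = Inf {enat (gdim W) | W :: ('k, 'g, nat \<Rightarrow> 'k) gmod.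
                    simple_gmod G W \<and> fin_dim W \<and> gdim W > 1}"

definition char_or_infinity :: "'k::field itself \<Rightarrow> enat" where
  "char_or_infinity _ = (if CHAR('k) > 0 then enat CHAR('k) else \<infinity>)"


section \<open>Polynomial functions\<close>

definition linear_form :: "('k::field, 'g, 'w::ab_group_add) gmod \<Rightarrow> ('w \<Rightarrow> 'k) \<Rightarrow> bool" where
  "linear_form W l \<longleftrightarrow>
     (\<forall>x\<in>space W. \<forall>y\<in>space W. l (x + y) = l x + l y) \<and>
     (\<forall>c. \<forall>x\<in>space W. l (scal W c x) = c * l x)"

text \<open>Polynomial functions are represented extensionally, i.e. restricted to \<open>space W\<close>.\<close>

inductive_set polyfun :: "('k::field, 'g, 'w::ab_group_add) gmod \<Rightarrow> ('w \<Rightarrow> 'k) set"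
  for W where
  const: "(\<lambda>x\<in>space W. c) \<in> polyfun W"
| form: "linear_form W l \<Longrightarrow> restrict l (space W) \<in> polyfun W"
| add: "p \<in> polyfun W \<Longrightarrow> q \<in> polyfun W \<Longrightarrow> (\<lambda>x\<in>space W. p x + q x) \<in> polyfun W"
| mult: "p \<in> polyfun W \<Longrightarrow> q \<in> polyfun W \<Longrightarrow> (\<lambda>x\<in>space W. p x * q x) \<in> polyfun W"

definition polyring ::
    "('k::field, 'g, 'w::ab_group_add) gmod \<Rightarrow> ('k, 'w \<Rightarrow> 'k) module" where
  "polyring W =
     \<lparr>carrier = polyfun W,
      monoid.mult = (\<lambda>p q. \<lambda>x\<in>space W. p x * q x), one = (\<lambda>x\<in>space W. 1),
      zero = (\<lambda>x\<in>space W. 0), add = (\<lambda>p q. \<lambda>x\<in>space W. p x + q x),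
      module.smult = (\<lambda>c p. \<lambda>x\<in>space W. c * p x)\<rparr>"

definition poly_comp ::
    "('k::field, 'g, 'w::ab_group_add) gmod \<Rightarrow> nat \<Rightarrow> ('w \<Rightarrow> 'k) set" where
  "poly_comp W d =
     {(\<lambda>x\<in>space W. \<Sum>j<n. c j * (\<Prod>i<d. l j i x)) | (n::nat) c l.
        \<forall>j<n. \<forall>i<d. linear_form W (l j i)}"

definition poly_act ::
    "('g, 'b) monoid_scheme \<Rightarrow> ('k::field, 'g, 'w::ab_group_add) gmod \<Rightarrow>
     'g \<Rightarrow> ('w \<Rightarrow> 'k) \<Rightarrow> 'w \<Rightarrow> 'k" where
  "poly_act G W g = (\<lambda>p\<in>polyfun W. \<lambda>x\<in>space W. p (act W (inv\<^bsub>G\<^esub> g) x))"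

abbreviation poly_inv ::
    "('g, 'b) monoid_scheme \<Rightarrow> ('k::field, 'g, 'w::ab_group_add) gmod \<Rightarrow> ('k, 'w \<Rightarrow> 'k) module" where
  "poly_inv G W \<equiv> fixed_alg G (polyring W) (poly_act G W)"

definition beta_poly_inv ::
    "('g, 'b) monoid_scheme \<Rightarrow> ('k::field, 'g, 'w::ab_group_add) gmod \<Rightarrow> enat" where
  "beta_poly_inv G W = beta_fixed G (polyring W) (poly_comp W) (poly_act G W)"

definition generates_algebra :: "('k, 'a) module \<Rightarrow> 'a set \<Rightarrow> bool" where
  "generates_algebra R S \<longleftrightarrow> S \<subseteq> carrier R \<and>
     \<Inter>{B. S \<subseteq> B \<and> subring B R \<and> (\<forall>c. \<forall>b\<in>B. c \<odot>\<^bsub>R\<^esub> b \<in> B)} = carrier R"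


section \<open>Generalized polarization\<close>

definition poly_end ::
    "('k::field, 'g, 'w::ab_group_add) gmod \<Rightarrow> (('w \<Rightarrow> 'k) \<Rightarrow> 'w \<Rightarrow> 'k) set" where
  "poly_end W = {T \<in> polyfun W \<rightarrow>\<^sub>E polyfun W.
     (\<forall>p\<in>polyfun W. \<forall>q\<in>polyfun W. T (p \<oplus>\<^bsub>polyring W\<^esub> q) = T p \<oplus>\<^bsub>polyring W\<^esub> T q) \<and>
     (\<forall>c. \<forall>p\<in>polyfun W. T (c \<odot>\<^bsub>polyring W\<^esub> p) = c \<odot>\<^bsub>polyring W\<^esub> T p)}"

definition pullback_op ::
    "('k::field, 'g, 'w::ab_group_add) gmod \<Rightarrow> ('w \<Rightarrow> 'w) \<Rightarrow> ('w \<Rightarrow> 'k) \<Rightarrow> 'w \<Rightarrow> 'k" where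
  "pullback_op W t = (\<lambda>p\<in>polyfun W. \<lambda>x\<in>space W. p (t x))"

inductive_set op_algebra ::
    "('k::field, 'g, 'w::ab_group_add) gmod \<Rightarrow> (('w \<Rightarrow> 'k) \<Rightarrow> 'w \<Rightarrow> 'k) set \<Rightarrow>
     (('w \<Rightarrow> 'k) \<Rightarrow> 'w \<Rightarrow> 'k) set"
  for W Q where
  ident: "(\<lambda>p\<in>polyfun W. p) \<in> op_algebra W Q"
| base: "T \<in> Q \<Longrightarrow> T \<in> op_algebra W Q"
| add: "T \<in> op_algebra W Q \<Longrightarrow> T' \<in> op_algebra W Q \<Longrightarrow>
          (\<lambda>p\<in>polyfun W. T p \<oplus>\<^bsub>polyring W\<^esub> T' p) \<in> op_algebra W Q"
| smult: "T \<in> op_algebra W Q \<Longrightarrow> (\<lambda>p\<in>polyfun W. c \<odot>\<^bsub>polyring W\<^esub> T p) \<in> op_algebra W Q"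
| comp: "T \<in> op_algebra W Q \<Longrightarrow> T' \<in> op_algebra W Q \<Longrightarrow>
          (\<lambda>p\<in>polyfun W. T (T' p)) \<in> op_algebra W Q"

inductive_set op_submodule ::
    "('k::field, 'g, 'w::ab_group_add) gmod \<Rightarrow> (('w \<Rightarrow> 'k) \<Rightarrow> 'w \<Rightarrow> 'k) set \<Rightarrow>
     ('w \<Rightarrow> 'k) set \<Rightarrow> ('w \<Rightarrow> 'k) set"
  for W P S where
  zero: "\<zero>\<^bsub>polyring W\<^esub> \<in> op_submodule W P S"
| base: "s \<in> S \<Longrightarrow> s \<in> op_submodule W P S"
| add: "p \<in> op_submodule W P S \<Longrightarrow> q \<in> op_submodule W P S \<Longrightarrow>
          p \<oplus>\<^bsub>polyring W\<^esub> q \<in> op_submodule W P S"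
| oper: "T \<in> P \<Longrightarrow> p \<in> op_submodule W P S \<Longrightarrow> T p \<in> op_submodule W P S"

text \<open>
  The matrix \<open>a\<close> acting on \<open>M\<^bsup>m\<^esup> = M \<otimes> k\<^bsup>m\<^esup>\<close> through the second factor, and a map \<open>h\<close> acting
  diagonally, i.e. through the first factor.
\<close>

definition mat_act ::
    "('k::field, 'g, 'v::ab_group_add) gmod \<Rightarrow> nat \<Rightarrow> 'k mat \<Rightarrow> (nat \<Rightarrow> 'v) \<Rightarrow> nat \<Rightarrow> 'v" where
  "mat_act M m a x = (\<lambda>j. if j < m then \<Sum>l<m. scal M (a $$ (j, l)) (x l) else 0)"

definition diag_act :: "nat \<Rightarrow> ('v \<Rightarrow> 'v) \<Rightarrow> (nat \<Rightarrow> 'v) \<Rightarrow> nat \<Rightarrow> 'v::zero" where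
  "diag_act m h x = (\<lambda>j. if j < m then h (x j) else 0)"

definition GL_space :: "('k::field, 'g, 'v::ab_group_add) gmod \<Rightarrow> ('v \<Rightarrow> 'v) set" where
  "GL_space M = {h. bij_betw h (space M) (space M) \<and>
     (\<forall>x\<in>space M. \<forall>y\<in>space M. h (x + y) = h x + h y) \<and>
     (\<forall>c. \<forall>x\<in>space M. h (scal M c x) = scal M c (h x))}"

text \<open>
  A group element \<open>a\<close> acts on functions by \<open>p \<mapsto> p \<circ> a\<^bsup>-1\<^esup>\<close>. The inverse can be dropped below because
  \<open>a\<close> ranges over a whole group.
\<close>

definition factor_ops ::
    "('k::field, 'g, 'v::ab_group_add) gmod \<Rightarrow> nat \<Rightarrow>
     (((nat \<Rightarrow> 'v) \<Rightarrow> 'k) \<Rightarrow> (nat \<Rightarrow> 'v) \<Rightarrow> 'k) set" where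
  "factor_ops M m =
     (if gdim M > 1
      then {pullback_op (gpow M m) (mat_act M m a) | a. a \<in> carrier_mat m m \<and> invertible_mat a}
      else {T \<in> poly_end (gpow M m). \<forall>h\<in>GL_space M. \<forall>p\<in>polyfun (gpow M m).
              T (pullback_op (gpow M m) (diag_act m h) p) =
              pullback_op (gpow M m) (diag_act m h) (T p)})"

text \<open>
  \<open>W = M\<^sub>0\<^bsup>m\<^sub>0\<^esup> \<oplus> \<dots> \<oplus> M\<^bsub>r-1\<^esub>\<^bsup>m\<^bsub>r-1\<^esub>\<^esup>\<close> via the isomorphism \<open>\<Phi>\<close>. As every simple constituent of \<open>W\<close>
  occurs as a submodule, the representatives \<open>M i\<close> are chosen inside \<open>W\<close>.
\<close>

definition isotypic_decomp ::
    "('g, 'b) monoid_scheme \<Rightarrow> ('k::field, 'g, 'w::ab_group_add) gmod \<Rightarrow> nat \<Rightarrow> (nat \<Rightarrow> 'w set) \<Rightarrow>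
     (nat \<Rightarrow> nat) \<Rightarrow> ((nat \<Rightarrow> nat \<Rightarrow> 'w) \<Rightarrow> 'w) \<Rightarrow> bool" where
  "isotypic_decomp G W r M m \<Phi> \<longleftrightarrow>
     (\<forall>i<r. gsubmodule G W (M i) \<and> simple_gmod G (subgmod W (M i))) \<and>
     (\<forall>i<r. \<forall>j<r. i \<noteq> j \<longrightarrow> \<not> (\<exists>f. gmod_iso G (subgmod W (M i)) (subgmod W (M j)) f)) \<and>
     gmod_iso G (dsum r (\<lambda>i. gpow (subgmod W (M i)) (m i))) W \<Phi>"

definition coords ::
    "('k::field, 'g, 'w::ab_group_add) gmod \<Rightarrow> nat \<Rightarrow> (nat \<Rightarrow> 'w set) \<Rightarrow> (nat \<Rightarrow> nat) \<Rightarrow>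
     ((nat \<Rightarrow> nat \<Rightarrow> 'w) \<Rightarrow> 'w) \<Rightarrow> 'w \<Rightarrow> nat \<Rightarrow> nat \<Rightarrow> 'w" where
  "coords W r M m \<Phi> = inv_into (space (dsum r (\<lambda>i. gpow (subgmod W (M i)) (m i)))) \<Phi>"

text \<open>
  The operator on \<open>k[W] = k[M\<^sub>0\<^bsup>m\<^sub>0\<^esup>] \<otimes> \<dots> \<otimes> k[M\<^bsub>r-1\<^esub>\<^bsup>m\<^bsub>r-1\<^esub>\<^esup>]\<close> given by \<open>T\<close> on the \<open>i\<close>-th tensor factor
  and by the identity on the others. It is characterized by its values on pure tensors.
\<close>

definition acts_on_factor ::
    "('k::field, 'g, 'w::ab_group_add) gmod \<Rightarrow> nat \<Rightarrow> (nat \<Rightarrow> 'w set) \<Rightarrow> (nat \<Rightarrow> nat) \<Rightarrow>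
     ((nat \<Rightarrow> nat \<Rightarrow> 'w) \<Rightarrow> 'w) \<Rightarrow> nat \<Rightarrow> (((nat \<Rightarrow> 'w) \<Rightarrow> 'k) \<Rightarrow> (nat \<Rightarrow> 'w) \<Rightarrow> 'k) \<Rightarrow>
     (('w \<Rightarrow> 'k) \<Rightarrow> 'w \<Rightarrow> 'k) \<Rightarrow> bool" where
  "acts_on_factor W r M m \<Phi> i T Q \<longleftrightarrow> Q \<in> poly_end W \<and>
     (\<forall>f. (\<forall>l<r. f l \<in> polyfun (gpow (subgmod W (M l)) (m l))) \<longrightarrow>
        Q (\<lambda>w\<in>space W. \<Prod>l<r. f l (coords W r M m \<Phi> w l)) =
        (\<lambda>w\<in>space W. \<Prod>l<r. (if l = i then T (f l) else f l) (coords W r M m \<Phi> w l)))"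

definition pol_algebra ::
    "('k::field, 'g, 'w::ab_group_add) gmod \<Rightarrow> nat \<Rightarrow> (nat \<Rightarrow> 'w set) \<Rightarrow> (nat \<Rightarrow> nat) \<Rightarrow>
     ((nat \<Rightarrow> nat \<Rightarrow> 'w) \<Rightarrow> 'w) \<Rightarrow> (('w \<Rightarrow> 'k) \<Rightarrow> 'w \<Rightarrow> 'k) set" where
  "pol_algebra W r M m \<Phi> =
     op_algebra W {Q. \<exists>i<r. \<exists>T\<in>factor_ops (subgmod W (M i)) (m i). acts_on_factor W r M m \<Phi> i T Q}"

definition Pol ::
    "('k::field, 'g, 'w::ab_group_add) gmod \<Rightarrow> nat \<Rightarrow> (nat \<Rightarrow> 'w set) \<Rightarrow> (nat \<Rightarrow> nat) \<Rightarrow>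
     ((nat \<Rightarrow> nat \<Rightarrow> 'w) \<Rightarrow> 'w) \<Rightarrow> ('w \<Rightarrow> 'k) set \<Rightarrow> ('w \<Rightarrow> 'k) set" where
  "Pol W r M m \<Phi> S = op_submodule W (pol_algebra W r M m \<Phi>) S"

text \<open>
  \<open>Ext\<close> and \<open>Res\<close> for \<open>U\<close> as the quotient of \<open>U \<oplus> V\<close> by \<open>V\<close> and \<open>V\<close> as the submodule \<open>0 \<oplus> V\<close>.
\<close>

definition Ext_sum ::
    "('k, 'g, 'u) gmod \<Rightarrow> ('k, 'g, 'v) gmod \<Rightarrow> ('u \<Rightarrow> 'k) set \<Rightarrow> ('u \<times> 'v \<Rightarrow> 'k) set" where
  "Ext_sum U V S = (\<lambda>p. \<lambda>w\<in>space (gsum U V). p (fst w)) ` S"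

definition Res_sum :: "('k, 'g, 'v) gmod \<Rightarrow> ('u::zero \<times> 'v \<Rightarrow> 'k) set \<Rightarrow> ('v \<Rightarrow> 'k) set" where
  "Res_sum V S = (\<lambda>p. \<lambda>v\<in>space V. p (0, v)) ` S"

text \<open>
  The modules \<open>V\<close> range over those with underlying space in the type \<open>'v\<close>. The isotypic decomposition
  is unique up to automorphisms of \<open>U \<oplus> V\<close>; the property is required for every choice, and a choice is
  required to exist, so that the condition is never vacuous.
\<close>

definition weakly_universal_invariants ::
    "'v::ab_group_add itself \<Rightarrow> ('g, 'b) monoid_scheme \<Rightarrow> ('k::field, 'g, 'u::ab_group_add) gmod \<Rightarrow> bool" where
  "weakly_universal_invariants _ G U \<longleftrightarrow>
     is_gmod G U \<and> fin_dim U \<and>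
     (\<forall>V :: ('k, 'g, 'v) gmod. is_gmod G V \<and> fin_dim V \<longrightarrow>
        (\<exists>r M m \<Phi>. isotypic_decomp G (gsum U V) r M m \<Phi>) \<and>
        (\<forall>r M m \<Phi>. isotypic_decomp G (gsum U V) r M m \<Phi> \<longrightarrow>
           (\<forall>S. generates_algebra (poly_inv G U) S \<longrightarrow>
              generates_algebra (poly_inv G V)
                (Res_sum V (Pol (gsum U V) r M m \<Phi> (Ext_sum U V S))))))"

end

theory Submission
  imports Defs
begin

text \<open>
  Let \<open>W = R \<oplus> V\<close> and let \<open>S\<close> be a set of functions on \<open>W\<close> that is stable under the automorphisms of the
  \<open>G\<close>-module \<open>W\<close> and under the operators \<open>qop\<close>, which extract the part of a given degree in a
  one-dimensional constituent and replace it by an arbitrary product of linear forms.  If the algebra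
  generated by \<open>S\<close> contains the pullback of \<open>k[R]\<^sup>G\<close>, then applying the Reynolds operator reduces the claim
  \<open>k[V]\<^sup>G \<subseteq> Res (alg S)\<close> to the case where it contains all of \<open>k[R]\<close>.  The transvections of \<open>W\<close> given by
  homomorphisms \<open>V \<rightarrow> R\<close>, i.e. by linear forms \<open>\<lambda>\<close> on \<open>V\<close>, then yield all the functions
  \<open>v \<mapsto> \<Prod>\<^sub>s \<lambda> (a\<^sub>s v)\<close> with \<open>a\<^sub>s\<close> in the group algebra.  Taking matrix units for the \<open>a\<^sub>s\<close> and polarizing in
  \<open>\<lambda>\<close> gives every monomial in which each matrix unit occurs fewer than \<open>p\<close> times, and the matrix units move
  the letters of a word within an isotypic type.  A type of dimension \<open>n\<close> has \<open>n\<close> letters, so that words of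
  length at most \<open>n (p - 1)\<close> are reached; this is where \<open>p \<ge> \<beta> / \<ell> + 1\<close> enters.

  Taking the invariants of degree at most \<open>\<beta> (k[R]\<^sup>G)\<close> on \<open>W\<close> for \<open>S\<close> bounds \<open>\<beta> (k[V]\<^sup>G)\<close> for all \<open>V\<close>, and
  finitely many elements of an algebra generated in degree at most 1 lie in the equivariant image of such a
  \<open>k[V]\<close>.
\<close>


section \<open>Modules over a finite group\<close>

text \<open>The obstacle in characteristic p is that polarizing a q-fold factor produces the scalar
  q, so one linear form yields only words in which no letter occurs p times. A type of dimension n
  supplies n letters, the matrix units of one row, over which a repeated letter can be spread. In
  the worst case all letters of a word have the same type; this gives the condition d <= n (p - 1)
  for every n > 1 that occurs, and n >= \<ell> turns all of them into one inequality. Only degrees d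
  up to \<beta> matter, as these invariants generate k[V]^G.

  A one-dimensional type has a single letter and is not seen by \<ell>. This is where generalized
  polarization exceeds GL(m): every operator commuting with the scalars is available, in particular
  one that reads off a coefficient of degree d and multiplies by d new linear forms.

  Letters are moved by substituting (1 + t e) v for v, with e a matrix unit, and taking the
  coefficient of t. This substitution is in general not equivariant; it is therefore built into the
  subspace \<open>N\<close> of \<open>words_in_Res\<close> by a quantifier over the group
  algebra.\<close>

lemma group_actionI:
 assumes "group G"
  and ext: "\<And>g. g \<in> carrier G \<Longrightarrow> \<phi> g \<in> extensional E"
  and cl: "\<And>g x. g \<in> carrier G \<Longrightarrow> x \<in> E \<Longrightarrow> \<phi> g x \<in> E"
  and one: "\<And>x. x \<in> E \<Longrightarrow> \<phi> \<one>\<^bsub>G\<^esub> x = x"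
  and mult: "\<And>g h x. g \<in> carrier G \<Longrightarrow> h \<in> carrier G \<Longrightarrow> x \<in> E \<Longrightarrow> \<phi> (g \<otimes>\<^bsub>G\<^esub> h) x = \<phi> g (\<phi> h x)"
 shows "group_action G E \<phi>"
proof -
 interpret group G by fact
 have bij: "\<phi> g \<in> Bij E" if g: "g \<in> carrier G" for g
 proof -
  have "bij_betw (\<phi> g) E E"
  proof (rule bij_betw_byWitness[where f' = "\<phi> (inv\<^bsub>G\<^esub> g)"])
   show "\<forall>a\<in>E. \<phi> (inv\<^bsub>G\<^esub> g) (\<phi> g a) = a" using g mult[symmetric] one by (simp add: l_inv)
   show "\<forall>a'\<in>E. \<phi> g (\<phi> (inv\<^bsub>G\<^esub> g) a') = a'" using g mult[symmetric] one by (simp add: r_inv)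
  qed (use g cl in auto)
  then show ?thesis using ext[OF g] by (simp add: Bij_def)
 qed
 have "\<phi> \<in> hom G (BijGroup E)"
 proof (rule homI)
  fix x y assume xy: "x \<in> carrier G" "y \<in> carrier G"
  show "\<phi> (x \<otimes>\<^bsub>G\<^esub> y) = \<phi> x \<otimes>\<^bsub>BijGroup E\<^esub> \<phi> y"
   using xy bij ext[of "x \<otimes>\<^bsub>G\<^esub> y"] by (auto simp: BijGroup_def compose_def mult extensional_def fun_eq_iff)
 qed (use bij in \<open>simp add: BijGroup_def\<close>)
 then show ?thesis by (simp add: group_action_def group_hom_def group_hom_axioms_def group_BijGroup is_group)
qed

text \<open>Linearity is relative to the subspaces \<open>space M\<close> and
  \<open>space N\<close>; values outside are arbitrary, so that the extensional maps
  \<open>act M g\<close> qualify.\<close>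

definition lin :: "('k::field, 'g, 'v::ab_group_add) gmod \<Rightarrow> ('k, 'g, 'w::ab_group_add) gmod \<Rightarrow> ('v \<Rightarrow> 'w) \<Rightarrow> bool" where
 "lin M N f \<longleftrightarrow> (\<forall>x\<in>space M. f x \<in> space N) \<and>
   (\<forall>x\<in>space M. \<forall>y\<in>space M. f (x + y) = f x + f y) \<and>
   (\<forall>c. \<forall>x\<in>space M. f (scal M c x) = scal N c (f x))"

definition ghom :: "('g, 'b) monoid_scheme \<Rightarrow> ('k::field, 'g, 'v::ab_group_add) gmod \<Rightarrow> ('k, 'g, 'w::ab_group_add) gmod \<Rightarrow> ('v \<Rightarrow> 'w) \<Rightarrow> bool" where
 "ghom G M N f \<longleftrightarrow> lin M N f \<and> (\<forall>g\<in>carrier G. \<forall>x\<in>space M. f (act M g x) = act N g (f x))"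

lemma gmod_iso_alt: "gmod_iso G M N f \<longleftrightarrow> ghom G M N f \<and> bij_betw f (space M) (space N)"
 unfolding gmod_iso_def ghom_def lin_def by (auto dest: bij_betwE)

text \<open>The action on \<open>M\<close> of the element \<Sum> a(g) g of the group algebra. Such
  elements are represented by their coefficient functions on G, and \<open>gconv\<close> is their
  product.\<close>

definition ga :: "('g, 'b) monoid_scheme \<Rightarrow> ('k::field, 'g, 'v::ab_group_add) gmod \<Rightarrow> ('g \<Rightarrow> 'k) \<Rightarrow> 'v \<Rightarrow> 'v" where
 "ga G M a x = (\<Sum>g\<in>carrier G. scal M (a g) (act M g x))"

definition gconv :: "('g, 'b) monoid_scheme \<Rightarrow> ('g \<Rightarrow> 'k::field) \<Rightarrow> ('g \<Rightarrow> 'k) \<Rightarrow> 'g \<Rightarrow> 'k" where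
 "gconv G a b = (\<lambda>g. \<Sum>h\<in>carrier G. a h * b (inv\<^bsub>G\<^esub> h \<otimes>\<^bsub>G\<^esub> g))"

locale gm =
 fixes G :: "('g, 'b) monoid_scheme" (structure) and M :: "('k::field, 'g, 'v::ab_group_add) gmod"
 assumes group_G: "group G" and finite_G: "finite (carrier G)" and is_gmod: "is_gmod G M"
begin

sublocale G: group G by (fact group_G)

sublocale vs: vector_space "scal M" using is_gmod by (simp add: is_gmod_def)

lemma subspace_space: "vs.subspace (space M)" using is_gmod by (simp add: is_gmod_def)

sublocale ac: group_action G "space M" "act M" using is_gmod by (simp add: is_gmod_def)

lemma zero_mem [simp]: "0 \<in> space M"
 using vs.subspace_0[OF subspace_space] .
lemma add_mem [simp]: "x \<in> space M \<Longrightarrow> y \<in> space M \<Longrightarrow> x + y \<in> space M"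
 using vs.subspace_add[OF subspace_space] .
lemma diff_mem [simp]: "x \<in> space M \<Longrightarrow> y \<in> space M \<Longrightarrow> x - y \<in> space M"
 using vs.subspace_diff[OF subspace_space] .
lemma scal_mem [simp]: "x \<in> space M \<Longrightarrow> scal M c x \<in> space M"
 using vs.subspace_scale[OF subspace_space] .
lemma sum_mem [simp]: "(\<And>i. i \<in> I \<Longrightarrow> f i \<in> space M) \<Longrightarrow> sum f I \<in> space M"
 using vs.subspace_sum[OF subspace_space] .

lemma act_mem [simp]: "g \<in> carrier G \<Longrightarrow> x \<in> space M \<Longrightarrow> act M g x \<in> space M" using ac.element_image by blast
lemma act_add [simp]: "g \<in> carrier G \<Longrightarrow> x \<in> space M \<Longrightarrow> y \<in> space M \<Longrightarrow> act M g (x + y) = act M g x + act M g y"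
 using is_gmod by (simp add: is_gmod_def)
lemma act_scal [simp]: "g \<in> carrier G \<Longrightarrow> x \<in> space M \<Longrightarrow> act M g (scal M c x) = scal M c (act M g x)"
 using is_gmod by (simp add: is_gmod_def)
lemma act_one [simp]: "x \<in> space M \<Longrightarrow> act M \<one> x = x" using ac.id_eq_one by (metis restrict_apply')
lemma act_mult: "g \<in> carrier G \<Longrightarrow> h \<in> carrier G \<Longrightarrow> x \<in> space M \<Longrightarrow> act M (g \<otimes> h) x = act M g (act M h x)"
 using ac.composition_rule by blast
lemma act_inv [simp]: "g \<in> carrier G \<Longrightarrow> x \<in> space M \<Longrightarrow> act M g (act M (inv g) x) = x"
 by (subst act_mult[symmetric]) auto
lemma act_inv' [simp]: "g \<in> carrier G \<Longrightarrow> x \<in> space M \<Longrightarrow> act M (inv g) (act M g x) = x"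
 by (subst act_mult[symmetric]) auto

lemma lin_act: "g \<in> carrier G \<Longrightarrow> lin M M (act M g)" by (simp add: lin_def)

lemma lin_0: "lin M N f \<Longrightarrow> vector_space (scal N) \<Longrightarrow> f 0 = 0"
 unfolding lin_def by (metis add_0_right add_left_cancel zero_mem)

lemma lin_sum: "lin M N f \<Longrightarrow> (\<And>i. i \<in> I \<Longrightarrow> x i \<in> space M) \<Longrightarrow> f (sum x I) = (\<Sum>i\<in>I. f (x i))"
proof (induction I rule: infinite_finite_induct)
 case (insert i I)
 then show ?case by (auto simp: lin_def)
next
 case empty
 then show ?case unfolding lin_def by (metis add_0_right add_left_cancel sum.empty zero_mem)
next
 case (infinite I)
 then show ?case unfolding lin_def by (metis add_0_right add_left_cancel sum.infinite zero_mem)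
qed

lemma act_0 [simp]: "g \<in> carrier G \<Longrightarrow> act M g 0 = 0" using lin_0[OF lin_act] vs.vector_space_axioms by blast

lemma act_diff: "g \<in> carrier G \<Longrightarrow> x \<in> space M \<Longrightarrow> y \<in> space M \<Longrightarrow> act M g (x - y) = act M g x - act M g y"
 by (metis act_add add_diff_cancel diff_add_cancel diff_mem)

lemma act_sum: "g \<in> carrier G \<Longrightarrow> (\<And>i. i \<in> I \<Longrightarrow> x i \<in> space M) \<Longrightarrow> act M g (sum x I) = (\<Sum>i\<in>I. act M g (x i))"
 using lin_sum[OF lin_act] .

lemma bij_mult: "h \<in> carrier G \<Longrightarrow> bij_betw (\<lambda>g. h \<otimes> g) (carrier G) (carrier G)"
 by (rule bij_betw_byWitness[where f' = "\<lambda>g. inv h \<otimes> g"]) (auto simp: G.m_assoc[symmetric])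

lemma bij_inv: "bij_betw (\<lambda>g. inv g) (carrier G) (carrier G)" by (rule bij_betw_byWitness[where f' = "\<lambda>g. inv g"]) auto

lemma ga_mem [simp]: "x \<in> space M \<Longrightarrow> ga G M a x \<in> space M" by (simp add: ga_def)

lemma ga_add: "x \<in> space M \<Longrightarrow> y \<in> space M \<Longrightarrow> ga G M a (x + y) = ga G M a x + ga G M a y"
 by (simp add: ga_def vs.scale_right_distrib sum.distrib)

lemma ga_scal: "x \<in> space M \<Longrightarrow> ga G M a (scal M c x) = scal M c (ga G M a x)" by (simp add: ga_def vs.scale_sum_right mult.commute)

lemma lin_ga: "lin M M (ga G M a)" by (simp add: lin_def ga_add ga_scal)

lemma ga_add_left: "ga G M (\<lambda>g. a g + b g) x = ga G M a x + ga G M b x" by (simp add: ga_def vs.scale_left_distrib sum.distrib)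

lemma ga_scal_left: "ga G M (\<lambda>g. c * a g) x = scal M c (ga G M a x)" by (simp add: ga_def vs.scale_sum_right)

lemma ga_sum_left: "ga G M (\<lambda>g. \<Sum>i\<in>I. a i g) x = (\<Sum>i\<in>I. ga G M (a i) x)"
 by (simp add: ga_def vs.scale_sum_left sum.swap[of _ I])

text \<open>In the double sum over h and g the group element h g becomes the new summation
  variable.\<close>

lemma ga_conv: "x \<in> space M \<Longrightarrow> ga G M (gconv G a b) x = ga G M a (ga G M b x)"
proof -
 assume x: "x \<in> space M"
 have "ga G M a (ga G M b x) = (\<Sum>h\<in>carrier G. \<Sum>g\<in>carrier G. scal M (a h * b g) (act M (h \<otimes> g) x))"
  unfolding ga_def using x by (intro sum.cong refl) (simp add: act_sum act_mult vs.scale_sum_right)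
 also have "\<dots> = (\<Sum>h\<in>carrier G. \<Sum>g\<in>carrier G. scal M (a h * b (inv h \<otimes> g)) (act M g x))"
 proof (rule sum.cong, rule refl)
  fix h assume h: "h \<in> carrier G"
  show "(\<Sum>g\<in>carrier G. scal M (a h * b g) (act M (h \<otimes> g) x)) =
    (\<Sum>g\<in>carrier G. scal M (a h * b (inv h \<otimes> g)) (act M g x))"
   using h sum.reindex_bij_betw[OF bij_mult[OF h], of "\<lambda>g. scal M (a h * b (inv h \<otimes> g)) (act M g x)"]
   by (simp add: G.m_assoc[symmetric])
 qed
 also have "\<dots> = ga G M (gconv G a b) x"
  unfolding ga_def gconv_def by (subst sum.swap) (simp add: vs.scale_sum_left)
 finally show ?thesis by simp
qed

lemma ga_one: "x \<in> space M \<Longrightarrow> ga G M (\<lambda>g. if g = \<one> then c else 0) x = scal M c x"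
 by (simp add: ga_def if_distrib[of "\<lambda>c. scal M c _"] finite_G cong: if_cong)

lemma gsubmodule_gmod:
 assumes "gsubmodule G M N"
 shows "is_gmod G (subgmod M N)"
proof -
 have N: "vs.subspace N" "N \<subseteq> space M" "\<And>g x. g \<in> carrier G \<Longrightarrow> x \<in> N \<Longrightarrow> act M g x \<in> N"
  using assms by (auto simp: gsubmodule_def)
 have "group_action G N (\<lambda>g. restrict (act M g) N)" using N by (intro group_actionI group_G) (auto simp: act_mult subset_iff)
 moreover have "\<And>x y. x \<in> N \<Longrightarrow> y \<in> N \<Longrightarrow> x + y \<in> N" "\<And>x c. x \<in> N \<Longrightarrow> scal M c x \<in> N"
  using N(1) vs.subspace_add vs.subspace_scale by auto
 ultimately show ?thesis using N vs.vector_space_axioms by (auto simp: is_gmod_def subgmod_def subset_iff)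
qed

lemma ga_hom:
 assumes "gm G N" "ghom G M N f" "x \<in> space M"
 shows "f (ga G M a x) = ga G N a (f x)"
proof -
 have "lin M N f" using assms by (simp add: ghom_def)
 then show ?thesis
  unfolding ga_def using assms by (subst lin_sum[of N f]) (auto simp: lin_def ghom_def intro!: sum.cong)
qed

end

lemma ghom_comp: "ghom G M N f \<Longrightarrow> ghom G N P h \<Longrightarrow> ghom G M P (\<lambda>x. h (f x))" by (auto simp: ghom_def lin_def)

lemma gmod_iso_inv:
 assumes "gm G M" "gm G N" "gmod_iso G M N f"
 shows "gmod_iso G N M (inv_into (space M) f)"
proof -
 interpret M: gm G M by fact
 interpret N: gm G N by fact
 let ?h = "inv_into (space M) f"
 have b: "bij_betw f (space M) (space N)" and f: "ghom G M N f" using assms(3) by (auto simp: gmod_iso_alt)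
 have inj: "\<And>x y. x \<in> space M \<Longrightarrow> y \<in> space M \<Longrightarrow> f x = f y \<Longrightarrow> x = y"
  using b by (auto simp: bij_betw_def inj_on_def)
 have h: "\<And>y. y \<in> space N \<Longrightarrow> ?h y \<in> space M" "\<And>y. y \<in> space N \<Longrightarrow> f (?h y) = y"
  using b by (auto simp: bij_betw_def inv_into_into f_inv_into_f)
 have "ghom G N M ?h"
  unfolding ghom_def lin_def using h f by (intro conjI ballI allI) (auto intro!: inj simp: ghom_def lin_def)
 moreover have "bij_betw ?h (space N) (space M)" using b by (rule bij_betw_inv_into)
 ultimately show ?thesis by (simp add: gmod_iso_alt)
qed

section \<open>Submodules, homomorphisms and Schur's lemma\<close>

lemma space_subgmod [simp]: "space (subgmod W N) = N" by (simp add: subgmod_def)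
lemma scal_subgmod [simp]: "scal (subgmod W N) = scal W" by (simp add: subgmod_def)
lemma act_subgmod' [simp]: "x \<in> N \<Longrightarrow> act (subgmod W N) g x = act W g x" by (simp add: subgmod_def)

context gm begin

lemma gm_subgmod: "gsubmodule G M N \<Longrightarrow> gm G (subgmod M N)" using gsubmodule_gmod group_G finite_G by (simp add: gm_def)

lemma gsubmodule_image:
 assumes "gm G N" "ghom G M N f" "gsubmodule G M S"
 shows "gsubmodule G N (f ` S)"
proof -
 interpret N: gm G N by fact
 have S: "vs.subspace S" "S \<subseteq> space M" "\<And>g x. g \<in> carrier G \<Longrightarrow> x \<in> S \<Longrightarrow> act M g x \<in> S"
  using assms(3) by (auto simp: gsubmodule_def)
 have f: "\<And>x y. x \<in> S \<Longrightarrow> y \<in> S \<Longrightarrow> f (x + y) = f x + f y" "\<And>c x. x \<in> S \<Longrightarrow> f (scal M c x) = scal N c (f x)"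
  "\<And>g x. g \<in> carrier G \<Longrightarrow> x \<in> S \<Longrightarrow> f (act M g x) = act N g (f x)" "f ` S \<subseteq> space N"
  using assms(2) S(2) by (auto simp: ghom_def lin_def subset_iff)
 have f0: "f 0 = 0" using assms(2) lin_0 N.vs.vector_space_axioms by (auto simp: ghom_def)
 show ?thesis
  unfolding gsubmodule_def N.vs.subspace_def
 proof (intro conjI ballI allI impI)
  show "0 \<in> f ` S" using vs.subspace_0[OF S(1)] f0 by (metis imageI)
  fix x y assume "x \<in> f ` S" "y \<in> f ` S"
  then obtain a b where "a \<in> S" "b \<in> S" "x = f a" "y = f b" by blast
  then show "x + y \<in> f ` S" using f(1)[of a b] vs.subspace_add[OF S(1), of a b] by force
 next
  fix c x assume "x \<in> f ` S"
  then obtain a where "a \<in> S" "x = f a" by blast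
  then show "scal N c x \<in> f ` S" using f(2)[of a c] vs.subspace_scale[OF S(1), of a c] by force
 next
  show "f ` S \<subseteq> space N" by (fact f(4))
  fix g x assume g: "g \<in> carrier G" and "x \<in> f ` S"
  then obtain a where "a \<in> S" "x = f a" by blast
  then show "act N g x \<in> f ` S" using f(3)[of g a] S(3)[of g a] g by force
 qed
qed

lemma gsubmodule_space: "gsubmodule G M (space M)" by (simp add: gsubmodule_def subspace_space)

lemma gsubmodule_kernel:
 assumes "gm G N" "ghom G M N f"
 shows "gsubmodule G M {x \<in> space M. f x = 0}"
proof -
 interpret N: gm G N by fact
 have f0: "f 0 = 0" using assms(2) lin_0 N.vs.vector_space_axioms by (auto simp: ghom_def)
 show ?thesis using assms(2) f0 by (auto simp: gsubmodule_def vs.subspace_def ghom_def lin_def)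
qed

end

text \<open>Kernel and image are submodules: if the kernel is {0}, the map is injective and its
  image is nonzero, hence everything.\<close>

lemma Schur_zero_or_iso:
 assumes "gm G M" "gm G N" "simple_gmod G M" "simple_gmod G N" "ghom G M N f"
 shows "(\<forall>x\<in>space M. f x = 0) \<or> gmod_iso G M N f"
proof -
 interpret M: gm G M by fact
 interpret N: gm G N by fact
 let ?K = "{x \<in> space M. f x = 0}"
 have lf: "lin M N f" using assms(5) by (simp add: ghom_def)
 have f0: "f 0 = 0" using lf M.lin_0 N.vs.vector_space_axioms by auto
 have "?K = {0} \<or> ?K = space M" using M.gsubmodule_kernel[OF assms(2,5)] assms(3) by (simp add: simple_gmod_def)
 then consider "?K = space M" | "?K = {0}" by blast
 then show ?thesis
 proof cases
  case 2
  have "inj_on f (space M)"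
  proof (rule inj_onI)
   fix x y assume xy: "x \<in> space M" "y \<in> space M" "f x = f y"
   have "f (x - y) + f y = f x" using lf xy M.diff_mem unfolding lin_def by (metis diff_add_cancel)
   then have "x - y \<in> ?K" using xy by simp
   then show "x = y" using 2 by auto
  qed
  moreover have "f ` space M = {0} \<or> f ` space M = space N"
   using M.gsubmodule_image[OF assms(2,5) M.gsubmodule_space] assms(4) by (simp add: simple_gmod_def)
  moreover have "f ` space M \<noteq> {0}"
  proof
   assume "f ` space M = {0}"
   then have "?K = space M" by auto
   with 2 assms(3) show False by (simp add: simple_gmod_def)
  qed
  ultimately show ?thesis using assms(5) by (simp add: gmod_iso_alt bij_betw_def)
 qed auto
qed

text \<open>The vectors v, f v, ..., f^n v, with n the size of a spanning set, are one too many to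
  be independent. Independence is a property of sets, so a repetition f^i v = f^j v is a case of its
  own; it yields the polynomial X^j - X^i.\<close>

lemma (in gm) fin_dim_powers_dependent:
 assumes fd: "fin_dim M" and f: "lin M M f" and v: "v \<in> space M"
 shows "\<exists>p. p \<noteq> 0 \<and> (\<Sum>j\<le>Polynomial.degree p. scal M (Polynomial.coeff p j) ((f ^^ j) v)) = 0"
proof -
 have mem: "(f ^^ j) v \<in> space M" for j by (induction j) (use v f in \<open>auto simp: lin_def\<close>)
 obtain B where B: "finite B" "space M \<subseteq> vs.span B" using fd by (auto simp: fin_dim_def)
 show ?thesis
 proof (cases "inj_on (\<lambda>j. (f ^^ j) v) {..card B}")
  case False
  then obtain i j where ij: "i < j" "(f ^^ i) v = (f ^^ j) v"
   unfolding inj_on_def by (metis linorder_neqE_nat)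
  let ?p = "monom 1 j - monom (1::'k) i"
  have deg: "Polynomial.degree ?p \<le> j" using ij(1) by (intro degree_diff_le) (auto simp: degree_monom_eq)
  have "Polynomial.coeff ?p j = 1" using ij(1) by simp
  then have nz: "?p \<noteq> 0" by (metis coeff_0 zero_neq_one)
  have "(\<Sum>l\<le>Polynomial.degree ?p. scal M (Polynomial.coeff ?p l) ((f ^^ l) v)) = (\<Sum>l\<le>j. scal M (Polynomial.coeff ?p l) ((f ^^ l) v))"
   using deg by (intro sum.mono_neutral_left) (auto simp del: coeff_diff coeff_monom intro: coeff_eq_0)
  also have "\<dots> = (\<Sum>l\<le>j. if l = j then (f ^^ l) v else 0) - (\<Sum>l\<le>j. if l = i then (f ^^ l) v else 0)"
   using ij(1) by (subst sum_subtractf[symmetric]) (intro sum.cong refl, auto simp: vs.scale_left_diff_distrib)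
  also have "\<dots> = 0" using ij by simp
  finally show ?thesis using nz by blast
 next
  case True
  let ?S = "(\<lambda>j. (f ^^ j) v) ` {..card B}"
  have "card ?S = Suc (card B)" using True by (simp add: card_image)
  moreover have "?S \<subseteq> vs.span B" using mem B(2) by auto
  ultimately have "vs.dependent ?S" using vs.independent_span_bound[OF B(1), of ?S] by auto
  then obtain u where u: "\<exists>x\<in>?S. u x \<noteq> 0" "(\<Sum>x\<in>?S. scal M (u x) x) = 0" by (auto simp: vs.dependent_finite)
  define p where "p = (\<Sum>j\<le>card B. monom (u ((f ^^ j) v)) j)"
  have cp: "Polynomial.coeff p j = (if j \<le> card B then u ((f ^^ j) v) else 0)" for j by (auto simp: p_def coeff_sum)
  have "p \<noteq> 0" using u(1) cp by (auto simp: poly_eq_iff)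
  moreover have "(\<Sum>l\<le>Polynomial.degree p. scal M (Polynomial.coeff p l) ((f ^^ l) v)) = (\<Sum>l\<le>card B. scal M (Polynomial.coeff p l) ((f ^^ l) v))"
  proof (intro sum.mono_neutral_left)
   show "{..Polynomial.degree p} \<subseteq> {..card B}" using cp degree_le[of "card B" p] by auto
  qed (auto intro: coeff_eq_0)
  moreover have "\<dots> = (\<Sum>x\<in>?S. scal M (u x) x)" by (subst sum.reindex[OF True]) (simp add: cp)
  ultimately show ?thesis using u(2) by metis
 qed
qed

text \<open>Induction on the degree of a polynomial p with p(f) v = 0: write p = (X - z) q and u =
  q(f) v. If u = 0, then q is a smaller polynomial of this kind; otherwise (f - z) u = p(f) v = 0
  shows that u is an eigenvector.\<close>

lemma (in gm) eigenvalue_exists: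
 fixes f :: "'v \<Rightarrow> 'v"
 assumes roots: "\<And>p :: 'k poly. Polynomial.degree p > 0 \<Longrightarrow> \<exists>z. poly p z = 0"
  and f: "lin M M f" and v: "v \<in> space M" "v \<noteq> 0"
  and p: "p \<noteq> 0" "(\<Sum>j\<le>Polynomial.degree p. scal M (Polynomial.coeff p j) ((f ^^ j) v)) = 0"
 shows "\<exists>z u. u \<in> space M \<and> u \<noteq> 0 \<and> f u = scal M z u"
 using p
proof (induction "Polynomial.degree p" arbitrary: p rule: less_induct)
 case less
 have mem: "(f ^^ j) v \<in> space M" for j by (induction j) (use v f in \<open>auto simp: lin_def\<close>)
 have "Polynomial.degree p > 0"
 proof (rule ccontr)
  assume "\<not> Polynomial.degree p > 0"
  then have "Polynomial.degree p = 0" "Polynomial.coeff p 0 \<noteq> 0" using less.prems(1) by (auto simp: leading_coeff_0_iff[symmetric] simp del: leading_coeff_0_iff)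
  then show False using less.prems(2) v(2) by simp
 qed
 then obtain z where "poly p z = 0" using roots by blast
 then obtain q where q: "p = [:-z, 1:] * q" using dvd_def poly_eq_0_iff_dvd by metis
 have q0: "q \<noteq> 0" using q less.prems(1) by auto
 then have dq: "Polynomial.degree p = Suc (Polynomial.degree q)" using q by (simp add: degree_mult_eq del: mult_pCons_left)
 define u where "u = (\<Sum>j\<le>Polynomial.degree q. scal M (Polynomial.coeff q j) ((f ^^ j) v))"
 have um: "u \<in> space M" using mem by (simp add: u_def)
 show ?case
 proof (cases "u = 0")
  case True
  then show ?thesis using less.hyps[of q] dq q0 u_def by auto
 next
  case False
  \<comment> \<open>The coefficients of (X - z) q: those of q moved up by one place, minus z times
    those of q.\<close>
  have cp: "Polynomial.coeff p j = (case j of 0 \<Rightarrow> 0 | Suc i \<Rightarrow> Polynomial.coeff q i) - z * Polynomial.coeff q j" for j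
   by (simp add: q coeff_pCons split: nat.split)
  have "(\<Sum>j\<le>Polynomial.degree p. scal M (Polynomial.coeff p j) ((f ^^ j) v)) =
   (\<Sum>j\<le>Suc (Polynomial.degree q). scal M (case j of 0 \<Rightarrow> 0 | Suc i \<Rightarrow> Polynomial.coeff q i) ((f ^^ j) v)) -
   (\<Sum>j\<le>Suc (Polynomial.degree q). scal M (z * Polynomial.coeff q j) ((f ^^ j) v))"
   unfolding dq sum_subtractf[symmetric] by (simp only: cp vs.scale_left_diff_distrib)
  also have "(\<Sum>j\<le>Suc (Polynomial.degree q). scal M (case j of 0 \<Rightarrow> 0 | Suc i \<Rightarrow> Polynomial.coeff q i) ((f ^^ j) v)) = f u"
   unfolding u_def lin_sum[OF f scal_mem[OF mem]] by (subst sum.atMost_Suc_shift) (use f mem in \<open>simp add: lin_def\<close>)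
  also have "(\<Sum>j\<le>Suc (Polynomial.degree q). scal M (z * Polynomial.coeff q j) ((f ^^ j) v)) = scal M z u"
   by (simp add: u_def vs.scale_sum_right coeff_eq_0)
  finally have "f u = scal M z u" using less.prems(2) by simp
  then show ?thesis using um False by blast
 qed
qed

text \<open>For an eigenvalue z the equivariant map f - z has a nonzero kernel, so it is not an
  isomorphism and must vanish.\<close>

lemma Schur_scalar:
 fixes M :: "('k::alg_closed_field, 'g, 'v::ab_group_add) gmod"
 assumes "gm G M" "simple_gmod G M" "fin_dim M" "ghom G M M f"
 shows "\<exists>c. \<forall>x\<in>space M. f x = scal M c x"
proof -
 interpret M: gm G M by fact
 have lf: "lin M M f" using assms(4) by (simp add: ghom_def)
 obtain v where v: "v \<in> space M" "v \<noteq> 0" using assms(2) M.zero_mem by (auto simp: simple_gmod_def)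
 obtain p where p: "p \<noteq> 0" "(\<Sum>j\<le>Polynomial.degree p. scal M (Polynomial.coeff p j) ((f ^^ j) v)) = 0"
  using M.fin_dim_powers_dependent[OF assms(3) lf v(1)] by blast
 obtain z u where u: "u \<in> space M" "u \<noteq> 0" "f u = scal M z u" using M.eigenvalue_exists[OF _ lf v p] alg_closed_imp_poly_has_root by metis
 let ?h = "\<lambda>x. f x - scal M z x"
 have "ghom G M M ?h" using assms(4) by (auto simp: ghom_def lin_def M.vs.scale_right_distrib M.vs.scale_right_diff_distrib mult.commute M.act_diff)
 from Schur_zero_or_iso[OF assms(1,1,2,2) this] show ?thesis
 proof
  assume "\<forall>x\<in>space M. f x - scal M z x = 0" then show ?thesis by auto
 next
  assume "gmod_iso G M M ?h"
  then have "inj_on ?h (space M)" by (auto simp: gmod_iso_def bij_betw_def)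
  moreover have "?h 0 = 0" using M.lin_0[OF lf M.vs.vector_space_axioms] by simp
  ultimately have "u = 0" using u M.zero_mem unfolding inj_on_def by (metis diff_self)
  with u show ?thesis by simp
 qed
qed

section \<open>Averaging over the group, orthogonality and matrix units\<close>

context gm begin

lemma fin_dim_basis:
 assumes "fin_dim M"
 obtains B where "finite B" "B \<subseteq> space M" "vs.independent B" "vs.span B = space M" "card B = gdim M"
proof -
 obtain B where B: "B \<subseteq> space M" "vs.independent B" "space M \<subseteq> vs.span B" "card B = vs.dim (space M)"
  using vs.basis_exists by blast
 obtain F where "finite F" "space M \<subseteq> vs.span F" using assms by (auto simp: fin_dim_def)
 then have "finite B" using vs.independent_span_bound B by blast
 moreover have "vs.span B = space M" using B(1,3) vs.span_minimal[OF B(1) subspace_space] by blast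
 ultimately show ?thesis using that B by (simp add: gdim_def)
qed

lemma linear_form_representation:
 assumes "vs.independent B" "vs.span B = space M"
 shows "linear_form M (\<lambda>v. vs.representation B v b)" using assms by (simp add: linear_form_def vs.representation_add vs.representation_scale)

lemma linear_form_0: "linear_form M l \<Longrightarrow> l 0 = 0"
 unfolding linear_form_def by (metis add_0_right add_left_cancel zero_mem)

lemma linear_form_sum:
 "linear_form M l \<Longrightarrow> (\<And>i. i \<in> I \<Longrightarrow> x i \<in> space M) \<Longrightarrow> l (sum x I) = (\<Sum>i\<in>I. l (x i))"
 by (induction I rule: infinite_finite_induct) (auto simp: linear_form_0, auto simp: linear_form_def)

lemma basis_expand:
 assumes "finite B" "vs.independent B" "vs.span B = space M" "v \<in> space M"
 shows "(\<Sum>b\<in>B. scal M (vs.representation B v b) b) = v" using vs.sum_representation_eq[of B v B] assms by simp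

text \<open>The map is the sum over g of the conjugates of the rank-one map w \<mapsto> \<xi>(w) v,
  so translation of g by h only permutes the summands.\<close>

lemma averaging_ghom:
 assumes N: "gm G N" and xi: "linear_form M \<xi>" and v: "v \<in> space N"
 shows "ghom G M N (\<lambda>w. ga G N (\<lambda>g. \<xi> (act M (inv g) w)) v)"
proof -
 interpret N: gm G N by fact
 have equi: "ga G N (\<lambda>g. \<xi> (act M (inv g) (act M h w))) v = act N h (ga G N (\<lambda>g. \<xi> (act M (inv g) w)) v)"
  if h: "h \<in> carrier G" and w: "w \<in> space M" for h w
 proof -
  have "act N h (ga G N (\<lambda>g. \<xi> (act M (inv g) w)) v) =
    (\<Sum>g\<in>carrier G. scal N (\<xi> (act M (inv (h \<otimes> g)) (act M h w))) (act N (h \<otimes> g) v))"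
   using h w v by (simp add: ga_def N.act_sum N.act_mult G.inv_mult_group act_mult)
  also have "\<dots> = (\<Sum>g\<in>carrier G. scal N (\<xi> (act M (inv g) (act M h w))) (act N g v))"
   by (rule sum.reindex_bij_betw[OF bij_mult[OF h]])
  finally show ?thesis by (simp add: ga_def)
 qed
 have xa: "\<xi> (x + y) = \<xi> x + \<xi> y" "\<xi> (scal M c x) = c * \<xi> x" if "x \<in> space M" "y \<in> space M" for x y c
  using xi that by (auto simp: linear_form_def)
 show ?thesis
  unfolding ghom_def lin_def
 proof (intro conjI ballI allI)
  fix x y assume x: "x \<in> space M" "y \<in> space M"
  show "ga G N (\<lambda>g. \<xi> (act M (inv g) (x + y))) v =
   ga G N (\<lambda>g. \<xi> (act M (inv g) x)) v + ga G N (\<lambda>g. \<xi> (act M (inv g) y)) v"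
   using x by (simp add: ga_def xa N.vs.scale_left_distrib sum.distrib)
 next
  fix c x assume x: "x \<in> space M"
  show "ga G N (\<lambda>g. \<xi> (act M (inv g) (scal M c x))) v = scal N c (ga G N (\<lambda>g. \<xi> (act M (inv g) x)) v)"
   using x by (simp add: ga_def xa N.vs.scale_sum_right)
 qed (use v equi in auto)
qed

lemma ga_average_inverse:
 "(\<Sum>g\<in>carrier G. f (inv g)) = (\<Sum>g\<in>carrier G. f g)" by (rule sum.reindex_bij_betw[OF bij_inv])

end

text \<open>Schur's lemma makes the averaged rank-one map of \<xi> and v a scalar C(\<xi>, v).
  Applying a form \<eta> and replacing g by its inverse gives C(\<xi>, v) \<eta>(w) = C(\<eta>, w)
  \<xi>(v), whence C(\<xi>, v) = c \<xi>(v) with a single constant c. Traces would identify it as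
  |G| / dim M; here only its nonvanishing is shown.\<close>

lemma simple_orthogonality:
 fixes M :: "('k::alg_closed_field, 'g, 'v::ab_group_add) gmod"
 assumes gm: "gm G M" and simple: "simple_gmod G M" and fd: "fin_dim M"
  and card: "of_nat (card (carrier G)) \<noteq> (0::'k)"
 shows "\<exists>c. c \<noteq> 0 \<and> (\<forall>\<xi> v w. linear_form M \<xi> \<longrightarrow> v \<in> space M \<longrightarrow> w \<in> space M \<longrightarrow>
  ga G M (\<lambda>g. \<xi> (act M (inv\<^bsub>G\<^esub> g) w)) v = scal M (c * \<xi> v) w)"
proof -
 interpret gm G M by fact
 obtain B where B: "finite B" "B \<subseteq> space M" "vs.independent B" "vs.span B = space M" "card B = gdim M" by (rule fin_dim_basis[OF fd])
 let ?T = "\<lambda>\<xi> v w. ga G M (\<lambda>g. \<xi> (act M (inv\<^bsub>G\<^esub> g) w)) v"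
 have "\<exists>c. \<forall>w\<in>space M. ?T \<xi> v w = scal M c w" if "linear_form M \<xi>" "v \<in> space M" for \<xi> v
  by (rule Schur_scalar[OF gm simple fd averaging_ghom[OF gm that]])
 then obtain C where C: "\<And>\<xi> v w. linear_form M \<xi> \<Longrightarrow> v \<in> space M \<Longrightarrow> w \<in> space M \<Longrightarrow> ?T \<xi> v w = scal M (C \<xi> v) w"
  by metis
 have lfsum: "\<eta> (\<Sum>g\<in>carrier G. scal M (a g) (x g)) = (\<Sum>g\<in>carrier G. a g * \<eta> (x g))"
  if e: "linear_form M \<eta>" and x: "\<And>g. g \<in> carrier G \<Longrightarrow> x g \<in> space M" for \<eta> a x
  using e x by (subst linear_form_sum[OF e]) (auto simp: linear_form_def)
 have sym: "C \<xi> v * \<eta> w = C \<eta> w * \<xi> v"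
  if "linear_form M \<xi>" "linear_form M \<eta>" "v \<in> space M" "w \<in> space M" for \<xi> \<eta> v w
 proof -
  have 1: "C \<xi> v * \<eta> w = (\<Sum>g\<in>carrier G. \<xi> (act M (inv\<^bsub>G\<^esub> g) w) * \<eta> (act M g v))"
   if "linear_form M \<xi>" "linear_form M \<eta>" "v \<in> space M" "w \<in> space M" for \<xi> \<eta> v w
   using arg_cong[OF C[OF that(1,3,4)], of \<eta>] that lfsum[OF that(2), of "\<lambda>g. act M g v"]
   by (simp add: ga_def) (simp add: linear_form_def)
  have "C \<eta> w * \<xi> v = (\<Sum>g\<in>carrier G. \<eta> (act M (inv\<^bsub>G\<^esub> g) v) * \<xi> (act M g w))" by (rule 1) (use that in auto)
  also have "\<dots> = (\<Sum>g\<in>carrier G. \<eta> (act M (inv\<^bsub>G\<^esub> (inv\<^bsub>G\<^esub> g)) v) * \<xi> (act M (inv\<^bsub>G\<^esub> g) w))"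
   by (rule ga_average_inverse[symmetric])
  also have "\<dots> = C \<xi> v * \<eta> w" using 1[OF that] by (simp add: mult.commute)
  finally show ?thesis by simp
 qed
 have "B \<noteq> {}" using B(4) simple by (auto simp: simple_gmod_def)
 then obtain b where b: "b \<in> B" by blast
 let ?r = "\<lambda>b v. vs.representation B v b"
 have lr: "linear_form M (?r b)" for b by (rule linear_form_representation[OF B(3,4)])
 have rb: "?r b c = (if b = c then 1 else 0)" if "c \<in> B" for b c using vs.representation_basis[OF B(3) that] by auto
 define c where "c = C (?r b) b"
 \<comment> \<open>The symmetry is used with the dual form of b, which takes the value 1 at
   b.\<close>
 have c: "C \<xi> v = c * \<xi> v" if "linear_form M \<xi>" "v \<in> space M" for \<xi> v
  using sym[OF that(1) lr[of b] that(2), of b] b B(2) rb[OF b, of b] by (auto simp: c_def)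
 have "c \<noteq> 0"
 proof
  assume "c = 0"
  \<comment> \<open>The rank-one maps formed from the d and their dual forms add up to the identity,
    whose conjugates sum to |G|. Hence c = 0 would force |G| b = 0.\<close>
  then have "?T (?r d) d b = 0" if "d \<in> B" for d using C[OF lr, of d b d] c[OF lr, of d d] that b B(2) by auto
  then have "0 = (\<Sum>d\<in>B. ?T (?r d) d b)" by simp
  also have "\<dots> = (\<Sum>g\<in>carrier G. act M g (\<Sum>d\<in>B. scal M (?r d (act M (inv\<^bsub>G\<^esub> g) b)) d))"
   unfolding ga_def using B(2) by (subst sum.swap) (auto simp: act_sum subset_iff intro!: sum.cong)
  also have "\<dots> = (\<Sum>g\<in>carrier G. b)" using b B by (intro sum.cong refl) (auto simp: basis_expand[OF B(1,3,4)])
  also have "\<dots> = scal M (of_nat (card (carrier G))) b" by (simp add: vs.sum_constant_scale)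
  finally have "b = 0" using card by simp
  then show False using b B(3) vs.dependent_zero by blast
 qed
 moreover have "\<forall>\<xi> v w. linear_form M \<xi> \<longrightarrow> v \<in> space M \<longrightarrow> w \<in> space M \<longrightarrow> ?T \<xi> v w = scal M (c * \<xi> v) w"
  using C by (simp add: c)
 ultimately show ?thesis by blast
qed

text \<open>With \<xi> the dual form of the basis vector c, the element with coefficients \<xi>(g^-1
  b), divided by the orthogonality constant, acts on M as the unit from c to b. On another simple
  module N it gives a value of an averaged homomorphism from M to N, which is 0 by Schur's lemma.
  The coefficient of a diagonal unit at the identity is recorded because it makes the unit visible
  in the regular representation.\<close>

lemma simple_matrix_units:
 fixes M :: "('k::alg_closed_field, 'g, 'v::ab_group_add) gmod"
 assumes gm: "gm G M" and simple: "simple_gmod G M" and fd: "fin_dim M"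
  and card: "of_nat (card (carrier G)) \<noteq> (0::'k)"
  and B: "B \<subseteq> space M" "Modules.module.independent (scal M) B" "Modules.module.span (scal M) B = space M"
 shows "\<exists>e. (\<forall>b\<in>B. \<forall>c\<in>B. \<forall>v\<in>space M. ga G M (e b c) v = scal M (Modules.module.representation (scal M) B v c) b)
  \<and> (\<forall>b\<in>B. e b b \<one>\<^bsub>G\<^esub> \<noteq> 0)
  \<and> (\<forall>b\<in>B. \<forall>c\<in>B. \<forall>N :: ('k, 'g, 'w::ab_group_add) gmod. gm G N \<longrightarrow> simple_gmod G N \<longrightarrow> \<not> (\<exists>f. gmod_iso G M N f) \<longrightarrow>
     (\<forall>v\<in>space N. ga G N (e b c) v = 0))"
proof -
 interpret gm G M by fact
 obtain C where C: "C \<noteq> 0" "\<And>\<xi> v w. linear_form M \<xi> \<Longrightarrow> v \<in> space M \<Longrightarrow> w \<in> space M \<Longrightarrow>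
  ga G M (\<lambda>g. \<xi> (act M (inv\<^bsub>G\<^esub> g) w)) v = scal M (C * \<xi> v) w" using simple_orthogonality[OF gm simple fd card] by metis
 let ?r = "\<lambda>b v. vs.representation B v b"
 have lr: "linear_form M (?r b)" for b by (rule linear_form_representation[OF B(2,3)])
 define e where "e b c = (\<lambda>g. inverse C * ?r c (act M (inv\<^bsub>G\<^esub> g) b))" for b c
 have "ga G M (e b c) v = scal M (?r c v) b" if "b \<in> B" "c \<in> B" "v \<in> space M" for b c v
  unfolding e_def ga_scal_left using C(2)[OF lr that(3), of b c] that B(1) C(1) by (auto simp: field_simps)
 moreover have "e b b \<one>\<^bsub>G\<^esub> \<noteq> 0" if "b \<in> B" for b
  using that B(1) C(1) vs.representation_basis[OF B(2) that] by (auto simp: e_def)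
 moreover have "ga G N (e b c) v = 0"
  if b: "b \<in> B" and N: "gm G N" "simple_gmod G N" "\<not> (\<exists>f. gmod_iso G M N f)" "v \<in> space N"
  for b c v and N :: "('k, 'g, 'w) gmod"
 proof -
  interpret N: gm G N by fact
  have "ga G N (\<lambda>g. ?r c (act M (inv\<^bsub>G\<^esub> g) b)) v = 0"
   using Schur_zero_or_iso[OF gm N(1) simple N(2) averaging_ghom[OF N(1) lr[of c] N(4)]] N(3) b B(1) by blast
  then show ?thesis unfolding e_def N.ga_scal_left by simp
 qed
 ultimately show ?thesis by (intro exI[of _ e]) blast
qed

section \<open>Complete reducibility and isotypic decompositions\<close>

lemma (in gm) Maschke:
 assumes card: "of_nat (card (carrier G)) \<noteq> (0::'k)" and N: "gsubmodule G M N"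
 shows "\<exists>P. ghom G M M P \<and> (\<forall>x\<in>space M. P x \<in> N) \<and> (\<forall>x\<in>N. P x = x)"
proof -
 interpret vp: vector_space_pair "scal M" "scal M" by unfold_locales
 have sN: "vs.subspace N" "N \<subseteq> space M" "\<And>g x. g \<in> carrier G \<Longrightarrow> x \<in> N \<Longrightarrow> act M g x \<in> N"
  using N by (auto simp: gsubmodule_def)
 have "Vector_Spaces.linear (scal M) (scal M) (\<lambda>x. x)" using vs.vector_space_axioms by (simp add: Vector_Spaces.linear_iff)
 \<comment> \<open>A linear left inverse of the inclusion of N, with range in N; the average of its
   conjugates is the equivariant projection.\<close>
 from vp.linear_exists_left_inverse_on[OF this sN(1)]
 obtain p where p: "range p \<subseteq> N" "Vector_Spaces.linear (scal M) (scal M) p" "\<And>v. v \<in> N \<Longrightarrow> p v = v" by auto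
 have pl: "p (x + y) = p x + p y" "p (scal M c x) = scal M c (p x)" for x y c using p(2) by (auto simp: Vector_Spaces.linear_iff)
 have pN: "p x \<in> N" for x using p(1) by auto
 then have pM [simp]: "p x \<in> space M" for x using sN(2) by auto
 define s where "s = inverse (of_nat (card (carrier G)) :: 'k)"
 define P where "P x = scal M s (\<Sum>g\<in>carrier G. act M g (p (act M (inv g) x)))" for x
 have "P (act M h x) = act M h (P x)" if h: "h \<in> carrier G" and x: "x \<in> space M" for h x
 proof -
  have "act M h (P x) = scal M s (\<Sum>g\<in>carrier G. act M (h \<otimes> g) (p (act M (inv (h \<otimes> g)) (act M h x))))"
   using h x by (simp add: P_def act_sum act_mult G.inv_mult_group)
  also have "\<dots> = P (act M h x)"
   unfolding P_def by (rule arg_cong[OF sum.reindex_bij_betw[OF bij_mult[OF h]]])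
  finally show ?thesis by simp
 qed
 moreover have "P (x + y) = P x + P y" "P (scal M c x) = scal M c (P x)"
  if "x \<in> space M" "y \<in> space M" for x y c
  using that by (simp_all add: P_def pl sum.distrib vs.scale_right_distrib vs.scale_sum_right mult.commute)
 moreover have PN: "P x \<in> N" if "x \<in> space M" for x
  unfolding P_def using sN pN by (intro vs.subspace_scale vs.subspace_sum) auto
 ultimately have "ghom G M M P" using sN(2) by (auto simp: ghom_def lin_def)
 moreover have "P x = x" if x: "x \<in> N" for x
 proof -
  have xm: "x \<in> space M" using x sN(2) by blast
  have "P x = scal M s (\<Sum>g\<in>carrier G. x)"
   unfolding P_def using x xm sN by (intro arg_cong[of _ _ "scal M s"] sum.cong refl) (simp add: p(3))
  also have "\<dots> = scal M (s * of_nat (card (carrier G))) x" by (simp add: vs.sum_constant_scale)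
  finally show ?thesis using card by (simp add: s_def)
 qed
 ultimately show ?thesis using PN by (intro exI[of _ P] conjI ballI)
qed

lemma (in gm) gmod_isoI:
 assumes "gm G N" "ghom G M N f" and inj: "\<And>x. x \<in> space M \<Longrightarrow> f x = 0 \<Longrightarrow> x = 0"
  and surj: "\<And>y. y \<in> space N \<Longrightarrow> \<exists>x\<in>space M. f x = y"
 shows "gmod_iso G M N f"
proof -
 have f: "\<And>x. x \<in> space M \<Longrightarrow> f x \<in> space N" "\<And>x y. x \<in> space M \<Longrightarrow> y \<in> space M \<Longrightarrow> f (x + y) = f x + f y"
  using assms(2) by (auto simp: ghom_def lin_def)
 have "inj_on f (space M)"
 proof (rule inj_onI)
  fix x y assume xy: "x \<in> space M" "y \<in> space M" "f x = f y"
  then have "f (x - y) + f y = f y" using f(2)[of "x - y" y] by simp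
  then show "x = y" using inj[of "x - y"] xy by simp
 qed
 moreover have "f ` space M = space N" using f(1) surj by blast
 ultimately show ?thesis using assms(2) by (simp add: gmod_iso_alt bij_betw_def)
qed

text \<open>A vector space structure is assumed for every index, not only below n, because
  \<open>dsum\<close> applies \<open>scal (N i)\<close> at all positions and the entries from n on
  must stay 0.\<close>

lemma dsum_gmod:
 assumes "group G" and vs: "\<And>i. vector_space (scal (N i))" and N: "\<And>i. i < n \<Longrightarrow> is_gmod G (N i)"
  and "finite (carrier G)"
 shows "is_gmod G (dsum n N)"
proof -
 have gm: "gm G (N i)" if "i < n" for i using assms that by (simp add: gm_def)
 have a1: "act (N i) \<one>\<^bsub>G\<^esub> x = x" if "i < n" "x \<in> space (N i)" for i x using gm.act_one[OF gm] that by blast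
 have am: "act (N i) (g \<otimes>\<^bsub>G\<^esub> h) x = act (N i) g (act (N i) h x)"
  if "i < n" "x \<in> space (N i)" "g \<in> carrier G" "h \<in> carrier G" for i x g h using gm.act_mult[OF gm] that by blast
 have cl: "act (N i) g x \<in> space (N i)" if "i < n" "x \<in> space (N i)" "g \<in> carrier G" for i x g using gm.act_mem[OF gm] that by blast
 have sz: "scal (N i) c 0 = 0" for i c
 proof -
  interpret v: vector_space "scal (N i)" by (rule vs)
  show ?thesis by simp
 qed
 have mem: "x i \<in> space (N i)" if "x \<in> dsum_space n N" "i < n" for x i using that by (auto simp: dsum_space_def)
 have mem0: "x i = 0" if "x \<in> dsum_space n N" "\<not> i < n" for x i using that by (auto simp: dsum_space_def)
 have memI: "x \<in> dsum_space n N" if "\<And>i. i < n \<Longrightarrow> x i \<in> space (N i)" "\<And>i. \<not> i < n \<Longrightarrow> x i = 0" for x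
  using that by (auto simp: dsum_space_def)
 have zm: "0 \<in> space (N i)" if "i < n" for i using gm.zero_mem[OF gm[OF that]] .
 have ad: "x + y \<in> space (N i)" if "i < n" "x \<in> space (N i)" "y \<in> space (N i)" for i x y using gm.add_mem[OF gm[OF that(1)]] that by blast
 have sc: "scal (N i) c x \<in> space (N i)" if "i < n" "x \<in> space (N i)" for i x c using gm.scal_mem[OF gm[OF that(1)]] that by blast
 have dadd: "x + y \<in> dsum_space n N" if "x \<in> dsum_space n N" "y \<in> dsum_space n N" for x y
  by (rule memI) (simp_all add: ad mem that mem0[OF that(1)] mem0[OF that(2)])
 have dscal: "(\<lambda>i. scal (N i) c (x i)) \<in> dsum_space n N" if "x \<in> dsum_space n N" for x c
  by (rule memI) (simp_all add: sc mem that mem0[OF that] sz)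
 have dzero: "0 \<in> dsum_space n N" by (rule memI) (simp_all add: zm)
 have "group_action G (dsum_space n N) (\<lambda>g. \<lambda>x\<in>dsum_space n N. \<lambda>i. if i < n then act (N i) g (x i) else 0)"
 proof (rule group_actionI[OF \<open>group G\<close>], goal_cases)
  case (2 g x) then show ?case using cl mem by (auto intro!: memI)
 next
  case (3 x) then show ?case using a1 mem mem0 by (auto simp: fun_eq_iff)
 next
  case (4 g h x)
  then have "(\<lambda>i. if i < n then act (N i) h (x i) else 0) \<in> dsum_space n N" using cl mem by (auto intro!: memI)
  with 4 show ?case using am mem by (auto simp: fun_eq_iff)
 qed auto
 moreover have vsp: "vector_space (\<lambda>c x i. scal (N i) c (x i))" using vs by (auto simp: vector_space_def fun_eq_iff)
 moreover have "Modules.module.subspace (\<lambda>c x i. scal (N i) c (x i)) (dsum_space n N)"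
 proof -
  interpret v: vector_space "\<lambda>c x i. scal (N i) c (x i)" by (rule vsp)
  show ?thesis
   unfolding v.subspace_def using dzero dadd dscal by blast
 qed
 moreover have "act (dsum n N) g (x + y) = act (dsum n N) g x + act (dsum n N) g y"
  if a: "g \<in> carrier G" "x \<in> dsum_space n N" "y \<in> dsum_space n N" for g x y
 proof -
  have "x + y \<in> dsum_space n N" using a dadd by blast
  then show ?thesis using a mem gm.act_add[OF gm] by (auto simp: dsum_def fun_eq_iff)
 qed
 moreover have "act (dsum n N) g (scal (dsum n N) c x) = scal (dsum n N) c (act (dsum n N) g x)"
  if a: "g \<in> carrier G" "x \<in> dsum_space n N" for g c x
 proof -
  have "(\<lambda>i. scal (N i) c (x i)) \<in> dsum_space n N" using a dscal by blast
  then show ?thesis using a mem gm.act_scal[OF gm] sz by (auto simp: dsum_def fun_eq_iff)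
 qed
 ultimately show ?thesis by (simp add: is_gmod_def dsum_def)
qed

abbreviation isum :: "('k, 'g, 'w::ab_group_add) gmod \<Rightarrow> nat \<Rightarrow> (nat \<Rightarrow> 'w set) \<Rightarrow> (nat \<Rightarrow> nat) \<Rightarrow> ('k, 'g, nat \<Rightarrow> nat \<Rightarrow> 'w) gmod" where
 "isum W r M m \<equiv> dsum r (\<lambda>i. gpow (subgmod W (M i)) (m i))"

lemma space_isum: "x \<in> space (isum W r M m) \<longleftrightarrow> (\<forall>i j. if i < r \<and> j < m i then x i j \<in> M i else x i j = 0)"
 by (auto simp: dsum_def dsum_space_def fun_eq_iff)

lemma isumD: "x \<in> space (isum W r M m) \<Longrightarrow> if i < r \<and> j < m i then x i j \<in> M i else x i j = 0"
 by (rule iffD1[OF space_isum, THEN spec, THEN spec])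

lemma isum_mem: "x \<in> space (isum W r M m) \<Longrightarrow> i < r \<Longrightarrow> j < m i \<Longrightarrow> x i j \<in> M i"
 by (drule isumD[where i = i and j = j]) simp

lemma scal_isum: "scal (isum W r M m) = (\<lambda>c x i j. scal W c (x i j))" by (simp add: dsum_def)

context gm begin

lemma act_isum:
 assumes "x \<in> space (isum M r N m)" "g \<in> carrier G"
 shows "act (isum M r N m) g x = (\<lambda>i j. act M g (x i j))"
proof (intro ext)
 fix i j
 have "x \<in> dsum_space r (\<lambda>i. gpow (subgmod M (N i)) (m i))" using assms(1) by (simp add: dsum_def)
 moreover have "x i \<in> dsum_space (m i) (\<lambda>_. subgmod M (N i))" if "i < r"
 proof -
  have "x i \<in> space (gpow (subgmod M (N i)) (m i))" using assms(1) that by (simp add: dsum_def[of r] dsum_space_def[of r])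
  then show ?thesis by (simp add: dsum_def)
 qed
 moreover have "if i < r \<and> j < m i then x i j \<in> N i else x i j = 0"
  using isumD[OF assms(1)] .
 ultimately show "act (isum M r N m) g x i j = act M g (x i j)" using assms(2) by (auto simp: dsum_def split: if_splits)
qed

lemma gm_isum:
 assumes "\<And>i. i < r \<Longrightarrow> gsubmodule G M (N i)"
 shows "gm G (isum M r N m)"
proof -
 have v: "vector_space (scal (gpow (subgmod M (N i)) (m i)))" for i using vs.vector_space_axioms by (auto simp: dsum_def vector_space_def fun_eq_iff)
 have "is_gmod G (isum M r N m)" by (intro dsum_gmod group_G finite_G v) (use assms gsubmodule_gmod vs.vector_space_axioms in auto)
 then show ?thesis using group_G finite_G by (simp add: gm_def)
qed

lemma gpow_gmod:
 assumes "gsubmodule G M N" shows "gm G (gpow (subgmod M N) m)"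
proof -
 have "is_gmod G (gpow (subgmod M N) m)" by (intro dsum_gmod group_G finite_G) (use assms gsubmodule_gmod vs.vector_space_axioms in auto)
 then show ?thesis using group_G finite_G by (simp add: gm_def)
qed

lemma dim_strict_mono:
 assumes fd: "fin_dim M" and S: "vs.subspace S" "S \<subseteq> space M" and T: "vs.subspace T" "T \<subset> S"
 shows "vs.dim T < vs.dim S"
proof -
 obtain F where F: "finite F" "space M \<subseteq> vs.span F" using fd by (auto simp: fin_dim_def)
 obtain B where B: "B \<subseteq> T" "vs.independent B" "T \<subseteq> vs.span B" "card B = vs.dim T" by (rule vs.basis_exists)
 obtain C where C: "B \<subseteq> C" "C \<subseteq> S" "vs.independent C" "S \<subseteq> vs.span C"
  using vs.maximal_independent_subset_extend[of B S] B T by blast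
 have cf: "finite C" using vs.independent_span_bound[OF F(1) C(3)] C(2) S(2) F(2) by blast
 have "B \<noteq> C"
 proof
  assume "B = C"
  then have "S \<subseteq> T" using C(4) vs.span_minimal[OF B(1) T(1)] by blast
  then show False using T(2) by blast
 qed
 then have "card B < card C" using C(1) cf by (simp add: psubset_card_mono psubsetI)
 also have "card C = vs.dim S" by (rule vs.basis_card_eq_dim) (use C in auto)
 finally show ?thesis using B(4) by simp
qed

text \<open>A nonzero submodule of least dimension inside N has no proper nonzero submodule.\<close>

lemma simple_submodule_exists:
 assumes fd: "fin_dim M" and N: "gsubmodule G M N" "N \<noteq> {0}"
 obtains S where "gsubmodule G M S" "S \<subseteq> N" "simple_gmod G (subgmod M S)"
proof -
 let ?P = "\<lambda>S. gsubmodule G M S \<and> S \<subseteq> N \<and> S \<noteq> {0}"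
 obtain S where S: "?P S" "\<And>T. ?P T \<Longrightarrow> vs.dim S \<le> vs.dim T" using ex_has_least_nat[of ?P N vs.dim] N by blast
 have sub: "vs.subspace S" "S \<subseteq> space M" using S(1) by (auto simp: gsubmodule_def)
 have "simple_gmod G (subgmod M S)"
  unfolding simple_gmod_def
 proof (intro conjI allI impI)
  show "is_gmod G (subgmod M S)" using S(1) gsubmodule_gmod by blast
  show "space (subgmod M S) \<noteq> {0}" using S(1) by simp
  fix T assume T: "gsubmodule G (subgmod M S) T"
  then have T': "gsubmodule G M T" "T \<subseteq> S" "vs.subspace T" using sub by (auto simp: gsubmodule_def) (metis act_subgmod' subsetD)
  show "T = {0} \<or> T = space (subgmod M S)"
  proof (rule ccontr)
   assume "\<not> (T = {0} \<or> T = space (subgmod M S))"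
   then have "T \<noteq> {0}" "T \<subset> S" using T' by auto
   then have "vs.dim T < vs.dim S" "?P T" using dim_strict_mono[OF fd sub T'(3)] T' S(1) by auto
   then show False using S(2)[of T] by simp
  qed
 qed
 then show ?thesis using that S(1) by blast
qed

text \<open>One step in building a decomposition: L is the direct sum of K, the kernel of P on L,
  and a submodule S isomorphic to \<open>N i\<close>. The new copy occupies the position
  \<open>m i\<close>, vacant so far; this entry is erased before \<Phi> is applied, because \<Phi>
  is only controlled on vectors vanishing there.\<close>

lemma isum_extend:
 assumes sub: "\<And>i. i < r \<Longrightarrow> gsubmodule G M (N i)"
  and K: "gsubmodule G M K" and S: "gsubmodule G M S" and L: "gsubmodule G M L"
  and Phi: "gmod_iso G (isum M r N m) (subgmod M K) \<Phi>"
  and i: "i < r" and psi: "gmod_iso G (subgmod M (N i)) (subgmod M S) \<psi>"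
  and P: "ghom G M M P" "\<And>x. x \<in> L \<Longrightarrow> P x \<in> S" "\<And>x. x \<in> S \<Longrightarrow> P x = x" "S \<subseteq> L" "K = {x \<in> L. P x = 0}"
 shows "gmod_iso G (isum M r N (m(i := Suc (m i)))) (subgmod M L)
  (\<lambda>x. \<Phi> (x(i := (x i)(m i := 0))) + \<psi> (x i (m i)))" (is "gmod_iso G ?D _ ?F")
proof -
 let ?t = "\<lambda>x::nat \<Rightarrow> nat \<Rightarrow> 'v. x(i := (x i)(m i := 0))"
 interpret D: gm G ?D by (intro gm_isum sub)
 have subs: "\<And>i. i < r \<Longrightarrow> N i \<subseteq> space M" "K \<subseteq> space M" "S \<subseteq> space M" "L \<subseteq> space M" "K \<subseteq> L"
  using sub K S L P(5) by (auto simp: gsubmodule_def)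
 have N0: "0 \<in> N i" using sub[OF i] vs.subspace_0 by (auto simp: gsubmodule_def)
 have t: "?t x \<in> space (isum M r N m)" if "x \<in> space ?D" for x
  unfolding space_isum
 proof (intro allI)
  fix a b
  have "if a < r \<and> b < (m(i := Suc (m i))) a then x a b \<in> N a else x a b = 0"
   using isumD[OF that] .
  then show "if a < r \<and> b < m a then ?t x a b \<in> N a else ?t x a b = 0" using i by (auto simp: less_Suc_eq split: if_splits)
 qed
 have xi: "x i (m i) \<in> N i" if "x \<in> space ?D" for x using isum_mem[OF that i, of "m i"] by simp
 have Ph: "\<And>x. x \<in> space (isum M r N m) \<Longrightarrow> \<Phi> x \<in> K"
  "\<And>x y. x \<in> space (isum M r N m) \<Longrightarrow> y \<in> space (isum M r N m) \<Longrightarrow> \<Phi> (x + y) = \<Phi> x + \<Phi> y"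
  "\<And>c x. x \<in> space (isum M r N m) \<Longrightarrow> \<Phi> (\<lambda>i j. scal M c (x i j)) = scal M c (\<Phi> x)"
  "\<And>g x. x \<in> space (isum M r N m) \<Longrightarrow> g \<in> carrier G \<Longrightarrow> \<Phi> (\<lambda>i j. act M g (x i j)) = act M g (\<Phi> x)"
  and Pb: "bij_betw \<Phi> (space (isum M r N m)) K"
 proof -
  have h: "ghom G (isum M r N m) (subgmod M K) \<Phi>" and b: "bij_betw \<Phi> (space (isum M r N m)) K" using Phi by (auto simp: gmod_iso_alt)
  show "bij_betw \<Phi> (space (isum M r N m)) K" by fact
  show mem: "\<And>x. x \<in> space (isum M r N m) \<Longrightarrow> \<Phi> x \<in> K" using b by (auto dest: bij_betwE)
  show "\<And>x y. x \<in> space (isum M r N m) \<Longrightarrow> y \<in> space (isum M r N m) \<Longrightarrow> \<Phi> (x + y) = \<Phi> x + \<Phi> y"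
   using h by (simp add: ghom_def lin_def)
  show "\<And>c x. x \<in> space (isum M r N m) \<Longrightarrow> \<Phi> (\<lambda>i j. scal M c (x i j)) = scal M c (\<Phi> x)"
   using h by (simp add: ghom_def lin_def scal_isum)
  fix g x assume x: "x \<in> space (isum M r N m)" "g \<in> carrier G"
  show "\<Phi> (\<lambda>i j. act M g (x i j)) = act M g (\<Phi> x)"
  proof -
   have "\<Phi> (act (isum M r N m) g x) = act (subgmod M K) g (\<Phi> x)" using h x unfolding ghom_def by simp
   then show ?thesis using mem[OF x(1)] by (simp only: act_isum[OF x] act_subgmod')
  qed
 qed
 have ps: "\<And>x. x \<in> N i \<Longrightarrow> \<psi> x \<in> S" "\<And>x y. x \<in> N i \<Longrightarrow> y \<in> N i \<Longrightarrow> \<psi> (x + y) = \<psi> x + \<psi> y"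
  "\<And>c x. x \<in> N i \<Longrightarrow> \<psi> (scal M c x) = scal M c (\<psi> x)"
  "\<And>g x. x \<in> N i \<Longrightarrow> g \<in> carrier G \<Longrightarrow> \<psi> (act M g x) = act M g (\<psi> x)"
  and psb: "bij_betw \<psi> (N i) S" using psi by (auto simp: gmod_iso_alt ghom_def lin_def)
 have p0: "\<psi> 0 = 0" using ps(2)[OF N0 N0] by simp
 have z: "(0::nat \<Rightarrow> nat \<Rightarrow> 'v) \<in> space (isum M r N m)"
  using sub vs.subspace_0 unfolding space_isum by (auto simp: gsubmodule_def)
 have Ph0: "\<Phi> 0 = 0" using Ph(2)[OF z z] by simp
 have a0: "act M g 0 = 0" if "g \<in> carrier G" for g using that by simp
 have "ghom G ?D (subgmod M L) ?F"
  unfolding ghom_def lin_def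
 proof (intro conjI ballI allI)
  fix x assume x: "x \<in> space ?D"
  have "\<Phi> (?t x) \<in> L" "\<psi> (x i (m i)) \<in> L" using Ph(1)[OF t[OF x]] ps(1)[OF xi[OF x]] P(4) subs by auto
  then show "?F x \<in> space (subgmod M L)" using L vs.subspace_add by (auto simp: gsubmodule_def)
  fix y assume y: "y \<in> space ?D"
  have "?t (x + y) = ?t x + ?t y" by (auto simp: fun_eq_iff)
  then show "?F (x + y) = ?F x + ?F y" using Ph(2)[OF t[OF x] t[OF y]] ps(2)[OF xi[OF x] xi[OF y]] by simp
 next
  fix c x assume x: "x \<in> space ?D"
  have "?t (scal ?D c x) = (\<lambda>i j. scal M c (?t x i j))" by (auto simp: fun_eq_iff scal_isum)
  then show "?F (scal ?D c x) = scal (subgmod M L) c (?F x)"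
   using Ph(3)[OF t[OF x], of c] ps(3)[OF xi[OF x], of c] by (simp add: scal_isum vs.scale_right_distrib)
 next
  fix g x assume x: "x \<in> space ?D" and g: "g \<in> carrier G"
  have e1: "?t (act ?D g x) = (\<lambda>i j. act M g (?t x i j))"
   unfolding act_isum[OF x g] using a0[OF g] by (auto simp: fun_eq_iff)
  have e2: "act ?D g x i (m i) = act M g (x i (m i))" by (simp only: act_isum[OF x g])
  have F: "\<Phi> (?t x) \<in> L" "\<psi> (x i (m i)) \<in> L" using Ph(1)[OF t[OF x]] ps(1)[OF xi[OF x]] P(4) subs by auto
  then have FL: "?F x \<in> L" using L vs.subspace_add by (auto simp: gsubmodule_def)
  have "\<Phi> (?t x) \<in> space M" "\<psi> (x i (m i)) \<in> space M" using F subs(4) by auto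
  then show "?F (act ?D g x) = act (subgmod M L) g (?F x)"
   unfolding e1 e2 Ph(4)[OF t[OF x] g] ps(4)[OF xi[OF x] g] act_subgmod'[OF FL] using g by simp
 qed
 moreover have "x = 0" if x: "x \<in> space ?D" and Fx: "?F x = 0" for x
 proof -
  have m: "\<Phi> (?t x) \<in> K" "\<psi> (x i (m i)) \<in> S" using Ph(1)[OF t[OF x]] ps(1)[OF xi[OF x]] by auto
  \<comment> \<open>P kills the K-part and fixes the S-part, so it separates the two
    summands.\<close>
  have "P (?F x) = P (\<Phi> (?t x)) + P (\<psi> (x i (m i)))" using P(1) m subs by (auto simp: ghom_def lin_def subset_iff)
  also have "\<dots> = \<psi> (x i (m i))" using m P by auto
  finally have "\<psi> (x i (m i)) = 0" using Fx P(1) vs.vector_space_axioms lin_0[of M P] by (simp add: ghom_def)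
  moreover from this have "\<Phi> (?t x) = 0" using Fx by simp
  ultimately have "\<psi> (x i (m i)) = \<psi> 0" "\<Phi> (?t x) = \<Phi> 0" using p0 Ph0 by simp_all
  then have xz: "x i (m i) = 0" and t0: "?t x = 0"
   using inj_onD[OF bij_betw_imp_inj_on[OF psb] _ xi[OF x] N0] inj_onD[OF bij_betw_imp_inj_on[OF Pb] _ t[OF x] z] by simp_all
  have tz: "?t x a b = 0" for a b using t0 by (simp only: zero_fun_apply)
  have "x a b = 0" for a b using tz[of a b] xz by (cases "a = i"; cases "b = m i") simp_all
  then show "x = 0" by (simp add: fun_eq_iff)
 qed
 moreover have "\<exists>x\<in>space ?D. ?F x = y" if y: "y \<in> space (subgmod M L)" for y
 proof -
  have yL: "y \<in> L" "y \<in> space M" using y subs by auto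
  have Py: "P y \<in> S" "P y \<in> space M" using P(2) yL subs by auto
  \<comment> \<open>y is the sum of y - P y, which lies in K, and P y, which lies in S.\<close>
  have "y - P y \<in> L" using yL Py P(4) L vs.subspace_diff by (auto simp: gsubmodule_def)
  moreover have "P (y - P y) + P (P y) = P y" using P(1) yL Py diff_mem[OF yL(2) Py(2)] unfolding ghom_def lin_def by (metis diff_add_cancel)
  ultimately have "y - P y \<in> K" using P(5) P(3)[OF Py(1)] by simp
  then have "y - P y \<in> \<Phi> ` space (isum M r N m)" using bij_betw_imp_surj_on[OF Pb] by simp
  then obtain x' where x': "x' \<in> space (isum M r N m)" "\<Phi> x' = y - P y" by auto
  have "P y \<in> \<psi> ` N i" using bij_betw_imp_surj_on[OF psb] Py by simp
  then obtain u where u: "u \<in> N i" "\<psi> u = P y" by auto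
  let ?x = "x'(i := (x' i)(m i := u))"
  have "x' i (m i) = 0" using isumD[OF x'(1), of i "m i"] by simp
  then have "?t ?x = x'" by (auto simp: fun_eq_iff)
  moreover have "?x \<in> space ?D" unfolding space_isum
  proof (intro allI)
   fix a b
   show "if a < r \<and> b < (m(i := Suc (m i))) a then ?x a b \<in> N a else ?x a b = 0"
    using isumD[OF x'(1), of a b] u i by (auto simp: less_Suc_eq split: if_splits)
  qed
  ultimately have "?x \<in> space ?D \<and> ?F ?x = y" using x' u by simp
  then show ?thesis by blast
 qed
 ultimately show ?thesis by (intro D.gmod_isoI gm_subgmod L)
qed

text \<open>Induction on the dimension of a submodule L: a simple S is split off by complete
  reducibility, and the kernel of the projection is decomposed. S then joins a type already listed
  or opens a new one.\<close>

lemma isotypic_decomp_exists: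
 assumes fd: "fin_dim M" and card: "of_nat (card (carrier G)) \<noteq> (0::'k)"
 shows "\<exists>r N m \<Phi>. isotypic_decomp G M r N m \<Phi>"
proof -
 have "\<exists>r N m \<Phi>. (\<forall>i<r. gsubmodule G M (N i) \<and> simple_gmod G (subgmod M (N i))) \<and>
   (\<forall>i<r. \<forall>j<r. i \<noteq> j \<longrightarrow> \<not> (\<exists>f. gmod_iso G (subgmod M (N i)) (subgmod M (N j)) f)) \<and>
   gmod_iso G (isum M r N m) (subgmod M L) \<Phi>" if "gsubmodule G M L" for L
  using that
 proof (induction "vs.dim L" arbitrary: L rule: less_induct)
  case less
  show ?case
  proof (cases "L = {0}")
   case True
   have "gmod_iso G (isum M 0 N m) (subgmod M {0}) (\<lambda>_. 0)" for N m
   proof -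
    interpret I: gm G "isum M 0 N m" by (rule gm_isum) simp
    have L: "gm G (subgmod M {0})" using gm_subgmod less.prems True by simp
    show ?thesis by (rule I.gmod_isoI[OF L]) (auto simp: ghom_def lin_def space_isum fun_eq_iff intro!: bexI[of _ 0])
   qed
   then show ?thesis using True by (intro exI[of _ 0]) (simp, blast)
  next
   case False
   obtain S where S: "gsubmodule G M S" "S \<subseteq> L" "simple_gmod G (subgmod M S)"
    using simple_submodule_exists[OF fd less.prems False] .
   obtain P where P: "ghom G M M P" "\<And>x. x \<in> space M \<Longrightarrow> P x \<in> S" "\<And>x. x \<in> S \<Longrightarrow> P x = x"
    using Maschke[OF card S(1)] by auto
   define K where "K = {x \<in> L. P x = 0}"
   have Ls: "vs.subspace L" "L \<subseteq> space M" using less.prems by (auto simp: gsubmodule_def)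
   have Lm: "\<And>x. x \<in> L \<Longrightarrow> x \<in> space M" using Ls(2) by auto
   have P0: "P 0 = 0" using P(1) lin_0[of M P] vs.vector_space_axioms by (auto simp: ghom_def)
   have Pl: "\<And>x y. x \<in> L \<Longrightarrow> y \<in> L \<Longrightarrow> P (x + y) = P x + P y" "\<And>x c. x \<in> L \<Longrightarrow> P (scal M c x) = scal M c (P x)"
    "\<And>x g. x \<in> L \<Longrightarrow> g \<in> carrier G \<Longrightarrow> P (act M g x) = act M g (P x)"
    using P(1) by (auto simp: ghom_def lin_def Lm)
   have Ks: "gsubmodule G M K" using less.prems P0 Pl by (auto simp: K_def gsubmodule_def vs.subspace_def)
   obtain x where x: "x \<in> S" "x \<noteq> 0" using S(3) S(1) vs.subspace_0 by (auto simp: simple_gmod_def gsubmodule_def)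
   then have "x \<notin> K" "x \<in> L" using P(3) S(2) by (auto simp: K_def)
   then have "K \<subset> L" by (auto simp: K_def)
   then have "vs.dim K < vs.dim L" using dim_strict_mono[OF fd Ls] Ks by (auto simp: gsubmodule_def)
   from less.hyps[OF this Ks] obtain r N m \<Phi> where IH:
    "\<forall>i<r. gsubmodule G M (N i) \<and> simple_gmod G (subgmod M (N i))"
    "\<forall>i<r. \<forall>j<r. i \<noteq> j \<longrightarrow> \<not> (\<exists>f. gmod_iso G (subgmod M (N i)) (subgmod M (N j)) f)"
    "gmod_iso G (isum M r N m) (subgmod M K) \<Phi>" by blast
   have PL: "\<And>x. x \<in> L \<Longrightarrow> P x \<in> S" using P(2) Ls(2) by blast
   show ?thesis
   proof (cases "\<exists>i<r. \<exists>f. gmod_iso G (subgmod M (N i)) (subgmod M S) f")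
    case True
    then obtain i \<psi> where i: "i < r" and psi: "gmod_iso G (subgmod M (N i)) (subgmod M S) \<psi>" by blast
    have "gmod_iso G (isum M r N (m(i := Suc (m i)))) (subgmod M L)
     (\<lambda>x. \<Phi> (x(i := (x i)(m i := 0))) + \<psi> (x i (m i)))"
     by (rule isum_extend[OF _ Ks S(1) less.prems IH(3) i psi P(1) PL P(3) S(2) K_def]) (use IH(1) in auto)
    with IH show ?thesis by blast
   next
    case False
    \<comment> \<open>A new type is first adjoined with multiplicity 0, which does not change the
      sum; adding S is then the same extension step as in the other case.\<close>
    let ?N = "N(r := S)" and ?m = "m(r := 0)"
    have sub: "\<forall>i<Suc r. gsubmodule G M (?N i) \<and> simple_gmod G (subgmod M (?N i))" using IH(1) S by (auto simp: less_Suc_eq)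
    have gms: "gm G (subgmod M (?N i))" if "i < Suc r" for i using sub that gm_subgmod by blast
    have "\<not> (\<exists>f. gmod_iso G (subgmod M S) (subgmod M (N i)) f)" if "i < r" for i
    proof
     assume "\<exists>f. gmod_iso G (subgmod M S) (subgmod M (N i)) f"
     then obtain f where f: "gmod_iso G (subgmod M S) (subgmod M (N i)) f" ..
     have "gm G (subgmod M S)" "gm G (subgmod M (N i))" using gms[of r] gms[of i] that by auto
     from gmod_iso_inv[OF this f] False that show False by blast
    qed
    then have noniso: "\<forall>i<Suc r. \<forall>j<Suc r. i \<noteq> j \<longrightarrow> \<not> (\<exists>f. gmod_iso G (subgmod M (?N i)) (subgmod M (?N j)) f)"
     using IH(2) False by (auto simp: less_Suc_eq)
    have sp: "space (isum M (Suc r) ?N ?m) = space (isum M r N m)"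
    proof (rule Set.set_eqI)
     fix x
     have "(if i < Suc r \<and> j < ?m i then x i j \<in> ?N i else x i j = 0) \<longleftrightarrow>
      (if i < r \<and> j < m i then x i j \<in> N i else x i j = 0)" for i j by (auto simp: less_Suc_eq)
     then show "x \<in> space (isum M (Suc r) ?N ?m) \<longleftrightarrow> x \<in> space (isum M r N m)"
      unfolding space_isum by simp
    qed
    have "act (isum M (Suc r) ?N ?m) g x = act (isum M r N m) g x" if "x \<in> space (isum M r N m)" "g \<in> carrier G" for g x
     unfolding act_isum[OF that] by (rule act_isum) (use that sp in simp_all)
    then have Ph: "gmod_iso G (isum M (Suc r) ?N ?m) (subgmod M K) \<Phi>" using IH(3) unfolding gmod_iso_def sp scal_isum by simp
    have psi: "gmod_iso G (subgmod M (?N r)) (subgmod M S) (\<lambda>x. x)" by (simp add: gmod_iso_def bij_betw_def)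
    have "gmod_iso G (isum M (Suc r) ?N (?m(r := Suc (?m r)))) (subgmod M L)
     (\<lambda>x. \<Phi> (x(r := (x r)(?m r := 0))) + (\<lambda>x. x) (x r (?m r)))"
    proof (rule isum_extend[where K = K and S = S and P = P and i = r and r = "Suc r" and m = ?m and N = ?N and \<Phi> = \<Phi> and \<psi> = "\<lambda>x. x" and L = L])
     show "gmod_iso G (isum M (Suc r) ?N ?m) (subgmod M K) \<Phi>" by (rule Ph)
     show "gmod_iso G (subgmod M (?N r)) (subgmod M S) (\<lambda>x. x)" by (rule psi)
     show "gsubmodule G M (?N i)" if "i < Suc r" for i using sub that by blast
     show "K = {x \<in> L. P x = 0}" by (rule K_def)
     show "P x \<in> S" if "x \<in> L" for x by (rule PL[OF that])
     show "P x = x" if "x \<in> S" for x by (rule P(3)[OF that])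
    qed (simp_all only: Ks S(1,2) less.prems P(1) lessI)
    with sub noniso show ?thesis by blast
   qed
  qed
 qed
 from this[OF gsubmodule_space] obtain r N m \<Phi> where *: "(\<forall>i<r. gsubmodule G M (N i) \<and> simple_gmod G (subgmod M (N i)))"
  "(\<forall>i<r. \<forall>j<r. i \<noteq> j \<longrightarrow> \<not> (\<exists>f. gmod_iso G (subgmod M (N i)) (subgmod M (N j)) f))"
  "gmod_iso G (isum M r N m) (subgmod M (space M)) \<Phi>" by blast
 have "gmod_iso G (isum M r N m) M \<Phi>" using *(3) by (auto simp: gmod_iso_def dest: bij_betwE)
 then have "isotypic_decomp G M r N m \<Phi>"
  unfolding isotypic_decomp_def by (intro conjI *(1,2))
 then show ?thesis by (intro exI)
qed

end

section \<open>Polarization of words\<close>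

definition fsub :: "('x \<Rightarrow> 'k::field) set \<Rightarrow> bool" where
 "fsub N \<longleftrightarrow> (\<lambda>_. 0) \<in> N \<and> (\<forall>f\<in>N. \<forall>g\<in>N. (\<lambda>x. f x + g x) \<in> N) \<and> (\<forall>c. \<forall>f\<in>N. (\<lambda>x. c * f x) \<in> N)"

lemma fsub_add: "fsub N \<Longrightarrow> f \<in> N \<Longrightarrow> g \<in> N \<Longrightarrow> (\<lambda>x. f x + g x) \<in> N"
 and fsub_scale: "fsub N \<Longrightarrow> f \<in> N \<Longrightarrow> (\<lambda>x. c * f x) \<in> N"
 and fsub_zero: "fsub N \<Longrightarrow> (\<lambda>_. 0) \<in> N" by (auto simp: fsub_def)

lemma fsub_diff: assumes "fsub N" "f \<in> N" "g \<in> N" shows "(\<lambda>x. f x - g x) \<in> N"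
 using fsub_add[OF assms(1,2) fsub_scale[OF assms(1,3), of "-1"]] by simp

lemma fsub_sum: "fsub N \<Longrightarrow> (\<And>i. i \<in> I \<Longrightarrow> f i \<in> N) \<Longrightarrow> (\<lambda>x. \<Sum>i\<in>I. f i x) \<in> N"
 by (induction I rule: infinite_finite_induct) (auto simp: fsub_zero fsub_add)

lemma fsub_scale_iff: assumes "fsub N" "c \<noteq> 0" shows "(\<lambda>x. c * f x) \<in> N \<longleftrightarrow> f \<in> N"
proof
 assume "(\<lambda>x. c * f x) \<in> N"
 from fsub_scale[OF assms(1) this, of "inverse c"] show "f \<in> N" using assms(2) by (simp add: mult.assoc[symmetric])
qed (simp add: fsub_scale assms)

text \<open>Induction on n: substituting c t for t and subtracting c^(n+1) times the given
  combination removes the top term and multiplies the others by c^j - c^(n+1). Over an infinite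
  field c can be chosen such that these factors are nonzero.\<close>

lemma coefficients_in_subspace:
 fixes f :: "nat \<Rightarrow> 'x \<Rightarrow> 'k::field"
 assumes inf: "infinite (UNIV :: 'k set)" and N: "fsub N"
  and all: "\<And>t. (\<lambda>x. \<Sum>j\<le>n. t ^ j * f j x) \<in> N"
 shows "\<forall>j\<le>n. f j \<in> N"
 using all
proof (induction n arbitrary: f)
 case 0
 from 0[of 1] show ?case by simp
next
 case (Suc n)
 have "finite (\<Union>j\<le>n. {c::'k. poly (monom 1 j - monom 1 (Suc n)) c = 0})"
 proof (intro finite_UN_I poly_roots_finite)
  fix j assume "j \<in> {..n}"
  then have "Polynomial.coeff (monom 1 j - monom (1::'k) (Suc n)) j = 1" by simp
  then show "monom 1 j - monom (1::'k) (Suc n) \<noteq> 0" by (metis coeff_0 zero_neq_one)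
 qed simp
 then obtain c where "c \<notin> (\<Union>j\<le>n. {c::'k. poly (monom 1 j - monom 1 (Suc n)) c = 0})" using inf ex_new_if_finite by blast
 then have c: "c ^ j - c ^ Suc n \<noteq> 0" if "j \<le> n" for j using that by (auto simp: poly_monom)
 have "(\<lambda>x. \<Sum>j\<le>n. t ^ j * ((c ^ j - c ^ Suc n) * f j x)) \<in> N" for t
 proof -
  have "(\<lambda>x. (\<Sum>j\<le>Suc n. (c * t) ^ j * f j x) - c ^ Suc n * (\<Sum>j\<le>Suc n. t ^ j * f j x)) \<in> N"
   by (intro fsub_diff[OF N] fsub_scale[OF N] Suc.prems)
  moreover have "(\<Sum>j\<le>Suc n. (c * t) ^ j * f j x) - c ^ Suc n * (\<Sum>j\<le>Suc n. t ^ j * f j x) =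
    (\<Sum>j\<le>n. t ^ j * ((c ^ j - c ^ Suc n) * f j x))" for x
   unfolding sum_distrib_left sum_subtractf[symmetric] by (simp add: algebra_simps power_mult_distrib)
  ultimately show ?thesis by simp
 qed
 from Suc.IH[OF this] have IH: "f j \<in> N" if "j \<le> n" for j using fsub_scale_iff[OF N c[OF that]] that by auto
 have "(\<lambda>x. (\<Sum>j\<le>Suc n. 1 ^ j * f j x) - (\<Sum>j\<le>n. f j x)) \<in> N"
  by (intro fsub_diff[OF N] fsub_sum[OF N] Suc.prems) (simp add: IH)
 then have "f (Suc n) \<in> N" by simp
 with IH show ?case by (auto simp: le_Suc_eq)
qed

text \<open>The function in the conclusion is the coefficient of t in the given product, which for
  each x is a polynomial in t. Over an infinite field the coefficients lie in every subspace that
  contains all the values.\<close>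

lemma derivation_in_subspace:
 fixes \<alpha> \<beta> :: "'d \<Rightarrow> 'x \<Rightarrow> 'k::field"
 assumes inf: "infinite (UNIV :: 'k set)" and N: "fsub N" and D: "finite D"
  and all: "\<And>t. (\<lambda>x. \<Prod>s\<in>D. \<alpha> s x + t * \<beta> s x) \<in> N"
 shows "(\<lambda>x. \<Sum>s\<in>D. \<beta> s x * (\<Prod>s'\<in>D - {s}. \<alpha> s' x)) \<in> N"
proof -
 define P where "P x = (\<Prod>s\<in>D. [:\<alpha> s x, \<beta> s x:])" for x
 \<comment> \<open>One more than the number of factors, so that the index 1 is in range even for
   empty D.\<close>
 define n where "n = Suc (card D)"
 have deg: "Polynomial.degree (P x) \<le> n" for x
 proof -
  have "Polynomial.degree (P x) \<le> (\<Sum>s\<in>D. Polynomial.degree [:\<alpha> s x, \<beta> s x:])"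
   unfolding P_def by (rule degree_prod_sum_le[OF D, unfolded o_def])
  also have "\<dots> \<le> (\<Sum>s\<in>D. 1)" by (intro sum_mono) simp
  finally show ?thesis by (simp add: n_def)
 qed
 have "(\<lambda>x. \<Sum>j\<le>n. t ^ j * Polynomial.coeff (P x) j) \<in> N" for t
 proof -
  have "(\<Sum>j\<le>n. t ^ j * Polynomial.coeff (P x) j) = (\<Prod>s\<in>D. \<alpha> s x + t * \<beta> s x)" for x
  proof -
   have "(\<Sum>j\<le>n. t ^ j * Polynomial.coeff (P x) j) = poly (P x) t"
    unfolding poly_altdef using deg[of x] by (intro sum.mono_neutral_cong_right) (auto intro: coeff_eq_0)
   then show ?thesis by (simp add: P_def poly_prod)
  qed
  then show ?thesis using all[of t] by simp
 qed
 from coefficients_in_subspace[OF inf N this] have "(\<lambda>x. Polynomial.coeff (P x) 1) \<in> N" by (auto simp: n_def)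
 moreover have "Polynomial.coeff (P x) 1 = (\<Sum>s\<in>D. \<beta> s x * (\<Prod>s'\<in>D - {s}. \<alpha> s' x))" for x
 proof -
  have "Polynomial.coeff (P x) 1 = poly (pderiv (P x)) 0" by (simp add: poly_0_coeff_0 coeff_pderiv)
  also have "\<dots> = (\<Sum>s\<in>D. \<beta> s x * (\<Prod>s'\<in>D - {s}. \<alpha> s' x))"
   by (simp add: P_def pderiv_prod poly_sum poly_prod pderiv_pCons mult.commute)
  finally show ?thesis .
 qed
 ultimately show ?thesis by simp
qed

text \<open>Positions with equal \<open>c s\<close> form a class; they start with the same function
  and are set free one at a time. Perturbing the common function of the class of s0 by t times
  \<open>u s0\<close> and taking the coefficient of t gives the desired product once for every
  position of the class that is not yet free. Their number has to be divided out, which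
  \<open>small\<close> permits; in characteristic p it limits the classes to fewer than p
  positions.\<close>

lemma polarization_in_subspace:
 fixes c :: "'d \<Rightarrow> 'l" and u :: "'d \<Rightarrow> 'x \<Rightarrow> 'k::field" and F :: "'l \<Rightarrow> ('x \<Rightarrow> 'k::field) set"
 assumes inf: "infinite (UNIV :: 'k set)" and N: "fsub N" and D: "finite D"
  and F: "\<And>a. fsub (F a)"
  and diag: "\<And>\<mu>. (\<And>a. \<mu> a \<in> F a) \<Longrightarrow> (\<lambda>x. \<Prod>s\<in>D. \<mu> (c s) x) \<in> N"
  and small: "\<And>a q. 1 \<le> q \<Longrightarrow> q \<le> card {s\<in>D. c s = a} \<Longrightarrow> of_nat q \<noteq> (0::'k)"
  and lam: "\<And>s. s \<in> D \<Longrightarrow> u s \<in> F (c s)"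
 shows "(\<lambda>x. \<Prod>s\<in>D. u s x) \<in> N"
proof -
 \<comment> \<open>The positions in S are free, all others still share one function per
   class.\<close>
 have claim: "(\<lambda>x. \<Prod>s\<in>D. if s \<in> S then u s x else \<mu> (c s) x) \<in> N"
  if "S \<subseteq> D" "\<And>a. \<mu> a \<in> F a" for S \<mu>
  using finite_subset[OF that(1) D] that
 proof (induction S arbitrary: \<mu> rule: finite_induct)
  case empty
  then show ?case using diag[of \<mu>] by simp
 next
  case (insert s0 S)
  let ?a = "c s0"
  define \<alpha> where "\<alpha> s = (if s \<in> S then u s else \<mu> (c s))" for s
  define \<beta> where "\<beta> s = (if s \<notin> S \<and> c s = ?a then u s0 else (\<lambda>_. 0))" for s
  have s0: "s0 \<in> D" using insert.prems by auto
  have "(\<lambda>x. \<Prod>s\<in>D. \<alpha> s x + t * \<beta> s x) \<in> N" for t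
  proof -
   define \<nu> where "\<nu> = \<mu>(?a := (\<lambda>x. \<mu> ?a x + t * u s0 x))"
   have "\<nu> a \<in> F a" for a using insert.prems lam[OF s0] F by (auto simp: \<nu>_def intro!: fsub_add fsub_scale)
   then have "(\<lambda>x. \<Prod>s\<in>D. if s \<in> S then u s x else \<nu> (c s) x) \<in> N" using insert.IH[of \<nu>] insert.prems by auto
   moreover have "(if s \<in> S then u s x else \<nu> (c s) x) = \<alpha> s x + t * \<beta> s x" for s x
    by (auto simp: \<alpha>_def \<beta>_def \<nu>_def)
   ultimately show ?thesis by simp
  qed
  from derivation_in_subspace[OF inf N D this]
  have 1: "(\<lambda>x. \<Sum>s\<in>D. \<beta> s x * (\<Prod>s'\<in>D - {s}. \<alpha> s' x)) \<in> N" .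
  let ?Q = "{s\<in>D. s \<notin> S \<and> c s = ?a}"
  have "(\<Sum>s\<in>D. \<beta> s x * (\<Prod>s'\<in>D - {s}. \<alpha> s' x)) =
   of_nat (card ?Q) * (\<Prod>s\<in>D. if s \<in> insert s0 S then u s x else \<mu> (c s) x)" for x
  proof -
   have "(\<Sum>s\<in>D. \<beta> s x * (\<Prod>s'\<in>D - {s}. \<alpha> s' x)) = (\<Sum>s\<in>?Q. \<beta> s x * (\<Prod>s'\<in>D - {s}. \<alpha> s' x))"
    using D by (intro sum.mono_neutral_right) (auto simp: \<beta>_def)
   also have "\<dots> = (\<Sum>s\<in>?Q. \<Prod>s\<in>D. if s \<in> insert s0 S then u s x else \<mu> (c s) x)"
   proof (rule sum.cong, rule refl)
    fix s assume s: "s \<in> ?Q"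
    \<comment> \<open>Omitting s instead of s0 makes no difference: both positions still carry the
      common function of their class.\<close>
    have eq: "(\<Prod>s'\<in>D - {s}. \<alpha> s' x) = (\<Prod>s'\<in>D - {s0}. \<alpha> s' x)"
    proof (cases "s = s0")
     case False
     have "(\<Prod>s'\<in>D - {s}. \<alpha> s' x) = \<alpha> s0 x * (\<Prod>s'\<in>D - {s} - {s0}. \<alpha> s' x)"
      using False s0 D by (intro prod.remove) auto
     moreover have "(\<Prod>s'\<in>D - {s0}. \<alpha> s' x) = \<alpha> s x * (\<Prod>s'\<in>D - {s0} - {s}. \<alpha> s' x)"
      using False s D by (intro prod.remove) auto
     moreover have "\<alpha> s = \<alpha> s0" using s insert.hyps by (auto simp: \<alpha>_def)
     moreover have "D - {s} - {s0} = D - {s0} - {s}" by auto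
     ultimately show ?thesis by simp
    qed simp
    have "(\<Prod>s\<in>D. if s \<in> insert s0 S then u s x else \<mu> (c s) x) =
     u s0 x * (\<Prod>s\<in>D - {s0}. if s \<in> insert s0 S then u s x else \<mu> (c s) x)"
     using prod.remove[OF D s0, of "\<lambda>s. if s \<in> insert s0 S then u s x else \<mu> (c s) x"] by simp
    also have "(\<Prod>s\<in>D - {s0}. if s \<in> insert s0 S then u s x else \<mu> (c s) x) = (\<Prod>s\<in>D - {s0}. \<alpha> s x)"
     by (intro prod.cong) (auto simp: \<alpha>_def)
    finally show "\<beta> s x * (\<Prod>s'\<in>D - {s}. \<alpha> s' x) = (\<Prod>s\<in>D. if s \<in> insert s0 S then u s x else \<mu> (c s) x)"
     using s by (simp add: eq \<beta>_def)
   qed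
   finally show ?thesis by simp
  qed
  then have m: "(\<lambda>x. of_nat (card ?Q) * (\<Prod>s\<in>D. if s \<in> insert s0 S then u s x else \<mu> (c s) x)) \<in> N" using 1 by simp
  have nz: "of_nat (card ?Q) \<noteq> (0::'k)"
  proof (rule small[of _ ?a])
   have "s0 \<in> ?Q" using s0 insert.hyps by auto
   moreover have "finite ?Q" using D by auto
   ultimately have "card ?Q > 0" unfolding card_gt_0_iff by auto
   then show "1 \<le> card ?Q" by linarith
   show "card ?Q \<le> card {s\<in>D. c s = ?a}" using D by (intro card_mono) auto
  qed
  show ?case by (rule iffD1[OF fsub_scale_iff[OF N nz] m])
 qed
 have z: "(\<lambda>_. 0) \<in> F a" for a by (rule fsub_zero[OF F])
 have eq: "(\<Prod>s\<in>D. if s \<in> D then u s x else 0) = (\<Prod>s\<in>D. u s x)" for x by (rule prod.cong[OF refl]) simp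
 \<comment> \<open>With S = D no position uses a common function any more; zero functions serve as
   defaults.\<close>
 have "(\<lambda>x. \<Prod>s\<in>D. if s \<in> D then u s x else (\<lambda>_ _. 0) (c s) x) \<in> N"
  by (rule claim[of D "\<lambda>_ _. 0", OF subset_refl]) (rule z)
 then show ?thesis unfolding eq .
qed

text \<open>
 Modulo \<open>p\<close>, the down operator from the \<open>(t+1)\<close>-subsets to the \<open>t\<close>-subsets of a \<open>(2t+1)\<close>-set is onto
 when \<open>1, \<dots>, t + 1\<close> are invertible: sort the subsets by the size \<open>j\<close> of their intersection with \<open>A\<close>.
\<close>

lemma down_operator_onto:
 fixes g :: "'d set \<Rightarrow> 'x \<Rightarrow> 'k::field"
 assumes N: "fsub N" and fin: "finite A" "finite C" and disj: "A \<inter> C = {}" and card: "card C = Suc (card A)"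
  and down: "\<And>B. B \<subseteq> A \<union> C \<Longrightarrow> card B = Suc (card A) \<Longrightarrow> (\<lambda>x. \<Sum>s\<in>B. g (B - {s}) x) \<in> N"
  and inv: "\<And>j. 1 \<le> j \<Longrightarrow> j \<le> Suc (card A) \<Longrightarrow> of_nat j \<noteq> (0::'k)"
 shows "g A \<in> N"
proof -
 let ?t = "card A"
 define \<T> where "\<T> j = {T. T \<subseteq> A \<union> C \<and> card T = ?t \<and> card (T \<inter> A) = j}" for j
 define \<B> where "\<B> j = {B. B \<subseteq> A \<union> C \<and> card B = Suc ?t \<and> card (B \<inter> A) = j}" for j
 have fT: "finite (\<T> j)" for j by (rule finite_subset[of _ "Pow (A \<union> C)"]) (use fin in \<open>auto simp: \<T>_def\<close>)
 have fB: "finite (\<B> j)" for j by (rule finite_subset[of _ "Pow (A \<union> C)"]) (use fin in \<open>auto simp: \<B>_def\<close>)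
 have fAC: "finite T" if "T \<subseteq> A \<union> C" for T using that by (rule finite_subset) (use fin in simp)
 \<comment> \<open>The pairs (B, s) are counted by T = B - {s}. A T meeting A in j elements is
   enlarged by one of the j + 1 elements of C - T; a T meeting A in j - 1 elements is enlarged by
   one of the t - (j - 1) elements of A - T.\<close>
 have key: "(\<Sum>B\<in>\<B> j. \<Sum>s\<in>B. g (B - {s}) x) =
   of_nat (Suc j) * (\<Sum>T\<in>\<T> j. g T x) + (if j = 0 then 0 else of_nat (Suc ?t - j) * (\<Sum>T\<in>\<T> (j - 1). g T x))"
  if j: "j \<le> ?t" for j x
 proof -
  let ?U = "{T. T \<subseteq> A \<union> C \<and> card T = ?t}"
  have fU: "finite ?U" by (rule finite_subset[of _ "Pow (A \<union> C)"]) (use fin in auto)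
  have "(\<Sum>B\<in>\<B> j. \<Sum>s\<in>B. g (B - {s}) x) = (\<Sum>(B, s)\<in>Sigma (\<B> j) (\<lambda>B. B). g (B - {s}) x)"
  proof (rule sum.Sigma[OF fB], rule ballI)
   fix B assume "B \<in> \<B> j" then show "finite B" by (intro fAC) (simp add: \<B>_def)
  qed
  also have "\<dots> = (\<Sum>(T, s)\<in>Sigma ?U (\<lambda>T. {s \<in> (A \<union> C) - T. card (insert s T \<inter> A) = j}). g T x)"
  proof (rule sum.reindex_bij_witness[where i = "\<lambda>(T, s). (insert s T, s)" and j = "\<lambda>(B, s). (B - {s}, s)"])
   fix a assume "a \<in> Sigma (\<B> j) (\<lambda>B. B)"
   then obtain B s where a: "a = (B, s)" "B \<in> \<B> j" "s \<in> B" by (cases a) simp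
   have ins: "insert s (B - {s}) = B" using a(3) by (rule insert_Diff)
   show "(\<lambda>(T, s). (insert s T, s)) ((\<lambda>(B, s). (B - {s}, s)) a) = a" using ins by (simp add: a(1))
   have B: "B \<subseteq> A \<union> C" "card B = Suc ?t" "card (B \<inter> A) = j" using a(2) by (simp_all add: \<B>_def)
   have "card (B - {s}) = ?t" using B(2) a(3) fAC[OF B(1)] by simp
   moreover have "B - {s} \<subseteq> A \<union> C" "s \<in> A \<union> C - (B - {s})" using B(1) a(3) by auto
   ultimately show "(\<lambda>(B, s). (B - {s}, s)) a \<in> Sigma ?U (\<lambda>T. {s \<in> (A \<union> C) - T. card (insert s T \<inter> A) = j})"
    unfolding a(1) prod.case mem_Sigma_iff mem_Collect_eq ins using B(3) by (intro conjI)
   show "(case (case a of (B, s) \<Rightarrow> (B - {s}, s)) of (T, s) \<Rightarrow> g T x) = (case a of (B, s) \<Rightarrow> g (B - {s}) x)"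
    by (simp add: a(1))
  next
   fix b assume "b \<in> Sigma ?U (\<lambda>T. {s \<in> (A \<union> C) - T. card (insert s T \<inter> A) = j})"
   then obtain T s where b: "b = (T, s)" "T \<subseteq> A \<union> C" "card T = ?t" "s \<in> A \<union> C" "s \<notin> T" "card (insert s T \<inter> A) = j"
    by (cases b) simp
   show "(\<lambda>(B, s). (B - {s}, s)) ((\<lambda>(T, s). (insert s T, s)) b) = b" using b(5) by (simp add: b(1))
   show "(\<lambda>(T, s). (insert s T, s)) b \<in> Sigma (\<B> j) (\<lambda>B. B)" using b(2-6) fAC[OF b(2)] by (simp add: b(1) \<B>_def)
  qed
  also have "\<dots> = (\<Sum>T\<in>?U. \<Sum>s\<in>{s \<in> (A \<union> C) - T. card (insert s T \<inter> A) = j}. g T x)"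
   by (rule sum.Sigma[symmetric, OF fU]) (use fin in simp)
  also have "\<dots> = (\<Sum>T\<in>?U. of_nat (card {s \<in> (A \<union> C) - T. card (insert s T \<inter> A) = j}) * g T x)" by simp
  also have "\<dots> = (\<Sum>T\<in>?U. (if card (T \<inter> A) = j then of_nat (Suc j) * g T x else 0) +
    (if j \<noteq> 0 \<and> card (T \<inter> A) = j - 1 then of_nat (Suc ?t - j) * g T x else 0))"
  proof (rule sum.cong, rule refl)
   fix T assume "T \<in> ?U"
   then have T: "T \<subseteq> A \<union> C" "card T = ?t" "finite T" using fAC by auto
   have cT: "card (T \<inter> A) + card (T \<inter> C) = ?t"
   proof -
    have "card ((T \<inter> A) \<union> (T \<inter> C)) = card (T \<inter> A) + card (T \<inter> C)" by (rule card_Un_disjoint) (use T disj in auto)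
    moreover have "(T \<inter> A) \<union> (T \<inter> C) = T" using T by auto
    ultimately show ?thesis by (simp add: T(2))
   qed
   define k where "k = card (T \<inter> A)"
   have mem: "card (insert s T \<inter> A) = (if s \<in> A then Suc k else k)" if "s \<notin> T" for s
    using that T by (simp add: Int_insert_left k_def)
   have "(s \<in> (A \<union> C) - T \<and> card (insert s T \<inter> A) = j) \<longleftrightarrow> (s \<in> A - T \<and> Suc k = j) \<or> (s \<in> C - T \<and> k = j)" for s
    using mem[of s] disj by (cases "s \<in> A"; cases "s \<in> C"; cases "s \<in> T") auto
   then have E: "{s \<in> (A \<union> C) - T. card (insert s T \<inter> A) = j} = {s. (s \<in> A - T \<and> Suc k = j) \<or> (s \<in> C - T \<and> k = j)}"
    by (simp only:)
   have kt: "k \<le> ?t" unfolding k_def using fin by (intro card_mono) auto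
   have dA: "card (A - T) = ?t - k" using fin card_Diff_subset_Int[of A T] by (simp add: k_def Int_commute)
   have dC: "card (C - T) = Suc k" using fin card_Diff_subset_Int[of C T] card cT kt by (simp add: k_def Int_commute)
   show "of_nat (card {s \<in> (A \<union> C) - T. card (insert s T \<inter> A) = j}) * g T x =
    (if card (T \<inter> A) = j then of_nat (Suc j) * g T x else 0) +
    (if j \<noteq> 0 \<and> card (T \<inter> A) = j - 1 then of_nat (Suc ?t - j) * g T x else 0)"
   proof (cases "k = j")
    case True
    then have e: "{s. (s \<in> A - T \<and> Suc k = j) \<or> (s \<in> C - T \<and> k = j)} = C - T" by auto
    have f: "(j \<noteq> 0 \<and> k = j - 1) = False" using True by (cases j) auto
    show ?thesis unfolding E e k_def[symmetric] f dC using True by simp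
   next
    case False
    show ?thesis
    proof (cases "Suc k = j")
     case True
     then have "{s. (s \<in> A - T \<and> Suc k = j) \<or> (s \<in> C - T \<and> k = j)} = A - T" by auto
     then show ?thesis unfolding E k_def[symmetric] using True dA by auto
    next
     case F: False
     then have e: "{s. (s \<in> A - T \<and> Suc k = j) \<or> (s \<in> C - T \<and> k = j)} = {}" using False by auto
     have f: "(j \<noteq> 0 \<and> k = j - 1) = False" using F by auto
     show ?thesis unfolding E e k_def[symmetric] f using False by simp
    qed
   qed
  qed
  also have "\<dots> = (\<Sum>T\<in>?U. if card (T \<inter> A) = j then of_nat (Suc j) * g T x else 0) +
    (\<Sum>T\<in>?U. if j \<noteq> 0 \<and> card (T \<inter> A) = j - 1 then of_nat (Suc ?t - j) * g T x else 0)" by (rule sum.distrib)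
  also have "(\<Sum>T\<in>?U. if card (T \<inter> A) = j then of_nat (Suc j) * g T x else 0) = of_nat (Suc j) * (\<Sum>T\<in>\<T> j. g T x)"
   unfolding sum_distrib_left using fU by (intro sum.mono_neutral_cong_right) (auto simp: \<T>_def)
  also have "(\<Sum>T\<in>?U. if j \<noteq> 0 \<and> card (T \<inter> A) = j - 1 then of_nat (Suc ?t - j) * g T x else 0) =
    (if j = 0 then 0 else of_nat (Suc ?t - j) * (\<Sum>T\<in>\<T> (j - 1). g T x))"
  proof (cases "j = 0")
   case False
   then show ?thesis unfolding sum_distrib_left if_not_P[OF False] using fU by (intro sum.mono_neutral_cong_right) (auto simp: \<T>_def)
  qed simp
  finally show ?thesis .
 qed
 \<comment> \<open>A triangular system: the sums over \<open>\<T> j\<close> are reached for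
   increasing j, dividing by j + 1 <= t + 1.\<close>
 have "(\<lambda>x. \<Sum>T\<in>\<T> j. g T x) \<in> N" if "j \<le> ?t" for j
  using that
 proof (induction j)
  case 0
  have "(\<lambda>x. \<Sum>B\<in>\<B> 0. \<Sum>s\<in>B. g (B - {s}) x) \<in> N" by (intro fsub_sum[OF N] down) (auto simp: \<B>_def)
  then show ?case using key[of 0] by simp
 next
  case (Suc j)
  have "(\<lambda>x. (\<Sum>B\<in>\<B> (Suc j). \<Sum>s\<in>B. g (B - {s}) x) - of_nat (Suc ?t - Suc j) * (\<Sum>T\<in>\<T> j. g T x)) \<in> N"
   by (intro fsub_diff[OF N] fsub_scale[OF N] fsub_sum[OF N] down Suc.IH) (use Suc.prems in \<open>auto simp: \<B>_def\<close>)
  then have m: "(\<lambda>x. of_nat (Suc (Suc j)) * (\<Sum>T\<in>\<T> (Suc j). g T x)) \<in> N" using key[OF Suc.prems] by simp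
  have nz: "of_nat (Suc (Suc j)) \<noteq> (0::'k)" using inv[of "Suc (Suc j)"] Suc.prems by (simp del: of_nat_Suc)
  show ?case by (rule iffD1[OF fsub_scale_iff[OF N nz] m])
 qed
 from this[of ?t] have "(\<lambda>x. \<Sum>T\<in>\<T> ?t. g T x) \<in> N" by simp
 \<comment> \<open>A is the only subset of size t that meets A in t elements.\<close>
 moreover have "\<T> ?t = {A}"
 proof -
  have "T = A" if "T \<subseteq> A \<union> C" "card T = ?t" "card (T \<inter> A) = ?t" for T
  proof -
   have "T \<inter> A = A" using that fin by (intro card_subset_eq) auto
   moreover have "T \<inter> A = T" using that fAC by (intro card_subset_eq) auto
   ultimately show ?thesis by simp
  qed
  moreover have "A \<in> \<T> ?t" by (simp add: \<T>_def)
  ultimately show ?thesis unfolding \<T>_def by blast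
 qed
 ultimately show ?thesis by simp
qed

text \<open>Induction on the total excess of the letters over p - 1. If x occurs at least p times,
  \<open>bound\<close> yields a letter y of the same type with t < p - 1 occurrences. Take these t
  positions and t + 1 positions of x. Writing y on any t + 1 of the 2t + 1 positions and x on the
  rest lowers the excess; \<open>step\<close> turns such a word into the sum of the words with one y
  changed back to x; and the down operator is onto, as t + 1 < p.\<close>

lemma words_in_subspace:
 fixes w :: "('d \<Rightarrow> 'l) \<Rightarrow> 'x \<Rightarrow> 'k::field" and ty :: "'d \<Rightarrow> 'i"
 assumes N: "fsub N" and D: "finite D" and L: "finite L"
  and inv: "\<And>j. 1 \<le> j \<Longrightarrow> j < p \<Longrightarrow> of_nat j \<noteq> (0::'k)"
  and base: "\<And>c. (\<And>s. s \<in> D \<Longrightarrow> c s \<in> L \<and> \<tau> (c s) = ty s) \<Longrightarrow> (\<And>a. card {s\<in>D. c s = a} < p) \<Longrightarrow> w c \<in> N"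
  and step: "\<And>c x y. (\<And>s. s \<in> D \<Longrightarrow> c s \<in> L \<and> \<tau> (c s) = ty s) \<Longrightarrow> w c \<in> N \<Longrightarrow> x \<in> L \<Longrightarrow> y \<in> L \<Longrightarrow> x \<noteq> y \<Longrightarrow> \<tau> x = \<tau> y \<Longrightarrow>
    (\<lambda>z. \<Sum>s\<in>{s\<in>D. c s = y}. w (c(s := x)) z) \<in> N"
  and bound: "\<And>i. card {s\<in>D. ty s = i} \<le> card {a\<in>L. \<tau> a = i} * (p - 1)"
  and c: "\<And>s. s \<in> D \<Longrightarrow> c s \<in> L \<and> \<tau> (c s) = ty s"
  and p: "0 < p"
 shows "w c \<in> N"
 using c
proof (induction "\<Sum>a\<in>L. card {s\<in>D. c s = a} - (p - 1)" arbitrary: c rule: less_induct)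
 case less
 let ?n = "\<lambda>c a. card {s\<in>D. c s = a}"
 show ?case
 proof (cases "\<forall>a. ?n c a < p")
  case True
  then show ?thesis using base less.prems by blast
 next
  case False
  then obtain x where nx: "p \<le> ?n c x" by (auto simp: not_less)
  show ?thesis
  proof -
   have xpos: "?n c x \<noteq> 0" using nx p by simp
   then have "{s\<in>D. c s = x} \<noteq> {}" by (metis card.empty)
   then have xL: "x \<in> L" using less.prems by auto
   let ?Li = "{a\<in>L. \<tau> a = \<tau> x}"
   \<comment> \<open>Otherwise every letter of this type occurs at least p - 1 times and x more
     often, which exceeds the bound.\<close>
   have "\<exists>y\<in>?Li. ?n c y < p - 1"
   proof (rule ccontr)
    assume "\<not> ?thesis"
    then have ge: "\<forall>y\<in>?Li. p - 1 \<le> ?n c y" by (meson not_less)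
    have gt: "p - 1 < ?n c x" using nx xpos by linarith
    have xLi: "x \<in> ?Li" using xL by simp
    have fLi: "finite ?Li" using L by simp
    have "{s\<in>D. ty s = \<tau> x} = (\<Union>a\<in>?Li. {s\<in>D. c s = a})"
    proof (rule Set.set_eqI)
     fix s
     show "s \<in> {s\<in>D. ty s = \<tau> x} \<longleftrightarrow> s \<in> (\<Union>a\<in>?Li. {s\<in>D. c s = a})"
      using less.prems[of s] by (cases "s \<in> D") simp_all
    qed
    then have "card {s\<in>D. ty s = \<tau> x} = card (\<Union>a\<in>?Li. {s\<in>D. c s = a})" by (simp only:)
    also have "\<dots> = (\<Sum>a\<in>?Li. ?n c a)"
    proof (rule card_UN_disjoint[OF fLi])
     show "\<forall>i\<in>?Li. finite {s \<in> D. c s = i}" using D by simp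
     show "\<forall>i\<in>?Li. \<forall>j\<in>?Li. i \<noteq> j \<longrightarrow> {s \<in> D. c s = i} \<inter> {s \<in> D. c s = j} = {}" by auto
    qed
    finally have e: "card {s\<in>D. ty s = \<tau> x} = (\<Sum>a\<in>?Li. ?n c a)" .
    have "(\<Sum>a\<in>?Li. p - 1) < (\<Sum>a\<in>?Li. ?n c a)" by (rule sum_strict_mono_ex1[OF fLi ge]) (use gt xLi in blast)
    then show False using bound[of "\<tau> x"] e by simp
   qed
   then obtain y where y: "y \<in> L" "\<tau> y = \<tau> x" "?n c y < p - 1" by auto
   have yx: "y \<noteq> x" using y nx by auto
   define A where "A = {s\<in>D. c s = y}"
   have fA: "finite A" using D by (simp add: A_def)
   have "Suc (card A) \<le> card {s\<in>D. c s = x}" using y(3) nx by (simp add: A_def)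
   then obtain C where C: "C \<subseteq> {s\<in>D. c s = x}" "card C = Suc (card A)" "finite C" by (rule obtain_subset_with_card_n)
   have AC: "A \<inter> C = {}" "A \<union> C \<subseteq> D" using C(1) yx by (auto simp: A_def)
   \<comment> \<open>\<open>wd T\<close> writes y on T and x on the rest of A and C. Since A
     consists of all positions of y, \<open>wd A\<close> is the given word.\<close>
   define wd where "wd T = (\<lambda>s. if s \<in> A \<union> C then (if s \<in> T then y else x) else c s)" for T
   have wdA: "wd A = c" using C(1) yx by (auto simp: wd_def A_def fun_eq_iff)
   have valid: "wd T s \<in> L \<and> \<tau> (wd T s) = ty s" if "s \<in> D" for T s
    using that less.prems[OF that] y xL C(1) by (auto simp: wd_def A_def)
   have wy: "{s\<in>D. wd T s = y} = T" if "T \<subseteq> A \<union> C" for T using that AC(2) yx by (auto simp: wd_def A_def)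
   have "w (wd A) \<in> N"
   proof (rule down_operator_onto[OF N fA C(3) AC(1) C(2), where g = "\<lambda>T. w (wd T)"])
    show "of_nat j \<noteq> (0::'k)" if "1 \<le> j" "j \<le> Suc (card A)" for j using inv[of j] that y(3) by (simp add: A_def)
    fix B assume B: "B \<subseteq> A \<union> C" "card B = Suc (card A)"
    have "w (wd B) \<in> N"
    proof (rule less.hyps)
     have ny: "?n (wd B) y \<le> p - 1" using wy[OF B(1)] B(2) y(3) by (simp add: A_def)
     have fB: "finite B" using B(1) by (rule finite_subset) (use fA C(3) in simp)
     have xs: "{s\<in>D. wd B s = x} = ({s\<in>D. c s = x} - C) \<union> ((A \<union> C) - B)" using B(1) AC C(1) yx by (auto simp: wd_def A_def)
     have "?n (wd B) x = card ({s\<in>D. c s = x} - C) + card ((A \<union> C) - B)"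
      unfolding xs using D fA C(3) yx by (intro card_Un_disjoint) (auto simp: A_def)
     also have "card ((A \<union> C) - B) = card A" using B fA C(2,3) AC(1) fB by (simp add: card_Diff_subset card_Un_disjoint)
     also have "card ({s\<in>D. c s = x} - C) = ?n c x - Suc (card A)" using C by (simp add: card_Diff_subset)
     finally have nx': "?n (wd B) x = ?n c x - 1" using card_mono[OF _ C(1)] C(2) D by simp
     have other: "?n (wd B) a = ?n c a" if "a \<noteq> x" "a \<noteq> y" for a
      using that C(1) by (intro arg_cong[of _ _ card]) (auto simp: wd_def A_def)
     show "(\<Sum>a\<in>L. ?n (wd B) a - (p - 1)) < (\<Sum>a\<in>L. ?n c a - (p - 1))"
     proof (rule sum_strict_mono_ex1[OF L])
      show "\<forall>a\<in>L. ?n (wd B) a - (p - 1) \<le> ?n c a - (p - 1)"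
      proof
       fix a show "?n (wd B) a - (p - 1) \<le> ?n c a - (p - 1)" using ny nx' other[of a] by (cases "a = x"; cases "a = y") auto
      qed
      show "\<exists>a\<in>L. ?n (wd B) a - (p - 1) < ?n c a - (p - 1)" using nx' nx xpos xL by (intro bexI[of _ x]) auto
     qed
    qed (use valid in auto)
    from step[OF valid this xL y(1) yx[symmetric] y(2)[symmetric]]
    have "(\<lambda>z. \<Sum>s\<in>B. w ((wd B)(s := x)) z) \<in> N" unfolding wy[OF B(1)] .
    moreover have "(wd B)(s := x) = wd (B - {s})" if "s \<in> B" for s using that B(1) by (auto simp: wd_def fun_eq_iff)
    ultimately show "(\<lambda>z. \<Sum>s\<in>B. w (wd (B - {s})) z) \<in> N" by (simp cong: sum.cong)
   qed
   then show ?thesis by (simp add: wdA)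
  qed
 qed
qed

section \<open>Polynomial functions\<close>

text \<open>Over a finite field the polynomial \<Prod>(X - a) + 1 takes only the value 1.\<close>

lemma infinite_alg_closed: "infinite (UNIV :: 'k::alg_closed_field set)"
proof
 assume fin: "finite (UNIV :: 'k set)"
 define p where "p = (\<Prod>a\<in>(UNIV::'k set). [:- a, 1:]) + 1"
 have ev: "poly p x = 1" for x :: 'k using fin by (simp add: p_def poly_prod)
 have "Polynomial.degree (\<Prod>a\<in>(UNIV::'k set). [:- a, 1:]) = (\<Sum>a\<in>(UNIV::'k set). 1)" by (subst degree_prod_eq_sum_degree) auto
 then have "Polynomial.degree (\<Prod>a\<in>(UNIV::'k set). [:- a, 1:]) > 0" using fin by (simp add: card_gt_0_iff)
 then have "Polynomial.degree p > 0" unfolding p_def by (subst degree_add_eq_left) auto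
 then obtain z where "poly p z = 0" using alg_closed_imp_poly_has_root by blast
 with ev show False by simp
qed

text \<open>The predicates \<open>pf\<close>, \<open>hp\<close> (homogeneous) and \<open>hle\<close> (of bounded degree) ignore the values outside \<open>space W\<close>,
 whereas the elements of \<^const>\<open>polyfun\<close> are extensional.\<close>

definition pf :: "('k::field, 'g, 'w::ab_group_add) gmod \<Rightarrow> ('w \<Rightarrow> 'k) \<Rightarrow> bool" where
 "pf W f \<longleftrightarrow> restrict f (space W) \<in> polyfun W"

lemma pf_cong: "(\<And>x. x \<in> space W \<Longrightarrow> f x = g x) \<Longrightarrow> pf W f = pf W g"
 unfolding pf_def by (metis restrict_ext)

lemma polyfun_extensional: "f \<in> polyfun W \<Longrightarrow> f \<in> extensional (space W)"
 by (induction rule: polyfun.induct) (rule restrict_extensional)+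

lemma polyfun_restrict: "f \<in> polyfun W \<Longrightarrow> restrict f (space W) = f" by (rule extensional_restrict[OF polyfun_extensional])

lemma pf_polyfun: "f \<in> polyfun W \<Longrightarrow> pf W f" by (simp add: pf_def polyfun_restrict)

lemma pf_const: "pf W (\<lambda>_. c)"
 unfolding pf_def by (rule polyfun.const)

lemma pf_form: "linear_form W l \<Longrightarrow> pf W l"
 unfolding pf_def by (rule polyfun.form)

lemma pf_add: assumes "pf W f" "pf W g" shows "pf W (\<lambda>x. f x + g x)"
proof -
 have "(\<lambda>x\<in>space W. restrict f (space W) x + restrict g (space W) x) = restrict (\<lambda>x. f x + g x) (space W)"
  by (rule restrict_ext) simp
 with polyfun.add[OF assms[unfolded pf_def]] show ?thesis by (simp only: pf_def)
qed

lemma pf_mult: assumes "pf W f" "pf W g" shows "pf W (\<lambda>x. f x * g x)"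
proof -
 have "(\<lambda>x\<in>space W. restrict f (space W) x * restrict g (space W) x) = restrict (\<lambda>x. f x * g x) (space W)"
  by (rule restrict_ext) simp
 with polyfun.mult[OF assms[unfolded pf_def]] show ?thesis by (simp only: pf_def)
qed

lemma pf_cmult: "pf W f \<Longrightarrow> pf W (\<lambda>x. c * f x)" by (rule pf_mult[OF pf_const])

lemma pf_sum: "(\<And>i. i \<in> I \<Longrightarrow> pf W (f i)) \<Longrightarrow> pf W (\<lambda>x. \<Sum>i\<in>I. f i x)"
 by (induction I rule: infinite_finite_induct) (simp_all add: pf_const pf_add)

lemma pf_prod: "(\<And>i. i \<in> I \<Longrightarrow> pf W (f i)) \<Longrightarrow> pf W (\<lambda>x. \<Prod>i\<in>I. f i x)"
 by (induction I rule: infinite_finite_induct) (simp_all add: pf_const pf_mult)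

text \<open>Induction for \<open>pf\<close>; the case \<open>cong\<close> accounts for the arbitrary
  values outside \<open>space W\<close>.\<close>

lemma pf_induct [consumes 1, case_names cong const form add mult]:
 assumes "pf W f"
  and cong: "\<And>f g. (\<And>x. x \<in> space W \<Longrightarrow> f x = g x) \<Longrightarrow> P f \<Longrightarrow> P g"
  and const: "\<And>c. P (\<lambda>_. c)" and form: "\<And>l. linear_form W l \<Longrightarrow> P l"
  and add: "\<And>f g. pf W f \<Longrightarrow> pf W g \<Longrightarrow> P f \<Longrightarrow> P g \<Longrightarrow> P (\<lambda>x. f x + g x)"
  and mult: "\<And>f g. pf W f \<Longrightarrow> pf W g \<Longrightarrow> P f \<Longrightarrow> P g \<Longrightarrow> P (\<lambda>x. f x * g x)"
 shows "P f"
proof -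
 have "P f" if "f \<in> polyfun W" for f
  using that
 proof (induction rule: polyfun.induct)
  case (const c) show ?case by (rule cong[OF _ assms(3)]) simp
 next
  case (form l) show ?case by (rule cong[OF _ assms(4)[OF form]]) simp
 next
  case (add p q) show ?case by (rule cong[OF _ assms(5)[OF pf_polyfun[OF add(1)] pf_polyfun[OF add(2)] add(3,4)]]) simp
 next
  case (mult p q) show ?case by (rule cong[OF _ assms(6)[OF pf_polyfun[OF mult(1)] pf_polyfun[OF mult(2)] mult(3,4)]]) simp
 qed
 from this[OF assms(1)[unfolded pf_def]] show ?thesis by (rule cong[rotated]) simp
qed

lemma linear_form_comp: "lin U W T \<Longrightarrow> linear_form W l \<Longrightarrow> linear_form U (\<lambda>x. l (T x))"
 by (simp add: linear_form_def lin_def)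

lemma pf_comp:
 assumes T: "lin U W T" and "pf W f" shows "pf U (\<lambda>x. f (T x))"
 using assms(2)
proof (induction rule: pf_induct)
 case (cong f g)
 have "pf U (\<lambda>x. f (T x)) = pf U (\<lambda>x. g (T x))" by (rule pf_cong, rule cong(1)) (use T in \<open>simp add: lin_def\<close>)
 with cong(2) show ?case by simp
next
 case (form l) then show ?case by (rule pf_form[OF linear_form_comp[OF T]])
qed (simp_all add: pf_const pf_add pf_mult)

definition hp :: "('k::field, 'g, 'w::ab_group_add) gmod \<Rightarrow> nat \<Rightarrow> ('w \<Rightarrow> 'k) \<Rightarrow> bool" where
 "hp W d f \<longleftrightarrow> (\<exists>(n::nat) c l. (\<forall>j<n. \<forall>i<d. linear_form W (l j i)) \<and>
   (\<forall>x\<in>space W. f x = (\<Sum>j<n. c j * (\<Prod>i<d. l j i x))))"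

lemma hp_cong: "(\<And>x. x \<in> space W \<Longrightarrow> f x = g x) \<Longrightarrow> hp W d f = hp W d g"
 unfolding hp_def by simp

lemma poly_comp_iff: "f \<in> poly_comp W d \<longleftrightarrow> f \<in> extensional (space W) \<and> hp W d f"
proof
 assume "f \<in> poly_comp W d"
 then obtain n :: nat and c l where f: "f = (\<lambda>x\<in>space W. \<Sum>j<n. c j * (\<Prod>i<d. l j i x))"
  and l: "\<forall>j<n. \<forall>i<d. linear_form W (l j i)" by (auto simp: poly_comp_def)
 then show "f \<in> extensional (space W) \<and> hp W d f"
  unfolding hp_def by (intro conjI exI[of _ n] exI[of _ c] exI[of _ l]) simp_all
next
 assume f: "f \<in> extensional (space W) \<and> hp W d f"
 then obtain n :: nat and c l where l: "\<forall>j<n. \<forall>i<d. linear_form W (l j i)"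
  and e: "\<forall>x\<in>space W. f x = (\<Sum>j<n. c j * (\<Prod>i<d. l j i x))" unfolding hp_def by auto
 have "f = (\<lambda>x\<in>space W. \<Sum>j<n. c j * (\<Prod>i<d. l j i x))" using f e by (intro extensionalityI[of _ "space W"]) simp_all
 with l show "f \<in> poly_comp W d" unfolding poly_comp_def by blast
qed

lemma hp_restrict: "hp W d f \<longleftrightarrow> restrict f (space W) \<in> poly_comp W d"
 unfolding poly_comp_iff by (simp add: hp_cong[of W "restrict f (space W)" f])

lemma hp_zero: "hp W d (\<lambda>_. 0)"
 unfolding hp_def by (intro exI[of _ 0]) simp

lemma hp_cmult: assumes "hp W d f" shows "hp W d (\<lambda>x. a * f x)"
proof -
 from assms obtain n :: nat and c l where l: "\<forall>j<n. \<forall>i<d. linear_form W (l j i)"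
  and e: "\<forall>x\<in>space W. f x = (\<Sum>j<n. c j * (\<Prod>i<d. l j i x))" unfolding hp_def by auto
 show ?thesis unfolding hp_def
  by (rule exI[of _ n], rule exI[of _ "\<lambda>j. a * c j"], rule exI[of _ l]) (use l e in \<open>simp add: sum_distrib_left mult.assoc\<close>)
qed

lemma sum_lessThan_plus: "(\<Sum>j<n + m. h j) = (\<Sum>j<n. h j) + (\<Sum>j<m. h (n + j :: nat))" for h :: "nat \<Rightarrow> 'b::comm_monoid_add"
 by (induction m) (simp_all add: add.assoc)

lemma prod_lessThan_plus: "(\<Prod>j<n + m. h j) = (\<Prod>j<n. h j) * (\<Prod>j<m. h (n + j :: nat))" for h :: "nat \<Rightarrow> 'b::comm_monoid_mult"
 by (induction m) (simp_all add: mult.assoc)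

lemma hp_add: assumes "hp W d f" "hp W d g" shows "hp W d (\<lambda>x. f x + g x)"
proof -
 from assms(1) obtain n :: nat and c l where f: "\<forall>j<n. \<forall>i<d. linear_form W (l j i)"
  "\<forall>x\<in>space W. f x = (\<Sum>j<n. c j * (\<Prod>i<d. l j i x))" unfolding hp_def by auto
 from assms(2) obtain m :: nat and b k where g: "\<forall>j<m. \<forall>i<d. linear_form W (k j i)"
  "\<forall>x\<in>space W. g x = (\<Sum>j<m. b j * (\<Prod>i<d. k j i x))" unfolding hp_def by auto
 define c' where "c' j = (if j < n then c j else b (j - n))" for j
 define l' where "l' j = (if j < n then l j else k (j - n))" for j
 have "(\<Sum>j<n + m. c' j * (\<Prod>i<d. l' j i x)) = f x + g x" if "x \<in> space W" for x
  unfolding sum_lessThan_plus using f(2) g(2) that by (simp add: c'_def l'_def)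
 moreover have "\<forall>j<n + m. \<forall>i<d. linear_form W (l' j i)" using f(1) g(1) by (simp add: l'_def)
 ultimately show ?thesis unfolding hp_def by (intro exI[of _ "n + m"] exI[of _ c'] exI[of _ l']) simp
qed

lemma hp_sum: "(\<And>i. i \<in> I \<Longrightarrow> hp W d (f i)) \<Longrightarrow> hp W d (\<lambda>x. \<Sum>i\<in>I. f i x)"
 by (induction I rule: infinite_finite_induct) (simp_all add: hp_zero hp_add)

lemma hp_prod_forms_nat: "(\<And>i. i < d \<Longrightarrow> linear_form W (l i)) \<Longrightarrow> hp W d (\<lambda>x. \<Prod>i<d. l i x)"
 unfolding hp_def by (rule exI[of _ 1], rule exI[of _ "\<lambda>_. 1"], rule exI[of _ "\<lambda>_. l"]) simp

lemma hp_induct [consumes 1, case_names cong zero add prod]: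
 assumes "hp W d f"
  and cong: "\<And>f g. (\<And>x. x \<in> space W \<Longrightarrow> f x = g x) \<Longrightarrow> P f \<Longrightarrow> P g"
  and zero: "P (\<lambda>_. 0)" and add: "\<And>f g. P f \<Longrightarrow> P g \<Longrightarrow> P (\<lambda>x. f x + g x)"
  and prod: "\<And>c l. (\<And>i. i < d \<Longrightarrow> linear_form W (l i)) \<Longrightarrow> P (\<lambda>x. c * (\<Prod>i<d. l i x))"
 shows "P f"
proof -
 from assms(1) obtain n :: nat and c l where l: "\<forall>j<n. \<forall>i<d. linear_form W (l j i)"
  and e: "\<forall>x\<in>space W. f x = (\<Sum>j<n. c j * (\<Prod>i<d. l j i x))" unfolding hp_def by auto
 have "P (\<lambda>x. \<Sum>j<m. c j * (\<Prod>i<d. l j i x))" if "m \<le> n" for m using that by (induction m) (simp_all add: zero add prod l)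
 from this[of n] show ?thesis by (rule cong[rotated]) (use e in simp_all)
qed

lemma hp_mult: assumes "hp W d f" "hp W e g" shows "hp W (d + e) (\<lambda>x. f x * g x)"
 using assms(1)
proof (induction rule: hp_induct)
 case (cong f h)
 then show ?case using hp_cong[of W "\<lambda>x. f x * g x" "\<lambda>x. h x * g x"] by simp
next
 case zero then show ?case by (simp add: hp_zero)
next
 case (add f h) then show ?case by (simp add: distrib_right hp_add)
next
 case (prod c l)
 have "hp W (d + e) (\<lambda>x. (\<Prod>i<d. l i x) * g x)"
  using assms(2)
 proof (induction rule: hp_induct)
  case (cong f h)
  then show ?case using hp_cong[of W "\<lambda>x. (\<Prod>i<d. l i x) * f x" "\<lambda>x. (\<Prod>i<d. l i x) * h x"] by simp
 next
  case zero then show ?case by (simp add: hp_zero)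
 next
  case (add f h) then show ?case by (simp add: distrib_left hp_add)
 next
  case (prod c' k)
  define u where "u i = (if i < d then l i else k (i - d))" for i
  have "hp W (d + e) (\<lambda>x. c' * (\<Prod>i<d + e. u i x))"
   by (intro hp_cmult hp_prod_forms_nat) (use prod \<open>\<And>i. i < d \<Longrightarrow> linear_form W (l i)\<close> in \<open>simp add: u_def\<close>)
  moreover have "(\<Prod>i<d + e. u i x) = (\<Prod>i<d. l i x) * (\<Prod>i<e. k i x)" for x
   unfolding prod_lessThan_plus by (simp add: u_def)
  ultimately show ?case by (simp add: ac_simps)
 qed
 from hp_cmult[OF this, of c] show ?case by (simp add: mult.assoc)
qed

lemma hp_pf: "hp W d f \<Longrightarrow> pf W f"
proof (induction rule: hp_induct)
 case (cong f g) then show ?case by (metis (mono_tags, lifting) pf_cong)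
next
 case (prod c l) then show ?case by (intro pf_cmult pf_prod pf_form) auto
qed (simp_all add: pf_const pf_add)

lemma hp_const: "hp W 0 (\<lambda>_. c)" using hp_cmult[OF hp_prod_forms_nat[of 0 W], of _ c] by simp

lemma hp_form: "linear_form W l \<Longrightarrow> hp W 1 l" using hp_prod_forms_nat[of 1 W "\<lambda>_. l"] by simp

lemma hp_comp:
 assumes T: "lin U W T" and "hp W d f" shows "hp U d (\<lambda>x. f (T x))"
 using assms(2)
proof (induction rule: hp_induct)
 case (cong f g)
 have "hp U d (\<lambda>x. f (T x)) = hp U d (\<lambda>x. g (T x))" by (rule hp_cong, rule cong(1)) (use T in \<open>simp add: lin_def\<close>)
 with cong(2) show ?case by simp
next
 case (prod c l) then show ?case by (intro hp_cmult hp_prod_forms_nat linear_form_comp[OF T])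
qed (simp_all add: hp_zero hp_add)

lemma hp_homogeneous:
 assumes "\<And>c x. x \<in> space W \<Longrightarrow> scal W c x \<in> space W"
  and "hp W d f" shows "\<forall>x\<in>space W. f (scal W t x) = t ^ d * f x"
 using assms(2)
proof (induction rule: hp_induct)
 case (cong f g)
 then show ?case using assms(1) by metis
next
 case (prod c l)
 then show ?case by (auto simp: linear_form_def prod.distrib)
qed (simp_all add: distrib_left)

definition hle :: "('k::field, 'g, 'w::ab_group_add) gmod \<Rightarrow> nat \<Rightarrow> ('w \<Rightarrow> 'k) \<Rightarrow> bool" where
 "hle W n f \<longleftrightarrow> (\<exists>F. (\<forall>d\<le>n. hp W d (F d)) \<and> (\<forall>x\<in>space W. f x = (\<Sum>d\<le>n. F d x)))"

lemma hle_cong: "(\<And>x. x \<in> space W \<Longrightarrow> f x = g x) \<Longrightarrow> hle W d f = hle W d g"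
 unfolding hle_def by simp

lemma hle_pf: assumes "hle W n f" shows "pf W f"
proof -
 from assms obtain F where F: "\<forall>d\<le>n. hp W d (F d)" "\<forall>x\<in>space W. f x = (\<Sum>d\<le>n. F d x)" by (auto simp: hle_def)
 have "pf W (\<lambda>x. \<Sum>d\<le>n. F d x)" by (rule pf_sum, rule hp_pf[OF F(1)[rule_format]]) simp
 also have "pf W (\<lambda>x. \<Sum>d\<le>n. F d x) = pf W f" by (rule pf_cong) (use F in simp)
 finally show ?thesis .
qed

lemma hp_hle: assumes "hp W d f" "d \<le> n" shows "hle W n f"
 unfolding hle_def
 by (rule exI[of _ "\<lambda>e. if e = d then f else (\<lambda>_. 0)"]) (use assms in \<open>simp add: hp_zero if_distrib[of "\<lambda>h. h _"] cong: if_cong\<close>)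

lemma hle_add: assumes "hle W n f" "hle W n g" shows "hle W n (\<lambda>x. f x + g x)"
proof -
 from assms obtain F H where F: "\<forall>d\<le>n. hp W d (F d)" "\<forall>x\<in>space W. f x = (\<Sum>d\<le>n. F d x)"
  and H: "\<forall>d\<le>n. hp W d (H d)" "\<forall>x\<in>space W. g x = (\<Sum>d\<le>n. H d x)" by (auto simp: hle_def)
 show ?thesis unfolding hle_def by (rule exI[of _ "\<lambda>d x. F d x + H d x"]) (use F H in \<open>simp add: hp_add sum.distrib\<close>)
qed

lemma hle_zero: "hle W n (\<lambda>_. 0)" by (rule hp_hle[OF hp_zero, of 0]) simp

lemma hle_sum: "(\<And>i. i \<in> I \<Longrightarrow> hle W d (f i)) \<Longrightarrow> hle W d (\<lambda>x. \<Sum>i\<in>I. f i x)"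
 by (induction I rule: infinite_finite_induct) (simp_all add: hle_zero hle_add)

lemma hle_mono: assumes "hle W n f" "n \<le> m" shows "hle W m f"
proof -
 from assms obtain F where F: "\<forall>d\<le>n. hp W d (F d)" "\<forall>x\<in>space W. f x = (\<Sum>d\<le>n. F d x)" by (auto simp: hle_def)
 have "hle W m (\<lambda>x. \<Sum>d\<le>n. F d x)" by (rule hle_sum, rule hp_hle[OF F(1)[rule_format]]) (use assms(2) in auto)
 then show ?thesis using hle_cong[of W f "\<lambda>x. \<Sum>d\<le>n. F d x"] F(2) by simp
qed

lemma hle_mult: assumes "hle W n f" "hle W m g" shows "hle W (n + m) (\<lambda>x. f x * g x)"
proof -
 from assms obtain F H where F: "\<forall>d\<le>n. hp W d (F d)" "\<forall>x\<in>space W. f x = (\<Sum>d\<le>n. F d x)"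
  and H: "\<forall>d\<le>m. hp W d (H d)" "\<forall>x\<in>space W. g x = (\<Sum>d\<le>m. H d x)" by (auto simp: hle_def)
 have "hle W (n + m) (\<lambda>x. \<Sum>d\<le>n. \<Sum>e\<le>m. F d x * H e x)"
  by (intro hle_sum) (rule hp_hle[OF hp_mult[OF F(1)[rule_format] H(1)[rule_format]]], auto)
 then show ?thesis
  using hle_cong[of W "\<lambda>x. f x * g x" "\<lambda>x. \<Sum>d\<le>n. \<Sum>e\<le>m. F d x * H e x"] F(2) H(2) by (simp add: sum_product)
qed

lemma hle_comp:
 assumes T: "lin U W T" and "hle W n f" shows "hle U n (\<lambda>x. f (T x))"
proof -
 from assms(2) obtain F where F: "\<forall>d\<le>n. hp W d (F d)" "\<forall>x\<in>space W. f x = (\<Sum>d\<le>n. F d x)" by (auto simp: hle_def)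
 show ?thesis unfolding hle_def by (rule exI[of _ "\<lambda>d x. F d (T x)"]) (use F T hp_comp[OF T] in \<open>simp add: lin_def\<close>)
qed

lemma pf_hle: "pf W f \<Longrightarrow> \<exists>n. hle W n f"
proof (induction rule: pf_induct)
 case (cong f g) then show ?case using hle_cong[of W f g] by simp
next
 case (const c) show ?case using hp_hle[OF hp_const, of 0] by blast
next
 case (form l) then show ?case using hp_hle[OF hp_form, of W l 1] by blast
next
 case (add f g)
 then obtain n m where "hle W n f" "hle W m g" by blast
 then have "hle W (max n m) (\<lambda>x. f x + g x)" by (intro hle_add) (erule hle_mono, simp)+
 then show ?case by blast
next
 case (mult f g) then show ?case using hle_mult by blast
qed

text \<open>The coefficient at \<open>t\<^sup>d\<close>; arbitrary if \<open>\<phi>\<close> is not a polynomial function.\<close>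

definition cf :: "nat \<Rightarrow> ('k::field \<Rightarrow> 'k) \<Rightarrow> 'k" where
 "cf d \<phi> = Polynomial.coeff (THE P. \<forall>t. poly P t = \<phi> t) d"

lemma cf_eq:
 assumes inf: "infinite (UNIV :: 'k::field set)" and P: "\<And>t. poly P t = \<phi> t"
 shows "cf d \<phi> = Polynomial.coeff (P :: 'k poly) d"
proof -
 have "(THE P. \<forall>t. poly P t = \<phi> t) = P"
 proof (rule the_equality)
  show "\<forall>t. poly P t = \<phi> t" using P by simp
  fix Q assume "\<forall>t. poly Q t = \<phi> t"
  then have "poly (Q - P) t = 0" for t using P by simp
  then have "{t. poly (Q - P) t = 0} = UNIV" by simp
  then have "Q - P = 0" using poly_roots_finite[of "Q - P"] inf by auto
  then show "Q = P" by simp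
 qed
 then show ?thesis by (simp add: cf_def)
qed

text \<open>This makes \<open>cf\<close> meaningful along affine lines.\<close>

lemma (in gm) poly_on_line:
 assumes "pf M f" and ab: "a \<in> space M" "b \<in> space M"
 shows "\<exists>P. \<forall>t. poly P t = f (a + scal M t b)"
 using assms(1)
proof (induction rule: pf_induct)
 case (cong f g) then show ?case using ab by auto
next
 case (const c) show ?case by (intro exI[of _ "[:c:]"]) simp
next
 case (form l)
 then show ?case using ab by (intro exI[of _ "[:l a, l b:]"]) (simp add: linear_form_def)
next
 case (add f g)
 then obtain P Q where "\<forall>t. poly P t = f (a + scal M t b)" "\<forall>t. poly Q t = g (a + scal M t b)" by blast
 then show ?case by (intro exI[of _ "P + Q"]) simp
next
 case (mult f g)
 then obtain P Q where "\<forall>t. poly P t = f (a + scal M t b)" "\<forall>t. poly Q t = g (a + scal M t b)" by blast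
 then show ?case by (intro exI[of _ "P * Q"]) simp
qed

text \<open>For fixed x the sum at t x is the polynomial in t with coefficients
  \<open>F d x\<close>; it vanishes at infinitely many t.\<close>

lemma (in gm) homogeneous_components_zero:
 assumes inf: "infinite (UNIV :: 'k set)" and F: "\<And>d. d \<le> n \<Longrightarrow> hp M d (F d)"
  and z: "\<And>x. x \<in> space M \<Longrightarrow> (\<Sum>d\<le>n. F d x) = 0" and d: "d \<le> n" and x: "x \<in> space M"
 shows "F d x = 0"
proof -
 define P where "P = (\<Sum>d\<le>n. monom (F d x) d)"
 have "poly P t = 0" for t
 proof -
  have "poly P t = (\<Sum>d\<le>n. F d (scal M t x))" using hp_homogeneous[OF scal_mem F] x by (simp add: P_def poly_sum poly_monom mult.commute)
  then show ?thesis using z[of "scal M t x"] x by simp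
 qed
 then have "cf d (\<lambda>_. 0::'k) = Polynomial.coeff P d" by (rule cf_eq[OF inf])
 moreover have "cf d (\<lambda>_. 0::'k) = Polynomial.coeff 0 d" by (rule cf_eq[OF inf]) simp
 moreover have "Polynomial.coeff P d = F d x" using d by (simp add: P_def coeff_sum)
 ultimately show ?thesis by simp
qed

section \<open>Isotypic decompositions\<close>

locale isod = gm G W
 for G :: "('g, 'b) monoid_scheme" (structure) and W :: "('k::alg_closed_field, 'g, 'w::ab_group_add) gmod" +
 fixes r :: nat and M :: "nat \<Rightarrow> 'w set" and m :: "nat \<Rightarrow> nat" and \<Phi> :: "(nat \<Rightarrow> nat \<Rightarrow> 'w) \<Rightarrow> 'w"
 assumes fd: "fin_dim W" and card_G: "of_nat (card (carrier G)) \<noteq> (0::'k)"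
  and dec: "isotypic_decomp G W r M m \<Phi>"
begin

abbreviation "D \<equiv> isum W r M m"
abbreviation "co \<equiv> coords W r M m \<Phi>"
abbreviation "Mi i \<equiv> subgmod W (M i)"

definition sgl :: "nat \<Rightarrow> nat \<Rightarrow> 'w \<Rightarrow> nat \<Rightarrow> nat \<Rightarrow> 'w" where
 "sgl i j v = (\<lambda>a b. if a = i \<and> b = j then v else 0)"

text \<open>The projection of W onto its i-th isotypic component, and 0 for i >= r.\<close>

definition pr :: "nat \<Rightarrow> 'w \<Rightarrow> 'w" where
 "pr i w = \<Phi> (\<lambda>a. if a = i then co w a else 0)"

lemma sub: "i < r \<Longrightarrow> gsubmodule G W (M i)" and simple: "i < r \<Longrightarrow> simple_gmod G (Mi i)"
 and noniso: "i < r \<Longrightarrow> j < r \<Longrightarrow> i \<noteq> j \<Longrightarrow> \<not> (\<exists>f. gmod_iso G (Mi i) (Mi j) f)"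
 and iso: "gmod_iso G D W \<Phi>" using dec by (simp_all add: isotypic_decomp_def)

lemma gm_Mi: "i < r \<Longrightarrow> gm G (Mi i)" by (rule gm_subgmod[OF sub])
lemma gm_W: "gm G W" by unfold_locales
lemma gm_D: "gm G D" by (rule gm_isum[OF sub])

sublocale D: gm G D by (rule gm_D)

lemma M_sub: "i < r \<Longrightarrow> M i \<subseteq> space W" using sub by (simp add: gsubmodule_def)
lemma M_subsp: "i < r \<Longrightarrow> vs.subspace (M i)" using sub by (simp add: gsubmodule_def)
lemma M_0: "i < r \<Longrightarrow> 0 \<in> M i" using vs.subspace_0[OF M_subsp] .
lemma M_act: "i < r \<Longrightarrow> g \<in> carrier G \<Longrightarrow> v \<in> M i \<Longrightarrow> act W g v \<in> M i" using sub by (simp add: gsubmodule_def)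

lemma fd_Mi: "i < r \<Longrightarrow> fin_dim (Mi i)" using fd M_sub[of i] by (auto simp: fin_dim_def)

lemma ghom_Phi: "ghom G D W \<Phi>" and bij_Phi: "bij_betw \<Phi> (space D) (space W)" using iso by (simp_all add: gmod_iso_alt)

lemma iso_co: "gmod_iso G W D co"
 unfolding coords_def by (rule gmod_iso_inv[OF gm_D gm_W iso])

lemma ghom_co: "ghom G W D co" using iso_co by (simp add: gmod_iso_alt)

lemma co_mem: "w \<in> space W \<Longrightarrow> co w \<in> space D" using ghom_co by (simp add: ghom_def lin_def)
lemma Phi_mem: "x \<in> space D \<Longrightarrow> \<Phi> x \<in> space W" using ghom_Phi by (simp add: ghom_def lin_def)
lemma Phi_co: "w \<in> space W \<Longrightarrow> \<Phi> (co w) = w"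
 unfolding coords_def by (rule bij_betw_inv_into_right[OF bij_Phi])
lemma co_Phi: "x \<in> space D \<Longrightarrow> co (\<Phi> x) = x"
 unfolding coords_def by (rule bij_betw_inv_into_left[OF bij_Phi])
lemma Phi_add: "x \<in> space D \<Longrightarrow> y \<in> space D \<Longrightarrow> \<Phi> (x + y) = \<Phi> x + \<Phi> y"
 using ghom_Phi by (simp add: ghom_def lin_def)
lemma Phi_scal: "x \<in> space D \<Longrightarrow> \<Phi> (\<lambda>i j. scal W c (x i j)) = scal W c (\<Phi> x)"
 using ghom_Phi by (simp add: ghom_def lin_def scal_isum)
lemma Phi_act: "x \<in> space D \<Longrightarrow> g \<in> carrier G \<Longrightarrow> \<Phi> (\<lambda>i j. act W g (x i j)) = act W g (\<Phi> x)"
proof -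
 assume x: "x \<in> space D" and g: "g \<in> carrier G"
 have "\<Phi> (act D g x) = act W g (\<Phi> x)" using ghom_Phi x g by (simp add: ghom_def)
 then show ?thesis by (simp only: act_isum[OF x g])
qed
lemma Phi_0: "\<Phi> 0 = 0" using Phi_add[OF D.zero_mem D.zero_mem] by simp
lemma Phi_sum: "(\<And>i. i \<in> I \<Longrightarrow> x i \<in> space D) \<Longrightarrow> \<Phi> (sum x I) = (\<Sum>i\<in>I. \<Phi> (x i))"
 using D.lin_sum[of W \<Phi> I x] ghom_Phi by (simp add: ghom_def)
lemma co_add: "x \<in> space W \<Longrightarrow> y \<in> space W \<Longrightarrow> co (x + y) = co x + co y"
 using ghom_co by (simp add: ghom_def lin_def)
lemma co_scal: "x \<in> space W \<Longrightarrow> co (scal W c x) = (\<lambda>i j. scal W c (co x i j))"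
 using ghom_co by (simp add: ghom_def lin_def scal_isum)
lemma co_act: "x \<in> space W \<Longrightarrow> g \<in> carrier G \<Longrightarrow> co (act W g x) = (\<lambda>i j. act W g (co x i j))"
proof -
 assume x: "x \<in> space W" and g: "g \<in> carrier G"
 have "co (act W g x) = act D g (co x)" using ghom_co x g by (simp add: ghom_def)
 then show ?thesis by (simp only: act_isum[OF co_mem[OF x] g])
qed
lemma co_in: "w \<in> space W \<Longrightarrow> i < r \<Longrightarrow> j < m i \<Longrightarrow> co w i j \<in> M i" by (rule isum_mem[OF co_mem])
lemma co_out: "w \<in> space W \<Longrightarrow> \<not> (i < r \<and> j < m i) \<Longrightarrow> co w i j = 0"
 using isumD[OF co_mem, of w i j] by simp
lemma DI: "(\<And>i j. i < r \<Longrightarrow> j < m i \<Longrightarrow> x i j \<in> M i) \<Longrightarrow> (\<And>i j. \<not> (i < r \<and> j < m i) \<Longrightarrow> x i j = 0) \<Longrightarrow> x \<in> space D"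
 unfolding space_isum by simp

lemma sgl_mem: "i < r \<Longrightarrow> j < m i \<Longrightarrow> v \<in> M i \<Longrightarrow> sgl i j v \<in> space D"
 by (rule DI) (auto simp: sgl_def M_0)

lemma sgl_ghom: assumes "i < r" "j < m i" shows "ghom G (Mi i) W (\<lambda>v. \<Phi> (sgl i j v))"
 unfolding ghom_def lin_def
proof (intro conjI ballI allI)
 fix v assume v: "v \<in> space (Mi i)"
 show "\<Phi> (sgl i j v) \<in> space W" by (rule Phi_mem[OF sgl_mem]) (use assms v in auto)
 { fix u assume u: "u \<in> space (Mi i)"
  have "sgl i j (v + u) = sgl i j v + sgl i j u" by (auto simp: sgl_def fun_eq_iff)
  then show "\<Phi> (sgl i j (v + u)) = \<Phi> (sgl i j v) + \<Phi> (sgl i j u)" using Phi_add[OF sgl_mem sgl_mem] assms u v by simp }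
 { fix c
  have "sgl i j (scal W c v) = (\<lambda>a b. scal W c (sgl i j v a b))" by (auto simp: sgl_def fun_eq_iff)
  then show "\<Phi> (sgl i j (scal (Mi i) c v)) = scal W c (\<Phi> (sgl i j v))" using Phi_scal[OF sgl_mem] assms v by simp }
next
 fix g v assume g: "g \<in> carrier G" and v: "v \<in> space (Mi i)"
 have "sgl i j (act W g v) = (\<lambda>a b. act W g (sgl i j v a b))" using g by (auto simp: sgl_def fun_eq_iff)
 then show "\<Phi> (sgl i j (act (Mi i) g v)) = act W g (\<Phi> (sgl i j v))" using Phi_act[OF sgl_mem] assms v g by simp
qed

lemma sgl_expand: "x \<in> space D \<Longrightarrow> x = (\<Sum>i<r. \<Sum>j<m i. sgl i j (x i j))"
proof (intro ext)
 fix a b assume x: "x \<in> space D"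
 have sum_app: "(\<Sum>s\<in>S. h s) a b = (\<Sum>s\<in>S. h s a b)" for S :: "nat set" and h :: "nat \<Rightarrow> nat \<Rightarrow> nat \<Rightarrow> 'w"
  by (induction S rule: infinite_finite_induct) simp_all
 have "(\<Sum>i<r. \<Sum>j<m i. sgl i j (x i j)) a b = (\<Sum>i<r. \<Sum>j<m i. sgl i j (x i j) a b)"
  unfolding sum_app ..
 also have "\<dots> = (\<Sum>i<r. if i = a then (\<Sum>j<m a. if j = b then x a b else 0) else 0)" by (intro sum.cong refl) (auto simp: sgl_def)
 also have "\<dots> = (if a < r \<and> b < m a then x a b else 0)" by simp
 also have "\<dots> = x a b" using isumD[OF x, of a b] by simp
 finally show "x a b = (\<Sum>i<r. \<Sum>j<m i. sgl i j (x i j)) a b" by simp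
qed

lemma W_expand: "w \<in> space W \<Longrightarrow> w = (\<Sum>i<r. \<Sum>j<m i. \<Phi> (sgl i j (co w i j)))"
proof -
 assume w: "w \<in> space W"
 have mem: "sgl i j (co w i j) \<in> space D" if "i < r" "j < m i" for i j using that co_in[OF w] by (intro sgl_mem)
 have "w = \<Phi> (\<Sum>i<r. \<Sum>j<m i. sgl i j (co w i j))" using sgl_expand[OF co_mem[OF w]] Phi_co[OF w] by simp
 also have "\<dots> = (\<Sum>i<r. \<Phi> (\<Sum>j<m i. sgl i j (co w i j)))" by (rule Phi_sum) (use mem in \<open>intro D.sum_mem, auto\<close>)
 also have "\<dots> = (\<Sum>i<r. \<Sum>j<m i. \<Phi> (sgl i j (co w i j)))" by (intro sum.cong refl Phi_sum) (use mem in auto)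
 finally show ?thesis .
qed

section \<open>The group algebra acting on a decomposed module\<close>

lemma ga_expand:
 assumes w: "w \<in> space W"
 shows "ga G W a w = (\<Sum>i<r. \<Sum>j<m i. \<Phi> (sgl i j (ga G (Mi i) a (co w i j))))"
proof -
 have mem: "\<Phi> (sgl i j (co w i j)) \<in> space W" if "i < r" "j < m i" for i j using that co_in[OF w] by (intro Phi_mem sgl_mem)
 have "ga G W a w = ga G W a (\<Sum>i<r. \<Sum>j<m i. \<Phi> (sgl i j (co w i j)))" using W_expand[OF w] by simp
 also have "\<dots> = (\<Sum>i<r. ga G W a (\<Sum>j<m i. \<Phi> (sgl i j (co w i j))))"
  by (rule lin_sum[OF lin_ga]) (use mem in \<open>intro sum_mem, auto\<close>)
 also have "\<dots> = (\<Sum>i<r. \<Sum>j<m i. ga G W a (\<Phi> (sgl i j (co w i j))))" by (intro sum.cong refl lin_sum[OF lin_ga]) (use mem in auto)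
 also have "\<dots> = (\<Sum>i<r. \<Sum>j<m i. \<Phi> (sgl i j (ga G (Mi i) a (co w i j))))"
 proof (rule sum.cong[OF refl], rule sum.cong[OF refl])
  fix i j assume ij: "i \<in> {..<r}" "j \<in> {..<m i}"
  interpret Mi: gm G "Mi i" by (rule gm_Mi) (use ij in simp)
  show "ga G W a (\<Phi> (sgl i j (co w i j))) = \<Phi> (sgl i j (ga G (Mi i) a (co w i j)))"
   using Mi.ga_hom[OF gm_W sgl_ghom[of i j], of "co w i j" a] ij co_in[OF w] by simp
 qed
 finally show ?thesis .
qed

text \<open>The group algebra acts summand by summand, so the action of an element on W is
  determined by its actions on the simple modules \<open>Mi i\<close>.\<close>

lemma ga_eqI:
 assumes w: "w \<in> space W" and e: "\<And>i v. i < r \<Longrightarrow> v \<in> M i \<Longrightarrow> ga G (Mi i) a v = ga G (Mi i) b v"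
 shows "ga G W a w = ga G W b w"
 unfolding ga_expand[OF w] using e co_in[OF w] by (intro sum.cong refl) simp

lemma pr_dom: "w \<in> space W \<Longrightarrow> (\<lambda>a. if a = i then co w a else 0) \<in> space D" by (rule DI) (auto simp: co_in co_out M_0)

lemma pr_mem: "w \<in> space W \<Longrightarrow> pr i w \<in> space W"
 unfolding pr_def by (rule Phi_mem[OF pr_dom])

lemma co_pr: "w \<in> space W \<Longrightarrow> co (pr i w) = (\<lambda>a. if a = i then co w a else 0)"
 unfolding pr_def by (rule co_Phi[OF pr_dom])

lemma pr_ghom: "ghom G W W (pr i)"
 unfolding ghom_def lin_def
proof (intro conjI ballI allI)
 fix x y assume xy: "x \<in> space W" "y \<in> space W"
 have "(\<lambda>a. if a = i then co (x + y) a else 0) = (\<lambda>a. if a = i then co x a else 0) + (\<lambda>a. if a = i then co y a else 0)"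
  using co_add[OF xy] by (auto simp: fun_eq_iff)
 then show "pr i (x + y) = pr i x + pr i y"
  unfolding pr_def using Phi_add[OF pr_dom[OF xy(1)] pr_dom[OF xy(2)]] by simp
next
 fix c x assume x: "x \<in> space W"
 have "(\<lambda>a. if a = i then co (scal W c x) a else 0) = (\<lambda>a b. scal W c ((if a = i then co x a else 0) b))"
  using co_scal[OF x] by (auto simp: fun_eq_iff)
 then show "pr i (scal W c x) = scal W c (pr i x)"
  unfolding pr_def using Phi_scal[OF pr_dom[OF x]] by simp
next
 fix g x assume g: "g \<in> carrier G" and x: "x \<in> space W"
 have "(\<lambda>a. if a = i then co (act W g x) a else 0) = (\<lambda>a b. act W g ((if a = i then co x a else 0) b))"
  using co_act[OF x g] g by (auto simp: fun_eq_iff)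
 then show "pr i (act W g x) = act W g (pr i x)"
  unfolding pr_def using Phi_act[OF pr_dom[OF x] g] by simp
qed (rule pr_mem)

lemma pr_pr: "w \<in> space W \<Longrightarrow> pr i (pr j w) = (if i = j then pr i w else 0)"
proof -
 assume w: "w \<in> space W"
 have "(\<lambda>a. if a = i then co (pr j w) a else 0) = (if i = j then (\<lambda>a. if a = i then co w a else 0) else 0)"
  unfolding co_pr[OF w] by (auto simp: fun_eq_iff)
 then show ?thesis unfolding pr_def[of i "pr j w"] using Phi_0 by (simp add: pr_def)
qed

lemma pr_eq_sum: "w \<in> space W \<Longrightarrow> i < r \<Longrightarrow> pr i w = (\<Sum>j<m i. \<Phi> (sgl i j (co w i j)))"
proof -
 assume w: "w \<in> space W" and i: "i < r"
 have "pr i w = (\<Sum>a<r. \<Sum>j<m a. \<Phi> (sgl a j (co (pr i w) a j)))" by (rule W_expand[OF pr_mem[OF w]])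
 also have "\<dots> = (\<Sum>a<r. if a = i then (\<Sum>j<m i. \<Phi> (sgl i j (co w i j))) else 0)"
 proof (rule sum.cong[OF refl])
  fix a
  have z: "sgl a j 0 = 0" for j by (auto simp: sgl_def fun_eq_iff)
  show "(\<Sum>j<m a. \<Phi> (sgl a j (co (pr i w) a j))) = (if a = i then (\<Sum>j<m i. \<Phi> (sgl i j (co w i j))) else 0)"
   unfolding co_pr[OF w] by (simp add: z Phi_0)
 qed
 also have "\<dots> = (\<Sum>j<m i. \<Phi> (sgl i j (co w i j)))" using i by simp
 finally show ?thesis .
qed

text \<open>A full system of matrix units for all types, with the relations required only for the
  action on W. The last two clauses serve the regular representation and the one-dimensional types:
  diagonal units have a nonzero coefficient at the identity, and the unit of a one-dimensional type
  acts as the isotypic projection.\<close>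

definition munits :: "(nat \<Rightarrow> 'w set) \<Rightarrow> (nat \<Rightarrow> 'w \<Rightarrow> 'w \<Rightarrow> 'g \<Rightarrow> 'k) \<Rightarrow> bool" where
 "munits B e \<longleftrightarrow> (\<forall>i<r. finite (B i) \<and> B i \<noteq> {} \<and> card (B i) = gdim (Mi i)) \<and>
  (\<forall>i<r. \<forall>b\<in>B i. \<forall>c\<in>B i. \<forall>i'<r. \<forall>b'\<in>B i'. \<forall>c'\<in>B i'. \<forall>w\<in>space W.
    ga G W (e i b c) (ga G W (e i' b' c') w) = (if i = i' \<and> c = b' then ga G W (e i b c') w else 0)) \<and>
  (\<forall>w\<in>space W. (\<Sum>i<r. \<Sum>b\<in>B i. ga G W (e i b b) w) = w) \<and>
  (\<forall>i<r. \<forall>b\<in>B i. e i b b \<one> \<noteq> 0) \<and>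
  (\<forall>i<r. card (B i) = 1 \<longrightarrow> (\<forall>b\<in>B i. \<forall>w\<in>space W. ga G W (e i b b) w = pr i w))"

text \<open>The units of each type come from \<open>simple_matrix_units\<close>. Relations are
  verified on the simple modules, where they are those of matrices within a type, and 0 across
  types.\<close>

lemma munits_exist: "\<exists>B e. munits B e"
proof -
 have exB: "\<exists>B. finite B \<and> B \<subseteq> M i \<and> vs.independent B \<and> vs.span B = M i \<and> card B = gdim (Mi i)" if i: "i < r" for i
 proof -
  interpret Mi: gm G "Mi i" by (rule gm_Mi[OF i])
  obtain B where "finite B" "B \<subseteq> space (Mi i)" "vs.independent B" "vs.span B = space (Mi i)" "card B = gdim (Mi i)"
   using Mi.fin_dim_basis[OF fd_Mi[OF i]] unfolding scal_subgmod by auto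
  then show ?thesis by (intro exI[of _ B]) simp
 qed
 then have "\<forall>i. \<exists>B. i < r \<longrightarrow> (finite B \<and> B \<subseteq> M i \<and> vs.independent B \<and> vs.span B = M i \<and> card B = gdim (Mi i))" by auto
 from choice[OF this] obtain B where
  B': "\<forall>i. i < r \<longrightarrow> (finite (B i) \<and> B i \<subseteq> M i \<and> vs.independent (B i) \<and> vs.span (B i) = M i \<and> card (B i) = gdim (Mi i))" ..
 have B: "\<And>i. i < r \<Longrightarrow> finite (B i)" "\<And>i. i < r \<Longrightarrow> B i \<subseteq> M i" "\<And>i. i < r \<Longrightarrow> vs.independent (B i)"
  "\<And>i. i < r \<Longrightarrow> vs.span (B i) = M i" "\<And>i. i < r \<Longrightarrow> card (B i) = gdim (Mi i)" using B' by simp_all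
 have Bne: "B i \<noteq> {}" if "i < r" for i using B(4)[OF that] simple[OF that] by (auto simp: simple_gmod_def)
 define xi where "xi i c v = vs.representation (B i) v c" for i c v
 have "\<exists>e. (\<forall>b\<in>B i. \<forall>c\<in>B i. \<forall>v\<in>M i. ga G (Mi i) (e b c) v = scal W (xi i c v) b) \<and> (\<forall>b\<in>B i. e b b \<one> \<noteq> 0) \<and>
  (\<forall>b\<in>B i. \<forall>c\<in>B i. \<forall>i'<r. i' \<noteq> i \<longrightarrow> (\<forall>v\<in>M i'. ga G (Mi i') (e b c) v = 0))" if i: "i < r" for i
 proof -
  obtain e where e: "\<forall>b\<in>B i. \<forall>c\<in>B i. \<forall>v\<in>space (Mi i). ga G (Mi i) (e b c) v = scal (Mi i) (Modules.module.representation (scal (Mi i)) (B i) v c) b"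
   "\<forall>b\<in>B i. e b b \<one> \<noteq> 0"
   "\<forall>b\<in>B i. \<forall>c\<in>B i. \<forall>N :: ('k, 'g, 'w) gmod. gm G N \<longrightarrow> simple_gmod G N \<longrightarrow> \<not> (\<exists>f. gmod_iso G (Mi i) N f) \<longrightarrow>
     (\<forall>v\<in>space N. ga G N (e b c) v = 0)"
   using simple_matrix_units[OF gm_Mi[OF i] simple[OF i] fd_Mi[OF i] card_G, of "B i"] B(2-4)[OF i] by auto
  show ?thesis
  proof (intro exI[of _ e] conjI ballI allI impI)
   fix b c i' v assume "b \<in> B i" "c \<in> B i" "i' < r" "i' \<noteq> i" "v \<in> M i'"
   then show "ga G (Mi i') (e b c) v = 0" using e(3)[rule_format, OF _ _ gm_Mi simple noniso[OF i], of b c i' v] by simp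
  qed (use e(1,2) in \<open>auto simp: xi_def\<close>)
 qed
 then have "\<forall>i. \<exists>e. i < r \<longrightarrow> ((\<forall>b\<in>B i. \<forall>c\<in>B i. \<forall>v\<in>M i. ga G (Mi i) (e b c) v = scal W (xi i c v) b) \<and> (\<forall>b\<in>B i. e b b \<one> \<noteq> 0) \<and>
  (\<forall>b\<in>B i. \<forall>c\<in>B i. \<forall>i'<r. i' \<noteq> i \<longrightarrow> (\<forall>v\<in>M i'. ga G (Mi i') (e b c) v = 0)))" by auto
 from choice[OF this] obtain e where e': "\<forall>i. i < r \<longrightarrow> ((\<forall>b\<in>B i. \<forall>c\<in>B i. \<forall>v\<in>M i. ga G (Mi i) (e i b c) v = scal W (xi i c v) b) \<and> (\<forall>b\<in>B i. e i b b \<one> \<noteq> 0) \<and>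
  (\<forall>b\<in>B i. \<forall>c\<in>B i. \<forall>i'<r. i' \<noteq> i \<longrightarrow> (\<forall>v\<in>M i'. ga G (Mi i') (e i b c) v = 0)))" ..
 have e: "\<And>i b c v. i < r \<Longrightarrow> b \<in> B i \<Longrightarrow> c \<in> B i \<Longrightarrow> v \<in> M i \<Longrightarrow> ga G (Mi i) (e i b c) v = scal W (xi i c v) b"
  "\<And>i b. i < r \<Longrightarrow> b \<in> B i \<Longrightarrow> e i b b \<one> \<noteq> 0"
  "\<And>i b c i' v. i < r \<Longrightarrow> b \<in> B i \<Longrightarrow> c \<in> B i \<Longrightarrow> i' < r \<Longrightarrow> i' \<noteq> i \<Longrightarrow> v \<in> M i' \<Longrightarrow> ga G (Mi i') (e i b c) v = 0"
  using e' by simp_all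
 have xib: "xi i c b = (if c = b then 1 else 0)" if "i < r" "b \<in> B i" for i b c
  unfolding xi_def by (simp add: vs.representation_basis[OF B(3)[OF that(1)] that(2)])
 have xis: "xi i c (scal W a v) = a * xi i c v" if "i < r" "v \<in> M i" for i c a v
  unfolding xi_def using that B(4)[OF that(1)] by (simp add: vs.representation_scale[OF B(3)[OF that(1)]])
 have exp: "(\<Sum>b\<in>B i. scal W (xi i b v) b) = v" if "i < r" "v \<in> M i" for i v
  unfolding xi_def by (rule vs.sum_representation_eq) (use that B in auto)
 have zero: "ga G W a w = 0" if "w \<in> space W" "\<And>i v. i < r \<Longrightarrow> v \<in> M i \<Longrightarrow> ga G (Mi i) a v = 0" for a w
 proof -
  have "ga G W a w = ga G W (\<lambda>_. 0) w" by (rule ga_eqI[OF that(1)]) (simp add: that(2), simp add: ga_def)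
  then show ?thesis by (simp add: ga_def)
 qed
 have rel: "ga G W (e i b c) (ga G W (e i' b' c') w) = (if i = i' \<and> c = b' then ga G W (e i b c') w else 0)"
  if i: "i < r" "b \<in> B i" "c \<in> B i" "i' < r" "b' \<in> B i'" "c' \<in> B i'" and w: "w \<in> space W" for i b c i' b' c' w
 proof -
  have conv: "ga G (Mi a) (gconv G (e i b c) (e i' b' c')) v = ga G (Mi a) (e i b c) (ga G (Mi a) (e i' b' c') v)"
   if "a < r" "v \<in> M a" for a v using gm.ga_conv[OF gm_Mi[OF that(1)], of v] that by simp
  have mem: "ga G (Mi a) x v \<in> M a" if "a < r" "v \<in> M a" for a v x using gm.ga_mem[OF gm_Mi[OF that(1)], of v] that by simp
  have z: "ga G (Mi a) x 0 = 0" if "a < r" for a x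
  proof -
   interpret Mi: gm G "Mi a" by (rule gm_Mi[OF that])
   show ?thesis using Mi.ga_scal[of 0 x 0] M_0[OF that] by simp
  qed
  have "ga G W (e i b c) (ga G W (e i' b' c') w) = ga G W (gconv G (e i b c) (e i' b' c')) w" by (rule ga_conv[OF w, symmetric])
  also have "\<dots> = (if i = i' \<and> c = b' then ga G W (e i b c') w else 0)"
  proof (cases "i = i'")
   case True
   have *: "ga G (Mi a) (gconv G (e i b c) (e i' b' c')) v = (if c = b' then ga G (Mi a) (e i b c') v else 0)"
    if a: "a < r" "v \<in> M a" for a v
   proof (cases "a = i")
    case T: True
    have b'M: "b' \<in> M i" "c' \<in> B i" "b' \<in> B i" "v \<in> M i" using B(2)[OF i(1)] i(5,6) True T a by auto
    have "ga G (Mi i) (e i b c) (scal W (xi i c' v) b') = scal W (xi i c (scal W (xi i c' v) b')) b"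
     using i b'M vs.subspace_scale[OF M_subsp[OF i(1)]] by (intro e(1)) auto
    moreover have "ga G (Mi i) (gconv G (e i b c) (e i' b' c')) v = ga G (Mi i) (e i b c) (scal W (xi i c' v) b')"
     using conv[OF a] T i b'M True e(1)[of i b' c' v] by simp
    moreover have "ga G (Mi i) (e i b c') v = scal W (xi i c' v) b" using i b'M e(1)[of i b c' v] by simp
    ultimately show ?thesis unfolding T using i b'M by (simp add: xis xib)
   next
    case False
    then show ?thesis unfolding conv[OF a] using e(3) i a True mem[OF a] z[OF a(1)] by simp
   qed
   show ?thesis
   proof (cases "c = b'")
    case T: True
    show ?thesis using True T * ga_eqI[OF w, of "gconv G (e i b c) (e i' b' c')" "e i b c'"] by simp
   next
    case False
    then show ?thesis using True * zero[OF w, of "gconv G (e i b c) (e i' b' c')"] by simp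
   qed
  next
   case False
   have "ga G (Mi a) (gconv G (e i b c) (e i' b' c')) v = 0" if a: "a < r" "v \<in> M a" for a v
   proof (cases "a = i")
    case True
    then show ?thesis unfolding conv[OF a] using e(3)[of i' b' c' a v] i a False z[OF a(1)] by simp
   next
    case F: False
    then show ?thesis unfolding conv[OF a] using e(3)[OF i(1-3) a(1) _ mem[OF a]] by simp
   qed
   then show ?thesis using False zero[OF w] by simp
  qed
  finally show ?thesis .
 qed
 have one: "(\<Sum>i<r. \<Sum>b\<in>B i. ga G W (e i b b) w) = w" if w: "w \<in> space W" for w
 proof -
  have "(\<Sum>i<r. \<Sum>b\<in>B i. ga G W (e i b b) w) = ga G W (\<lambda>g. \<Sum>i<r. \<Sum>b\<in>B i. e i b b g) w" by (simp add: ga_sum_left)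
  \<comment> \<open>The sum of all diagonal units acts on each simple module like the identity of
    the group algebra.\<close>
  also have "\<dots> = ga G W (\<lambda>g. if g = \<one> then 1 else 0) w"
  proof (rule ga_eqI[OF w])
   fix a v assume a: "a < r" "v \<in> M a"
   interpret Mi: gm G "Mi a" by (rule gm_Mi[OF a(1)])
   have "ga G (Mi a) (\<lambda>g. \<Sum>i<r. \<Sum>b\<in>B i. e i b b g) v = (\<Sum>i<r. \<Sum>b\<in>B i. ga G (Mi a) (e i b b) v)"
    by (simp add: Mi.ga_sum_left)
   also have "\<dots> = (\<Sum>i<r. if i = a then (\<Sum>b\<in>B a. scal W (xi a b v) b) else 0)" by (intro sum.cong refl) (auto simp: e a)
   also have "\<dots> = v" using a exp by simp
   finally show "ga G (Mi a) (\<lambda>g. \<Sum>i<r. \<Sum>b\<in>B i. e i b b g) v = ga G (Mi a) (\<lambda>g. if g = \<one> then 1 else 0) v"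
    using Mi.ga_one[of v 1] a Mi.vs.scale_one by simp
  qed
  also have "\<dots> = w" using ga_one[OF w, of 1] by simp
  finally show ?thesis .
 qed
 have ab: "ga G W (e i b b) w = pr i w" if i: "i < r" "card (B i) = 1" "b \<in> B i" and w: "w \<in> space W" for i b w
 proof -
  have Bi: "B i = {b}" using i(2,3) by (auto simp: card_1_singleton_iff)
  have z: "sgl a j 0 = 0" for a j by (auto simp: sgl_def fun_eq_iff)
  \<comment> \<open>As b alone spans the simple module, the unit acts as the identity there, and as
    0 on the other types.\<close>
  have "ga G W (e i b b) w = (\<Sum>a<r. if a = i then (\<Sum>j<m i. \<Phi> (sgl i j (co w i j))) else 0)"
   unfolding ga_expand[OF w]
  proof (rule sum.cong[OF refl])
   fix a assume a: "a \<in> {..<r}"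
   show "(\<Sum>j<m a. \<Phi> (sgl a j (ga G (Mi a) (e i b b) (co w a j)))) = (if a = i then (\<Sum>j<m i. \<Phi> (sgl i j (co w i j))) else 0)"
   proof (cases "a = i")
    case True
    have "ga G (Mi i) (e i b b) (co w i j) = co w i j" if "j < m i" for j
     using e(1)[OF i(1,3,3) co_in[OF w i(1) that]] exp[OF i(1) co_in[OF w i(1) that]] Bi by simp
    then show ?thesis using True by simp
   next
    case False
    have "ga G (Mi a) (e i b b) (co w a j) = 0" if "j < m a" for j using e(3)[OF i(1,3,3), of a "co w a j"] False a co_in[OF w, of a j] that by simp
    then show ?thesis using False by (simp add: z Phi_0)
   qed
  qed
  also have "\<dots> = pr i w" using i pr_eq_sum[OF w i(1)] by simp
  finally show ?thesis .
 qed
 show ?thesis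
  unfolding munits_def by (rule exI[of _ B], rule exI[of _ e]) (use B(1,5) Bne rel one e(2) ab in simp)
qed

lemma munitsD:
 assumes "munits B e"
 shows munits_finite: "i < r \<Longrightarrow> finite (B i)" and munits_ne: "i < r \<Longrightarrow> B i \<noteq> {}"
  and munits_card: "i < r \<Longrightarrow> card (B i) = gdim (Mi i)"
  and munits_rel: "i < r \<Longrightarrow> b \<in> B i \<Longrightarrow> c \<in> B i \<Longrightarrow> i' < r \<Longrightarrow> b' \<in> B i' \<Longrightarrow> c' \<in> B i' \<Longrightarrow> w \<in> space W \<Longrightarrow>
    ga G W (e i b c) (ga G W (e i' b' c') w) = (if i = i' \<and> c = b' then ga G W (e i b c') w else 0)"
  and munits_one: "w \<in> space W \<Longrightarrow> (\<Sum>i<r. \<Sum>b\<in>B i. ga G W (e i b b) w) = w"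
  and munits_nz: "i < r \<Longrightarrow> b \<in> B i \<Longrightarrow> e i b b \<one> \<noteq> 0"
  and munits_pr: "i < r \<Longrightarrow> card (B i) = 1 \<Longrightarrow> b \<in> B i \<Longrightarrow> w \<in> space W \<Longrightarrow> ga G W (e i b b) w = pr i w"
 using assms by (simp_all add: munits_def)

section \<open>Coefficient extraction in a one-dimensional type\<close>

abbreviation "shift i \<omega> w t \<equiv> w - pr i w + scal W t \<omega>"

text \<open>The line \<open>shift\<close> replaces the component of w of type i by t \<omega>. The
  coefficient at t^d along it is the part of F of degree d in that component, evaluated there at
  \<omega>; the d forms \<open>l s\<close> bring the degree back to what it was.\<close>

definition qop :: "nat \<Rightarrow> 'w \<Rightarrow> nat \<Rightarrow> (nat \<Rightarrow> 'w \<Rightarrow> 'k) \<Rightarrow> ('w \<Rightarrow> 'k) \<Rightarrow> 'w \<Rightarrow> 'k" where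
 "qop i \<omega> d l F = (\<lambda>w. cf d (\<lambda>t. F (shift i \<omega> w t)) * (\<Prod>s<d. l s w))"

text \<open>The admissible parameters: \<omega> lies in the component of a one-dimensional type i,
  and the forms depend on this component only. It is the simple module that has dimension 1; its
  multiplicity is arbitrary.\<close>

definition qpar :: "nat \<Rightarrow> 'w \<Rightarrow> nat \<Rightarrow> (nat \<Rightarrow> 'w \<Rightarrow> 'k) \<Rightarrow> bool" where
 "qpar i \<omega> d l \<longleftrightarrow> i < r \<and> gdim (Mi i) = 1 \<and> \<omega> \<in> space W \<and> pr i \<omega> = \<omega> \<and>
   (\<forall>s<d. linear_form W (l s) \<and> (\<forall>w\<in>space W. l s (pr i w) = l s w))"

text \<open>The closure properties on which the whole argument runs, shared by the set of
  polarizations and by the set of invariants of bounded degree.\<close>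

definition qclosed :: "('w \<Rightarrow> 'k) set \<Rightarrow> bool" where
 "qclosed L \<longleftrightarrow> (\<forall>F F'. F \<in> L \<longrightarrow> (\<forall>x\<in>space W. F x = F' x) \<longrightarrow> F' \<in> L) \<and>
   (\<forall>\<gamma> F. gmod_iso G W W \<gamma> \<longrightarrow> F \<in> L \<longrightarrow> (\<lambda>w. F (\<gamma> w)) \<in> L) \<and>
   (\<forall>i \<omega> d l F. qpar i \<omega> d l \<longrightarrow> F \<in> L \<longrightarrow> qop i \<omega> d l F \<in> L)"

lemma qclosed_cong: "qclosed L \<Longrightarrow> F \<in> L \<Longrightarrow> (\<And>x. x \<in> space W \<Longrightarrow> F x = F' x) \<Longrightarrow> F' \<in> L"
 and qclosed_iso: "qclosed L \<Longrightarrow> gmod_iso G W W \<gamma> \<Longrightarrow> F \<in> L \<Longrightarrow> (\<lambda>w. F (\<gamma> w)) \<in> L"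
 and qclosed_qop: "qclosed L \<Longrightarrow> qpar i \<omega> d l \<Longrightarrow> F \<in> L \<Longrightarrow> qop i \<omega> d l F \<in> L"
 by (simp_all add: qclosed_def)

lemma pr_add: "x \<in> space W \<Longrightarrow> y \<in> space W \<Longrightarrow> pr i (x + y) = pr i x + pr i y"
 and pr_scal: "x \<in> space W \<Longrightarrow> pr i (scal W c x) = scal W c (pr i x)" using pr_ghom by (simp_all add: ghom_def lin_def)

lemma pr_diff: "x \<in> space W \<Longrightarrow> y \<in> space W \<Longrightarrow> pr i (x - y) = pr i x - pr i y"
 using pr_add[of "x - y" y i] by simp

lemma pr_shift:
 assumes "w \<in> space W" "\<omega> \<in> space W" "pr i \<omega> = \<omega>"
 shows "pr j (shift i \<omega> w t) = (if j = i then scal W t \<omega> else pr j w)"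
proof -
 have "pr j \<omega> = (if j = i then \<omega> else 0)" using pr_pr[OF assms(2), of j i] assms(3) by (auto split: if_splits)
 then show ?thesis using assms by (simp add: pr_add pr_diff pr_scal pr_mem pr_pr)
qed

text \<open>Along the line the factor \<Lambda>(pr i w) becomes t, as \<Lambda>(\<omega>) = 1, and K
  stays constant. The coefficient at t^|S| is therefore K, and the forms \<open>l s\<close> take the
  place of the power of \<Lambda>.\<close>

lemma one_dim_swap:
 assumes L: "qclosed L" and i: "i < r" "gdim (Mi i) = 1" and om: "\<omega> \<in> space W" "pr i \<omega> = \<omega>"
  and lf: "linear_form W \<Lambda>" "\<Lambda> \<omega> = 1"
  and K: "\<And>w t. w \<in> space W \<Longrightarrow> K (shift i \<omega> w t) = K w"
  and S: "finite S" "\<And>s. s \<in> S \<Longrightarrow> linear_form W (l s)" "\<And>s w. s \<in> S \<Longrightarrow> w \<in> space W \<Longrightarrow> l s (pr i w) = l s w"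
  and mem: "(\<lambda>w. (\<Prod>s\<in>S. \<Lambda> (pr i w)) * K w) \<in> L"
 shows "(\<lambda>w. (\<Prod>s\<in>S. l s w) * K w) \<in> L"
proof -
 obtain h where h: "bij_betw h {..<card S} S" using ex_bij_betw_nat_finite[OF S(1)] by (auto simp: lessThan_atLeast0)
 have hS: "h s \<in> S" if "s < card S" for s using bij_betwE[OF h] that by simp
 have "qpar i \<omega> (card S) (\<lambda>s. l (h s))" using i om S(2,3) hS by (simp add: qpar_def)
 from qclosed_qop[OF L this mem] show ?thesis
 proof (rule qclosed_cong[OF L])
  fix w assume w: "w \<in> space W"
  have "cf (card S) (\<lambda>t. (\<Prod>s\<in>S. \<Lambda> (pr i (shift i \<omega> w t))) * K (shift i \<omega> w t)) = cf (card S) (\<lambda>t. t ^ card S * K w)"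
   using lf om w by (simp add: pr_shift K linear_form_def)
  also have "\<dots> = Polynomial.coeff (monom (K w) (card S)) (card S)" by (rule cf_eq[OF infinite_alg_closed]) (simp add: poly_monom mult.commute)
  also have "\<dots> = K w" by simp
  finally show "qop i \<omega> (card S) (\<lambda>s. l (h s)) (\<lambda>w. (\<Prod>s\<in>S. \<Lambda> (pr i w)) * K w) w = (\<Prod>s\<in>S. l s w) * K w"
   using prod.reindex_bij_betw[OF h, of "\<lambda>s. l s w"] by (simp add: qop_def mult.commute)
 qed
qed

end

section \<open>Restriction from the sum with the regular representation\<close>

lemma regular_gmod:
 assumes "group G" "finite (carrier G)"
 shows "gm G (regular_rep G :: ('k::field, 'g, 'g \<Rightarrow> 'k) gmod)"
proof -
 interpret group G by fact
 let ?S = "{f :: 'g \<Rightarrow> 'k. \<forall>h. h \<notin> carrier G \<longrightarrow> f h = 0}"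
 have vs: "vector_space (\<lambda>(c::'k) f (h::'g). c * f h)" by (simp add: vector_space_def fun_eq_iff algebra_simps)
 then interpret v: vector_space "\<lambda>(c::'k) f (h::'g). c * f h" .
 have "group_action G ?S (\<lambda>g. \<lambda>f\<in>?S. \<lambda>h. if h \<in> carrier G then f (inv\<^bsub>G\<^esub> g \<otimes>\<^bsub>G\<^esub> h) else 0)"
  by (rule group_actionI[OF assms(1)]) (auto simp: fun_eq_iff inv_mult_group m_assoc)
 moreover have "v.subspace ?S" by (simp add: v.subspace_def)
 ultimately show ?thesis using assms vs by (auto simp: gm_def is_gmod_def regular_rep_def fun_eq_iff)
qed

lemma regular_fin_dim:
 assumes "group G" "finite (carrier G)"
 shows "fin_dim (regular_rep G :: ('k::field, 'g, 'g \<Rightarrow> 'k) gmod)"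
proof -
 interpret U: gm G "regular_rep G :: ('k, 'g, 'g \<Rightarrow> 'k) gmod" by (rule regular_gmod[OF assms])
 let ?d = "\<lambda>(g::'g) (h::'g). if h = g then (1::'k) else 0"
 have "f \<in> U.vs.span (?d ` carrier G)" if "f \<in> space (regular_rep G)" for f :: "'g \<Rightarrow> 'k"
 proof -
  have app: "(\<Sum>g\<in>S. F g) h = (\<Sum>g\<in>S. F g h)" for F :: "'g \<Rightarrow> 'g \<Rightarrow> 'k" and S h
   by (induction S rule: infinite_finite_induct) simp_all
  have "f = (\<Sum>g\<in>carrier G. scal (regular_rep G) (f g) (?d g))"
  proof (rule ext)
   fix h
   have "(\<Sum>g\<in>carrier G. scal (regular_rep G) (f g) (?d g)) h = (\<Sum>g\<in>carrier G. if g = h then f g else 0)"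
    unfolding app by (intro sum.cong refl) (simp add: regular_rep_def)
   also have "\<dots> = f h" using that assms(2) by (simp add: regular_rep_def)
   finally show "f h = (\<Sum>g\<in>carrier G. scal (regular_rep G) (f g) (?d g)) h" by simp
  qed
  also have "\<dots> \<in> U.vs.span (?d ` carrier G)" by (intro U.vs.span_sum U.vs.span_scale U.vs.span_base imageI)
  finally show ?thesis .
 qed
 then show ?thesis using assms(2) unfolding fin_dim_def by (intro exI[of _ "?d ` carrier G"]) auto
qed

section \<open>The sum with the regular representation and its transvections\<close>

lemma space_gsum: "space (gsum U V) = space U \<times> space V" by (simp add: gsum_def)
lemma scal_gsum [simp]: "scal (gsum U V) c (u, v) = (scal U c u, scal V c v)" by (simp add: gsum_def)
lemma act_gsum: "u \<in> space U \<Longrightarrow> v \<in> space V \<Longrightarrow> act (gsum U V) g (u, v) = (act U g u, act V g v)"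
 by (simp add: gsum_def)

lemma gsum_gmod:
 assumes "gm G U" "gm G V" shows "gm G (gsum U V)"
proof -
 interpret U: gm G U by fact
 interpret V: gm G V by fact
 have vs: "vector_space (scal (gsum U V))"
  by (auto simp: vector_space_def U.vs.scale_right_distrib V.vs.scale_right_distrib U.vs.scale_left_distrib V.vs.scale_left_distrib)
 then interpret v: vector_space "scal (gsum U V)" .
 have "group_action G (space U \<times> space V) (\<lambda>g. \<lambda>(u, v)\<in>space U \<times> space V. (act U g u, act V g v))"
  by (rule group_actionI[OF U.group_G]) (auto simp: U.act_mult V.act_mult)
 moreover have "v.subspace (space (gsum U V))"
  unfolding v.subspace_def by (auto simp: space_gsum)
   (auto simp: zero_prod_def)
 ultimately have "is_gmod G (gsum U V)" using vs unfolding is_gmod_def space_gsum by (auto simp: act_gsum) (auto simp: gsum_def)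
 then show ?thesis using U.group_G U.finite_G by (simp add: gm_def)
qed

lemma gsum_fin_dim:
 assumes "gm G U" "gm G V" "fin_dim U" "fin_dim V" shows "fin_dim (gsum U V)"
proof -
 interpret U: gm G U by fact
 interpret V: gm G V by fact
 interpret W: gm G "gsum U V" by (rule gsum_gmod[OF assms(1,2)])
 obtain B where B: "finite B" "B \<subseteq> space U" "U.vs.independent B" "U.vs.span B = space U" "card B = gdim U"
  by (rule U.fin_dim_basis[OF assms(3)])
 obtain C where C: "finite C" "C \<subseteq> space V" "V.vs.independent C" "V.vs.span C = space V" "card C = gdim V"
  by (rule V.fin_dim_basis[OF assms(4)])
 let ?F = "(\<lambda>b. (b, 0)) ` B \<union> (\<lambda>c. (0, c)) ` C"
 have "(u, v) \<in> W.vs.span ?F" if uv: "u \<in> space U" "v \<in> space V" for u v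
 proof -
  have "(u, v) = (\<Sum>b\<in>B. scal (gsum U V) (U.vs.representation B u b) (b, 0)) + (\<Sum>c\<in>C. scal (gsum U V) (V.vs.representation C v c) (0, c))"
   using U.basis_expand[OF B(1,3,4) uv(1)] V.basis_expand[OF C(1,3,4) uv(2)] by (simp add: prod_eq_iff fst_sum snd_sum)
  also have "\<dots> \<in> W.vs.span ?F" by (intro W.vs.span_add W.vs.span_sum W.vs.span_scale W.vs.span_base) auto
  finally show ?thesis .
 qed
 then show ?thesis using B(1) C(1) unfolding fin_dim_def space_gsum by (intro exI[of _ ?F]) auto
qed

locale regsum = isod G "gsum (regular_rep G) V" r M m \<Phi> + V: gm G V
 for G :: "('g, 'b) monoid_scheme" (structure) and V :: "('k::alg_closed_field, 'g, 'v::ab_group_add) gmod"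
  and r M m \<Phi>
begin

abbreviation "U \<equiv> regular_rep G :: ('k, 'g, 'g \<Rightarrow> 'k) gmod"
abbreviation "W \<equiv> gsum U V"

sublocale U: gm G U by (rule regular_gmod[OF group_G finite_G])

text \<open>The situation after the reduction by the Reynolds operator: the pullbacks of all
  polynomial functions on R are available, not only those of the invariants.\<close>

definition good :: "(('g \<Rightarrow> 'k) \<times> 'v \<Rightarrow> 'k) set \<Rightarrow> bool" where
 "good L \<longleftrightarrow> fsub L \<and> qclosed L \<and> (\<forall>f. pf U f \<longrightarrow> (\<lambda>w. f (fst w)) \<in> L)"

lemma good_ext: "good L \<Longrightarrow> pf U f \<Longrightarrow> (\<lambda>w. f (fst w)) \<in> L"
 unfolding good_def by blast

text \<open>The value at the identity of the R-component of w, after the transvection that adds to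
  it the image of the V-component under the homomorphism corresponding to u.\<close>

definition Lam :: "('v \<Rightarrow> 'k) \<Rightarrow> ('g \<Rightarrow> 'k) \<times> 'v \<Rightarrow> 'k" where
 "Lam u w = fst w \<one> + u (snd w)"

lemma space_W: "w \<in> space W \<longleftrightarrow> fst w \<in> space U \<and> snd w \<in> space V" by (simp add: space_gsum mem_Times_iff)

lemma fst_scal: "fst (scal W c w) = scal U c (fst w)" and snd_scal: "snd (scal W c w) = scal V c (snd w)"
 by (simp_all add: gsum_def split: prod.split)

lemma fst_act: "w \<in> space W \<Longrightarrow> fst (act W g w) = act U g (fst w)"
 and snd_act: "w \<in> space W \<Longrightarrow> snd (act W g w) = act V g (snd w)" using act_gsum[of "fst w" U "snd w" V g] by (auto simp: space_W)

lemma fst_ga: "w \<in> space W \<Longrightarrow> fst (ga G W a w) = ga G U a (fst w)"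
 and snd_ga: "w \<in> space W \<Longrightarrow> snd (ga G W a w) = ga G V a (snd w)"
 by (simp_all add: ga_def fst_sum snd_sum fst_scal snd_scal fst_act snd_act)

lemma scal_U: "scal U c f = (\<lambda>h. c * f h)" by (simp add: regular_rep_def)

lemma act_U: "f \<in> space U \<Longrightarrow> act U g f = (\<lambda>h. if h \<in> carrier G then f (inv g \<otimes> h) else 0)"
 by (simp add: regular_rep_def)

lemma Lam_form: "linear_form V u \<Longrightarrow> linear_form W (Lam u)"
 by (simp add: linear_form_def Lam_def fst_scal snd_scal scal_U space_W algebra_simps)

text \<open>Frobenius reciprocity: the form u corresponds to the homomorphism from V to R sending v
  to the function h \<mapsto> u(h^-1 v), whose value at the identity is u(v). The given product is
  the polynomial function \<rho> \<mapsto> \<Prod> (a_s \<rho>)(1) on R, pulled back to W and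
  composed with the transvection.\<close>

lemma transvection:
 assumes L: "good L" and u: "linear_form V u" and E: "finite E"
 shows "(\<lambda>w. \<Prod>s\<in>E. Lam u (ga G W (a s) w)) \<in> L"
proof -
 define \<phi> where "\<phi> v = (\<lambda>h. if h \<in> carrier G then u (act V (inv h) v) else 0)" for v
 have phi_mem: "\<phi> v \<in> space U" for v by (simp add: \<phi>_def regular_rep_def)
 have ul: "u (x + y) = u x + u y" "u (scal V c x) = c * u x" if "x \<in> space V" "y \<in> space V" for x y c
  using u that by (simp_all add: linear_form_def)
 have phi_add: "\<phi> (x + y) = \<phi> x + \<phi> y" "\<phi> (scal V c x) = scal U c (\<phi> x)"
  if "x \<in> space V" "y \<in> space V" for x y c using that by (auto simp: \<phi>_def fun_eq_iff ul scal_U)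
 have phi_scal: "\<phi> (scal V c x) = scal U c (\<phi> x)" if "x \<in> space V" for x c by (rule phi_add(2)[OF that that])
 have phi_act: "\<phi> (act V g v) = act U g (\<phi> v)" if "g \<in> carrier G" "v \<in> space V" for g v
  unfolding act_U[OF phi_mem] using that by (auto simp: \<phi>_def fun_eq_iff V.act_mult[symmetric] G.inv_mult_group)
 have phi: "ghom G V U \<phi>" using phi_mem phi_add phi_act by (simp add: ghom_def lin_def)
 define \<gamma> where "\<gamma> w = (fst w + \<phi> (snd w), snd w)" for w
 have gam: "gmod_iso G W W \<gamma>"
 proof (rule gmod_isoI[OF gm_W])
  show "ghom G W W \<gamma>"
   unfolding ghom_def lin_def
  proof (intro conjI ballI allI)
   fix x y assume "x \<in> space W" "y \<in> space W"
   then show "\<gamma> (x + y) = \<gamma> x + \<gamma> y" by (simp add: \<gamma>_def space_W phi_add prod_eq_iff)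
  next
   fix x c assume x: "x \<in> space W"
   then show "\<gamma> (scal W c x) = scal W c (\<gamma> x)"
    by (simp add: \<gamma>_def space_W phi_scal prod_eq_iff fst_scal snd_scal U.vs.scale_right_distrib)
  next
   fix g x assume g: "g \<in> carrier G" and x: "x \<in> space W"
   have gm: "\<gamma> x \<in> space W" using x phi_mem by (simp add: \<gamma>_def space_W)
   show "\<gamma> (act W g x) = act W g (\<gamma> x)"
    unfolding prod_eq_iff fst_act[OF gm] snd_act[OF gm] using x x[unfolded space_W] g phi_mem by (simp add: \<gamma>_def fst_act snd_act phi_act)
  qed (use phi_mem in \<open>simp add: \<gamma>_def space_W\<close>)
 next
  fix x assume "x \<in> space W" "\<gamma> x = 0"
  moreover from this have "snd x = 0" by (simp add: \<gamma>_def prod_eq_iff)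
  moreover have "\<phi> 0 = 0" using phi_add(1)[of 0 0] by simp
  ultimately show "x = 0" by (simp add: \<gamma>_def prod_eq_iff)
 next
  fix y assume y: "y \<in> space W"
  then show "\<exists>x\<in>space W. \<gamma> x = y"
   by (intro bexI[of _ "(fst y - \<phi> (snd y), snd y)"]) (simp_all add: \<gamma>_def space_W phi_mem)
 qed
 let ?f = "\<lambda>\<rho>. \<Prod>s\<in>E. ga G U (a s) \<rho> \<one>"
 have "pf U ?f" by (intro pf_prod pf_form) (simp add: linear_form_def U.ga_add U.ga_scal, simp add: scal_U)
 then have "(\<lambda>w. ?f (fst w)) \<in> L" by (rule good_ext[OF L])
 then have "(\<lambda>w. ?f (fst (\<gamma> w))) \<in> L" using L qclosed_iso[OF _ gam] unfolding good_def by blast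
 then show ?thesis
 proof (rule qclosed_cong[rotated])
  show "qclosed L" using L by (simp add: good_def)
  fix w assume w: "w \<in> space W"
  have "ga G U (a s) (fst (\<gamma> w)) \<one> = Lam u (ga G W (a s) w)" for s
  proof -
   have "ga G U (a s) (fst (\<gamma> w)) = ga G U (a s) (fst w) + \<phi> (ga G V (a s) (snd w))"
    using w phi_mem by (simp add: \<gamma>_def space_W U.ga_add V.ga_hom[OF _ phi] U.gm_axioms)
   moreover have "\<phi> (ga G V (a s) (snd w)) \<one> = u (ga G V (a s) (snd w))" using w by (simp add: \<phi>_def space_W)
   ultimately show ?thesis using w by (simp add: Lam_def fst_ga snd_ga)
  qed
  then show "?f (fst (\<gamma> w)) = (\<Prod>s\<in>E. Lam u (ga G W (a s) w))" by simp
 qed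
qed

text \<open>The unit of type i is applied to the indicator function of the identity. For every a in
  the group algebra, a times this function takes the value a(1) at the identity; for a diagonal unit
  this is nonzero and can be scaled to 1.\<close>

lemma one_dim_vector:
 assumes mu: "munits B e" and i: "i < r" "card (B i) = 1"
 shows "\<exists>\<omega>\<in>space W. pr i \<omega> = \<omega> \<and> fst \<omega> \<one> = 1 \<and> snd \<omega> = 0"
proof -
 obtain b where b: "b \<in> B i" using munits_ne[OF mu i(1)] by auto
 define \<delta> where "\<delta> = (\<lambda>h. if h = \<one> then (1::'k) else 0)"
 have d: "\<delta> \<in> space U" by (auto simp: \<delta>_def regular_rep_def)
 have dW: "(\<delta>, 0) \<in> space W" using d by (simp add: space_W)
 have app: "(\<Sum>g\<in>S. F g) h = (\<Sum>g\<in>S. F g h)" for F :: "'g \<Rightarrow> 'g \<Rightarrow> 'k" and S h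
  by (induction S rule: infinite_finite_induct) simp_all
 have ev: "ga G U a \<delta> \<one> = a \<one>" for a
 proof -
  have "ga G U a \<delta> \<one> = (\<Sum>g\<in>carrier G. if g = \<one> then a g else 0)"
   unfolding ga_def app
  proof (rule sum.cong[OF refl])
   fix g assume g: "g \<in> carrier G"
   have "inv g = \<one> \<longleftrightarrow> g = \<one>" using g by (metis G.inv_inv G.inv_one)
   then show "scal U (a g) (act U g \<delta>) \<one> = (if g = \<one> then a g else 0)"
    using g by (simp add: scal_U act_U[OF d]) (simp add: \<delta>_def)
  qed
  then show ?thesis using finite_G by simp
 qed
 define c where "c = e i b b \<one>"
 have c: "c \<noteq> 0" using munits_nz[OF mu i(1) b] by (simp add: c_def)
 have p: "pr i (\<delta>, 0) = ga G W (e i b b) (\<delta>, 0)" using munits_pr[OF mu i b dW] by simp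
 have f: "fst (pr i (\<delta>, 0)) \<one> = c" unfolding p fst_ga[OF dW] by (simp add: ev c_def)
 have "ga G V (e i b b) 0 = 0" using V.ga_scal[of 0 "e i b b" 0] by simp
 then have s: "snd (pr i (\<delta>, 0)) = 0" unfolding p snd_ga[OF dW] by simp
 show ?thesis
 proof (intro bexI[of _ "scal W (inverse c) (pr i (\<delta>, 0))"] conjI)
  show "pr i (scal W (inverse c) (pr i (\<delta>, 0))) = scal W (inverse c) (pr i (\<delta>, 0))"
   using pr_mem[OF dW] by (simp add: pr_scal pr_pr[OF dW])
  show "fst (scal W (inverse c) (pr i (\<delta>, 0))) \<one> = 1" using c f by (simp add: fst_scal scal_U)
  show "snd (scal W (inverse c) (pr i (\<delta>, 0))) = 0" by (simp add: snd_scal s)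
 qed (rule scal_mem[OF pr_mem[OF dW]])
qed

text \<open>The weights of the one-dimensional constituents are moved freely, the others stay in place.\<close>

lemma mixed_products:
 assumes L: "good L" and mu: "munits B e" and u: "linear_form V u"
  and uab: "\<And>i w. i < r \<Longrightarrow> card (B i) = 1 \<Longrightarrow> w \<in> space W \<Longrightarrow> u (snd (pr i w)) = 0"
  and E: "finite E1" "finite E2" "E1 \<inter> E2 = {}"
  and ty: "\<And>s. s \<in> E1 \<Longrightarrow> ty s < r \<and> card (B (ty s)) = 1"
  and l: "\<And>s. s \<in> E1 \<Longrightarrow> linear_form W (l s)" "\<And>s w. s \<in> E1 \<Longrightarrow> w \<in> space W \<Longrightarrow> l s (pr (ty s) w) = l s w"
  and a: "\<And>s i w. s \<in> E2 \<Longrightarrow> i < r \<Longrightarrow> card (B i) = 1 \<Longrightarrow> w \<in> space W \<Longrightarrow> ga G W (a s) (pr i w) = 0"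
 shows "(\<lambda>w. (\<Prod>s\<in>E1. l s w) * (\<Prod>s\<in>E2. Lam u (ga G W (a s) w))) \<in> L"
proof -
 have qc: "qclosed L" using L by (simp add: good_def)
 define b where "b i = (SOME b. b \<in> B i)" for i
 have b: "b i \<in> B i" if "i < r" for i using munits_ne[OF mu that] by (simp add: b_def some_in_eq)
 let ?H = "\<lambda>w. \<Prod>s\<in>E2. Lam u (ga G W (a s) w)"
 \<comment> \<open>Factors of types in T already have their final form \<open>l s\<close>; those of
   the other one-dimensional types still come from the transvection. T grows by one type at a
   time.\<close>
 define P where "P T w = (\<Prod>s\<in>E1. if ty s \<in> T then l s w else Lam u (pr (ty s) w))" for T w
 have "(\<lambda>w. P T w * ?H w) \<in> L" if "finite T" "T \<subseteq> {i. i < r \<and> card (B i) = 1}" for T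
  using that
 proof (induction T rule: finite_induct)
  case empty
  \<comment> \<open>At the start all factors come from one transvection; on E1 the diagonal unit of
    the type of s acts as the projection \<open>pr\<close>.\<close>
  define a' where "a' s = (if s \<in> E1 then e (ty s) (b (ty s)) (b (ty s)) else a s)" for s
  have "(\<lambda>w. \<Prod>s\<in>E1 \<union> E2. Lam u (ga G W (a' s) w)) \<in> L" by (rule transvection[OF L u]) (use E in simp)
  then show ?case
  proof (rule qclosed_cong[OF qc])
   fix w assume w: "w \<in> space W"
   have "(\<Prod>s\<in>E1 \<union> E2. Lam u (ga G W (a' s) w)) = (\<Prod>s\<in>E1. Lam u (ga G W (a' s) w)) * (\<Prod>s\<in>E2. Lam u (ga G W (a' s) w))"
    by (rule prod.union_disjoint[OF E])
   also have "(\<Prod>s\<in>E1. Lam u (ga G W (a' s) w)) = P {} w"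
    unfolding P_def using ty b w by (intro prod.cong refl) (simp add: a'_def munits_pr[OF mu])
   also have "(\<Prod>s\<in>E2. Lam u (ga G W (a' s) w)) = ?H w" using E(3) by (intro prod.cong refl) (auto simp: a'_def)
   finally show "(\<Prod>s\<in>E1 \<union> E2. Lam u (ga G W (a' s) w)) = P {} w * ?H w" .
  qed
 next
  case (insert i T)
  have i: "i < r" "card (B i) = 1" using insert.prems by auto
  obtain \<omega> where om: "\<omega> \<in> space W" "pr i \<omega> = \<omega>" "fst \<omega> \<one> = 1" "snd \<omega> = 0"
   using one_dim_vector[OF mu i] by auto
  have u0: "u 0 = 0" by (rule V.linear_form_0[OF u])
  let ?S = "{s\<in>E1. ty s = i}"
  \<comment> \<open>Everything except the positions of type i. It is constant along the shift in
    direction \<omega>: factors of other types do not see it, and the a_s annihilate the i-th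
    component.\<close>
  define K where "K w = (\<Prod>s\<in>E1 - ?S. if ty s \<in> T then l s w else Lam u (pr (ty s) w)) * ?H w" for w
  have split: "(\<Prod>s\<in>E1. h s) = (\<Prod>s\<in>?S. h s) * (\<Prod>s\<in>E1 - ?S. h s)" for h :: "_ \<Rightarrow> 'k"
   using prod.subset_diff[of ?S E1 h] E(1) by (simp add: mult.commute)
  have "(\<lambda>w. (\<Prod>s\<in>?S. l s w) * K w) \<in> L"
  proof (rule one_dim_swap[OF qc i(1) _ om(1,2) Lam_form[OF u]])
   show "gdim (Mi i) = 1" using munits_card[OF mu i(1)] i(2) by simp
   show "Lam u \<omega> = 1" using om u0 by (simp add: Lam_def)
   show "finite ?S" using E(1) by simp
   show "linear_form W (l s)" if "s \<in> ?S" for s using l(1) that by simp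
   show "l s (pr i w) = l s w" if "s \<in> ?S" "w \<in> space W" for s w using l(2)[of s w] that by auto
   show "(\<lambda>w. (\<Prod>s\<in>?S. Lam u (pr i w)) * K w) \<in> L"
   proof (rule qclosed_cong[OF qc insert.IH])
    show "T \<subseteq> {i. i < r \<and> card (B i) = 1}" using insert.prems by auto
    fix w assume "w \<in> space W"
    have "(\<Prod>s\<in>?S. if ty s \<in> T then l s w else Lam u (pr (ty s) w)) = (\<Prod>s\<in>?S. Lam u (pr i w))"
     using insert.hyps by (intro prod.cong refl) auto
    then show "P T w * ?H w = (\<Prod>s\<in>?S. Lam u (pr i w)) * K w"
     unfolding P_def K_def split by (simp only: mult.assoc)
   qed
   fix w t assume w: "w \<in> space W"
   let ?w = "shift i \<omega> w t"
   have w': "?w \<in> space W" using w om(1) pr_mem[OF w] by simp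
   have A: "(if ty s \<in> T then l s ?w else Lam u (pr (ty s) ?w)) = (if ty s \<in> T then l s w else Lam u (pr (ty s) w))"
    if "s \<in> E1 - ?S" for s
   proof -
    have p: "pr (ty s) ?w = pr (ty s) w" using that by (simp add: pr_shift[OF w om(1,2)])
    have "l s ?w = l s w" using that l(2)[of s ?w] l(2)[of s w] w w' p by simp
    then show ?thesis using p by simp
   qed
   have "ga G W (a s) ?w = ga G W (a s) w" if s: "s \<in> E2" for s
   proof -
    have "ga G W (a s) (w - pr i w) + ga G W (a s) (pr i w) = ga G W (a s) w" using ga_add[of "w - pr i w" "pr i w" "a s"] w pr_mem[OF w] by simp
    then have "ga G W (a s) (w - pr i w) = ga G W (a s) w" using a[OF s i w] by simp
    moreover have "ga G W (a s) (scal W t \<omega>) = 0" using a[OF s i om(1)] om(1,2) by (simp add: ga_scal)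
    ultimately show ?thesis using ga_add[of "w - pr i w" "scal W t \<omega>" "a s"] w pr_mem[OF w] om(1) by simp
   qed
   then show "K ?w = K w" unfolding K_def using A by (intro arg_cong2[where f = "(*)"] prod.cong refl) simp_all
  qed
  then show ?case
  proof (rule qclosed_cong[OF qc])
   fix w assume "w \<in> space W"
   have 1: "(\<Prod>s\<in>?S. if ty s \<in> insert i T then l s w else Lam u (pr (ty s) w)) = (\<Prod>s\<in>?S. l s w)" by (intro prod.cong refl) auto
   have 2: "(\<Prod>s\<in>E1 - ?S. if ty s \<in> insert i T then l s w else Lam u (pr (ty s) w)) =
    (\<Prod>s\<in>E1 - ?S. if ty s \<in> T then l s w else Lam u (pr (ty s) w))" by (intro prod.cong refl) auto
   show "(\<Prod>s\<in>?S. l s w) * K w = P (insert i T) w * ?H w"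
    unfolding P_def K_def split 1 2 by (simp only: mult.assoc)
  qed
 qed
 from this[of "{i. i < r \<and> card (B i) = 1}"] have "(\<lambda>w. P {i. i < r \<and> card (B i) = 1} w * ?H w) \<in> L" by simp
 moreover have "P {i. i < r \<and> card (B i) = 1} w = (\<Prod>s\<in>E1. l s w)" for w
  unfolding P_def using ty by (intro prod.cong refl) auto
 ultimately show ?thesis by simp
qed

end

section \<open>Words in the matrix units, restricted to V\<close>

context regsum begin

lemma zero_W: "v \<in> space V \<Longrightarrow> (0, v) \<in> space W" by (simp add: space_W)

lemma ga_zero_V: "v \<in> space V \<Longrightarrow> ga G W a (0, v) = (0, ga G V a v)"
proof -
 assume v: "v \<in> space V"
 have "ga G U a 0 = 0" using U.ga_scal[of 0 a 0] by simp
 then show ?thesis using fst_ga[OF zero_W[OF v], of a] snd_ga[OF zero_W[OF v], of a] by (simp add: prod_eq_iff)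
qed

definition Res :: "(('g \<Rightarrow> 'k) \<times> 'v \<Rightarrow> 'k) set \<Rightarrow> ('v \<Rightarrow> 'k) set" where
 "Res L = {f. \<exists>F\<in>L. \<forall>v\<in>space V. F (0, v) = f v}"

lemma ResI: "F \<in> L \<Longrightarrow> (\<And>v. v \<in> space V \<Longrightarrow> F (0, v) = f v) \<Longrightarrow> f \<in> Res L"
 unfolding Res_def by blast

lemma Res_cong: assumes "f \<in> Res L" "\<And>v. v \<in> space V \<Longrightarrow> f v = g v" shows "g \<in> Res L"
proof -
 from assms(1) obtain F where "F \<in> L" "\<forall>v\<in>space V. F (0, v) = f v" unfolding Res_def by auto
 then show ?thesis using assms(2) by (intro ResI[of F]) auto
qed

lemma fsub_Res: assumes L: "fsub L" shows "fsub (Res L)"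
 unfolding fsub_def
proof (intro conjI ballI allI)
 show "(\<lambda>_. 0) \<in> Res L" by (rule ResI[OF fsub_zero[OF L]]) simp
 fix f assume "f \<in> Res L"
 then obtain F where F: "F \<in> L" "\<forall>v\<in>space V. F (0, v) = f v" unfolding Res_def by auto
 show "(\<lambda>x. c * f x) \<in> Res L" for c by (rule ResI[OF fsub_scale[OF L F(1), of c]]) (simp add: F(2))
 fix g assume "g \<in> Res L"
 then obtain H where H: "H \<in> L" "\<forall>v\<in>space V. H (0, v) = g v" unfolding Res_def by auto
 show "(\<lambda>x. f x + g x) \<in> Res L" by (rule ResI[OF fsub_add[OF L F(1) H(1)]]) (simp add: F(2) H(2))
qed

text \<open>V is the submodule of W with first component 0, so the relations of the units on W
  restrict to V.\<close>

lemma V_rel: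
 assumes mu: "munits B e" and i: "i < r" "b \<in> B i" "c \<in> B i" "i' < r" "b' \<in> B i'" "c' \<in> B i'" and v: "v \<in> space V"
 shows "ga G V (e i b c) (ga G V (e i' b' c') v) = (if i = i' \<and> c = b' then ga G V (e i b c') v else 0)"
proof (cases "i = i' \<and> c = b'")
 case True
 then show ?thesis using munits_rel[OF mu i zero_W[OF v]] v by (simp add: ga_zero_V)
next
 case False
 then have "ga G W (e i b c) (ga G W (e i' b' c') (0, v)) = 0" using munits_rel[OF mu i zero_W[OF v]] by auto
 then have "ga G V (e i b c) (ga G V (e i' b' c') v) = 0" using v by (simp add: ga_zero_V zero_prod_def)
 then show ?thesis unfolding if_not_P[OF False] .
qed

lemma V_one:
 assumes mu: "munits B e" and v: "v \<in> space V"
 shows "(\<Sum>i<r. \<Sum>b\<in>B i. ga G V (e i b b) v) = v"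
 using arg_cong[OF munits_one[OF mu zero_W[OF v]], of snd] v by (simp add: ga_zero_V snd_sum)

text \<open>Positions of one-dimensional types (E1) are left to \<open>mixed_products\<close>. The
  others (E2) form a word whose letters (i, b) stand for the units e(b0, b) of type i in a fixed row
  b0. Right multiplication by e(b, c) turns the letter b into c, which is the move required by
  \<open>words_in_subspace\<close>; words with fewer than p occurrences of each letter come from
  polarization.\<close>

lemma words_in_Res:
 fixes B :: "nat \<Rightarrow> (('g \<Rightarrow> 'k) \<times> 'v) set"
 assumes L: "good L" and mu: "munits B e" and p: "0 < p" "\<And>j. 1 \<le> j \<Longrightarrow> j < p \<Longrightarrow> of_nat j \<noteq> (0::'k)"
  and E: "finite E" and cond: "\<And>i. i < r \<Longrightarrow> gdim (Mi i) = 1 \<or> card E \<le> gdim (Mi i) * (p - 1)"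
  and lam: "\<And>s. s \<in> E \<Longrightarrow> linear_form V (lam s)"
  and c: "\<And>s. s \<in> E \<Longrightarrow> fst (c s) < r \<and> snd (c s) \<in> B (fst (c s))"
  and b0: "\<And>i. i < r \<Longrightarrow> b0 i \<in> B i"
 shows "(\<lambda>v. \<Prod>s\<in>E. lam s (ga G V (e (fst (c s)) (b0 (fst (c s))) (snd (c s))) v)) \<in> Res L"
proof -
 define x where "x a = e (fst a) (b0 (fst a)) (snd a)" for a
 define E1 where "E1 = {s\<in>E. card (B (fst (c s))) = 1}"
 define E2 where "E2 = E - E1"
 have fE: "finite E1" "finite E2" "E1 \<inter> E2 = {}" "E = E1 \<union> E2" using E by (auto simp: E1_def E2_def)
 define h where "h v = (\<Prod>s\<in>E1. lam s (ga G V (x (c s)) v))" for v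
 \<comment> \<open>The factor h has to stay in place while the rest of the word is acted on by the
   group algebra; the quantifier over a makes N stable under composition with every element of
   it.\<close>
 define N where "N = {f. \<forall>a. (\<lambda>v. h v * f (ga G V a v)) \<in> Res L}"
 have fL: "fsub L" and qc: "qclosed L" using L by (simp_all add: good_def)
 have fR: "fsub (Res L)" by (rule fsub_Res[OF fL])
 have fN: "fsub N"
  unfolding fsub_def
 proof (intro conjI ballI allI)
  show "(\<lambda>_. 0) \<in> N" using fsub_zero[OF fR] by (simp add: N_def)
  fix f assume f: "f \<in> N"
  show "(\<lambda>x. d * f x) \<in> N" for d
   unfolding N_def using f fsub_scale[OF fR, of _ d] by (simp add: N_def mult.left_commute)
  fix g assume g: "g \<in> N"
  show "(\<lambda>x. f x + g x) \<in> N" using f g fsub_add[OF fR] by (simp add: N_def distrib_left)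
 qed
 have Ncong: "g \<in> N" if "f \<in> N" "\<And>v. v \<in> space V \<Longrightarrow> f v = g v" for f g
  unfolding N_def
 proof (intro CollectI allI)
  fix a
  have "(\<lambda>v. h v * f (ga G V a v)) \<in> Res L" using that(1) by (simp add: N_def)
  then show "(\<lambda>v. h v * g (ga G V a v)) \<in> Res L" by (rule Res_cong) (simp add: that(2))
 qed
 have Ncomp: "(\<lambda>v. f (ga G V b v)) \<in> N" if "f \<in> N" for f b
  unfolding N_def
 proof (intro CollectI allI)
  fix a
  have "(\<lambda>v. h v * f (ga G V (gconv G b a) v)) \<in> Res L" using that by (simp add: N_def)
  then show "(\<lambda>v. h v * f (ga G V b (ga G V a v))) \<in> Res L" by (rule Res_cong) (simp add: V.ga_conv)
 qed
 define Lt where "Lt = (SIGMA i:{i. i < r \<and> card (B i) \<noteq> 1}. B i)"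
 have fLt: "finite Lt" unfolding Lt_def using munits_finite[OF mu] by auto
 have Lt: "fst a < r" "card (B (fst a)) \<noteq> 1" "snd a \<in> B (fst a)" if "a \<in> Lt" for a using that by (auto simp: Lt_def)
 \<comment> \<open>The letter a times a unit in row a' is 0 unless a = a'; then it is the letter
   given by the column of that unit.\<close>
 have relx: "ga G V (x a) (ga G V (e (fst a') (snd a') d) v) = (if a = a' then ga G V (e (fst a) (b0 (fst a)) d) v else 0)"
  if "a \<in> Lt" "a' \<in> Lt" "d \<in> B (fst a')" "v \<in> space V" for a a' d v
  unfolding x_def using V_rel[OF mu Lt(1)[OF that(1)] b0[OF Lt(1)[OF that(1)]] Lt(3)[OF that(1)] Lt(1)[OF that(2)] Lt(3)[OF that(2)] that(3,4)]
  by (simp add: prod_eq_iff)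
 define w where "w d = (\<lambda>v. \<Prod>s\<in>E2. lam s (ga G V (x (d s)) v))" for d
 have "w c \<in> N"
 proof (rule words_in_subspace[OF fN fE(2) fLt p(2), where \<tau> = fst and ty = "\<lambda>s. fst (c s)" and p = p])
  show "c s \<in> Lt \<and> fst (c s) = fst (c s)" if "s \<in> E2" for s using that c[of s] by (cases "c s") (simp add: E2_def E1_def Lt_def)
  show "0 < p" by (rule p(1))
  fix i
  show "card {s \<in> E2. fst (c s) = i} \<le> card {a \<in> Lt. fst a = i} * (p - 1)"
  proof (cases "i < r \<and> card (B i) \<noteq> 1")
   case True
   have "{a \<in> Lt. fst a = i} = Pair i ` B i" using True by (auto simp: Lt_def)
   then have "card {a \<in> Lt. fst a = i} = gdim (Mi i)" using munits_card[OF mu, of i] True by (simp add: card_image inj_on_def)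
   \<comment> \<open>The worst case is allowed for: all positions may belong to the single type
     i.\<close>
   moreover have "card {s \<in> E2. fst (c s) = i} \<le> card E" using E by (intro card_mono) (auto simp: E2_def)
   moreover have "card E \<le> gdim (Mi i) * (p - 1)" using cond[of i] munits_card[OF mu, of i] True by auto
   ultimately show ?thesis by simp
  next
   case False
   have "{s \<in> E2. fst (c s) = i} = {}"
   proof (rule ccontr)
    assume "{s \<in> E2. fst (c s) = i} \<noteq> {}"
    then obtain s where "s \<in> E2" "fst (c s) = i" by auto
    then show False using c[of s] False by (auto simp: E2_def E1_def)
   qed
   then show ?thesis by (simp only: card.empty)
  qed
 next
  fix d assume d: "\<And>s. s \<in> E2 \<Longrightarrow> d s \<in> Lt \<and> fst (d s) = fst (c s)" and small: "\<And>a. card {s \<in> E2. d s = a} < p"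
  \<comment> \<open>The functions available for the letter a: a linear form applied after its matrix
    unit.\<close>
  define F where "F a = {f. \<exists>u. linear_form V u \<and> (\<forall>v\<in>space V. f v = u (ga G V (x a) v))}" for a
  show "w d \<in> N"
   unfolding w_def
  proof (rule polarization_in_subspace[OF infinite_alg_closed fN fE(2), where F = F and c = d])
   fix a show "fsub (F a)"
    unfolding fsub_def
   proof (intro conjI ballI allI)
    show "(\<lambda>_. 0) \<in> F a" unfolding F_def by (intro CollectI exI[of _ "\<lambda>_. 0"]) (simp add: linear_form_def)
    fix f assume "f \<in> F a"
    then obtain u where u: "linear_form V u" "\<forall>v\<in>space V. f v = u (ga G V (x a) v)" by (auto simp: F_def)
    show "(\<lambda>x. q * f x) \<in> F a" for q unfolding F_def
     by (intro CollectI exI[of _ "\<lambda>v. q * u v"]) (use u in \<open>simp add: linear_form_def algebra_simps\<close>)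
    fix g assume "g \<in> F a"
    then obtain u' where u': "linear_form V u'" "\<forall>v\<in>space V. g v = u' (ga G V (x a) v)" by (auto simp: F_def)
    show "(\<lambda>x. f x + g x) \<in> F a" unfolding F_def
     by (intro CollectI exI[of _ "\<lambda>v. u v + u' v"]) (use u u' in \<open>simp add: linear_form_def algebra_simps\<close>)
   qed
  next
   fix a q assume "1 \<le> q" "q \<le> card {s \<in> E2. d s = a}"
   then show "of_nat q \<noteq> (0::'k)" using p(2)[of q] small[of a] by linarith
  next
   fix s assume s: "s \<in> E2"
   show "(\<lambda>v. lam s (ga G V (x (d s)) v)) \<in> F (d s)"
    unfolding F_def using lam[of s] s by (intro CollectI exI[of _ "lam s"]) (simp add: E2_def)
  next
   fix \<mu> assume mF: "\<And>a. \<mu> a \<in> F a"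
   have "\<forall>a. \<exists>u. linear_form V u \<and> (\<forall>v\<in>space V. \<mu> a v = u (ga G V (x a) v))" using mF by (simp add: F_def)
   from choice[OF this] obtain u where u: "\<forall>a. linear_form V (u a) \<and> (\<forall>v\<in>space V. \<mu> a v = u a (ga G V (x a) v))" ..
   \<comment> \<open>One form for all letters: U' after the diagonal unit of a is \<open>u a\<close>
     after the letter a, so a single transvection, the one of U', produces all factors.\<close>
   define U' where "U' v = (\<Sum>a\<in>Lt. u a (ga G V (x a) v))" for v
   have lfu: "linear_form V (u a)" for a using spec[OF u, of a] by (rule conjunct1)
   have uv: "\<mu> a v = u a (ga G V (x a) v)" if "v \<in> space V" for a v using spec[OF u, of a] that by simp
   have ul: "u a (y + z) = u a y + u a z" "u a (scal V q y) = q * u a y" if "y \<in> space V" "z \<in> space V" for a y z q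
    using lfu[of a] that by (simp_all add: linear_form_def)
   have u0: "u a 0 = 0" for a by (rule V.linear_form_0[OF lfu])
   have U': "linear_form V U'"
    unfolding linear_form_def U'_def by (simp add: V.ga_add V.ga_scal ul(1) sum.distrib sum_distrib_left) (simp add: ul(2)[OF _ V.zero_mem])
   show "(\<lambda>v. \<Prod>s\<in>E2. \<mu> (d s) v) \<in> N"
    unfolding N_def
   proof (intro CollectI allI)
    fix a
    define a' where "a' s = gconv G (e (fst (d s)) (snd (d s)) (snd (d s))) a" for s
    define l where "l s = (\<lambda>w :: ('g \<Rightarrow> 'k) \<times> 'v. lam s (ga G V (x (c s)) (snd w)))" for s
    have "(\<lambda>w. (\<Prod>s\<in>E1. l s w) * (\<Prod>s\<in>E2. Lam U' (ga G W (a' s) w))) \<in> L"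
    proof (rule mixed_products[OF L mu U' _ fE(1-3), where ty = "\<lambda>s. fst (c s)"])
     fix i w assume i: "i < r" "card (B i) = 1" "w \<in> space W"
     have bi: "b0 i \<in> B i" by (rule b0[OF i(1)])
     have wV: "snd w \<in> space V" using i(3) by (simp add: space_W)
     have pw: "snd (pr i w) = ga G V (e i (b0 i) (b0 i)) (snd w)"
      using munits_pr[OF mu i(1,2) bi i(3)] snd_ga[OF i(3), of "e i (b0 i) (b0 i)"] by simp
     \<comment> \<open>A letter in \<open>Lt\<close> and the unit of a one-dimensional type belong
       to different types, so their product is 0. Hence U' vanishes on the one-dimensional
       components.\<close>
     have "ga G V (x a) (snd (pr i w)) = 0" if a: "a \<in> Lt" for a
     proof -
      have "fst a \<noteq> i" using Lt(2)[OF a] i(2) by auto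
      then show ?thesis unfolding pw x_def using V_rel[OF mu Lt(1)[OF a] b0[OF Lt(1)[OF a]] Lt(3)[OF a] i(1) bi bi wV] by simp
     qed
     then show "U' (snd (pr i w)) = 0" by (simp add: U'_def u0)
    next
     fix s assume s: "s \<in> E1"
     then have sE: "s \<in> E" and cs: "fst (c s) < r" "snd (c s) \<in> B (fst (c s))" "card (B (fst (c s))) = 1" using c[of s] by (auto simp: E1_def)
     show "fst (c s) < r \<and> card (B (fst (c s))) = 1" using cs by simp
     have lf: "linear_form V (lam s)" by (rule lam[OF sE])
     show "linear_form W (l s)" using lf by (simp add: l_def linear_form_def snd_scal space_W V.ga_add V.ga_scal)
     fix w assume w: "w \<in> space W"
     have "snd (c s) = b0 (fst (c s))" using cs b0[OF cs(1)] by (auto simp: card_1_singleton_iff)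
     then have xe: "x (c s) = e (fst (c s)) (b0 (fst (c s))) (b0 (fst (c s)))" by (simp add: x_def)
     have b: "b0 (fst (c s)) \<in> B (fst (c s))" by (rule b0[OF cs(1)])
     have "ga G V (x (c s)) (snd w') = snd (pr (fst (c s)) w')" if "w' \<in> space W" for w'
      unfolding xe using munits_pr[OF mu cs(1,3) b that] snd_ga[OF that, of "e (fst (c s)) (b0 (fst (c s))) (b0 (fst (c s)))"] by simp
     then show "l s (pr (fst (c s)) w) = l s w" using w pr_mem[OF w] by (simp add: l_def pr_pr)
    next
     fix s i w assume s: "s \<in> E2" and i: "i < r" "card (B i) = 1" and w: "w \<in> space W"
     have ds: "d s \<in> Lt" using d[OF s] by simp
     have "ga G W (a' s) (pr i w) = ga G W (e (fst (d s)) (snd (d s)) (snd (d s))) (pr i (ga G W a w))"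
      unfolding a'_def ga_conv[OF pr_mem[OF w]] using ga_hom[OF gm_W pr_ghom w] by simp
     also have "pr i (ga G W a w) = ga G W (e i (b0 i) (b0 i)) (ga G W a w)" using munits_pr[OF mu i b0[OF i(1)], of "ga G W a w"] w by simp
     also have "ga G W (e (fst (d s)) (snd (d s)) (snd (d s))) \<dots> = 0"
      using munits_rel[OF mu Lt(1)[OF ds] Lt(3)[OF ds] Lt(3)[OF ds] i(1) b0[OF i(1)] b0[OF i(1)], of "ga G W a w"] Lt(2)[OF ds] i w by auto
     finally show "ga G W (a' s) (pr i w) = 0" .
    qed
    then show "(\<lambda>v. h v * (\<Prod>s\<in>E2. \<mu> (d s) (ga G V a v))) \<in> Res L"
    proof (rule ResI)
     fix v assume v: "v \<in> space V"
     have "Lam U' (ga G W (a' s) (0, v)) = \<mu> (d s) (ga G V a v)" if s: "s \<in> E2" for s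
     proof -
      have ds: "d s \<in> Lt" using d[OF s] by simp
      have "Lam U' (ga G W (a' s) (0, v)) = U' (ga G V (e (fst (d s)) (snd (d s)) (snd (d s))) (ga G V a v))"
       using v by (simp add: ga_zero_V Lam_def a'_def V.ga_conv)
      also have "\<dots> = (\<Sum>b\<in>Lt. if b = d s then u (d s) (ga G V (x (d s)) (ga G V a v)) else 0)"
       unfolding U'_def using relx[OF _ ds Lt(3)[OF ds], of _ "ga G V a v"] v by (intro sum.cong refl) (auto simp: u0 x_def)
      also have "\<dots> = \<mu> (d s) (ga G V a v)" using ds fLt uv v by simp
      finally show ?thesis .
     qed
     then show "(\<Prod>s\<in>E1. l s (0, v)) * (\<Prod>s\<in>E2. Lam U' (ga G W (a' s) (0, v))) = h v * (\<Prod>s\<in>E2. \<mu> (d s) (ga G V a v))"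
      by (simp add: l_def h_def)
    qed
   qed
  qed
 next
  fix d y z assume d: "\<And>s. s \<in> E2 \<Longrightarrow> d s \<in> Lt \<and> fst (d s) = fst (c s)" and wd: "w d \<in> N"
   and yz: "y \<in> Lt" "z \<in> Lt" "y \<noteq> z" "fst y = fst z"
  define \<alpha> where "\<alpha> s v = lam s (ga G V (x (d s)) v)" for s v
  define \<beta> where "\<beta> s v = (if d s = z then lam s (ga G V (x y) v) else 0)" for s v
  have "(\<lambda>v. \<Sum>s\<in>E2. \<beta> s v * (\<Prod>s'\<in>E2 - {s}. \<alpha> s' v)) \<in> N"
  proof (rule derivation_in_subspace[OF infinite_alg_closed fN fE(2)])
   fix t
   \<comment> \<open>The element 1 + t e(z, y) of the group algebra. Multiplying from the right, it
     turns the letter z into z + t y and fixes the others; the coefficient of t is the sum over the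
     occurrences of z.\<close>
   define tv where "tv g = (if g = \<one> then 1 else 0) + t * e (fst z) (snd z) (snd y) g" for g
   have tv: "ga G V tv v = v + scal V t (ga G V (e (fst z) (snd z) (snd y)) v)" if "v \<in> space V" for v
    unfolding tv_def V.ga_add_left V.ga_scal_left using V.ga_one[OF that, of 1] by simp
   show "(\<lambda>v. \<Prod>s\<in>E2. \<alpha> s v + t * \<beta> s v) \<in> N"
   proof (rule Ncong[OF Ncomp[OF wd, of tv]])
    fix v assume v: "v \<in> space V"
    have "lam s (ga G V (x (d s)) (ga G V tv v)) = \<alpha> s v + t * \<beta> s v" if s: "s \<in> E2" for s
    proof -
     have ds: "d s \<in> Lt" using d[OF s] by simp
     have ls: "linear_form V (lam s)" using lam[of s] s by (simp add: E2_def)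
     have yB: "snd y \<in> B (fst z)" using Lt(3)[OF yz(1)] yz(4) by simp
     have "ga G V (x (d s)) (ga G V (e (fst z) (snd z) (snd y)) v) = (if d s = z then ga G V (x y) v else 0)"
      using relx[OF ds yz(2) yB v] yz(4) by (auto simp: x_def)
     then have "ga G V (x (d s)) (ga G V tv v) = ga G V (x (d s)) v + scal V t (if d s = z then ga G V (x y) v else 0)"
      unfolding tv[OF v] using v by (simp add: V.ga_add V.ga_scal)
     moreover have "lam s 0 = 0" by (rule V.linear_form_0[OF ls])
     ultimately show ?thesis using ls v by (simp add: \<alpha>_def \<beta>_def linear_form_def)
    qed
    then show "w d (ga G V tv v) = (\<Prod>s\<in>E2. \<alpha> s v + t * \<beta> s v)" by (simp add: w_def)
   qed
  qed
  moreover have "(\<Sum>s\<in>E2. \<beta> s v * (\<Prod>s'\<in>E2 - {s}. \<alpha> s' v)) = (\<Sum>s\<in>{s \<in> E2. d s = z}. w (d(s := y)) v)" for v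
  proof -
   have "(\<Sum>s\<in>{s \<in> E2. d s = z}. w (d(s := y)) v) = (\<Sum>s\<in>{s \<in> E2. d s = z}. \<beta> s v * (\<Prod>s'\<in>E2 - {s}. \<alpha> s' v))"
   proof (rule sum.cong[OF refl])
    fix s assume s: "s \<in> {s \<in> E2. d s = z}"
    have "w (d(s := y)) v = lam s (ga G V (x y) v) * (\<Prod>s'\<in>E2 - {s}. lam s' (ga G V (x ((d(s := y)) s')) v))"
     unfolding w_def using s by (subst prod.remove[OF fE(2), of s]) auto
    also have "(\<Prod>s'\<in>E2 - {s}. lam s' (ga G V (x ((d(s := y)) s')) v)) = (\<Prod>s'\<in>E2 - {s}. \<alpha> s' v)"
     by (intro prod.cong refl) (simp add: \<alpha>_def)
    finally have "w (d(s := y)) v = lam s (ga G V (x y) v) * (\<Prod>s'\<in>E2 - {s}. \<alpha> s' v)" .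
    moreover have "\<beta> s v = lam s (ga G V (x y) v)" using s by (simp add: \<beta>_def)
    ultimately show "w (d(s := y)) v = \<beta> s v * (\<Prod>s'\<in>E2 - {s}. \<alpha> s' v)" by (simp only:)
   qed
   also have "\<dots> = (\<Sum>s\<in>E2. \<beta> s v * (\<Prod>s'\<in>E2 - {s}. \<alpha> s' v))"
    using fE(2) by (intro sum.mono_neutral_left) (auto simp: \<beta>_def)
   finally show ?thesis by simp
  qed
  ultimately show "(\<lambda>v. \<Sum>s\<in>{s \<in> E2. d s = z}. w (d(s := y)) v) \<in> N" by simp
 qed
 \<comment> \<open>Membership in N is used for the identity of the group algebra.\<close>
 then have "(\<lambda>v. h v * w c (ga G V (\<lambda>g. if g = \<one> then 1 else 0) v)) \<in> Res L" by (simp add: N_def)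
 then show ?thesis
 proof (rule Res_cong)
  fix v assume v: "v \<in> space V"
  show "h v * w c (ga G V (\<lambda>g. if g = \<one> then 1 else 0) v) = (\<Prod>s\<in>E. lam s (ga G V (e (fst (c s)) (b0 (fst (c s))) (snd (c s))) v))"
   unfolding fE(4) prod.union_disjoint[OF fE(1-3)] using V.ga_one[OF v, of 1] by (simp add: h_def w_def x_def)
 qed
qed

text \<open>Write v as the sum of e(b, b) v = e(b, b0) e(b0, b) v over all types and all b, and
  expand the product: each summand is a word in the letters e(b0, b), with the linear forms l_s
  after e(b, b0).\<close>

lemma prod_forms_in_Res:
 assumes L: "good L" and p: "0 < p" "\<And>j. 1 \<le> j \<Longrightarrow> j < p \<Longrightarrow> of_nat j \<noteq> (0::'k)"
  and cond: "\<And>i. i < r \<Longrightarrow> gdim (Mi i) = 1 \<or> d \<le> gdim (Mi i) * (p - 1)"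
  and l: "\<And>s. s < d \<Longrightarrow> linear_form V (l s)"
 shows "(\<lambda>v. \<Prod>s<d. l s v) \<in> Res L"
proof -
 have fR: "fsub (Res L)" using fsub_Res L by (simp add: good_def)
 obtain B e where mu: "munits B e" using munits_exist by auto
 define b0 where "b0 i = (SOME b. b \<in> B i)" for i
 have b0: "b0 i \<in> B i" if "i < r" for i using munits_ne[OF mu that] by (simp add: b0_def some_in_eq)
 define Y where "Y = (SIGMA i:{..<r}. B i)"
 have fY: "finite Y" unfolding Y_def using munits_finite[OF mu] by auto
 have Y: "fst a < r" "snd a \<in> B (fst a)" if "a \<in> Y" for a using that by (auto simp: Y_def)
 define k where "k g s = (\<lambda>v. l s (ga G V (e (fst (g s)) (snd (g s)) (b0 (fst (g s)))) v))" for g s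
 have "(\<lambda>v. \<Sum>g\<in>PiE {..<d} (\<lambda>_. Y). \<Prod>s<d. k g s (ga G V (e (fst (g s)) (b0 (fst (g s))) (snd (g s))) v)) \<in> Res L"
 proof (rule fsub_sum[OF fR], rule words_in_Res[OF L mu p])
  fix g s assume g: "g \<in> PiE {..<d} (\<lambda>_. Y)" and s: "s \<in> {..<d}"
  show "linear_form V (k g s)" using l[of s] s by (simp add: k_def linear_form_def V.ga_add V.ga_scal)
  have "g s \<in> Y" using g s by auto
  then show "fst (g s) < r \<and> snd (g s) \<in> B (fst (g s))" using Y by simp
 qed (use cond b0 in auto)
 then show ?thesis
 proof (rule Res_cong)
  fix v assume v: "v \<in> space V"
  have "l s v = (\<Sum>a\<in>Y. l s (ga G V (e (fst a) (snd a) (b0 (fst a))) (ga G V (e (fst a) (b0 (fst a)) (snd a)) v)))" if s: "s < d" for s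
  proof -
   have ls: "linear_form V (l s)" using l s by simp
   have "v = (\<Sum>a\<in>Y. ga G V (e (fst a) (snd a) (snd a)) v)"
   proof -
    have "(\<Sum>a\<in>Y. ga G V (e (fst a) (snd a) (snd a)) v) = (\<Sum>(i, b)\<in>Y. ga G V (e i b b) v)" by (simp add: split_def)
    also have "\<dots> = (\<Sum>i<r. \<Sum>b\<in>B i. ga G V (e i b b) v)"
     unfolding Y_def by (rule sum.Sigma[symmetric]) (use munits_finite[OF mu] in auto)
    finally show ?thesis using V_one[OF mu v] by simp
   qed
   then have "l s v = l s (\<Sum>a\<in>Y. ga G V (e (fst a) (snd a) (snd a)) v)" by simp
   also have "\<dots> = (\<Sum>a\<in>Y. l s (ga G V (e (fst a) (snd a) (snd a)) v))" by (rule V.linear_form_sum[OF ls]) (use v in simp)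
   also have "\<dots> = (\<Sum>a\<in>Y. l s (ga G V (e (fst a) (snd a) (b0 (fst a))) (ga G V (e (fst a) (b0 (fst a)) (snd a)) v)))"
    by (intro sum.cong refl) (simp add: V_rel[OF mu _ _ _ _ _ _ v] Y b0)
   finally show ?thesis .
  qed
  then have "(\<Prod>s<d. l s v) = (\<Prod>s<d. \<Sum>a\<in>Y. l s (ga G V (e (fst a) (snd a) (b0 (fst a))) (ga G V (e (fst a) (b0 (fst a)) (snd a)) v)))"
   by (intro prod.cong refl) simp
  also have "\<dots> = (\<Sum>g\<in>PiE {..<d} (\<lambda>_. Y). \<Prod>s<d. k g s (ga G V (e (fst (g s)) (b0 (fst (g s))) (snd (g s))) v))"
   unfolding k_def by (rule prod_sum_PiE) (use fY in auto)
  finally show "(\<Sum>g\<in>PiE {..<d} (\<lambda>_. Y). \<Prod>s<d. k g s (ga G V (e (fst (g s)) (b0 (fst (g s))) (snd (g s))) v)) = (\<Prod>s<d. l s v)" ..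
 qed
qed

lemma homogeneous_in_Res:
 assumes L: "good L" and p: "0 < p" "\<And>j. 1 \<le> j \<Longrightarrow> j < p \<Longrightarrow> of_nat j \<noteq> (0::'k)"
  and cond: "\<And>i. i < r \<Longrightarrow> gdim (Mi i) = 1 \<or> d \<le> gdim (Mi i) * (p - 1)"
  and f: "hp V d f"
 shows "f \<in> Res L"
 using f
proof (induction rule: hp_induct)
 case (cong f g) then show ?case using Res_cong[of f L g] by simp
next
 case zero show ?case using fsub_zero[OF fsub_Res] L by (simp add: good_def)
next
 case (add f g) then show ?case using fsub_add[OF fsub_Res] L by (simp add: good_def)
next
 case (prod q l)
 show ?case using fsub_scale[OF fsub_Res prod_forms_in_Res[OF L p cond prod]] L by (simp add: good_def)
qed

end

text \<open>The rule \<open>cong\<close> disregards values outside Y, so that extensional functions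
  and unrestricted formulas can be mixed.\<close>

inductive_set alg :: "'x set \<Rightarrow> ('x \<Rightarrow> 'k::field) set \<Rightarrow> ('x \<Rightarrow> 'k) set" for Y S where
 const: "(\<lambda>_. c) \<in> alg Y S"
| incl: "f \<in> S \<Longrightarrow> f \<in> alg Y S"
| add: "f \<in> alg Y S \<Longrightarrow> g \<in> alg Y S \<Longrightarrow> (\<lambda>x. f x + g x) \<in> alg Y S"
| mult: "f \<in> alg Y S \<Longrightarrow> g \<in> alg Y S \<Longrightarrow> (\<lambda>x. f x * g x) \<in> alg Y S"
| cong: "f \<in> alg Y S \<Longrightarrow> (\<And>x. x \<in> Y \<Longrightarrow> f x = g x) \<Longrightarrow> g \<in> alg Y S"

lemma alg_cmult: "f \<in> alg Y S \<Longrightarrow> (\<lambda>x. c * f x) \<in> alg Y S" by (rule alg.mult[OF alg.const])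

lemma alg_comp:
 assumes "f \<in> alg Z S" and T: "\<And>y. y \<in> Y \<Longrightarrow> T y \<in> Z" and S: "\<And>s. s \<in> S \<Longrightarrow> (\<lambda>y. s (T y)) \<in> alg Y S'"
 shows "(\<lambda>y. f (T y)) \<in> alg Y S'"
 using assms(1)
proof (induction rule: alg.induct)
 case (cong f g) show ?case by (rule alg.cong[OF cong.IH]) (rule cong.hyps(2)[OF T])
next
 case (add f g) show ?case by (rule alg.add[OF add.IH])
next
 case (mult f g) show ?case by (rule alg.mult[OF mult.IH])
qed (intro alg.const S; assumption)+

lemma fsub_alg: "fsub (alg Y S)"
 unfolding fsub_def by (intro conjI ballI allI alg.const alg.add alg_cmult)

lemma alg_pf:
 assumes S: "\<And>f. f \<in> S \<Longrightarrow> pf W f" and f: "f \<in> alg (space W) S"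
 shows "pf W f"
 using f
proof (induction rule: alg.induct)
 case (incl f) then show ?case by (rule S)
next
 case (cong f g)
 then show ?case using pf_cong[of W f g] by simp
qed (simp_all add: pf_const pf_add pf_mult)

section \<open>Coefficient extraction and the Reynolds operator\<close>

lemma cf_add:
 assumes "infinite (UNIV :: 'k::field set)" "\<exists>P. \<forall>t. poly P t = \<phi> t" "\<exists>P. \<forall>t. poly P t = \<psi> t"
 shows "cf d (\<lambda>t. \<phi> t + \<psi> t :: 'k) = cf d \<phi> + cf d \<psi>"
proof -
 from assms obtain P Q where P: "\<And>t. poly P t = \<phi> t" and Q: "\<And>t. poly Q t = \<psi> t" by blast
 have "cf d (\<lambda>t. \<phi> t + \<psi> t) = Polynomial.coeff (P + Q) d" by (rule cf_eq[OF assms(1)]) (simp add: P Q)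
 then show ?thesis by (simp add: cf_eq[OF assms(1) P] cf_eq[OF assms(1) Q])
qed

lemma cf_mult:
 assumes "infinite (UNIV :: 'k::field set)" "\<exists>P. \<forall>t. poly P t = \<phi> t" "\<exists>P. \<forall>t. poly P t = \<psi> t"
 shows "cf d (\<lambda>t. \<phi> t * \<psi> t :: 'k) = (\<Sum>a\<le>d. cf a \<phi> * cf (d - a) \<psi>)"
proof -
 from assms obtain P Q where P: "\<And>t. poly P t = \<phi> t" and Q: "\<And>t. poly Q t = \<psi> t" by blast
 have "cf d (\<lambda>t. \<phi> t * \<psi> t) = Polynomial.coeff (P * Q) d" by (rule cf_eq[OF assms(1)]) (simp add: P Q)
 then show ?thesis by (simp add: cf_eq[OF assms(1) P] cf_eq[OF assms(1) Q] coeff_mult)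
qed

lemma cf_const: "infinite (UNIV :: 'k::field set) \<Longrightarrow> cf d (\<lambda>t. c :: 'k) = (if d = 0 then c else 0)"
 by (subst cf_eq[of "[:c:]"]) (auto simp: coeff_pCons split: nat.split)

lemma cf_cmult:
 assumes "infinite (UNIV :: 'k::field set)" "\<exists>P. \<forall>t. poly P t = \<phi> t"
 shows "cf d (\<lambda>t. c * \<phi> t :: 'k) = c * cf d \<phi>"
proof -
 from assms obtain P where P: "\<And>t. poly P t = \<phi> t" by blast
 have "cf d (\<lambda>t. c * \<phi> t) = Polynomial.coeff (Polynomial.smult c P) d" by (rule cf_eq[OF assms(1)]) (simp add: P)
 then show ?thesis by (simp add: cf_eq[OF assms(1) P])
qed

lemma cf_dilate:
 assumes "infinite (UNIV :: 'k::field set)" "\<exists>P. \<forall>t. poly P t = \<phi> t"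
 shows "cf d (\<lambda>t. \<phi> (c * t) :: 'k) = c ^ d * cf d \<phi>"
proof -
 from assms obtain P where P: "\<And>t. poly P t = \<phi> t" by blast
 have "cf d (\<lambda>t. \<phi> (c * t)) = Polynomial.coeff (P \<circ>\<^sub>p [:0, c:]) d"
  by (rule cf_eq[OF assms(1)]) (simp add: P poly_pcompose mult.commute)
 then show ?thesis by (simp add: cf_eq[OF assms(1) P] coeff_pcompose_linear)
qed

lemma cf_sum:
 assumes "infinite (UNIV :: 'k::field set)" "\<And>i. i \<in> I \<Longrightarrow> \<exists>P. \<forall>t. poly P t = \<phi> i t"
 shows "cf d (\<lambda>t. \<Sum>i\<in>I. \<phi> i t :: 'k) = (\<Sum>i\<in>I. cf d (\<phi> i))"
proof -
 have "\<forall>i. \<exists>P. i \<in> I \<longrightarrow> (\<forall>t. poly P t = \<phi> i t)" using assms(2) by blast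
 from choice[OF this] obtain P where P: "\<forall>i. i \<in> I \<longrightarrow> (\<forall>t. poly (P i) t = \<phi> i t)" ..
 have "cf d (\<lambda>t. \<Sum>i\<in>I. \<phi> i t) = Polynomial.coeff (\<Sum>i\<in>I. P i) d" by (rule cf_eq[OF assms(1)]) (simp add: P poly_sum)
 also have "\<dots> = (\<Sum>i\<in>I. cf d (\<phi> i))"
  unfolding coeff_sum by (intro sum.cong refl cf_eq[OF assms(1), symmetric]) (simp add: P)
 finally show ?thesis .
qed

text \<open>The Reynolds operator, written without inverses because g runs through the whole
  group.\<close>

definition rey :: "('g, 'b) monoid_scheme \<Rightarrow> ('k::field, 'g, 'w::ab_group_add) gmod \<Rightarrow> ('w \<Rightarrow> 'k) \<Rightarrow> 'w \<Rightarrow> 'k" where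
 "rey G W f = (\<lambda>x. inverse (of_nat (card (carrier G))) * (\<Sum>g\<in>carrier G. f (act W g x)))"

definition invf :: "('g, 'b) monoid_scheme \<Rightarrow> ('k::field, 'g, 'w::ab_group_add) gmod \<Rightarrow> ('w \<Rightarrow> 'k) \<Rightarrow> bool" where
 "invf G W f \<longleftrightarrow> (\<forall>g\<in>carrier G. \<forall>x\<in>space W. f (act W g x) = f x)"

context gm begin

lemma bij_mult_right: "h \<in> carrier G \<Longrightarrow> bij_betw (\<lambda>g. g \<otimes> h) (carrier G) (carrier G)"
 by (rule bij_betw_byWitness[where f' = "\<lambda>g. g \<otimes> inv h"]) (auto simp: G.m_assoc)

lemma rey_inv: "invf G M (rey G M f)"
 unfolding invf_def
proof (intro ballI)
 fix h x assume h: "h \<in> carrier G" and x: "x \<in> space M"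
 have "(\<Sum>g\<in>carrier G. f (act M g (act M h x))) = (\<Sum>g\<in>carrier G. f (act M (g \<otimes> h) x))"
  using h x by (intro sum.cong refl) (simp add: act_mult)
 also have "\<dots> = (\<Sum>g\<in>carrier G. f (act M g x))" by (rule sum.reindex_bij_betw[OF bij_mult_right[OF h]])
 finally show "rey G M f (act M h x) = rey G M f x" by (simp add: rey_def)
qed

lemma rey_of_inv:
 assumes "of_nat (card (carrier G)) \<noteq> (0::'k)" "invf G M f" "x \<in> space M" shows "rey G M f x = f x"
 using assms by (simp add: rey_def invf_def)

lemma rey_cong: "(\<And>x. x \<in> space M \<Longrightarrow> f x = f' x) \<Longrightarrow> x \<in> space M \<Longrightarrow> rey G M f x = rey G M f' x"
 by (simp add: rey_def)

lemma rey_pf: "pf M f \<Longrightarrow> pf M (rey G M f)"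
 unfolding rey_def by (intro pf_cmult pf_sum pf_comp[OF lin_act])

lemma rey_add: "rey G M (\<lambda>x. f x + f' x) x = rey G M f x + rey G M f' x" by (simp add: rey_def sum.distrib distrib_left)

lemma rey_cmult: "rey G M (\<lambda>x. c * f x) x = c * rey G M f x" by (simp add: rey_def sum_distrib_left[symmetric] mult.left_commute)

lemma rey_ghom:
 assumes "ghom G M N \<phi>" "x \<in> space M" shows "rey G M (\<lambda>x. f (\<phi> x)) x = rey G N f (\<phi> x)"
 using assms by (simp add: rey_def ghom_def)

end

context isod begin

lemma line_mem: "w \<in> space W \<Longrightarrow> \<omega> \<in> space W \<Longrightarrow> shift i \<omega> w t \<in> space W" by (simp add: pr_mem)

lemma line_poly:
 assumes "pf W F" "w \<in> space W" "\<omega> \<in> space W" shows "\<exists>P. \<forall>t. poly P t = F (shift i \<omega> w t)"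
 by (rule poly_on_line[OF assms(1)]) (use assms pr_mem in auto)

lemma qop_cong:
 assumes "\<And>x. x \<in> space W \<Longrightarrow> F x = F' x" "w \<in> space W" "\<omega> \<in> space W"
 shows "qop i \<omega> d l F w = qop i \<omega> d l F' w" using assms line_mem[OF assms(2,3)] by (simp add: qop_def)

text \<open>Coefficients of a product are convolutions, so \<open>qop\<close> of degree d at f f' is
  a sum over a of products of \<open>qop\<close> of degree a at f and of degree d - a at f'. The
  forms are distributed accordingly: the first a go with f, the others with f'.\<close>

lemma qclosed_alg:
 assumes S: "qclosed S" and pfS: "\<And>f. f \<in> S \<Longrightarrow> pf W f"
 shows "qclosed (alg (space W) S)"
proof -
 let ?A = "alg (space W) S"
 have pfA: "pf W F" if "F \<in> ?A" for F by (rule alg_pf[OF pfS that])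
 have iso_cl: "(\<lambda>w. F (\<gamma> w)) \<in> ?A" if g: "gmod_iso G W W \<gamma>" and F: "F \<in> ?A" for \<gamma> F
  using F
 proof (induction rule: alg.induct)
  case (incl f) then show ?case by (intro alg.incl qclosed_iso[OF S g])
 next
  case (cong f f')
  have "\<gamma> x \<in> space W" if "x \<in> space W" for x using g that by (auto simp: gmod_iso_alt ghom_def lin_def)
  then show ?case using cong by (intro alg.cong[OF cong(3)]) simp
 qed (simp_all add: alg.const alg.add alg.mult)
 have qop_cl: "qop i \<omega> d l F \<in> ?A" if q: "qpar i \<omega> d l" and F: "F \<in> ?A" for i \<omega> d l F
  using F q
 proof (induction arbitrary: d l rule: alg.induct)
  case (const c)
  show ?case
  proof (cases "d = 0")
   case True
   then show ?thesis by (simp add: qop_def cf_const[OF infinite_alg_closed] alg.const)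
  next
   case False
   then show ?thesis by (simp add: qop_def cf_const[OF infinite_alg_closed] alg.const)
  qed
 next
  case (incl f) then show ?case by (intro alg.incl qclosed_qop[OF S])
 next
  case (add f f')
  have om: "\<omega> \<in> space W" using add.prems by (simp add: qpar_def)
  show ?case
  proof (rule alg.cong[OF alg.add[OF add.IH(1)[OF add.prems] add.IH(2)[OF add.prems]]])
   fix w assume w: "w \<in> space W"
   show "qop i \<omega> d l f w + qop i \<omega> d l f' w = qop i \<omega> d l (\<lambda>x. f x + f' x) w"
    unfolding qop_def
     cf_add[OF infinite_alg_closed line_poly[OF pfA[OF add.hyps(1)] w om] line_poly[OF pfA[OF add.hyps(2)] w om]] by (rule distrib_right[symmetric])
  qed
 next
  case (mult f f')
  have om: "\<omega> \<in> space W" using mult.prems by (simp add: qpar_def)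
  have p1: "qpar i \<omega> a l" if "a \<le> d" for a using mult.prems that by (simp add: qpar_def)
  have p2: "qpar i \<omega> (d - a) (\<lambda>s. l (a + s))" if "a \<le> d" for a using mult.prems that by (simp add: qpar_def)
  have "(\<lambda>w. \<Sum>a\<le>d. qop i \<omega> a l f w * qop i \<omega> (d - a) (\<lambda>s. l (a + s)) f' w) \<in> ?A"
   by (intro fsub_sum[OF fsub_alg] alg.mult mult.IH p1 p2) simp_all
  then show ?case
  proof (rule alg.cong)
   fix w assume w: "w \<in> space W"
   have pl: "(\<Prod>s<d. l s w) = (\<Prod>s<a. l s w) * (\<Prod>s<d - a. l (a + s) w)" if "a \<le> d" for a
    using prod_lessThan_plus[of "\<lambda>s. l s w" a "d - a"] that by simp
   have "qop i \<omega> d l (\<lambda>x. f x * f' x) w = (\<Sum>a\<le>d. cf a (\<lambda>t. f (shift i \<omega> w t)) * cf (d - a) (\<lambda>t. f' (shift i \<omega> w t))) * (\<Prod>s<d. l s w)"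
    unfolding qop_def
     cf_mult[OF infinite_alg_closed line_poly[OF pfA[OF mult.hyps(1)] w om] line_poly[OF pfA[OF mult.hyps(2)] w om]] ..
   also have "\<dots> = (\<Sum>a\<le>d. qop i \<omega> a l f w * qop i \<omega> (d - a) (\<lambda>s. l (a + s)) f' w)"
    unfolding sum_distrib_right
   proof (rule sum.cong[OF refl])
    fix a assume "a \<in> {..d}"
    then have "a \<le> d" by simp
    show "cf a (\<lambda>t. f (shift i \<omega> w t)) * cf (d - a) (\<lambda>t. f' (shift i \<omega> w t)) * (\<Prod>s<d. l s w) =
     qop i \<omega> a l f w * qop i \<omega> (d - a) (\<lambda>s. l (a + s)) f' w"
     unfolding qop_def pl[OF \<open>a \<le> d\<close>] by (simp only: ac_simps)
   qed
   finally show "(\<Sum>a\<le>d. qop i \<omega> a l f w * qop i \<omega> (d - a) (\<lambda>s. l (a + s)) f' w) = qop i \<omega> d l (\<lambda>x. f x * f' x) w" by simp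
  qed
 next
  case (cong f f')
  have om: "\<omega> \<in> space W" using cong.prems by (simp add: qpar_def)
  show ?case by (rule alg.cong[OF cong.IH[OF cong.prems]]) (rule qop_cong[OF cong.hyps(2) _ om])
 qed
 show ?thesis
  unfolding qclosed_def
 proof (intro conjI allI impI)
  fix F F' assume F: "F \<in> ?A" and e: "\<forall>x\<in>space W. F x = F' x"
  show "F' \<in> ?A" by (rule alg.cong[OF F]) (use e in simp)
 next
  fix \<gamma> F assume "gmod_iso G W W \<gamma>" "F \<in> ?A"
  then show "(\<lambda>w. F (\<gamma> w)) \<in> ?A" by (rule iso_cl)
 next
  fix i \<omega> d l F assume "qpar i \<omega> d l" "F \<in> ?A"
  then show "qop i \<omega> d l F \<in> ?A" by (rule qop_cl)
 qed
qed

text \<open>The i-th isotypic component is a sum of copies of one one-dimensional module, so g acts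
  on it by a scalar, which is nonzero since g is invertible.\<close>

lemma one_dim_character:
 assumes i: "i < r" "gdim (Mi i) = 1" and g: "g \<in> carrier G"
 shows "\<exists>\<chi>. \<chi> \<noteq> 0 \<and> (\<forall>w\<in>space W. act W g (pr i w) = scal W \<chi> (pr i w))"
proof -
 interpret Mi: gm G "Mi i" by (rule gm_Mi[OF i(1)])
 obtain B where B: "finite B" "B \<subseteq> space (Mi i)" "Mi.vs.independent B" "Mi.vs.span B = space (Mi i)" "card B = gdim (Mi i)"
  by (rule Mi.fin_dim_basis[OF fd_Mi[OF i(1)]])
 have "card B = 1" using B(5) i(2) by simp
 then obtain b where Bb: "B = {b}" by (rule card_1_singletonE)
 have rep: "\<exists>c. v = scal W c b" if "v \<in> M i" for v
 proof -
  have "v \<in> vs.span {b}" using B(4) that by (simp add: Bb)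
  then show ?thesis by (auto simp: vs.span_singleton)
 qed
 have bM: "b \<in> M i" using B(2) by (simp add: Bb)
 have bW: "b \<in> space W" using bM M_sub[OF i(1)] by auto
 obtain \<chi> where chi: "act W g b = scal W \<chi> b" using rep[OF M_act[OF i(1) g bM]] by auto
 have "b \<noteq> 0" using B(3) by (auto simp: Bb)
 moreover have "act W (inv g) (act W g b) = b" using bW g by simp
 ultimately have chi0: "\<chi> \<noteq> 0" using chi bW g by auto
 have chiv: "act W g v = scal W \<chi> v" if v: "v \<in> M i" for v
 proof -
  obtain c where "v = scal W c b" using rep[OF v] by auto
  then show ?thesis using bW g chi by (simp add: mult.commute)
 qed
 have chip: "act W g (pr i w) = scal W \<chi> (pr i w)" if w: "w \<in> space W" for w
 proof -
  have "act W g (pr i w) = \<Phi> (\<lambda>a b. act W g ((if a = i then co w a else 0) b))"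
   unfolding pr_def by (rule Phi_act[OF pr_dom[OF w] g, symmetric])
  also have "(\<lambda>a b. act W g ((if a = i then co w a else 0) b)) = (\<lambda>a b. scal W \<chi> ((if a = i then co w a else 0) b))"
  proof (intro ext)
   fix a b
   show "act W g ((if a = i then co w a else 0) b) = scal W \<chi> ((if a = i then co w a else 0) b)"
    using chiv[of "co w i b"] co_in[OF w i(1), of b] co_out[OF w, of i b] g by (cases "b < m i"; cases "a = i") simp_all
  qed
  also have "\<Phi> \<dots> = scal W \<chi> (pr i w)"
   unfolding pr_def by (rule Phi_scal[OF pr_dom[OF w]])
  finally show ?thesis .
 qed
 show ?thesis by (intro exI[of _ \<chi>] conjI ballI chi0 chip)
qed

text \<open>Let \<chi> be the scalar by which g acts on the i-th component. The d forms contribute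
  \<chi>^d. The line of g w is the image under g of the line of w with t divided by \<chi>, which
  contributes \<chi>^-d.\<close>

lemma qop_act:
 assumes q: "qpar i \<omega> d l" and F: "pf W F" and g: "g \<in> carrier G" and w: "w \<in> space W"
 shows "qop i \<omega> d l F (act W g w) = qop i \<omega> d l (\<lambda>x. F (act W g x)) w"
proof -
 have i: "i < r" "gdim (Mi i) = 1" and om: "\<omega> \<in> space W" "pr i \<omega> = \<omega>"
  and l: "\<And>s. s < d \<Longrightarrow> linear_form W (l s)" "\<And>s w. s < d \<Longrightarrow> w \<in> space W \<Longrightarrow> l s (pr i w) = l s w"
  using q by (auto simp: qpar_def)
 obtain \<chi> where chi: "\<chi> \<noteq> 0" "\<And>w. w \<in> space W \<Longrightarrow> act W g (pr i w) = scal W \<chi> (pr i w)"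
  using one_dim_character[OF i g] by auto
 have pg: "pr i (act W g w) = act W g (pr i w)" using pr_ghom g w by (simp add: ghom_def)
 have og: "act W g \<omega> = scal W \<chi> \<omega>" using chi(2)[OF om(1)] om(2) by simp
 have lg: "l s (act W g w) = \<chi> * l s w" if "s < d" for s
 proof -
  have "l s (act W g w) = l s (pr i (act W g w))" using l(2)[OF that] w g by simp
  also have "\<dots> = l s (scal W \<chi> (pr i w))" unfolding pg chi(2)[OF w] ..
  also have "\<dots> = \<chi> * l s w" using l[OF that] w pr_mem[OF w] by (simp add: linear_form_def)
  finally show ?thesis .
 qed
 have line: "F (act W g w - pr i (act W g w) + scal W t \<omega>) = F (act W g (w - pr i w + scal W (inverse \<chi> * t) \<omega>))" for t
 proof -
  have e: "inverse \<chi> * t * \<chi> = t" using chi(1) by simp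
  show ?thesis using w g om pr_mem[OF w] by (simp add: pg og act_diff e)
 qed
 have Fg: "pf W (\<lambda>x. F (act W g x))" by (rule pf_comp[OF lin_act[OF g] F])
 have "cf d (\<lambda>t. F (act W g w - pr i (act W g w) + scal W t \<omega>)) =
   inverse \<chi> ^ d * cf d (\<lambda>t. F (act W g (shift i \<omega> w t)))"
  unfolding line by (rule cf_dilate[OF infinite_alg_closed line_poly[OF Fg w om(1)]])
 moreover have "(\<Prod>s<d. l s (act W g w)) = \<chi> ^ d * (\<Prod>s<d. l s w)" using lg by (simp add: prod.distrib)
 ultimately show ?thesis using chi(1) by (simp add: qop_def field_simps)
qed

lemma rey_qop:
 assumes q: "qpar i \<omega> d l" and F: "pf W F" and w: "w \<in> space W"
 shows "rey G W (qop i \<omega> d l F) w = qop i \<omega> d l (rey G W F) w"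
proof -
 have om: "\<omega> \<in> space W" using q by (simp add: qpar_def)
 have ex: "\<exists>P. \<forall>t. poly P t = F (act W g (shift i \<omega> w t))" if "g \<in> carrier G" for g
  by (rule line_poly[OF pf_comp[OF lin_act[OF that] F] w om])
 have ex': "\<exists>P. \<forall>t. poly P t = (\<Sum>g\<in>carrier G. F (act W g (shift i \<omega> w t)))"
  by (rule line_poly[OF pf_sum w om], rule pf_comp[OF lin_act F])
 have "rey G W (qop i \<omega> d l F) w = inverse (of_nat (card (carrier G))) *
   (\<Sum>g\<in>carrier G. cf d (\<lambda>t. F (act W g (shift i \<omega> w t)))) * (\<Prod>s<d. l s w)"
  unfolding rey_def using qop_act[OF q F _ w] by (simp add: qop_def sum_distrib_right mult.assoc)
 also have "\<dots> = qop i \<omega> d l (rey G W F) w"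
  unfolding qop_def rey_def by (simp add: cf_cmult[OF infinite_alg_closed ex'] cf_sum[OF infinite_alg_closed ex])
 finally show ?thesis .
qed

text \<open>Induction on F shows that coefficients along the line are polynomial in w: a linear form
  k has only the coefficients k(w - pr i w) and k(\<omega>), and products are handled by
  convolution.\<close>

lemma qop_pf:
 assumes q: "qpar i \<omega> d l" and F: "pf W F" shows "pf W (qop i \<omega> d l F)"
proof -
 have om: "\<omega> \<in> space W" "\<And>s. s < d \<Longrightarrow> linear_form W (l s)" using q by (auto simp: qpar_def)
 have lt: "lin W W (\<lambda>w. w - pr i w)" by (auto simp: lin_def pr_mem pr_add pr_scal vs.scale_right_diff_distrib)
 have "pf W (\<lambda>w. cf d (\<lambda>t. F (shift i \<omega> w t)))" for d
  using F
 proof (induction arbitrary: d rule: pf_induct)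
  case (cong f f')
  have "pf W (\<lambda>w. cf d (\<lambda>t. f (shift i \<omega> w t))) = pf W (\<lambda>w. cf d (\<lambda>t. f' (shift i \<omega> w t)))"
   by (rule pf_cong) (use cong(1) line_mem om(1) in simp)
  then show ?case using cong(2) by simp
 next
  case (const c) show ?case by (simp add: cf_const[OF infinite_alg_closed] pf_const)
 next
  case (form k)
  have k0: "k (x + scal W t \<omega>) = k x + t * k \<omega>" if "x \<in> space W" for x t using form om(1) that by (simp add: linear_form_def)
  have "cf d (\<lambda>t. k (shift i \<omega> w t)) = (if d = 0 then k (w - pr i w) else if d = 1 then k \<omega> else 0)"
   if w: "w \<in> space W" for w by (subst cf_eq[OF infinite_alg_closed, of "[:k (w - pr i w), k \<omega>:]"])
    (use w in \<open>auto simp: k0 pr_mem coeff_pCons split: nat.split\<close>)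
  then have "pf W (\<lambda>w. cf d (\<lambda>t. k (shift i \<omega> w t))) = pf W (\<lambda>w. if d = 0 then k (w - pr i w) else if d = 1 then k \<omega> else 0)"
   by (rule pf_cong)
  moreover have "pf W (\<lambda>w. k (w - pr i w))" by (rule pf_form[OF linear_form_comp[OF lt form]])
  ultimately show ?case by (cases "d = 0"; cases "d = 1") (simp_all add: pf_const)
 next
  case (add f f')
  have "pf W (\<lambda>w. cf d (\<lambda>t. f (shift i \<omega> w t) + f' (shift i \<omega> w t))) =
   pf W (\<lambda>w. cf d (\<lambda>t. f (shift i \<omega> w t)) + cf d (\<lambda>t. f' (shift i \<omega> w t)))"
   by (rule pf_cong, rule cf_add[OF infinite_alg_closed line_poly line_poly]) (use add(1,2) om(1) in auto)
  then show ?case using pf_add[OF add(3,4)] by simp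
 next
  case (mult f f')
  have "pf W (\<lambda>w. cf d (\<lambda>t. f (shift i \<omega> w t) * f' (shift i \<omega> w t))) =
   pf W (\<lambda>w. \<Sum>a\<le>d. cf a (\<lambda>t. f (shift i \<omega> w t)) * cf (d - a) (\<lambda>t. f' (shift i \<omega> w t)))"
   by (rule pf_cong, rule cf_mult[OF infinite_alg_closed line_poly line_poly]) (use mult(1,2) om(1) in auto)
  also have "\<dots>" by (intro pf_sum pf_mult mult(3,4))
  finally show ?case .
 qed
 moreover have "pf W (\<lambda>w. \<Prod>s<d. l s w)" using om(2) by (intro pf_prod pf_form) auto
 ultimately show ?thesis unfolding qop_def by (rule pf_mult)
qed

end

section \<open>Invariants of V as restrictions from the sum\<close>

context regsum begin

lemma fst_ghom: "ghom G W U fst" and zero_ghom: "ghom G V W (\<lambda>v. (0, v))"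
proof -
 show "ghom G W U fst" by (simp add: ghom_def lin_def space_W fst_scal fst_act)
 have "act W g (0, v) = (0, act V g v)" if "g \<in> carrier G" "v \<in> space V" for g v using that act_gsum[of 0 U v V g] by simp
 then show "ghom G V W (\<lambda>v. (0, v))" by (simp add: ghom_def lin_def space_W)
qed

text \<open>L consists of the functions whose average lies in the algebra generated by S. Averaging
  commutes with automorphisms, with \<open>qop\<close> and with the pullback from R, and it maps
  k[R] to invariants, which \<open>ext\<close> covers; so L is \<open>good\<close>. A function in L
  restricting to f can then be averaged, which leaves its restriction, the invariant f,
  unchanged.\<close>

lemma invariants_in_Res:
 assumes S: "qclosed S" and pfS: "\<And>F. F \<in> S \<Longrightarrow> pf W F"
  and ext: "\<And>f. pf U f \<Longrightarrow> invf G U f \<Longrightarrow> (\<lambda>w. f (fst w)) \<in> alg (space W) S"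
  and p: "0 < p" "\<And>j. 1 \<le> j \<Longrightarrow> j < p \<Longrightarrow> of_nat j \<noteq> (0::'k)"
  and cond: "\<And>i. i < r \<Longrightarrow> gdim (Mi i) = 1 \<or> d \<le> gdim (Mi i) * (p - 1)"
  and f: "hp V d f" "invf G V f"
 shows "f \<in> Res (alg (space W) S)"
proof -
 let ?A = "alg (space W) S"
 have qA: "qclosed ?A" by (rule qclosed_alg[OF S pfS])
 define L where "L = {F. pf W F \<and> rey G W F \<in> ?A}"
 have "good L"
  unfolding good_def
 proof (intro conjI allI impI)
  show "fsub L"
   unfolding fsub_def
  proof (intro conjI ballI allI)
   show "(\<lambda>_. 0) \<in> L" using alg.const[of 0] by (simp add: L_def pf_const rey_def)
   fix F assume F: "F \<in> L"
   have "rey G W (\<lambda>x. c * F x) = (\<lambda>x. c * rey G W F x)" for c by (rule HOL.ext) (rule rey_cmult)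
   then show "(\<lambda>x. c * F x) \<in> L" for c using F by (simp add: L_def pf_cmult alg_cmult)
   fix F' assume F': "F' \<in> L"
   have "rey G W (\<lambda>x. F x + F' x) = (\<lambda>x. rey G W F x + rey G W F' x)" by (rule HOL.ext) (rule rey_add)
   then show "(\<lambda>x. F x + F' x) \<in> L" using F F' by (simp add: L_def pf_add alg.add)
  qed
  show "qclosed L"
   unfolding qclosed_def
  proof (intro conjI allI impI)
   fix F F' assume F: "F \<in> L" and e: "\<forall>x\<in>space W. F x = F' x"
   have "pf W F'" using F pf_cong[of W F F'] e by (simp add: L_def)
   moreover have "rey G W F' \<in> ?A"
   proof (rule qclosed_cong[OF qA, of "rey G W F"])
    show "rey G W F \<in> ?A" using F by (simp add: L_def)
    show "rey G W F x = rey G W F' x" if "x \<in> space W" for x by (rule rey_cong[OF _ that]) (use e in simp)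
   qed
   ultimately show "F' \<in> L" by (simp add: L_def)
  next
   fix \<gamma> F assume g: "gmod_iso G W W \<gamma>" and F: "F \<in> L"
   have gh: "ghom G W W \<gamma>" using g by (simp add: gmod_iso_alt)
   then have "pf W (\<lambda>w. F (\<gamma> w))" using F pf_comp[of W W \<gamma> F] by (simp add: L_def ghom_def)
   moreover have "rey G W (\<lambda>w. F (\<gamma> w)) \<in> ?A"
   proof (rule qclosed_cong[OF qA qclosed_iso[OF qA g, of "rey G W F"]])
    show "rey G W F \<in> ?A" using F by (simp add: L_def)
    show "rey G W F (\<gamma> x) = rey G W (\<lambda>w. F (\<gamma> w)) x" if "x \<in> space W" for x by (rule rey_ghom[OF gh that, symmetric])
   qed
   ultimately show "(\<lambda>w. F (\<gamma> w)) \<in> L" by (simp add: L_def)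
  next
   fix i \<omega> d l F assume q: "qpar i \<omega> d l" and F: "F \<in> L"
   have "rey G W (qop i \<omega> d l F) \<in> ?A"
   proof (rule qclosed_cong[OF qA qclosed_qop[OF qA q, of "rey G W F"]])
    show "rey G W F \<in> ?A" using F by (simp add: L_def)
    show "qop i \<omega> d l (rey G W F) x = rey G W (qop i \<omega> d l F) x" if "x \<in> space W" for x
     by (rule rey_qop[OF q _ that, symmetric]) (use F in \<open>simp add: L_def\<close>)
   qed
   then show "qop i \<omega> d l F \<in> L" using F qop_pf[OF q] by (simp add: L_def)
  qed
  fix h assume h: "pf U h"
  have "rey G W (\<lambda>w. h (fst w)) \<in> ?A"
   by (rule qclosed_cong[OF qA ext[OF U.rey_pf[OF h] U.rey_inv]]) (rule rey_ghom[OF fst_ghom, symmetric])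
  moreover have "pf W (\<lambda>w. h (fst w))" using pf_comp[OF _ h, of W fst] fst_ghom by (simp add: ghom_def)
  ultimately show "(\<lambda>w. h (fst w)) \<in> L" by (simp add: L_def)
 qed
 then have "f \<in> Res L" by (rule homogeneous_in_Res[OF _ p cond f(1)])
 then obtain F where F: "F \<in> L" "\<forall>v\<in>space V. F (0, v) = f v"
  unfolding Res_def mem_Collect_eq by (elim bexE)
 show ?thesis
 proof (rule ResI)
  show "rey G W F \<in> ?A" using F(1) by (simp add: L_def)
  fix v assume v: "v \<in> space V"
  have "rey G W F (0, v) = rey G V (\<lambda>v. F (0, v)) v" by (rule V.rey_ghom[OF zero_ghom v, symmetric])
  also have "\<dots> = rey G V f v" by (rule V.rey_cong) (use F(2) v in auto)
  also have "\<dots> = f v" by (rule V.rey_of_inv[OF card_G f(2) v])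
  finally show "rey G W F (0, v) = f v" .
 qed
qed

end

section \<open>Generalized polarization\<close>

context isod begin

abbreviation "E i \<equiv> gpow (Mi i) (m i)"

lemma gmE: "i < r \<Longrightarrow> gm G (E i)" by (rule gpow_gmod[OF sub])

lemma space_E: "y \<in> space (E i) \<longleftrightarrow> (\<forall>j. if j < m i then y j \<in> M i else y j = 0)"
 by (simp add: dsum_def dsum_space_def)

lemma scal_E: "scal (E i) c y = (\<lambda>j. scal W c (y j))" by (simp add: dsum_def)

lemma space_EI: "(\<And>j. j < m i \<Longrightarrow> y j \<in> M i) \<Longrightarrow> (\<And>j. \<not> j < m i \<Longrightarrow> y j = 0) \<Longrightarrow> y \<in> space (E i)"
 unfolding space_E by simp
lemma E_mem: "y \<in> space (E i) \<Longrightarrow> j < m i \<Longrightarrow> y j \<in> M i"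
 unfolding space_E by (drule spec[of _ j]) simp
lemma E_out: "y \<in> space (E i) \<Longrightarrow> \<not> j < m i \<Longrightarrow> y j = 0"
 unfolding space_E by (drule spec[of _ j]) simp

lemma co_E: "w \<in> space W \<Longrightarrow> i < r \<Longrightarrow> co w i \<in> space (E i)" by (rule space_EI) (auto simp: co_in co_out)

lemma lin_co: "i < r \<Longrightarrow> lin W (E i) (\<lambda>w. co w i)" by (simp add: lin_def co_E co_add co_scal scal_E)

definition repl :: "nat \<Rightarrow> 'w \<Rightarrow> (nat \<Rightarrow> 'w) \<Rightarrow> 'w" where
 "repl i w y = \<Phi> ((co w)(i := y))"

lemma repl_dom: "w \<in> space W \<Longrightarrow> i < r \<Longrightarrow> y \<in> space (E i) \<Longrightarrow> (co w)(i := y) \<in> space D"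
 by (rule DI) (auto simp: co_in co_out E_mem E_out)

lemma repl_mem: "w \<in> space W \<Longrightarrow> i < r \<Longrightarrow> y \<in> space (E i) \<Longrightarrow> repl i w y \<in> space W"
 unfolding repl_def by (rule Phi_mem[OF repl_dom])

lemma co_repl: "w \<in> space W \<Longrightarrow> i < r \<Longrightarrow> y \<in> space (E i) \<Longrightarrow> co (repl i w y) = (co w)(i := y)"
 unfolding repl_def by (rule co_Phi[OF repl_dom])

lemma W_eqI: "x \<in> space W \<Longrightarrow> y \<in> space W \<Longrightarrow> co x = co y \<Longrightarrow> x = y" using Phi_co by metis

definition emb :: "nat \<Rightarrow> (nat \<Rightarrow> 'w) \<Rightarrow> 'w" where
 "emb i y = \<Phi> (\<lambda>a. if a = i then y else 0)"

lemma emb_dom: "i < r \<Longrightarrow> y \<in> space (E i) \<Longrightarrow> (\<lambda>a. if a = i then y else 0) \<in> space D"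
 by (rule DI) (auto simp: E_mem E_out M_0)

lemma lin_emb: "i < r \<Longrightarrow> lin (E i) W (emb i)"
proof -
 assume i: "i < r"
 have "(\<lambda>a. if a = i then x + y else 0) = (\<lambda>a. if a = i then x else 0) + (\<lambda>a. if a = i then y else 0)"
  for x y :: "nat \<Rightarrow> 'w" by (auto simp: fun_eq_iff)
 then have "emb i (x + y) = emb i x + emb i y" if "x \<in> space (E i)" "y \<in> space (E i)" for x y
  unfolding emb_def using Phi_add[OF emb_dom[OF i that(1)] emb_dom[OF i that(2)]] by (simp only:)
 moreover have "(\<lambda>a. if a = i then (\<lambda>j. scal W c (x j)) else 0) = (\<lambda>a b. scal W c ((if a = i then x else 0) b))"
  for x :: "nat \<Rightarrow> 'w" and c by (auto simp: fun_eq_iff)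
 then have "emb i (\<lambda>j. scal W c (x j)) = scal W c (emb i x)" if "x \<in> space (E i)" for x c
  unfolding emb_def using Phi_scal[OF emb_dom[OF i that], of c] by (simp only:)
 moreover have "emb i x \<in> space W" if "x \<in> space (E i)" for x
  unfolding emb_def by (rule Phi_mem[OF emb_dom[OF i that]])
 ultimately show ?thesis by (simp add: lin_def scal_E)
qed

lemma pr_emb: "pr i w = emb i (co w i)"
proof -
 have "(\<lambda>a. if a = i then co w a else 0) = (\<lambda>a. if a = i then co w i else 0)" by auto
 then show ?thesis unfolding pr_def emb_def by (rule arg_cong)
qed

lemma pr_sum: assumes w: "w \<in> space W" shows "w = (\<Sum>i<r. pr i w)" using W_expand[OF w] by (simp add: pr_eq_sum[OF w])

text \<open>Finite sums of pure tensors in k[W], the tensor product of the k[E l], up to values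
  outside \<open>space W\<close>.\<close>

inductive tens :: "('w \<Rightarrow> 'k) \<Rightarrow> bool" where
 pure: "(\<And>l. l < r \<Longrightarrow> pf (E l) (f l)) \<Longrightarrow> tens (\<lambda>w. c * (\<Prod>l<r. f l (co w l)))"
| add: "tens F \<Longrightarrow> tens F' \<Longrightarrow> tens (\<lambda>w. F w + F' w)"
| congr: "tens F \<Longrightarrow> (\<And>w. w \<in> space W \<Longrightarrow> F w = F' w) \<Longrightarrow> tens F'"

lemma tens_zero: "tens (\<lambda>_. 0)"
proof -
 have "tens (\<lambda>w. 0 * (\<Prod>l<r. (\<lambda>_ _. 0) l (co w l)))" by (rule tens.pure) (rule pf_const)
 then show ?thesis by simp
qed

lemma tens_sum: "(\<And>i. i \<in> I \<Longrightarrow> tens (F i)) \<Longrightarrow> tens (\<lambda>w. \<Sum>i\<in>I. F i w)"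
proof (induction I rule: infinite_finite_induct)
 case (insert i I)
 have "tens (\<lambda>w. F i w + (\<Sum>i\<in>I. F i w))" by (rule tens.add) (use insert in auto)
 with insert.hyps show ?case by simp
qed (simp_all add: tens_zero)

lemma tens_mult:
 assumes "tens F" "tens F'" shows "tens (\<lambda>w. F w * F' w)"
 using assms(1)
proof (induction rule: tens.induct)
 case (pure f c)
 show ?case
  using assms(2)
 proof (induction rule: tens.induct)
  case (pure f' c')
  have "tens (\<lambda>w. (c * c') * (\<Prod>l<r. f l (co w l) * f' l (co w l)))"
   by (rule tens.pure) (intro pf_mult \<open>\<And>l. l < r \<Longrightarrow> pf (E l) (f l)\<close> pure)
  then show ?case by (rule tens.congr) (simp add: prod.distrib)
 next
  case (add F F') from tens.add[OF add.IH] show ?case by (rule tens.congr) (simp add: distrib_left)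
 next
  case (congr F F') show ?case by (rule tens.congr[OF congr.IH]) (simp add: congr.hyps)
 qed
next
 case (add F F'') from tens.add[OF add.IH] show ?case by (rule tens.congr) (simp add: distrib_right)
next
 case (congr F F'') show ?case by (rule tens.congr[OF congr.IH]) (simp add: congr.hyps)
qed

text \<open>A linear form is the sum of its parts on the isotypic components, each a pure tensor
  with a single factor other than 1; and products of pure tensors are pure.\<close>

lemma pf_tens: "pf W F \<Longrightarrow> tens F"
proof (induction rule: pf_induct)
 case (cong f g) show ?case by (rule tens.congr[OF cong(2)]) (rule cong(1))
next
 case (const c)
 have "tens (\<lambda>w. c * (\<Prod>l<r. (\<lambda>_ _. 1) l (co w l)))" by (rule tens.pure) (rule pf_const)
 then show ?case by simp
next
 case (form k)
 have "tens (\<lambda>w. \<Sum>i<r. k (pr i w))"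
 proof (rule tens_sum)
  fix i assume "i \<in> {..<r}" then have i: "i < r" by simp
  define f where "f = (\<lambda>l. if l = i then (\<lambda>y. k (emb i y)) else (\<lambda>_. 1))"
  have "tens (\<lambda>w. 1 * (\<Prod>l<r. f l (co w l)))"
   by (rule tens.pure) (auto simp: f_def pf_const intro!: pf_form linear_form_comp[OF lin_emb form])
  then show "tens (\<lambda>w. k (pr i w))"
  proof (rule tens.congr)
   fix w
   have "(\<Prod>l<r. f l (co w l)) = (\<Prod>l<r. if l = i then k (pr i w) else 1)" by (intro prod.cong refl) (simp add: f_def pr_emb)
   then show "1 * (\<Prod>l<r. f l (co w l)) = k (pr i w)" using i by simp
  qed
 qed
 then show ?case
 proof (rule tens.congr)
  fix w assume w: "w \<in> space W"
  have "k (\<Sum>i<r. pr i w) = (\<Sum>i<r. k (pr i w))" by (rule linear_form_sum[OF form]) (simp add: pr_mem w)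
  then show "(\<Sum>i<r. k (pr i w)) = k w" using pr_sum[OF w] by simp
 qed
next
 case (add f g) then show ?case by (intro tens.add)
next
 case (mult f g) then show ?case by (intro tens_mult)
qed

section \<open>Operators on k[W] and their equivariance\<close>

abbreviation "PA \<equiv> pol_algebra W r M m \<Phi>"

lemma poly_endD:
 assumes "T \<in> poly_end N"
 shows "p \<in> polyfun N \<Longrightarrow> T p \<in> polyfun N"
  and "p \<in> polyfun N \<Longrightarrow> q \<in> polyfun N \<Longrightarrow> T (\<lambda>x\<in>space N. p x + q x) = (\<lambda>x\<in>space N. T p x + T q x)"
  and "p \<in> polyfun N \<Longrightarrow> T (\<lambda>x\<in>space N. c * p x) = (\<lambda>x\<in>space N. c * T p x)"
 using assms by (auto simp: poly_end_def polyring_def)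

lemma poly_endI:
 assumes "\<And>p. p \<in> polyfun N \<Longrightarrow> T p \<in> polyfun N" "\<And>p. p \<notin> polyfun N \<Longrightarrow> T p = undefined"
  and "\<And>p q. p \<in> polyfun N \<Longrightarrow> q \<in> polyfun N \<Longrightarrow> T (\<lambda>x\<in>space N. p x + q x) = (\<lambda>x\<in>space N. T p x + T q x)"
  and "\<And>c p. p \<in> polyfun N \<Longrightarrow> T (\<lambda>x\<in>space N. c * p x) = (\<lambda>x\<in>space N. c * T p x)"
 shows "T \<in> poly_end N"
 unfolding poly_end_def polyring_def using assms by (auto simp: PiE_def extensional_def)

lemma restrict_polyfun: "pf N f \<Longrightarrow> restrict f (space N) \<in> polyfun N" by (simp add: pf_def)

definition gp :: "'g \<Rightarrow> ('w \<Rightarrow> 'k) \<Rightarrow> 'w \<Rightarrow> 'k" where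
 "gp g p = (\<lambda>x\<in>space W. p (act W g x))"

lemma gp_polyfun: "g \<in> carrier G \<Longrightarrow> p \<in> polyfun W \<Longrightarrow> gp g p \<in> polyfun W"
 unfolding gp_def by (intro restrict_polyfun pf_comp[OF lin_act] pf_polyfun)

lemma act_E:
 assumes "g \<in> carrier G" "i < r" "y \<in> space (E i)" shows "act (E i) g y = (\<lambda>j. act W g (y j))"
proof -
 have y: "y \<in> dsum_space (m i) (\<lambda>_. Mi i)" using assms(3) by (simp add: dsum_def)
 show ?thesis using y E_mem[OF assms(3)] E_out[OF assms(3)] assms(1) by (auto simp: dsum_def fun_eq_iff)
qed

lemma lin_actE: "g \<in> carrier G \<Longrightarrow> i < r \<Longrightarrow> lin (E i) (E i) (\<lambda>y j. act W g (y j))"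
proof -
 assume g: "g \<in> carrier G" and i: "i < r"
 interpret Ei: gm G "E i" by (rule gmE[OF i])
 have "lin (E i) (E i) (act (E i) g)" by (rule Ei.lin_act[OF g])
 then show ?thesis using act_E[OF g i] Ei.add_mem Ei.scal_mem by (simp add: lin_def)
qed

text \<open>G acts on M_i \<otimes> k^m through the first factor. It commutes with matrices acting
  on the second; and operators in the larger algebra of a one-dimensional type commute with GL(M_i),
  through which G acts.\<close>

lemma factor_equivariant:
 assumes T: "T \<in> factor_ops (Mi i) (m i)" and i: "i < r" and g: "g \<in> carrier G" and p: "p \<in> polyfun (E i)"
  and y: "y \<in> space (E i)"
 shows "T (\<lambda>x\<in>space (E i). p (\<lambda>j. act W g (x j))) y = T p (\<lambda>j. act W g (y j))"
proof -
 interpret Ei: gm G "E i" by (rule gmE[OF i])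
 let ?g = "\<lambda>x j. act W g (x j)"
 have gy: "?g y \<in> space (E i)" using lin_actE[OF g i] y by (simp add: lin_def)
 have gpf: "(\<lambda>x\<in>space (E i). p (?g x)) \<in> polyfun (E i)" by (intro restrict_polyfun pf_comp[OF lin_actE[OF g i]] pf_polyfun p)
 show ?thesis
 proof (cases "gdim (Mi i) > 1")
  case True
  then obtain a where a: "T = pullback_op (E i) (mat_act (Mi i) (m i) a)" using T unfolding factor_ops_def by auto
  have yj: "y j \<in> space W" for j using E_mem[OF y, of j] E_out[OF y, of j] M_sub[OF i] by (cases "j < m i") auto
  have am: "mat_act (Mi i) (m i) a (?g y) = ?g (mat_act (Mi i) (m i) a y)" using g yj by (auto simp: mat_act_def fun_eq_iff act_sum)
  have my: "mat_act (Mi i) (m i) a y \<in> space (E i)"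
   by (rule space_EI) (use E_mem[OF y] M_subsp[OF i] in \<open>auto simp: mat_act_def intro!: vs.subspace_sum vs.subspace_scale\<close>)
  show ?thesis unfolding a pullback_op_def using gpf p y gy my am by simp
 next
  case False
  let ?h = "act W g"
  have h: "?h \<in> GL_space (Mi i)"
  proof -
   interpret Mi: gm G "Mi i" by (rule gm_Mi[OF i])
   have "bij_betw (act (Mi i) g) (M i) (M i)" using Mi.ac.bij_prop0[OF g] by (simp add: Bij_def)
   moreover have "bij_betw (act (Mi i) g) (M i) (M i) \<longleftrightarrow> bij_betw ?h (M i) (M i)" by (rule bij_betw_cong) simp
   ultimately show ?thesis using g M_sub[OF i] by (auto simp: GL_space_def subset_iff)
  qed
  have T': "T \<in> poly_end (E i)" "T (pullback_op (E i) (diag_act (m i) ?h) p) = pullback_op (E i) (diag_act (m i) ?h) (T p)"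
   using T False h p unfolding factor_ops_def by auto
  have d: "diag_act (m i) ?h x = ?g x" if "x \<in> space (E i)" for x using E_out[OF that] g by (auto simp: diag_act_def fun_eq_iff)
  have "pullback_op (E i) (diag_act (m i) ?h) p = (\<lambda>x\<in>space (E i). p (?g x))"
   unfolding pullback_op_def using p d by (auto intro!: restrict_ext)
  moreover have "pullback_op (E i) (diag_act (m i) ?h) (T p) y = T p (?g y)"
   unfolding pullback_op_def using poly_endD(1)[OF T'(1) p] d y by simp
  ultimately show ?thesis using T'(2) by simp
 qed
qed

lemma pullback_poly_end: "lin N N t \<Longrightarrow> pullback_op N t \<in> poly_end N"
proof (rule poly_endI)
 assume t: "lin N N t"
 then have tm: "\<And>x. x \<in> space N \<Longrightarrow> t x \<in> space N" by (simp add: lin_def)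
 show "pullback_op N t p \<in> polyfun N" if "p \<in> polyfun N" for p
  unfolding pullback_op_def restrict_apply'[OF that] by (intro restrict_polyfun pf_comp[OF t] pf_polyfun that)
 show "pullback_op N t p = undefined" if "p \<notin> polyfun N" for p using that by (simp add: pullback_op_def)
 show "pullback_op N t (\<lambda>x\<in>space N. p x + q x) = (\<lambda>x\<in>space N. pullback_op N t p x + pullback_op N t q x)"
  if pq: "p \<in> polyfun N" "q \<in> polyfun N" for p q
  unfolding pullback_op_def restrict_apply'[OF pq(1)] restrict_apply'[OF pq(2)] restrict_apply'[OF polyfun.add[OF pq]]
  by (rule restrict_ext) (simp only: restrict_apply' tm)
 show "pullback_op N t (\<lambda>x\<in>space N. c * p x) = (\<lambda>x\<in>space N. c * pullback_op N t p x)" if p: "p \<in> polyfun N" for c p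
  unfolding pullback_op_def restrict_apply'[OF p] restrict_apply'[OF restrict_polyfun[OF pf_cmult[OF pf_polyfun[OF p]]]]
  by (rule restrict_ext) (simp only: restrict_apply' tm)
qed

lemma poly_end_comp:
 assumes A: "A \<in> poly_end N" and B: "B \<in> poly_end N" shows "(\<lambda>p\<in>polyfun N. A (B p)) \<in> poly_end N"
proof (rule poly_endI)
 show "(\<lambda>p\<in>polyfun N. A (B p)) (\<lambda>x\<in>space N. c * p x) = (\<lambda>x\<in>space N. c * (\<lambda>p\<in>polyfun N. A (B p)) p x)" if p: "p \<in> polyfun N" for c p
  using restrict_polyfun[OF pf_cmult[OF pf_polyfun[OF p]], of c] poly_endD(3)[OF B p] poly_endD(3)[OF A poly_endD(1)[OF B p]] p by simp
qed (use poly_endD[OF A] poly_endD[OF B] in \<open>simp_all add: polyfun.add\<close>)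

text \<open>Pure tensors span k[W], so an endomorphism is determined by the values that
  \<open>acts_on_factor\<close> prescribes.\<close>

lemma poly_end_eqI:
 assumes A: "A \<in> poly_end W" and B: "B \<in> poly_end W"
  and AB: "\<And>f. (\<And>l. l < r \<Longrightarrow> f l \<in> polyfun (E l)) \<Longrightarrow> A (\<lambda>w\<in>space W. \<Prod>l<r. f l (co w l)) = B (\<lambda>w\<in>space W. \<Prod>l<r. f l (co w l))"
  and p: "p \<in> polyfun W"
 shows "A p = B p"
proof -
 have "pf W F \<and> A (restrict F (space W)) = B (restrict F (space W))" if "tens F" for F
  using that
 proof (induction rule: tens.induct)
  case (pure f c)
  define f' where "f' l = restrict (f l) (space (E l))" for l
  have f': "f' l \<in> polyfun (E l)" if "l < r" for l unfolding f'_def by (rule restrict_polyfun[OF pure[OF that]])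
  let ?P = "\<lambda>w\<in>space W. \<Prod>l<r. f' l (co w l)"
  have P: "?P \<in> polyfun W" by (intro restrict_polyfun pf_prod pf_comp[OF lin_co] pf_polyfun f') simp_all
  have e: "restrict (\<lambda>w. c * (\<Prod>l<r. f l (co w l))) (space W) = (\<lambda>w\<in>space W. c * ?P w)"
   by (rule restrict_ext) (simp add: f'_def co_E)
  have "pf W (\<lambda>w. c * (\<Prod>l<r. f l (co w l)))" by (rule pf_cmult, rule pf_prod, rule pf_comp[OF lin_co pure]) auto
  moreover have "A ?P = B ?P" by (rule AB) (rule f')
  ultimately show ?case unfolding e poly_endD(3)[OF A P] poly_endD(3)[OF B P] by simp
 next
  case (add F F')
  have P: "restrict F (space W) \<in> polyfun W" "restrict F' (space W) \<in> polyfun W" using add.IH by (auto intro: restrict_polyfun)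
  have e: "restrict (\<lambda>w. F w + F' w) (space W) = (\<lambda>w\<in>space W. restrict F (space W) w + restrict F' (space W) w)"
   by (rule restrict_ext) simp
  have "A (restrict F (space W)) = B (restrict F (space W))" "A (restrict F' (space W)) = B (restrict F' (space W))" using add.IH by blast+
  moreover have "pf W (\<lambda>w. F w + F' w)" using add.IH by (intro pf_add) blast+
  ultimately show ?case unfolding e poly_endD(2)[OF A P] poly_endD(2)[OF B P] by (simp only: simp_thms)
 next
  case (congr F F')
  have "restrict F' (space W) = restrict F (space W)" by (rule restrict_ext) (use congr.hyps(2) in simp)
  then show ?case using congr.IH pf_cong[of W F F'] congr.hyps(2) by simp
 qed
 from this[OF pf_tens[OF pf_polyfun[OF p]]] show ?thesis by (simp add: polyfun_restrict[OF p])
qed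

text \<open>Both sides are linear in p, so pure tensors suffice. On these, T affects only the i-th
  factor, where it is equivariant.\<close>

lemma acts_on_factor_equivariant:
 assumes i: "i < r" and T: "T \<in> factor_ops (Mi i) (m i)" and Q: "acts_on_factor W r M m \<Phi> i T Q"
  and g: "g \<in> carrier G" and p: "p \<in> polyfun W"
 shows "Q (gp g p) = gp g (Q p)"
proof -
 have QE: "Q \<in> poly_end W" and Qp: "\<And>f. (\<And>l. l < r \<Longrightarrow> f l \<in> polyfun (E l)) \<Longrightarrow>
   Q (\<lambda>w\<in>space W. \<Prod>l<r. f l (co w l)) = (\<lambda>w\<in>space W. \<Prod>l<r. (if l = i then T (f l) else f l) (co w l))"
  using Q by (auto simp: acts_on_factor_def)
 let ?g = "\<lambda>p\<in>polyfun W. gp g p"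
 have gE: "?g \<in> poly_end W" using pullback_poly_end[OF lin_act[OF g]] by (simp add: pullback_op_def gp_def)
 have "(\<lambda>p\<in>polyfun W. Q (?g p)) p = (\<lambda>p\<in>polyfun W. ?g (Q p)) p"
 proof (rule poly_end_eqI[OF poly_end_comp[OF QE gE] poly_end_comp[OF gE QE] _ p])
  fix f assume "\<And>l. l < r \<Longrightarrow> f l \<in> polyfun (E l)"
  note f = this
  let ?P = "\<lambda>f. \<lambda>w\<in>space W. \<Prod>l<r. f l (co w l)"
  have P: "?P f \<in> polyfun W" by (intro restrict_polyfun pf_prod pf_comp[OF lin_co] pf_polyfun f) simp_all
  define fg where "fg l = (\<lambda>x\<in>space (E l). f l (\<lambda>j. act W g (x j)))" for l
  have fg: "fg l \<in> polyfun (E l)" if "l < r" for l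
   unfolding fg_def by (intro restrict_polyfun pf_comp[OF lin_actE[OF g that]] pf_polyfun f that)
  have c: "co (act W g w) l = (\<lambda>j. act W g (co w l j))" if "w \<in> space W" for w l using co_act[OF that g] by simp
  have Qf: "Q (?P f) = ?P (\<lambda>l. if l = i then T (f l) else f l)" "Q (?P fg) = ?P (\<lambda>l. if l = i then T (fg l) else fg l)"
   by (rule Qp, rule f, assumption, rule Qp, rule fg)
  have "gp g (?P f) = ?P fg" unfolding gp_def by (rule restrict_ext) (simp add: c fg_def co_E g)
  moreover have "Q (?P fg) = gp g (Q (?P f))"
   unfolding Qf gp_def
  proof (rule restrict_ext)
   fix w assume w: "w \<in> space W"
   have "(if l = i then T (fg l) else fg l) (co w l) = (if l = i then T (f l) else f l) (co (act W g w) l)" if l: "l < r" for l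
    using factor_equivariant[OF T i g f[OF i] co_E[OF w i]] c[OF w] co_E[OF w l] by (cases "l = i") (simp_all add: fg_def)
   then show "(\<Prod>l<r. (if l = i then T (fg l) else fg l) (co w l)) =
     (\<lambda>w\<in>space W. \<Prod>l<r. (if l = i then T (f l) else f l) (co w l)) (act W g w)" using w g by simp
  qed
  ultimately show "(\<lambda>p\<in>polyfun W. Q (?g p)) (?P f) = (\<lambda>p\<in>polyfun W. ?g (Q p)) (?P f)" using P poly_endD(1)[OF QE P] by simp
 qed
 then show ?thesis using p poly_endD(1)[OF QE p] by simp
qed

text \<open>Equivariance passes from the generating operators to sums, multiples and composites; it
  is what makes polarizations of invariants invariant.\<close>

lemma PA_props:
 assumes "T \<in> PA" and p: "p \<in> polyfun W"
 shows "T p \<in> polyfun W \<and> (\<forall>g\<in>carrier G. T (gp g p) = gp g (T p))"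
 using assms unfolding pol_algebra_def
proof (induction arbitrary: p rule: op_algebra.induct)
 case ident then show ?case using gp_polyfun by simp
next
 case (base T)
 then obtain i T' where i: "i < r" "T' \<in> factor_ops (Mi i) (m i)" "acts_on_factor W r M m \<Phi> i T' T" by blast
 have "T \<in> poly_end W" using i(3) by (simp add: acts_on_factor_def)
 then show ?case using acts_on_factor_equivariant[OF i] base.prems poly_endD(1) by blast
next
 case (add T T')
 have "T p \<oplus>\<^bsub>polyring W\<^esub> T' p \<in> polyfun W" if "p \<in> polyfun W" for p
  using polyfun.add[of "T p" W "T' p"] add.IH[OF that] by (simp add: polyring_def)
 moreover have "T (gp g p) \<oplus>\<^bsub>polyring W\<^esub> T' (gp g p) = gp g (T p \<oplus>\<^bsub>polyring W\<^esub> T' p)" if g: "g \<in> carrier G" for g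
 proof -
  have a: "T (gp g p) = gp g (T p)" "T' (gp g p) = gp g (T' p)" using add.IH[OF add.prems] g by simp_all
  show ?thesis unfolding polyring_def ring.simps module.simps a by (simp add: gp_def g fun_eq_iff restrict_def)
 qed
 ultimately show ?case using add.prems gp_polyfun by simp
next
 case (smult T c)
 have "c \<odot>\<^bsub>polyring W\<^esub> T p \<in> polyfun W" if "p \<in> polyfun W" for p
  using restrict_polyfun[OF pf_cmult[OF pf_polyfun, of "T p" W c]] smult.IH[OF that] by (simp add: polyring_def)
 moreover have "c \<odot>\<^bsub>polyring W\<^esub> T (gp g p) = gp g (c \<odot>\<^bsub>polyring W\<^esub> T p)" if g: "g \<in> carrier G" for g
 proof -
  have a: "T (gp g p) = gp g (T p)" using smult.IH[OF smult.prems] g by simp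
  show ?thesis unfolding polyring_def ring.simps module.simps a by (simp add: gp_def g fun_eq_iff restrict_def)
 qed
 ultimately show ?case using smult.prems gp_polyfun by simp
next
 case (comp T T')
 then show ?case using gp_polyfun by simp
qed

text \<open>Dimension 0 is included because \<open>factor_ops\<close> only separates dimensions
  greater than 1 from the rest.\<close>

lemma one_dim_scalar:
 assumes i: "i < r" "gdim (Mi i) \<le> 1" and h: "h \<in> GL_space (Mi i)"
 shows "\<exists>c. \<forall>v\<in>M i. h v = scal W c v"
proof -
 interpret Mi: gm G "Mi i" by (rule gm_Mi[OF i(1)])
 obtain B where B: "finite B" "B \<subseteq> space (Mi i)" "Mi.vs.independent B" "Mi.vs.span B = space (Mi i)" "card B = gdim (Mi i)"
  by (rule Mi.fin_dim_basis[OF fd_Mi[OF i(1)]])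
 have hM: "h v \<in> M i" if "v \<in> M i" for v using h that by (auto simp: GL_space_def dest: bij_betwE)
 have hs: "h (scal W c v) = scal W c (h v)" if "v \<in> M i" for c v using h that by (simp add: GL_space_def)
 have "card B = 0 \<or> card B = 1" using B(5) i(2) by linarith
 then show ?thesis
 proof
  assume "card B = 0"
  then have "M i = {0}" using B(1,4) by simp
  then show ?thesis using hM by (intro exI[of _ 1]) auto
 next
  assume "card B = 1"
  then obtain b where Bb: "B = {b}" by (rule card_1_singletonE)
  have rep: "\<exists>c. v = scal W c b" if "v \<in> M i" for v
  proof -
   have "v \<in> vs.span {b}" using B(4) that by (simp add: Bb)
   then show ?thesis by (auto simp: vs.span_singleton)
  qed
  have bM: "b \<in> M i" using B(2) by (simp add: Bb)
  obtain c where c: "h b = scal W c b" using rep[OF hM[OF bM]] by auto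
  show ?thesis
  proof (intro exI[of _ c] ballI)
   fix v assume "v \<in> M i"
   from rep[OF this] obtain e where e: "v = scal W e b" by auto
   show "h v = scal W c v" unfolding e hs[OF bM] c by (simp add: mult.commute)
  qed
 qed
qed

section \<open>Module automorphisms as polarization operators\<close>

definition ma :: "(nat \<Rightarrow> nat \<Rightarrow> 'k) \<Rightarrow> nat \<Rightarrow> (nat \<Rightarrow> 'w) \<Rightarrow> nat \<Rightarrow> 'w" where
 "ma A n y = (\<lambda>j. if j < n then \<Sum>l<n. scal W (A j l) (y l) else 0)"

lemma mat_act_ma: "mat_act (Mi i) n (mat n n (\<lambda>(j, l). A j l)) y = ma A n y" by (auto simp: mat_act_def ma_def fun_eq_iff intro!: sum.cong)

lemma lin_ma: "i < r \<Longrightarrow> lin (E i) (E i) (ma A (m i))"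
proof -
 assume i: "i < r"
 have "ma A (m i) y \<in> space (E i)" if "y \<in> space (E i)" for y
  by (rule space_EI) (use E_mem[OF that] M_subsp[OF i] in \<open>auto simp: ma_def intro!: vs.subspace_sum vs.subspace_scale\<close>)
 then show ?thesis
  unfolding lin_def scal_E by (auto simp: ma_def fun_eq_iff vs.scale_right_distrib sum.distrib vs.scale_sum_right mult.commute intro!: sum.cong)
qed

text \<open>By Schur's lemma an endomorphism of W has no component between different types, and its
  components between copies of the same type are scalars. These scalars form the matrix A.\<close>

lemma iso_matrix:
 assumes \<gamma>: "ghom G W W \<gamma>" and i: "i < r"
 shows "\<exists>A. \<forall>w\<in>space W. co (\<gamma> w) i = ma A (m i) (co w i)"
proof -
 have lg: "lin W W \<gamma>" using \<gamma> by (simp add: ghom_def)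
 have gm': "\<gamma> w \<in> space W" if "w \<in> space W" for w using lg that by (simp add: lin_def)
 have cog: "ghom G W (Mi i) (\<lambda>w. co w i j)" if j: "j < m i" for j
  unfolding ghom_def lin_def using i j by (auto simp: co_in co_add co_scal co_act)
 define h where "h j i' l v = co (\<gamma> (\<Phi> (sgl i' l v))) i j" for j i' l v
 have hh: "ghom G (Mi i') (Mi i) (h j i' l)" if "i' < r" "l < m i'" "j < m i" for i' l j
  unfolding h_def
  by (rule ghom_comp[OF _ ghom_comp[OF \<gamma> cog[OF that(3)]], where f = "\<lambda>v. \<Phi> (sgl i' l v)"]) (rule sgl_ghom[OF that(1,2)])
 have h0: "h j i' l v = 0" if "i' < r" "l < m i'" "j < m i" "i' \<noteq> i" "v \<in> M i'" for i' l j v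
 proof -
  have "(\<forall>x\<in>space (Mi i'). h j i' l x = 0) \<or> gmod_iso G (Mi i') (Mi i) (h j i' l)"
   by (rule Schur_zero_or_iso[OF gm_Mi gm_Mi simple simple hh]) (use that i in simp_all)
  moreover have "\<not> gmod_iso G (Mi i') (Mi i) (h j i' l)" using noniso[OF that(1) i that(4)] by blast
  ultimately show ?thesis using that(5) by simp
 qed
 have "\<forall>jl. \<exists>c. fst jl < m i \<longrightarrow> snd jl < m i \<longrightarrow> (\<forall>v\<in>M i. h (fst jl) i (snd jl) v = scal W c v)"
 proof
  fix jl :: "nat \<times> nat"
  show "\<exists>c. fst jl < m i \<longrightarrow> snd jl < m i \<longrightarrow> (\<forall>v\<in>M i. h (fst jl) i (snd jl) v = scal W c v)"
  proof (cases "fst jl < m i \<and> snd jl < m i")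
   case True
   then have "\<exists>c. \<forall>v\<in>space (Mi i). h (fst jl) i (snd jl) v = scal (Mi i) c v"
    by (intro Schur_scalar[OF gm_Mi[OF i] simple[OF i] fd_Mi[OF i] hh[OF i]]) auto
   then show ?thesis by auto
  qed auto
 qed
 from choice[OF this] obtain a where
  a: "\<And>j l v. j < m i \<Longrightarrow> l < m i \<Longrightarrow> v \<in> M i \<Longrightarrow> h j i l v = scal W (a (j, l)) v" by fastforce
 have "co (\<gamma> w) i = ma (\<lambda>j l. a (j, l)) (m i) (co w i)" if w: "w \<in> space W" for w
 proof
  fix j
  show "co (\<gamma> w) i j = ma (\<lambda>j l. a (j, l)) (m i) (co w i) j"
  proof (cases "j < m i")
   case True
   let ?f = "\<lambda>w. co (\<gamma> w) i j"
   have lf: "lin W (Mi i) ?f" using ghom_comp[OF \<gamma> cog[OF True]] by (simp add: ghom_def)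
   have mem: "\<Phi> (sgl i' l (co w i' l)) \<in> space W" if "i' < r" "l < m i'" for i' l by (rule Phi_mem[OF sgl_mem[OF that co_in[OF w that]]])
   have "?f w = ?f (\<Sum>i'<r. \<Sum>l<m i'. \<Phi> (sgl i' l (co w i' l)))" using W_expand[OF w] by simp
   also have "\<dots> = (\<Sum>i'<r. ?f (\<Sum>l<m i'. \<Phi> (sgl i' l (co w i' l))))"
    by (rule lin_sum[OF lf]) (use mem in \<open>auto intro!: sum_mem\<close>)
   also have "\<dots> = (\<Sum>i'<r. \<Sum>l<m i'. h j i' l (co w i' l))"
    unfolding h_def by (rule sum.cong[OF refl], rule lin_sum[OF lf]) (use mem in auto)
   also have "\<dots> = (\<Sum>i'<r. if i' = i then \<Sum>l<m i. h j i l (co w i l) else 0)"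
    by (rule sum.cong[OF refl]) (use h0[OF _ _ True] co_in[OF w] in auto)
   also have "\<dots> = (\<Sum>l<m i. h j i l (co w i l))" using i by simp
   also have "\<dots> = (\<Sum>l<m i. scal W (a (j, l)) (co w i l))" by (rule sum.cong[OF refl]) (use a[OF True] co_in[OF w i] in simp)
   finally show ?thesis using True by (simp add: ma_def)
  qed (use gm'[OF w] in \<open>simp add: ma_def co_out\<close>)
 qed
 then show ?thesis by blast
qed

text \<open>The composite is evaluated on the vector whose only nonzero entry is v, in copy s;
  comparing multiples of v gives column s of B A.\<close>

lemma matrix_inverse:
 assumes i: "i < r" and A: "\<And>w. w \<in> space W \<Longrightarrow> co (\<gamma> w) i = ma A (m i) (co w i)"
  and B: "\<And>w. w \<in> space W \<Longrightarrow> co (\<delta> w) i = ma B (m i) (co w i)"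
  and inv: "\<And>w. w \<in> space W \<Longrightarrow> \<gamma> w \<in> space W" "\<And>w. w \<in> space W \<Longrightarrow> \<delta> (\<gamma> w) = w"
  and js: "j < m i" "s < m i"
 shows "(\<Sum>l<m i. B j l * A l s) = (if j = s then 1 else 0)"
proof -
 obtain v where v: "v \<in> M i" "v \<noteq> 0"
 proof -
  have "M i \<noteq> {0}" using simple[OF i] by (simp add: simple_gmod_def)
  moreover have "0 \<in> M i" by (rule M_0[OF i])
  ultimately show ?thesis using that by auto
 qed
 let ?w = "\<Phi> (sgl i s v)"
 have w: "?w \<in> space W" by (rule Phi_mem[OF sgl_mem[OF i js(2) v(1)]])
 have cw: "co ?w i l = (if l = s then v else 0)" for l using co_Phi[OF sgl_mem[OF i js(2) v(1)]] by (simp add: sgl_def)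
 have vW: "v \<in> space W" using v(1) M_sub[OF i] by auto
 have c1: "co (\<gamma> ?w) i l = scal W (A l s) v" if "l < m i" for l
 proof -
  have "co (\<gamma> ?w) i l = (\<Sum>k<m i. scal W (A l k) (if k = s then v else 0))" using that by (simp add: A[OF w] ma_def cw)
  also have "\<dots> = (\<Sum>k<m i. if k = s then scal W (A l s) v else 0)" by (intro sum.cong) auto
  finally show ?thesis using js(2) by simp
 qed
 have e0: "(if j = s then v else 0) = scal W (if j = s then 1 else 0) v" by simp
 have "(if j = s then v else 0) = co (\<delta> (\<gamma> ?w)) i j" using inv(2)[OF w] cw by simp
 also have "\<dots> = (\<Sum>l<m i. scal W (B j l) (scal W (A l s) v))" using js(1) c1 by (simp add: B[OF inv(1)[OF w]] ma_def)
 also have "\<dots> = scal W (\<Sum>l<m i. B j l * A l s) v" by (simp add: vs.scale_sum_left)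
 finally have "scal W (\<Sum>l<m i. B j l * A l s) v = scal W (if j = s then 1 else 0) v"
  unfolding e0 by (rule sym)
 then show ?thesis using v(2) vs.scale_cancel_right by blast
qed

lemma invertible_matI:
 assumes "\<And>j s. j < n \<Longrightarrow> s < n \<Longrightarrow> (\<Sum>l<n. B j l * A l s) = (if j = s then 1 else (0::'k))"
  and "\<And>j s. j < n \<Longrightarrow> s < n \<Longrightarrow> (\<Sum>l<n. A j l * B l s) = (if j = s then 1 else 0)"
 shows "invertible_mat (mat n n (\<lambda>(j, l). A j l))"
proof -
 let ?A = "mat n n (\<lambda>(j, l). A j l)" and ?B = "mat n n (\<lambda>(j, l). B j l)"
 have "?A * ?B = 1\<^sub>m n" "?B * ?A = 1\<^sub>m n" by (rule eq_matI; simp add: scalar_prod_def assms lessThan_atLeast0[symmetric])+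
 then show ?thesis unfolding invertible_mat_def inverts_mat_def square_mat.simps by (intro conjI exI[of _ ?B]) simp_all
qed

text \<open>In dimension greater than 1 this is the definition. In dimension at most 1, GL(M_i) acts
  by scalars, which commute with the matrix.\<close>

lemma pullback_factor_ops:
 assumes i: "i < r" and A: "invertible_mat (mat (m i) (m i) (\<lambda>(j, l). A j l))"
 shows "pullback_op (E i) (ma A (m i)) \<in> factor_ops (Mi i) (m i)"
proof (cases "gdim (Mi i) > 1")
 case True
 have "pullback_op (E i) (ma A (m i)) = pullback_op (E i) (mat_act (Mi i) (m i) (mat (m i) (m i) (\<lambda>(j, l). A j l)))"
  unfolding mat_act_ma[abs_def] ..
 then show ?thesis unfolding factor_ops_def using True A by auto
next
 case False
 have l: "lin (E i) (E i) (ma A (m i))" by (rule lin_ma[OF i])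
 have "pullback_op (E i) (ma A (m i)) (pullback_op (E i) (diag_act (m i) h) p) =
   pullback_op (E i) (diag_act (m i) h) (pullback_op (E i) (ma A (m i)) p)"
  if h: "h \<in> GL_space (Mi i)" and p: "p \<in> polyfun (E i)" for h p
 proof -
  have "gdim (Mi i) \<le> 1" using False by simp
  from one_dim_scalar[OF i this h] obtain c where c: "\<And>v. v \<in> M i \<Longrightarrow> h v = scal W c v" by blast
  have d: "diag_act (m i) h y = scal (E i) c y" if y: "y \<in> space (E i)" for y
   using E_mem[OF y] E_out[OF y] c by (auto simp: diag_act_def scal_E fun_eq_iff)
  interpret Ei: gm G "E i" by (rule gmE[OF i])
  have ld: "lin (E i) (E i) (diag_act (m i) h)" using d Ei.add_mem Ei.scal_mem by (auto simp: lin_def Ei.vs.scale_right_distrib mult.commute)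
  have s: "ma A (m i) (scal (E i) c y) = scal (E i) c (ma A (m i) y)" if "y \<in> space (E i)" for y using l that by (simp add: lin_def)
  have m: "ma A (m i) y \<in> space (E i)" if "y \<in> space (E i)" for y using l that by (simp add: lin_def)
  have P: "pullback_op (E i) (ma A (m i)) p \<in> polyfun (E i)" "pullback_op (E i) (diag_act (m i) h) p \<in> polyfun (E i)"
   by (rule poly_endD(1)[OF pullback_poly_end p], rule l, rule poly_endD(1)[OF pullback_poly_end p], rule ld)
  have L: "pullback_op (E i) (ma A (m i)) (pullback_op (E i) (diag_act (m i) h) p) =
    (\<lambda>y\<in>space (E i). pullback_op (E i) (diag_act (m i) h) p (ma A (m i) y))"
   unfolding pullback_op_def[of "E i" "ma A (m i)"] restrict_apply'[OF P(2)] ..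
  have R: "pullback_op (E i) (diag_act (m i) h) (pullback_op (E i) (ma A (m i)) p) =
    (\<lambda>y\<in>space (E i). pullback_op (E i) (ma A (m i)) p (diag_act (m i) h y))"
   unfolding pullback_op_def[of "E i" "diag_act (m i) h"] restrict_apply'[OF P(1)] ..
  show ?thesis
   unfolding L R unfolding pullback_op_def restrict_apply'[OF p] by (rule restrict_ext) (simp only: restrict_apply' d m s Ei.scal_mem)
 qed
 then show ?thesis unfolding factor_ops_def using False pullback_poly_end[OF l] by simp
qed

definition PS :: "('w \<Rightarrow> 'k) set \<Rightarrow> ('w \<Rightarrow> 'k) set" where
 "PS S = {F. restrict F (space W) \<in> Pol W r M m \<Phi> S}"

lemma PS_oper: "F \<in> PS S \<Longrightarrow> i < r \<Longrightarrow> T \<in> factor_ops (Mi i) (m i) \<Longrightarrow> acts_on_factor W r M m \<Phi> i T Q \<Longrightarrow>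
  Q (restrict F (space W)) \<in> Pol W r M m \<Phi> S"
 unfolding PS_def Pol_def mem_Collect_eq by (rule op_submodule.oper) (unfold pol_algebra_def, rule op_algebra.base, blast)

text \<open>A function is invariant on W if all the \<open>gp g\<close> fix it, and operators
  commuting with \<open>gp g\<close> preserve this.\<close>

lemma Pol_props:
 assumes S: "\<And>s. s \<in> S \<Longrightarrow> s \<in> polyfun W" and inv: "\<And>s. s \<in> S \<Longrightarrow> invf G W s" and p: "p \<in> Pol W r M m \<Phi> S"
 shows "p \<in> polyfun W \<and> invf G W p"
proof -
 have gpI: "gp g q = q" if q: "q \<in> polyfun W" "invf G W q" and g: "g \<in> carrier G" for q g
 proof (rule extensionalityI[of _ "space W"])
  show "gp g q \<in> extensional (space W)" unfolding gp_def by (rule restrict_extensional)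
  show "q \<in> extensional (space W)" by (rule polyfun_extensional[OF q(1)])
  fix x assume "x \<in> space W"
  then show "gp g q x = q x" using q(2) g unfolding gp_def invf_def by simp
 qed
 have gpD: "invf G W q" if "\<And>g. g \<in> carrier G \<Longrightarrow> gp g q = q" for q
  unfolding invf_def
 proof (intro ballI)
  fix g x assume g: "g \<in> carrier G" and x: "x \<in> space W"
  from fun_cong[OF that[OF g], of x] x show "q (act W g x) = q x" unfolding gp_def by (simp only: restrict_apply')
 qed
 show ?thesis using p unfolding Pol_def
 proof (induction rule: op_submodule.induct)
  case zero show ?case using polyfun.const[where W = W and c = 0] by (simp add: polyring_def invf_def restrict_def)
 next
  case (base s) then show ?case using S inv by simp
 next
  case (add p q)
  have e: "p \<oplus>\<^bsub>polyring W\<^esub> q = (\<lambda>x\<in>space W. p x + q x)" by (simp add: polyring_def)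
  show ?case unfolding e using add.IH by (intro conjI polyfun.add) (auto simp: invf_def)
 next
  case (oper T p)
  have PT: "T p \<in> polyfun W \<and> (\<forall>g\<in>carrier G. T (gp g p) = gp g (T p))" by (rule PA_props[OF oper.hyps(1) conjunct1[OF oper.IH]])
  have "gp g (T p) = T p" if g: "g \<in> carrier G" for g
  proof -
   have "T (gp g p) = gp g (T p)" by (rule bspec[OF conjunct2[OF PT] g])
   then show ?thesis unfolding gpI[OF conjunct1[OF oper.IH] conjunct2[OF oper.IH] g] by (rule sym)
  qed
  with conjunct1[OF PT] show ?case by (intro conjI gpD)
 qed
qed


end

context isod begin

text \<open>The linear map that applies A to the i-th coordinates and leaves the others alone
  induces, by pullback, an operator on the i-th tensor factor.\<close>

lemma PS_matrix:
 assumes i: "i < r" and A: "invertible_mat (mat (m i) (m i) (\<lambda>(j, l). A j l))" and F: "F \<in> PS S" "pf W F"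
 shows "(\<lambda>w. F (repl i w (ma A (m i) (co w i)))) \<in> PS S"
proof -
 let ?t = "\<lambda>w. repl i w (ma A (m i) (co w i))"
 have l: "lin (E i) (E i) (ma A (m i))" by (rule lin_ma[OF i])
 have am: "ma A (m i) (co w i) \<in> space (E i)" if "w \<in> space W" for w using l co_E[OF that i] by (simp add: lin_def)
 have tm: "?t w \<in> space W" if "w \<in> space W" for w by (rule repl_mem[OF that i am[OF that]])
 have tc: "co (?t w) = (co w)(i := ma A (m i) (co w i))" if "w \<in> space W" for w by (rule co_repl[OF that i am[OF that]])
 have lt: "lin W W ?t"
  unfolding lin_def
 proof (intro conjI ballI allI)
  show "?t x \<in> space W" if "x \<in> space W" for x by (rule tm[OF that])
  show "?t (x + y) = ?t x + ?t y" if xy: "x \<in> space W" "y \<in> space W" for x y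
  proof (rule W_eqI)
   have "ma A (m i) (co x i + co y i) = ma A (m i) (co x i) + ma A (m i) (co y i)" using l co_E[OF xy(1) i] co_E[OF xy(2) i] by (simp add: lin_def)
   moreover have "co (?t (x + y)) = (co (x + y))(i := ma A (m i) (co (x + y) i))" by (rule tc[OF add_mem[OF xy]])
   ultimately show "co (?t (x + y)) = co (?t x + ?t y)"
    unfolding co_add[OF tm[OF xy(1)] tm[OF xy(2)]] tc[OF xy(1)] tc[OF xy(2)] co_add[OF xy] by (simp add: fun_eq_iff)
  qed (use xy tm in simp_all)
  show "?t (scal W c x) = scal W c (?t x)" if x: "x \<in> space W" for c x
  proof (rule W_eqI)
   have "ma A (m i) (\<lambda>j. scal W c (co x i j)) = (\<lambda>j. scal W c (ma A (m i) (co x i) j))"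
    using l co_E[OF x i] by (simp add: lin_def scal_E)
   moreover have "co (?t (scal W c x)) = (co (scal W c x))(i := ma A (m i) (co (scal W c x) i))" by (rule tc[OF scal_mem[OF x]])
   ultimately show "co (?t (scal W c x)) = co (scal W c (?t x))"
    unfolding co_scal[OF tm[OF x]] tc[OF x] co_scal[OF x] by (simp add: fun_eq_iff)
  qed (use x tm in simp_all)
 qed
 let ?T = "pullback_op (E i) (ma A (m i))"
 have QE: "pullback_op W ?t \<in> poly_end W" by (rule pullback_poly_end[OF lt])
 have "acts_on_factor W r M m \<Phi> i ?T (pullback_op W ?t)"
  unfolding acts_on_factor_def
 proof (intro conjI allI impI QE)
  fix f assume f: "\<forall>l<r. f l \<in> polyfun (E l)"
  have P: "(\<lambda>w\<in>space W. \<Prod>l<r. f l (co w l)) \<in> polyfun W"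
   by (intro restrict_polyfun pf_prod pf_comp[OF lin_co] pf_polyfun) (use f in auto)
  have e: "f l (co (?t w) l) = (if l = i then ?T (f l) else f l) (co w l)" if w: "w \<in> space W" and "l < r" for w l
  proof -
   have Tf: "?T (f i) (co w i) = f i (ma A (m i) (co w i))" using f i unfolding pullback_op_def by (simp only: restrict_apply' co_E[OF w i])
   have "co (?t w) l = (if l = i then ma A (m i) (co w i) else co w l)"
    unfolding tc[OF w] fun_upd_def ..
   then show ?thesis using Tf by (cases "l = i") (simp_all only: simp_thms if_True if_False)
  qed
  have "pullback_op W ?t (\<lambda>w\<in>space W. \<Prod>l<r. f l (co w l)) = (\<lambda>w\<in>space W. \<Prod>l<r. f l (co (?t w) l))"
   unfolding pullback_op_def restrict_apply'[OF P] by (rule restrict_ext) (simp only: restrict_apply' tm)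
  also have "\<dots> = (\<lambda>w\<in>space W. \<Prod>l<r. (if l = i then ?T (f l) else f l) (co w l))"
   by (rule restrict_ext, rule prod.cong[OF refl], rule e) auto
  finally show "pullback_op W ?t (\<lambda>w\<in>space W. \<Prod>l<r. f l (co w l)) =
    (\<lambda>w\<in>space W. \<Prod>l<r. (if l = i then ?T (f l) else f l) (co w l))" .
 qed
 from PS_oper[OF F(1) i pullback_factor_ops[OF i A] this]
 have "pullback_op W ?t (restrict F (space W)) \<in> Pol W r M m \<Phi> S" .
 moreover have "pullback_op W ?t (restrict F (space W)) = (\<lambda>w\<in>space W. F (?t w))"
  unfolding pullback_op_def restrict_apply'[OF restrict_polyfun[OF F(2)]] by (rule restrict_ext) (simp only: restrict_apply' tm)
 ultimately show ?thesis by (simp add: PS_def)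
qed

text \<open>An automorphism acts on the coordinates of each type by an invertible matrix, so it is a
  composite of maps changing one type at a time. \<open>st k\<close> applies \<gamma> in the types
  below k, and one matrix operator leads from k to k + 1.\<close>

lemma PS_iso:
 assumes g: "gmod_iso G W W \<gamma>" and F: "F \<in> PS S" and pfS: "\<And>F. F \<in> PS S \<Longrightarrow> pf W F"
 shows "(\<lambda>w. F (\<gamma> w)) \<in> PS S"
proof -
 define \<delta> where "\<delta> = inv_into (space W) \<gamma>"
 have d: "gmod_iso G W W \<delta>" unfolding \<delta>_def by (rule gmod_iso_inv[OF gm_W gm_W g])
 have gh: "ghom G W W \<gamma>" and dh: "ghom G W W \<delta>" using g d by (simp_all add: gmod_iso_alt)
 have gw: "\<gamma> w \<in> space W" and dw: "\<delta> w \<in> space W" if "w \<in> space W" for w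
  using gh dh that by (simp_all add: ghom_def lin_def)
 have bij: "bij_betw \<gamma> (space W) (space W)" using g by (simp add: gmod_iso_alt)
 have dg: "\<delta> (\<gamma> w) = w" and gd: "\<gamma> (\<delta> w) = w" if "w \<in> space W" for w
  using bij_betw_inv_into_left[OF bij that] bij_betw_inv_into_right[OF bij that] by (simp_all add: \<delta>_def)
 have "\<forall>i. \<exists>A. i < r \<longrightarrow> (\<forall>w\<in>space W. co (\<gamma> w) i = ma A (m i) (co w i))"
  using iso_matrix[OF gh] by blast
 from choice[OF this] obtain A where A: "\<And>i w. i < r \<Longrightarrow> w \<in> space W \<Longrightarrow> co (\<gamma> w) i = ma (A i) (m i) (co w i)"
  by blast
 have "\<forall>i. \<exists>A. i < r \<longrightarrow> (\<forall>w\<in>space W. co (\<delta> w) i = ma A (m i) (co w i))"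
  using iso_matrix[OF dh] by blast
 from choice[OF this] obtain B where B: "\<And>i w. i < r \<Longrightarrow> w \<in> space W \<Longrightarrow> co (\<delta> w) i = ma (B i) (m i) (co w i)"
  by blast
 have invA: "invertible_mat (mat (m i) (m i) (\<lambda>(j, l). A i j l))" if i: "i < r" for i
  by (rule invertible_matI[OF matrix_inverse[OF i A[OF i] B[OF i] gw dg] matrix_inverse[OF i B[OF i] A[OF i] dw gd]])
 define st where "st k w = \<Phi> (\<lambda>i. if i < k then co (\<gamma> w) i else co w i)" for k :: nat and w
 have st_dom: "(\<lambda>i. if i < k then co (\<gamma> w) i else co w i) \<in> space D" if w: "w \<in> space W" for k w
  by (rule DI) (auto simp: co_in co_out w gw)
 have co_st: "co (st k w) = (\<lambda>i. if i < k then co (\<gamma> w) i else co w i)" if "w \<in> space W" for k w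
  unfolding st_def by (rule co_Phi[OF st_dom[OF that]])
 have st_mem: "st k w \<in> space W" if "w \<in> space W" for k w
  unfolding st_def by (rule Phi_mem[OF st_dom[OF that]])
 have cl: "F' \<in> PS S" if "F \<in> PS S" "\<And>w. w \<in> space W \<Longrightarrow> F w = F' w" for F F'
 proof -
  have "restrict F' (space W) = restrict F (space W)" by (rule restrict_ext) (simp add: that(2))
  then show ?thesis using that(1) by (simp add: PS_def)
 qed
 have "k \<le> r \<Longrightarrow> (\<lambda>w. F (st k w)) \<in> PS S" for k
 proof (induction k)
  case 0
  show ?case by (rule cl[OF F]) (simp add: st_def Phi_co)
 next
  case (Suc k)
  then have k: "k < r" and IH: "(\<lambda>w. F (st k w)) \<in> PS S" by simp_all
  show ?case
  proof (rule cl[OF PS_matrix[OF k invA[OF k] IH pfS[OF IH]]])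
   fix w assume w: "w \<in> space W"
   have am: "ma (A k) (m k) (co w k) \<in> space (E k)" using lin_ma[OF k] co_E[OF w k] by (simp add: lin_def)
   let ?t = "repl k w (ma (A k) (m k) (co w k))"
   have t: "?t \<in> space W" "co ?t = (co w)(k := co (\<gamma> w) k)" using repl_mem[OF w k am] co_repl[OF w k am] A[OF k w] by simp_all
   have "st k ?t = st (Suc k) w"
   proof (rule W_eqI[OF st_mem[OF t(1)] st_mem[OF w]], rule HOL.ext)
    fix i
    consider "i < k" | "i = k" | "k < i" by linarith
    then show "co (st k ?t) i = co (st (Suc k) w) i"
    proof cases
     case 1
     then have "i < r" using k by simp
     then show ?thesis using 1 unfolding co_st[OF t(1)] co_st[OF w] by (simp add: A[OF _ t(1)] t(2) A[OF _ w])
    qed (simp_all add: co_st[OF t(1)] co_st[OF w] t(2))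
   qed
   then show "F (st k ?t) = F (st (Suc k) w)" by simp
  qed
 qed
 from this[of r] have "(\<lambda>w. F (st r w)) \<in> PS S" by simp
 then show ?thesis
 proof (rule cl)
  fix w assume w: "w \<in> space W"
  have "st r w = \<gamma> w"
  proof (rule W_eqI[OF st_mem[OF w] gw[OF w]], rule HOL.ext)
   fix i
   show "co (st r w) i = co (\<gamma> w) i" using co_out[OF gw[OF w], of i] co_out[OF w, of i] by (auto simp: co_st[OF w] fun_eq_iff)
  qed
  then show "F (st r w) = F (\<gamma> w)" by simp
 qed
qed

text \<open>\<open>qop\<close> extends an operator T on the i-th tensor factor, which takes the
  coefficient of t^d in p(t \<omega>) and multiplies by the forms \<open>l s\<close>. As GL(M_i)
  consists of scalars c, T has to commute with these: composing p with c scales the coefficient by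
  c^d, and composing the product of forms with c scales it by c^d as well.\<close>

lemma PS_qop:
 assumes q: "qpar i \<omega> d l" and F: "F \<in> PS S" "pf W F"
 shows "qop i \<omega> d l F \<in> PS S"
proof -
 have i: "i < r" "gdim (Mi i) = 1" and om: "\<omega> \<in> space W" "pr i \<omega> = \<omega>"
  and l: "\<And>s. s < d \<Longrightarrow> linear_form W (l s)" "\<And>s w. s < d \<Longrightarrow> w \<in> space W \<Longrightarrow> l s (pr i w) = l s w"
  using q by (auto simp: qpar_def)
 interpret Ei: gm G "E i" by (rule gmE[OF i(1)])
 note inf = infinite_alg_closed
 define oi where "oi = co \<omega> i"
 have oi: "oi \<in> space (E i)" unfolding oi_def by (rule co_E[OF om(1) i(1)])
 have Ep: "\<exists>P. \<forall>t. poly P t = p (scal (E i) t oi)" if "pf (E i) p" for p using Ei.poly_on_line[OF that Ei.zero_mem oi] by simp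
 have lE: "linear_form (E i) (\<lambda>y. l s (emb i y))" if "s < d" for s by (rule linear_form_comp[OF lin_emb[OF i(1)] l(1)[OF that]])
 define T where "T = (\<lambda>p\<in>polyfun (E i). \<lambda>y\<in>space (E i). cf d (\<lambda>t. p (scal (E i) t oi)) * (\<Prod>s<d. l s (emb i y)))"
 have T: "T p y = cf d (\<lambda>t. p (scal (E i) t oi)) * (\<Prod>s<d. l s (emb i y))" if "p \<in> polyfun (E i)" "y \<in> space (E i)" for p y
  unfolding T_def using that by simp
 have TR: "T p = (\<lambda>y\<in>space (E i). cf d (\<lambda>t. p (scal (E i) t oi)) * (\<Prod>s<d. l s (emb i y)))" if "p \<in> polyfun (E i)" for p
  unfolding T_def restrict_apply'[OF that] ..
 have som: "scal (E i) t oi \<in> space (E i)" for t by (rule Ei.scal_mem[OF oi])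
 have TE: "T \<in> poly_end (E i)"
 proof (rule poly_endI)
  show "T p \<in> polyfun (E i)" if "p \<in> polyfun (E i)" for p
   unfolding TR[OF that] by (intro restrict_polyfun pf_cmult pf_prod pf_form lE) auto
  show "T p = undefined" if "p \<notin> polyfun (E i)" for p unfolding T_def using that by simp
  show "T (\<lambda>x\<in>space (E i). p x + q x) = (\<lambda>x\<in>space (E i). T p x + T q x)"
   if p: "p \<in> polyfun (E i)" and q: "q \<in> polyfun (E i)" for p q
  proof -
   have "cf d (\<lambda>t. (\<lambda>x\<in>space (E i). p x + q x) (scal (E i) t oi)) =
     cf d (\<lambda>t. p (scal (E i) t oi)) + cf d (\<lambda>t. q (scal (E i) t oi))"
    unfolding restrict_apply'[OF som] by (rule cf_add[OF inf Ep[OF pf_polyfun[OF p]] Ep[OF pf_polyfun[OF q]]])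
   then show ?thesis unfolding TR[OF polyfun.add[OF p q]] by (intro restrict_ext) (simp only: T[OF p] T[OF q] distrib_right)
  qed
  show "T (\<lambda>x\<in>space (E i). c * p x) = (\<lambda>x\<in>space (E i). c * T p x)" if p: "p \<in> polyfun (E i)" for c p
  proof -
   have "cf d (\<lambda>t. (\<lambda>x\<in>space (E i). c * p x) (scal (E i) t oi)) = c * cf d (\<lambda>t. p (scal (E i) t oi))"
    unfolding restrict_apply'[OF som] by (rule cf_cmult[OF inf Ep[OF pf_polyfun[OF p]]])
   then show ?thesis unfolding TR[OF restrict_polyfun[OF pf_cmult[OF pf_polyfun[OF p]]]] by (intro restrict_ext) (simp only: T[OF p] mult.assoc)
  qed
 qed
 have "T (pullback_op (E i) (diag_act (m i) h) p) = pullback_op (E i) (diag_act (m i) h) (T p)"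
  if h: "h \<in> GL_space (Mi i)" and p: "p \<in> polyfun (E i)" for h p
 proof -
  have "gdim (Mi i) \<le> 1" using i by simp
  from one_dim_scalar[OF i(1) this h] obtain c where c: "\<And>v. v \<in> M i \<Longrightarrow> h v = scal W c v" by blast
  have dg: "diag_act (m i) h y = scal (E i) c y" if y: "y \<in> space (E i)" for y
   using E_mem[OF y] E_out[OF y] c by (auto simp: diag_act_def scal_E fun_eq_iff)
  have ld: "lin (E i) (E i) (diag_act (m i) h)" using dg Ei.add_mem Ei.scal_mem by (auto simp: lin_def Ei.vs.scale_right_distrib mult.commute)
  have R: "pullback_op (E i) (diag_act (m i) h) p = (\<lambda>y\<in>space (E i). p (scal (E i) c y))" if "p \<in> polyfun (E i)" for p
   unfolding pullback_op_def restrict_apply'[OF that] by (rule restrict_ext) (simp only: dg)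
  have P: "(\<lambda>y\<in>space (E i). p (scal (E i) c y)) \<in> polyfun (E i)"
   using poly_endD(1)[OF pullback_poly_end[OF ld] p] unfolding R[OF p] .
  have e: "cf d (\<lambda>t. (\<lambda>y\<in>space (E i). p (scal (E i) c y)) (scal (E i) t oi)) = c ^ d * cf d (\<lambda>t. p (scal (E i) t oi))"
  proof -
   have "(\<lambda>y\<in>space (E i). p (scal (E i) c y)) (scal (E i) t oi) = p (scal (E i) (c * t) oi)" for t
    using som by (simp add: Ei.vs.scale_scale)
   then show ?thesis using cf_dilate[OF inf Ep[OF pf_polyfun[OF p]], of d c] by simp
  qed
  have lc: "l s (emb i (scal (E i) c y)) = c * l s (emb i y)" if "y \<in> space (E i)" "s < d" for s y
   using lE[OF that(2)] that(1) by (simp add: linear_form_def)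
  show ?thesis unfolding R[OF p] R[OF poly_endD(1)[OF TE p]] TR[OF P] e
  proof (rule restrict_ext)
   fix y assume y: "y \<in> space (E i)"
   have "(\<Prod>s<d. l s (emb i (scal (E i) c y))) = c ^ d * (\<Prod>s<d. l s (emb i y))" using lc[OF y] by (simp add: prod.distrib)
   then show "c ^ d * cf d (\<lambda>t. p (scal (E i) t oi)) * (\<Prod>s<d. l s (emb i y)) = T p (scal (E i) c y)"
    unfolding T[OF p Ei.scal_mem[OF y]] by simp
  qed
 qed
 then have TF: "T \<in> factor_ops (Mi i) (m i)" unfolding factor_ops_def using TE i(2) by simp
 define Q where "Q = (\<lambda>p\<in>polyfun W. restrict (qop i \<omega> d l p) (space W))"
 have QR: "Q p = restrict (qop i \<omega> d l p) (space W)" if "p \<in> polyfun W" for p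
  unfolding Q_def restrict_apply'[OF that] ..
 have LP: "\<exists>P. \<forall>t. poly P t = p (shift i \<omega> w t)" if "p \<in> polyfun W" "w \<in> space W" for p w
  by (rule line_poly[OF pf_polyfun[OF that(1)] that(2) om(1)])
 have QE: "Q \<in> poly_end W"
 proof (rule poly_endI)
  show "Q p \<in> polyfun W" if "p \<in> polyfun W" for p
   unfolding QR[OF that] by (intro restrict_polyfun qop_pf[OF q] pf_polyfun that)
  show "Q p = undefined" if "p \<notin> polyfun W" for p unfolding Q_def using that by simp
  show "Q (\<lambda>x\<in>space W. p x + q x) = (\<lambda>x\<in>space W. Q p x + Q q x)" if p: "p \<in> polyfun W" and p': "q \<in> polyfun W" for p q
   unfolding QR[OF polyfun.add[OF p p']] QR[OF p] QR[OF p']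
  proof (rule restrict_ext)
   fix w assume w: "w \<in> space W"
   have "cf d (\<lambda>t. (\<lambda>x\<in>space W. p x + q x) (shift i \<omega> w t)) =
     cf d (\<lambda>t. p (shift i \<omega> w t)) + cf d (\<lambda>t. q (shift i \<omega> w t))"
    unfolding restrict_apply'[OF line_mem[OF w om(1)]] by (rule cf_add[OF inf LP[OF p w] LP[OF p' w]])
   then show "qop i \<omega> d l (\<lambda>x\<in>space W. p x + q x) w =
     restrict (qop i \<omega> d l p) (space W) w + restrict (qop i \<omega> d l q) (space W) w"
    unfolding restrict_apply'[OF w] qop_def by (simp only: distrib_right)
  qed
  show "Q (\<lambda>x\<in>space W. c * p x) = (\<lambda>x\<in>space W. c * Q p x)" if p: "p \<in> polyfun W" for c p
   unfolding QR[OF restrict_polyfun[OF pf_cmult[OF pf_polyfun[OF p]]]] QR[OF p]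
  proof (rule restrict_ext)
   fix w assume w: "w \<in> space W"
   have "cf d (\<lambda>t. (\<lambda>x\<in>space W. c * p x) (shift i \<omega> w t)) =
     c * cf d (\<lambda>t. p (shift i \<omega> w t))"
    unfolding restrict_apply'[OF line_mem[OF w om(1)]] by (rule cf_cmult[OF inf LP[OF p w]])
   then show "qop i \<omega> d l (\<lambda>x\<in>space W. c * p x) w = c * restrict (qop i \<omega> d l p) (space W) w"
    unfolding restrict_apply'[OF w] qop_def by (simp only: mult.assoc)
  qed
 qed
 have "acts_on_factor W r M m \<Phi> i T Q"
  unfolding acts_on_factor_def
 proof (intro conjI allI impI QE)
  fix f assume "\<forall>l<r. f l \<in> polyfun (E l)"
  then have f: "\<And>l. l < r \<Longrightarrow> f l \<in> polyfun (E l)" by blast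
  have P: "(\<lambda>w\<in>space W. \<Prod>l<r. f l (co w l)) \<in> polyfun W"
   by (intro restrict_polyfun pf_prod pf_comp[OF lin_co] pf_polyfun f) auto
  show "Q (\<lambda>w\<in>space W. \<Prod>l<r. f l (co w l)) = (\<lambda>w\<in>space W. \<Prod>l<r. (if l = i then T (f l) else f l) (co w l))"
   unfolding QR[OF P]
  proof (rule restrict_ext)
   fix w assume w: "w \<in> space W"
   \<comment> \<open>Only the i-th coordinates see the shift: they become those of t \<omega>, the
     others remain those of w.\<close>
   have co_line: "co (shift i \<omega> w t) a = (if a = i then scal (E i) t oi else co w a)" for t a
   proof -
    have pw: "pr i w \<in> space W" by (rule pr_mem[OF w])
    have o: "co \<omega> a = 0" if "a \<noteq> i"
    proof -
     have "co \<omega> a = (if a = i then co \<omega> a else 0)"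
      using fun_cong[OF co_pr[OF om(1), of i], of a] unfolding om(2) .
     then show ?thesis unfolding if_not_P[OF that] .
    qed
    have dw: "w - pr i w \<in> space W" using w pw by simp
    have e0: "co (w - pr i w) + co (pr i w) = co w" using co_add[OF dw pw] by simp
    have c1: "co (w - pr i w) a + co (pr i w) a = co w a" using fun_cong[OF e0, of a] by (simp only: plus_fun_apply)
    have c2: "co (pr i w) a = (if a = i then co w a else 0)" by (simp add: co_pr[OF w])
    have c3: "co (w - pr i w) a = (if a = i then 0 else co w a)" using c1 c2 by (auto split: if_splits)
    have "co (shift i \<omega> w t) a = co (w - pr i w) a + (\<lambda>j. scal W t (co \<omega> a j))"
     using co_add[OF dw scal_mem[OF om(1)]] co_scal[OF om(1)] by simp
    then show ?thesis unfolding c3 using o by (auto simp: oi_def scal_E fun_eq_iff)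
   qed
   have split: "(\<Prod>a<r. h a) = h i * (\<Prod>a\<in>{..<r} - {i}. h a)" for h :: "nat \<Rightarrow> 'k" using i(1) by (intro prod.remove) auto
   have "(\<Prod>a<r. f a (co (shift i \<omega> w t) a)) = (\<Prod>a\<in>{..<r} - {i}. f a (co w a)) * f i (scal (E i) t oi)" for t
    unfolding split co_line by (simp add: mult.commute)
   then have "cf d (\<lambda>t. \<Prod>a<r. f a (co (shift i \<omega> w t) a)) =
     (\<Prod>a\<in>{..<r} - {i}. f a (co w a)) * cf d (\<lambda>t. f i (scal (E i) t oi))"
    using cf_cmult[OF inf Ep[OF pf_polyfun[OF f[OF i(1)]]], of d "\<Prod>a\<in>{..<r} - {i}. f a (co w a)"] by simp
   moreover have "(\<Prod>s<d. l s w) = (\<Prod>s<d. l s (emb i (co w i)))"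
    by (intro prod.cong refl) (simp add: l(2)[OF _ w, symmetric] pr_emb[symmetric])
   moreover have "(\<Prod>a<r. (if a = i then T (f a) else f a) (co w a)) = T (f i) (co w i) * (\<Prod>a\<in>{..<r} - {i}. f a (co w a))"
    unfolding split by simp
   ultimately show "qop i \<omega> d l (\<lambda>w\<in>space W. \<Prod>l<r. f l (co w l)) w = (\<Prod>l<r. (if l = i then T (f l) else f l) (co w l))"
    unfolding qop_def restrict_apply'[OF line_mem[OF w om(1)]] T[OF f[OF i(1)] co_E[OF w i(1)]] by simp
  qed
 qed
 from PS_oper[OF F(1) i(1) TF this] have "Q (restrict F (space W)) \<in> Pol W r M m \<Phi> S" .
 moreover have "Q (restrict F (space W)) = restrict (qop i \<omega> d l F) (space W)"
  unfolding QR[OF restrict_polyfun[OF F(2)]] by (rule restrict_ext, rule qop_cong[OF _ _ om(1)]) simp_all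
 ultimately show ?thesis by (simp add: PS_def)
qed

lemma qclosed_PS:
 assumes pfS: "\<And>F. F \<in> PS S \<Longrightarrow> pf W F"
 shows "qclosed (PS S)"
 unfolding qclosed_def
proof (intro conjI allI impI)
 fix F F' assume "F \<in> PS S" and e: "\<forall>x\<in>space W. F x = F' x"
 moreover have "restrict F' (space W) = restrict F (space W)" by (rule restrict_ext) (simp add: e)
 ultimately show "F' \<in> PS S" by (simp add: PS_def)
next
 fix \<gamma> F assume g: "gmod_iso G W W \<gamma>" and F: "F \<in> PS S"
 show "(\<lambda>w. F (\<gamma> w)) \<in> PS S" by (rule PS_iso[OF g F pfS])
next
 fix i \<omega> d l F assume q: "qpar i \<omega> d l" and F: "F \<in> PS S"
 show "qop i \<omega> d l F \<in> PS S" by (rule PS_qop[OF q F pfS[OF F]])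
qed

end

section \<open>Transport of rings of functions\<close>

text \<open>The ring \<open>C \<subseteq> k[V]\<close>, transported along an injection \<open>\<iota>\<close> with left inverse \<open>\<rho>\<close>; with \<open>\<iota>\<close> and \<open>\<rho>\<close> the identity,
 it is \<open>C\<close> itself.\<close>

definition pr :: "('k::field, 'g, 'w::ab_group_add) gmod \<Rightarrow> (('w \<Rightarrow> 'k) \<Rightarrow> 'a) \<Rightarrow> ('a \<Rightarrow> 'w \<Rightarrow> 'k) \<Rightarrow>
  ('w \<Rightarrow> 'k) set \<Rightarrow> ('k, 'a) module" where
 "pr V \<iota> \<rho> C =
   \<lparr>carrier = \<iota> ` C,
   monoid.mult = (\<lambda>a b. \<iota> (\<lambda>x\<in>space V. \<rho> a x * \<rho> b x)), one = \<iota> (\<lambda>x\<in>space V. 1),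
   zero = \<iota> (\<lambda>x\<in>space V. 0), add = (\<lambda>a b. \<iota> (\<lambda>x\<in>space V. \<rho> a x + \<rho> b x)),
   module.smult = (\<lambda>c a. \<iota> (\<lambda>x\<in>space V. c * \<rho> a x))\<rparr>"

text \<open>A second name for use in the locales where \<open>pr\<close> denotes an isotypic
  projection.\<close>

lemmas palg_def = pr_def

definition pract :: "('g, 'b) monoid_scheme \<Rightarrow> ('k::field, 'g, 'w::ab_group_add) gmod \<Rightarrow> (('w \<Rightarrow> 'k) \<Rightarrow> 'a) \<Rightarrow> ('a \<Rightarrow> 'w \<Rightarrow> 'k) \<Rightarrow>
  'g \<Rightarrow> 'a \<Rightarrow> 'a" where
 "pract G V \<iota> \<rho> g = (\<lambda>a\<in>\<iota> ` polyfun V. \<iota> (\<lambda>x\<in>space V. \<rho> a (act V (inv\<^bsub>G\<^esub> g) x)))"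

lemma pr_id: "pr V (\<lambda>p. p) (\<lambda>p. p) (polyfun V) = polyring V" by (simp add: pr_def polyring_def)
lemma pract_id: "pract G V (\<lambda>p. p) (\<lambda>p. p) = poly_act G V" by (simp add: pract_def poly_act_def fun_eq_iff)

text \<open>Subalgebras of k[V]; closure under scalars comes from the constants and the
  product.\<close>

definition pclosed :: "('k::field, 'g, 'w::ab_group_add) gmod \<Rightarrow> ('w \<Rightarrow> 'k) set \<Rightarrow> bool" where
 "pclosed V C \<longleftrightarrow> C \<subseteq> polyfun V \<and> (\<forall>c. (\<lambda>x\<in>space V. c) \<in> C) \<and>
   (\<forall>p\<in>C. \<forall>q\<in>C. (\<lambda>x\<in>space V. p x + q x) \<in> C \<and> (\<lambda>x\<in>space V. p x * q x) \<in> C)"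

text \<open>The degree bound \<beta>(k[V]^G) <= n, expressed by functions instead of rings.\<close>

definition GC :: "('g, 'b) monoid_scheme \<Rightarrow> ('k::field, 'g, 'w::ab_group_add) gmod \<Rightarrow> nat \<Rightarrow> bool" where
 "GC G V n \<longleftrightarrow> (\<forall>f. pf V f \<longrightarrow> invf G V f \<longrightarrow> f \<in> alg (space V) {f. hle V n f \<and> invf G V f})"

text \<open>\<iota> moves k[V] into the universe of algebras over which \<open>beta_grp\<close>
  takes its supremum.\<close>

locale prl = gm G V
 for G :: "('g, 'b) monoid_scheme" (structure) and V :: "('k::alg_closed_field, 'g, 'w::ab_group_add) gmod" +
 fixes \<iota> :: "('w \<Rightarrow> 'k) \<Rightarrow> 'a" and \<rho> :: "'a \<Rightarrow> 'w \<Rightarrow> 'k"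
 assumes rho: "p \<in> polyfun V \<Longrightarrow> \<rho> (\<iota> p) = p"
  and cardG: "of_nat (card (carrier G)) \<noteq> (0::'k)"
begin

abbreviation "P C \<equiv> pr V \<iota> \<rho> C"
definition "Inv = {p \<in> polyfun V. invf G V p}"

lemma pclosedD:
 assumes "pclosed V C"
 shows "p \<in> C \<Longrightarrow> p \<in> polyfun V" "(\<lambda>x\<in>space V. c) \<in> C"
  and "p \<in> C \<Longrightarrow> q \<in> C \<Longrightarrow> (\<lambda>x\<in>space V. p x + q x) \<in> C"
  and "p \<in> C \<Longrightarrow> q \<in> C \<Longrightarrow> (\<lambda>x\<in>space V. p x * q x) \<in> C"
  and "p \<in> C \<Longrightarrow> (\<lambda>x\<in>space V. c * p x) \<in> C"
proof -
 show a: "p \<in> C \<Longrightarrow> p \<in> polyfun V" "(\<lambda>x\<in>space V. c) \<in> C" "p \<in> C \<Longrightarrow> q \<in> C \<Longrightarrow> (\<lambda>x\<in>space V. p x + q x) \<in> C"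
  "p \<in> C \<Longrightarrow> q \<in> C \<Longrightarrow> (\<lambda>x\<in>space V. p x * q x) \<in> C" for p q c
  using assms unfolding pclosed_def by blast+
 assume p: "p \<in> C"
 have "(\<lambda>x\<in>space V. c * p x) = (\<lambda>x\<in>space V. (\<lambda>x\<in>space V. c) x * p x)" by (rule restrict_ext) simp
 then show "(\<lambda>x\<in>space V. c * p x) \<in> C" using a(4)[OF a(2) p] by simp
qed

lemma pclosed_polyfun: "pclosed V (polyfun V)"
 unfolding pclosed_def by (blast intro: polyfun.intros)

lemma pclosed_Inv: "pclosed V Inv"
proof -
 have "(\<lambda>x\<in>space V. c) \<in> Inv" for c using polyfun.const[where W = V and c = c] by (simp add: Inv_def invf_def)
 moreover have "(\<lambda>x\<in>space V. p x + q x) \<in> Inv \<and> (\<lambda>x\<in>space V. p x * q x) \<in> Inv" if "p \<in> Inv" "q \<in> Inv" for p q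
  using that polyfun.add[of p V q] polyfun.mult[of p V q] by (simp add: Inv_def invf_def)
 ultimately show ?thesis unfolding pclosed_def Inv_def by blast
qed

context
 fixes C assumes C: "pclosed V C"
begin

lemma pr_carrier: "a \<in> carrier (P C) \<Longrightarrow> \<exists>p\<in>C. p \<in> polyfun V \<and> a = \<iota> p"
 using pclosedD(1)[OF C] by (auto simp: pr_def)

lemma pr_in: "p \<in> C \<Longrightarrow> \<iota> p \<in> carrier (P C)" by (simp add: pr_def)

lemma pr_ops:
 "p \<in> C \<Longrightarrow> q \<in> C \<Longrightarrow> \<iota> p \<oplus>\<^bsub>P C\<^esub> \<iota> q = \<iota> (\<lambda>x\<in>space V. p x + q x)"
 "p \<in> C \<Longrightarrow> q \<in> C \<Longrightarrow> \<iota> p \<otimes>\<^bsub>P C\<^esub> \<iota> q = \<iota> (\<lambda>x\<in>space V. p x * q x)"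
 "p \<in> C \<Longrightarrow> c \<odot>\<^bsub>P C\<^esub> \<iota> p = \<iota> (\<lambda>x\<in>space V. c * p x)"
 "\<zero>\<^bsub>P C\<^esub> = \<iota> (\<lambda>x\<in>space V. 0)" "\<one>\<^bsub>P C\<^esub> = \<iota> (\<lambda>x\<in>space V. 1)"
 using pclosedD(1)[OF C] rho by (simp_all add: pr_def)

lemmas Cc = pclosedD(2-5)[OF C]

lemma ext_restrict: "p \<in> C \<Longrightarrow> (\<lambda>x\<in>space V. p x) = p" using polyfun_restrict[OF pclosedD(1)[OF C]] by simp

lemma pr_cring: "cring (P C)"
proof (rule cringI)
 show "abelian_group (P C)"
 proof (rule abelian_groupI)
  fix x y assume "x \<in> carrier (P C)" "y \<in> carrier (P C)"
  then obtain p q where p: "p \<in> C" "x = \<iota> p" "q \<in> C" "y = \<iota> q" using pr_carrier by meson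
  show "x \<oplus>\<^bsub>P C\<^esub> y \<in> carrier (P C)" unfolding p pr_ops(1)[OF p(1,3)] by (intro pr_in Cc p)
  show "x \<oplus>\<^bsub>P C\<^esub> y = y \<oplus>\<^bsub>P C\<^esub> x" unfolding p(2,4) pr_ops(1)[OF p(1,3)] pr_ops(1)[OF p(3,1)] by (simp add: add.commute)
  fix z assume "z \<in> carrier (P C)"
  then obtain s where s: "s \<in> C" "z = \<iota> s" using pr_carrier by meson
  show "x \<oplus>\<^bsub>P C\<^esub> y \<oplus>\<^bsub>P C\<^esub> z = x \<oplus>\<^bsub>P C\<^esub> (y \<oplus>\<^bsub>P C\<^esub> z)"
   unfolding p(2,4) s(2) pr_ops(1)[OF p(1,3)] pr_ops(1)[OF p(3) s(1)] pr_ops(1)[OF Cc(2)[OF p(1,3)] s(1)]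
    pr_ops(1)[OF p(1) Cc(2)[OF p(3) s(1)]] by (rule arg_cong[where f = \<iota>], rule restrict_ext) (simp add: add.assoc)
 next
  show "\<zero>\<^bsub>P C\<^esub> \<in> carrier (P C)" unfolding pr_ops by (intro pr_in Cc)
  fix x assume "x \<in> carrier (P C)"
  then obtain p where p: "p \<in> C" "x = \<iota> p" using pr_carrier by meson
  show "\<zero>\<^bsub>P C\<^esub> \<oplus>\<^bsub>P C\<^esub> x = x"
  proof -
   have "(\<lambda>x\<in>space V. (\<lambda>x\<in>space V. 0) x + p x) = (\<lambda>x\<in>space V. p x)" by (rule restrict_ext) simp
   then show ?thesis unfolding p(2) pr_ops(4) pr_ops(1)[OF Cc(1) p(1)] using ext_restrict[OF p(1)] by simp
  qed
  show "\<exists>y\<in>carrier (P C). y \<oplus>\<^bsub>P C\<^esub> x = \<zero>\<^bsub>P C\<^esub>"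
  proof
   show "\<iota> (\<lambda>x\<in>space V. -1 * p x) \<in> carrier (P C)" by (intro pr_in Cc p)
   show "\<iota> (\<lambda>x\<in>space V. -1 * p x) \<oplus>\<^bsub>P C\<^esub> x = \<zero>\<^bsub>P C\<^esub>"
    unfolding p(2) pr_ops(1)[OF Cc(4)[OF p(1)] p(1)] pr_ops(4) by (rule arg_cong[where f = \<iota>], rule restrict_ext) simp
  qed
 qed
 show "comm_monoid (P C)"
 proof (rule comm_monoidI)
  fix x y assume "x \<in> carrier (P C)" "y \<in> carrier (P C)"
  then obtain p q where p: "p \<in> C" "x = \<iota> p" "q \<in> C" "y = \<iota> q" using pr_carrier by meson
  show "x \<otimes>\<^bsub>P C\<^esub> y \<in> carrier (P C)" unfolding p pr_ops(2)[OF p(1,3)] by (intro pr_in Cc p)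
  show "x \<otimes>\<^bsub>P C\<^esub> y = y \<otimes>\<^bsub>P C\<^esub> x" unfolding p(2,4) pr_ops(2)[OF p(1,3)] pr_ops(2)[OF p(3,1)] by (simp add: mult.commute)
  fix z assume "z \<in> carrier (P C)"
  then obtain s where s: "s \<in> C" "z = \<iota> s" using pr_carrier by meson
  show "x \<otimes>\<^bsub>P C\<^esub> y \<otimes>\<^bsub>P C\<^esub> z = x \<otimes>\<^bsub>P C\<^esub> (y \<otimes>\<^bsub>P C\<^esub> z)"
   unfolding p(2,4) s(2) pr_ops(2)[OF p(1,3)] pr_ops(2)[OF p(3) s(1)] pr_ops(2)[OF Cc(3)[OF p(1,3)] s(1)]
    pr_ops(2)[OF p(1) Cc(3)[OF p(3) s(1)]] by (rule arg_cong[where f = \<iota>], rule restrict_ext) (simp add: mult.assoc)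
 next
  show "\<one>\<^bsub>P C\<^esub> \<in> carrier (P C)" unfolding pr_ops by (intro pr_in Cc)
  fix x assume "x \<in> carrier (P C)"
  then obtain p where p: "p \<in> C" "x = \<iota> p" using pr_carrier by meson
  have "(\<lambda>x\<in>space V. (\<lambda>x\<in>space V. 1) x * p x) = (\<lambda>x\<in>space V. p x)" by (rule restrict_ext) simp
  then show "\<one>\<^bsub>P C\<^esub> \<otimes>\<^bsub>P C\<^esub> x = x" unfolding p(2) pr_ops(5) pr_ops(2)[OF Cc(1) p(1)] using ext_restrict[OF p(1)] by simp
 qed
 fix x y z assume "x \<in> carrier (P C)" "y \<in> carrier (P C)" "z \<in> carrier (P C)"
 then obtain p q s where p: "p \<in> C" "x = \<iota> p" "q \<in> C" "y = \<iota> q" "s \<in> C" "z = \<iota> s" using pr_carrier by meson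
 show "(x \<oplus>\<^bsub>P C\<^esub> y) \<otimes>\<^bsub>P C\<^esub> z = x \<otimes>\<^bsub>P C\<^esub> z \<oplus>\<^bsub>P C\<^esub> y \<otimes>\<^bsub>P C\<^esub> z"
  unfolding p(2,4,6) pr_ops(1)[OF p(1,3)] pr_ops(2)[OF p(1,5)] pr_ops(2)[OF p(3,5)]
   pr_ops(2)[OF Cc(2)[OF p(1,3)] p(5)] pr_ops(1)[OF Cc(3)[OF p(1,5)] Cc(3)[OF p(3,5)]]
  by (rule arg_cong[where f = \<iota>], rule restrict_ext) (simp add: distrib_right)
qed

lemma pr_algebra: "algebra base_field (P C)"
proof (rule algebraI[OF cring_from_type_algebra pr_cring])
 have sc: "carrier (base_field :: 'k ring) = UNIV" "\<And>a b. a \<oplus>\<^bsub>base_field\<^esub> b = a + (b::'k)"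
  "\<And>a b. a \<otimes>\<^bsub>base_field\<^esub> b = a * (b::'k)" "\<one>\<^bsub>base_field\<^esub> = (1::'k)"
  by (simp_all add: ring_of_type_algebra_def)
 fix x assume "x \<in> carrier (P C)"
 then obtain p where p: "p \<in> C" "x = \<iota> p" using pr_carrier by meson
 show "c \<odot>\<^bsub>P C\<^esub> x \<in> carrier (P C)" for c unfolding p pr_ops(3)[OF p(1)] by (intro pr_in Cc p)
 show "(a \<oplus>\<^bsub>base_field\<^esub> b) \<odot>\<^bsub>P C\<^esub> x = a \<odot>\<^bsub>P C\<^esub> x \<oplus>\<^bsub>P C\<^esub> b \<odot>\<^bsub>P C\<^esub> x" for a b
  unfolding p(2) sc pr_ops(3)[OF p(1)] pr_ops(1)[OF Cc(4)[OF p(1)] Cc(4)[OF p(1)]]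
  by (rule arg_cong[where f = \<iota>], rule restrict_ext) (simp add: distrib_right)
 show "(a \<otimes>\<^bsub>base_field\<^esub> b) \<odot>\<^bsub>P C\<^esub> x = a \<odot>\<^bsub>P C\<^esub> (b \<odot>\<^bsub>P C\<^esub> x)" for a b
  unfolding p(2) sc pr_ops(3)[OF p(1)] pr_ops(3)[OF Cc(4)[OF p(1)]] by (rule arg_cong[where f = \<iota>], rule restrict_ext) (simp add: mult.assoc)
 show "\<one>\<^bsub>base_field\<^esub> \<odot>\<^bsub>P C\<^esub> x = x"
  unfolding p(2) sc pr_ops(3)[OF p(1)] using ext_restrict[OF p(1)] by simp
 fix y assume "y \<in> carrier (P C)"
 then obtain q where q: "q \<in> C" "y = \<iota> q" using pr_carrier by meson
 show "a \<odot>\<^bsub>P C\<^esub> (x \<oplus>\<^bsub>P C\<^esub> y) = a \<odot>\<^bsub>P C\<^esub> x \<oplus>\<^bsub>P C\<^esub> a \<odot>\<^bsub>P C\<^esub> y" for a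
  unfolding p(2) q(2) pr_ops(3)[OF p(1)] pr_ops(3)[OF q(1)] pr_ops(1)[OF p(1) q(1)]
   pr_ops(1)[OF Cc(4)[OF p(1)] Cc(4)[OF q(1)]] pr_ops(3)[OF Cc(2)[OF p(1) q(1)]]
  by (rule arg_cong[where f = \<iota>], rule restrict_ext) (simp add: distrib_left)
 show "(a \<odot>\<^bsub>P C\<^esub> x) \<otimes>\<^bsub>P C\<^esub> y = a \<odot>\<^bsub>P C\<^esub> (x \<otimes>\<^bsub>P C\<^esub> y)" for a
  unfolding p(2) q(2) pr_ops(3)[OF p(1)] pr_ops(2)[OF p(1) q(1)]
   pr_ops(2)[OF Cc(4)[OF p(1)] q(1)] pr_ops(3)[OF Cc(3)[OF p(1) q(1)]] by (rule arg_cong[where f = \<iota>], rule restrict_ext) (simp add: mult.assoc)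
qed

lemma pr_finsum:
 assumes "finite S" "\<And>d. d \<in> S \<Longrightarrow> q d \<in> C"
 shows "finsum (P C) (\<lambda>d. \<iota> (q d)) S = \<iota> (\<lambda>x\<in>space V. \<Sum>d\<in>S. q d x) \<and> (\<lambda>x\<in>space V. \<Sum>d\<in>S. q d x) \<in> C"
 using assms
proof (induction S rule: finite_induct)
 case empty
 interpret cring "P C" by (rule pr_cring)
 show ?case unfolding finsum_empty sum.empty pr_ops(4) using Cc(1)[of 0] by (intro conjI refl)
next
 case (insert d S)
 interpret cring "P C" by (rule pr_cring)
 let ?q = "\<lambda>x\<in>space V. \<Sum>d\<in>S. q d x"
 have IH: "finsum (P C) (\<lambda>d. \<iota> (q d)) S = \<iota> ?q" "?q \<in> C" using insert.IH[OF insert.prems] by blast+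
 have qd: "q d \<in> C" using insert by simp
 have e: "(\<lambda>x\<in>space V. \<Sum>d\<in>insert d S. q d x) = (\<lambda>x\<in>space V. q d x + ?q x)"
  by (rule restrict_ext) (use insert.hyps in simp)
 have "finsum (P C) (\<lambda>d. \<iota> (q d)) (insert d S) = \<iota> (q d) \<oplus>\<^bsub>P C\<^esub> \<iota> ?q"
  unfolding IH(1)[symmetric] by (rule finsum_insert) (use insert pr_in in \<open>auto simp: Pi_def\<close>)
 then show ?case unfolding e pr_ops(1)[OF qd IH(2)] using Cc(2)[OF qd IH(2)] by (intro conjI)
qed

end

lemma poly_compD: "p \<in> poly_comp V d \<Longrightarrow> hp V d p" "p \<in> poly_comp V d \<Longrightarrow> p \<in> polyfun V"
proof -
 assume p: "p \<in> poly_comp V d"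
 then show h: "hp V d p" by (simp add: poly_comp_iff)
 have "restrict p (space V) = p" using p by (simp add: poly_comp_iff extensional_restrict)
 then show "p \<in> polyfun V" using hp_pf[OF h] by (simp add: pf_def)
qed

lemma restrict_poly_comp: "hp V d f \<Longrightarrow> restrict f (space V) \<in> poly_comp V d" by (simp add: hp_restrict)

lemma iota_inj: "p \<in> polyfun V \<Longrightarrow> q \<in> polyfun V \<Longrightarrow> \<iota> p = \<iota> q \<Longrightarrow> p = q"
 by (drule arg_cong[where f = \<rho>]) (simp add: rho)

lemma polyfun_eqI: "p \<in> polyfun V \<Longrightarrow> q \<in> polyfun V \<Longrightarrow> (\<And>x. x \<in> space V \<Longrightarrow> p x = q x) \<Longrightarrow> p = q"
 by (rule extensionalityI[OF polyfun_extensional polyfun_extensional])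

lemma pract_iota: "p \<in> polyfun V \<Longrightarrow> pract G V \<iota> \<rho> g (\<iota> p) = \<iota> (\<lambda>x\<in>space V. p (act V (inv\<^bsub>G\<^esub> g) x))"
 by (simp add: pract_def rho)

lemma act_polyfun: "g \<in> carrier G \<Longrightarrow> p \<in> polyfun V \<Longrightarrow> (\<lambda>x\<in>space V. p (act V g x)) \<in> polyfun V"
 using pf_comp[OF lin_act pf_polyfun] by (simp add: pf_def)

lemma fixed_eq: "fixed_alg G (P (polyfun V)) (pract G V \<iota> \<rho>) = P Inv"
proof -
 have "(\<forall>g\<in>carrier G. pract G V \<iota> \<rho> g (\<iota> p) = \<iota> p) \<longleftrightarrow> invf G V p" if p: "p \<in> polyfun V" for p
 proof
  assume L: "\<forall>g\<in>carrier G. pract G V \<iota> \<rho> g (\<iota> p) = \<iota> p"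
  show "invf G V p" unfolding invf_def
  proof (intro ballI)
   fix g x assume g: "g \<in> carrier G" and x: "x \<in> space V"
   have "\<iota> (\<lambda>x\<in>space V. p (act V (inv\<^bsub>G\<^esub> (inv\<^bsub>G\<^esub> g)) x)) = \<iota> p"
    using bspec[OF L, of "inv\<^bsub>G\<^esub> g"] g unfolding pract_iota[OF p] by simp
   then have "(\<lambda>x\<in>space V. p (act V g x)) = p" using iota_inj[OF act_polyfun[OF g p] p] g by simp
   from fun_cong[OF this, of x] x show "p (act V g x) = p x" by simp
  qed
 next
  assume i: "invf G V p"
  show "\<forall>g\<in>carrier G. pract G V \<iota> \<rho> g (\<iota> p) = \<iota> p"
  proof
   fix g assume g: "g \<in> carrier G"
   then have "(\<lambda>x\<in>space V. p (act V (inv\<^bsub>G\<^esub> g) x)) = p"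
    by (intro polyfun_eqI act_polyfun p) (use i in \<open>simp_all add: invf_def\<close>)
   then show "pract G V \<iota> \<rho> g (\<iota> p) = \<iota> p" unfolding pract_iota[OF p] by simp
  qed
 qed
 then have "{a \<in> \<iota> ` polyfun V. \<forall>g\<in>carrier G. pract G V \<iota> \<rho> g a = a} = \<iota> ` Inv"
  unfolding Inv_def by blast
 then show ?thesis by (simp add: fixed_alg_def pr_def)
qed

definition H :: "('w \<Rightarrow> 'k) set \<Rightarrow> nat \<Rightarrow> ('w \<Rightarrow> 'k) set" where
 "H C n = {f. \<exists>F. (\<forall>d\<le>n. F d \<in> poly_comp V d \<inter> C) \<and> (\<forall>x\<in>space V. f x = (\<Sum>d\<le>n. F d x))}"

lemma HI: "(\<And>d. d \<le> n \<Longrightarrow> F d \<in> poly_comp V d \<inter> C) \<Longrightarrow> (\<And>x. x \<in> space V \<Longrightarrow> f x = (\<Sum>d\<le>n. F d x)) \<Longrightarrow> f \<in> H C n"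
 unfolding H_def by blast

lemma zero_comp: "(\<lambda>x\<in>space V. 0) \<in> poly_comp V d" by (rule restrict_poly_comp[OF hp_zero])

lemma H_single:
 assumes C: "pclosed V C" and p: "p \<in> poly_comp V d" "p \<in> C" "d \<le> n" shows "p \<in> H C n"
proof (rule HI[where F = "\<lambda>e. if e = d then p else (\<lambda>x\<in>space V. 0)"])
 show "(if e = d then p else (\<lambda>x\<in>space V. 0)) \<in> poly_comp V e \<inter> C" for e
  using p zero_comp[of e] pclosedD(2)[OF C, of 0] by auto
 fix x assume x: "x \<in> space V"
 have "(\<Sum>e\<le>n. (if e = d then p else (\<lambda>x\<in>space V. 0)) x) = (\<Sum>e\<le>n. if e = d then p x else 0)"
  by (intro sum.cong refl) (use x in auto)
 then show "p x = (\<Sum>e\<le>n. (if e = d then p else (\<lambda>x\<in>space V. 0)) x)" using p(3) by simp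
qed

lemma comp_upto_pr:
 assumes C: "pclosed V C"
 shows "comp_upto (P C) (\<lambda>d. \<iota> ` (poly_comp V d \<inter> C)) n = {\<iota> (restrict f (space V)) | f. f \<in> H C n}"
proof (intro Set.set_eqI iffI)
 fix a assume "a \<in> comp_upto (P C) (\<lambda>d. \<iota> ` (poly_comp V d \<inter> C)) n"
 then obtain x where x: "a = finsum (P C) x {..n}" "\<forall>d\<le>n. x d \<in> \<iota> ` (poly_comp V d \<inter> C)"
  unfolding comp_upto_def by blast
 have "\<forall>d. \<exists>q. d \<le> n \<longrightarrow> q \<in> poly_comp V d \<inter> C \<and> x d = \<iota> q" using x(2) by blast
 from choice[OF this] obtain q where q: "\<And>d. d \<le> n \<Longrightarrow> q d \<in> poly_comp V d \<inter> C \<and> x d = \<iota> (q d)" by blast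
 interpret cring "P C" by (rule pr_cring[OF C])
 have "finsum (P C) x {..n} = finsum (P C) (\<lambda>d. \<iota> (q d)) {..n}" by (rule finsum_cong') (use q pr_in[OF C] in auto)
 also have "\<dots> = \<iota> (\<lambda>x\<in>space V. \<Sum>d\<le>n. q d x)" using pr_finsum[OF C, of "{..n}" q] q by simp
 finally show "a \<in> {\<iota> (restrict f (space V)) | f. f \<in> H C n}"
  unfolding x(1) using HI[of n q C "\<lambda>x. \<Sum>d\<le>n. q d x"] q by blast
next
 fix a assume "a \<in> {\<iota> (restrict f (space V)) | f. f \<in> H C n}"
 then obtain f F where a: "a = \<iota> (restrict f (space V))" and F: "\<And>d. d \<le> n \<Longrightarrow> F d \<in> poly_comp V d \<inter> C"
  and e: "\<forall>x\<in>space V. f x = (\<Sum>d\<le>n. F d x)" unfolding H_def by blast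
 have "restrict f (space V) = (\<lambda>x\<in>space V. \<Sum>d\<le>n. F d x)" by (rule restrict_ext) (simp add: e)
 then have "a = finsum (P C) (\<lambda>d. \<iota> (F d)) {..n}" unfolding a using pr_finsum[OF C, of "{..n}" F] F by simp
 then show "a \<in> comp_upto (P C) (\<lambda>d. \<iota> ` (poly_comp V d \<inter> C)) n"
  unfolding comp_upto_def using F by (intro CollectI exI[of _ "\<lambda>d. \<iota> (F d)"]) auto
qed

lemma H_in_C: assumes C: "pclosed V C" and f: "f \<in> H C n" shows "restrict f (space V) \<in> C"
proof -
 obtain F where F: "\<And>d. d \<le> n \<Longrightarrow> F d \<in> poly_comp V d \<inter> C"
  and e: "\<forall>x\<in>space V. f x = (\<Sum>d\<le>n. F d x)" using f unfolding H_def by blast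
 have "restrict f (space V) = (\<lambda>x\<in>space V. \<Sum>d\<le>n. F d x)" by (rule restrict_ext) (simp add: e)
 then show ?thesis using pr_finsum[OF C, of "{..n}" F] F by simp
qed

lemma sub_pr:
 assumes C: "pclosed V C" and C': "pclosed V C'" "C' \<subseteq> C"
 shows "subring (\<iota> ` C') (P C)" and "b \<in> \<iota> ` C' \<Longrightarrow> c \<odot>\<^bsub>P C\<^esub> b \<in> \<iota> ` C'"
proof -
 interpret cring "P C" by (rule pr_cring[OF C])
 interpret C': cring "P C'" by (rule pr_cring[OF C'(1)])
 have "(P C)\<lparr>carrier := \<iota> ` C'\<rparr> = P C'" by (simp add: pr_def)
 then have "ring ((P C)\<lparr>carrier := \<iota> ` C'\<rparr>)" using C'.ring_axioms by simp
 moreover have "\<iota> ` C' \<subseteq> carrier (P C)" using C'(2) by (auto simp: pr_def)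
 ultimately show "subring (\<iota> ` C') (P C)" by (intro ring_incl_imp_subring)
 assume "b \<in> \<iota> ` C'"
 then obtain p where p: "p \<in> C'" "b = \<iota> p" by blast
 have "p \<in> C" using p(1) C'(2) by blast
 from pr_ops(3)[OF C this] show "c \<odot>\<^bsub>P C\<^esub> b \<in> \<iota> ` C'" unfolding p(2) using pclosedD(5)[OF C'(1) p(1)] by simp
qed

lemma pclosed_alg:
 assumes C: "pclosed V C" shows "pclosed V {p \<in> C. p \<in> alg (space V) S}"
proof -
 note Cc = pclosedD[OF C]
 have r: "restrict f (space V) \<in> alg (space V) S" if "f \<in> alg (space V) S" for f by (rule alg.cong[OF that]) simp
 show ?thesis unfolding pclosed_def
 proof (intro conjI allI ballI subsetI)
  show "(\<lambda>x\<in>space V. c) \<in> {p \<in> C. p \<in> alg (space V) S}" for c by (intro CollectI conjI Cc(2) r alg.const)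
  fix p q assume "p \<in> {p \<in> C. p \<in> alg (space V) S}" "q \<in> {p \<in> C. p \<in> alg (space V) S}"
  then show "(\<lambda>x\<in>space V. p x + q x) \<in> {p \<in> C. p \<in> alg (space V) S}" "(\<lambda>x\<in>space V. p x * q x) \<in> {p \<in> C. p \<in> alg (space V) S}"
   using Cc(3,4) r[OF alg.add] r[OF alg.mult] by blast+
 qed (use Cc(1) in blast)
qed

text \<open>A subring that contains the constants is closed under scalars, so it contains the
  algebra generated by any of its subsets.\<close>

lemma alg_subring:
 assumes C: "pclosed V C" and Q: "subring Q (P C)" "\<And>c. \<iota> (\<lambda>x\<in>space V. c) \<in> Q"
  and S: "\<And>f. f \<in> S \<Longrightarrow> restrict f (space V) \<in> C \<and> \<iota> (restrict f (space V)) \<in> Q" and f: "f \<in> alg (space V) S"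
 shows "restrict f (space V) \<in> C \<and> \<iota> (restrict f (space V)) \<in> Q"
 using f
proof (induction rule: alg.induct)
 case (const c) show ?case by (intro conjI pclosedD(2)[OF C] Q(2))
next
 case (incl f) then show ?case by (rule S)
next
 case (add f g)
 let ?f = "restrict f (space V)" and ?g = "restrict g (space V)"
 have e: "(\<lambda>x\<in>space V. f x + g x) = (\<lambda>x\<in>space V. ?f x + ?g x)" by (rule restrict_ext) simp
 have fg: "?f \<in> C" "?g \<in> C" using add.IH by blast+
 show ?case unfolding e
  by (intro conjI pclosedD(3)[OF C fg]) (unfold pr_ops(1)[OF C fg, symmetric], rule subringE(7)[OF Q(1) conjunct2[OF add.IH(1)] conjunct2[OF add.IH(2)]])
next
 case (mult f g)
 let ?f = "restrict f (space V)" and ?g = "restrict g (space V)"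
 have e: "(\<lambda>x\<in>space V. f x * g x) = (\<lambda>x\<in>space V. ?f x * ?g x)" by (rule restrict_ext) simp
 have fg: "?f \<in> C" "?g \<in> C" using mult.IH by blast+
 show ?case unfolding e
  by (intro conjI pclosedD(4)[OF C fg]) (unfold pr_ops(2)[OF C fg, symmetric], rule subringE(6)[OF Q(1) conjunct2[OF mult.IH(1)] conjunct2[OF mult.IH(2)]])
next
 case (cong f g)
 have "restrict g (space V) = restrict f (space V)" by (rule restrict_ext) (simp add: cong.hyps)
 then show ?case using cong.IH by simp
qed

text \<open>\<open>beta\<close> speaks of generation as a ring, \<open>alg\<close> of generation as
  an algebra. They agree because the constants lie in degree 0, hence among the generators.\<close>

lemma generate_pr:
 assumes C: "pclosed V C"
 shows "generate_ring (P C) (comp_upto (P C) (\<lambda>d. \<iota> ` (poly_comp V d \<inter> C)) n) = carrier (P C) \<longleftrightarrow>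
  (\<forall>p\<in>C. p \<in> alg (space V) (H C n))" (is "generate_ring _ ?K = _ \<longleftrightarrow> _")
proof
 interpret cring "P C" by (rule pr_cring[OF C])
 note Cc = pclosedD[OF C]
 have KC: "?K \<subseteq> carrier (P C)" unfolding comp_upto_pr[OF C] using H_in_C[OF C] pr_in[OF C] by blast
 {
  let ?D = "{p \<in> C. p \<in> alg (space V) (H C n)}"
  assume g: "generate_ring (P C) ?K = carrier (P C)"
  have "restrict f (space V) \<in> ?D" if "f \<in> H C n" for f
   using H_in_C[OF C that] alg.cong[OF alg.incl[OF that], of "space V" "restrict f (space V)"] by simp
  then have "?K \<subseteq> \<iota> ` ?D" unfolding comp_upto_pr[OF C] by blast
  from generate_ring_min_subring1[OF KC sub_pr(1)[OF C pclosed_alg[OF C]] this] have D: "carrier (P C) \<subseteq> \<iota> ` ?D"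
   unfolding g by blast
  show "\<forall>p\<in>C. p \<in> alg (space V) (H C n)"
  proof
   fix p assume p: "p \<in> C"
   obtain q where q: "q \<in> C" "\<iota> p = \<iota> q" "q \<in> alg (space V) (H C n)" using subsetD[OF D pr_in[OF C p]] by blast
   from iota_inj[OF Cc(1)[OF p] Cc(1)[OF q(1)] q(2)] q(3) show "p \<in> alg (space V) (H C n)" by simp
  qed
 next
  assume a: "\<forall>p\<in>C. p \<in> alg (space V) (H C n)"
  have k: "\<iota> (restrict f (space V)) \<in> generate_ring (P C) ?K" if "f \<in> H C n" for f
   by (rule generate_ring.incl) (use that comp_upto_pr[OF C] in blast)
  have c: "\<iota> (\<lambda>x\<in>space V. c) \<in> generate_ring (P C) ?K" for c
   using k[OF H_single[OF C restrict_poly_comp[OF hp_const[of V c]] Cc(2)]] by simp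
  have "\<iota> p \<in> generate_ring (P C) ?K" if p: "p \<in> C" for p
   using conjunct2[OF alg_subring[OF C generate_ring_is_subring[OF KC] c _ bspec[OF a p]]] H_in_C[OF C] k
   unfolding polyfun_restrict[OF Cc(1)[OF p]] by blast
  then have "carrier (P C) \<subseteq> generate_ring (P C) ?K" using pr_carrier[OF C] by blast
  then show "generate_ring (P C) ?K = carrier (P C)" using generate_ring_incl[OF KC] by blast
 }
qed

lemma H_polyfun: "H (polyfun V) n = {f. hle V n f}"
proof (intro Set.set_eqI iffI)
 fix f assume "f \<in> H (polyfun V) n"
 then show "f \<in> {f. hle V n f}" unfolding H_def hle_def using poly_compD(1) by blast
next
 fix f assume "f \<in> {f. hle V n f}"
 then obtain F where F: "\<forall>d\<le>n. hp V d (F d)" "\<forall>x\<in>space V. f x = (\<Sum>d\<le>n. F d x)" by (auto simp: hle_def)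
 show "f \<in> H (polyfun V) n"
 proof (rule HI[where F = "\<lambda>d. restrict (F d) (space V)"])
  fix d assume "d \<le> n"
  then have "restrict (F d) (space V) \<in> poly_comp V d" using F(1) by (intro restrict_poly_comp) simp
  then show "restrict (F d) (space V) \<in> poly_comp V d \<inter> polyfun V" by (intro IntI poly_compD(2))
 qed (simp add: F(2))
qed

lemma rey_hp: "hp V d f \<Longrightarrow> hp V d (rey G V f)"
 unfolding rey_def by (intro hp_cmult hp_sum hp_comp[OF lin_act])

text \<open>\<open>hle\<close> does not record that the components of an invariant are invariant;
  averaging them achieves this without changing their sum or their degrees.\<close>

lemma H_Inv: "H Inv n = {f. hle V n f \<and> invf G V f}"
proof (intro Set.set_eqI iffI)
 fix f assume "f \<in> H Inv n"
 then obtain F where F: "\<And>d. d \<le> n \<Longrightarrow> F d \<in> poly_comp V d \<inter> Inv" "\<And>x. x \<in> space V \<Longrightarrow> f x = (\<Sum>d\<le>n. F d x)"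
  unfolding H_def by blast
 have "hle V n f" unfolding hle_def using F poly_compD(1) by blast
 moreover have "invf G V f" unfolding invf_def
 proof (intro ballI)
  fix g x assume g: "g \<in> carrier G" and x: "x \<in> space V"
  have "(\<Sum>d\<le>n. F d (act V g x)) = (\<Sum>d\<le>n. F d x)"
   by (rule sum.cong[OF refl]) (use F(1) g x in \<open>auto simp: Inv_def invf_def\<close>)
  then show "f (act V g x) = f x" using F(2) g x by simp
 qed
 ultimately show "f \<in> {f. hle V n f \<and> invf G V f}" by simp
next
 fix f assume f: "f \<in> {f. hle V n f \<and> invf G V f}"
 then obtain F where F: "\<forall>d\<le>n. hp V d (F d)" "\<forall>x\<in>space V. f x = (\<Sum>d\<le>n. F d x)" by (auto simp: hle_def)
 show "f \<in> H Inv n"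
 proof (rule HI[where F = "\<lambda>d. restrict (rey G V (F d)) (space V)"])
  fix d assume "d \<le> n"
  then have h: "hp V d (rey G V (F d))" using F(1) by (intro rey_hp) simp
  have "invf G V (restrict (rey G V (F d)) (space V))" using rey_inv[of "F d"] by (simp add: invf_def)
  then show "restrict (rey G V (F d)) (space V) \<in> poly_comp V d \<inter> Inv" using restrict_poly_comp[OF h] poly_compD(2) by (simp add: Inv_def)
 next
  fix x assume x: "x \<in> space V"
  have "f x = rey G V f x" using rey_of_inv[OF cardG _ x, of f] f by simp
  also have "\<dots> = rey G V (\<lambda>x. \<Sum>d\<le>n. F d x) x" by (rule rey_cong[OF _ x]) (simp add: F(2))
  also have "\<dots> = (\<Sum>d\<le>n. rey G V (F d) x)"
   unfolding rey_def sum_distrib_left[symmetric] by (subst sum.swap) simp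
  finally show "f x = (\<Sum>d\<le>n. restrict (rey G V (F d)) (space V) x)" using x by simp
 qed
qed

lemma GC_alt: "GC G V n \<longleftrightarrow> (\<forall>p\<in>Inv. p \<in> alg (space V) (H Inv n))"
proof
 assume "GC G V n"
 then show "\<forall>p\<in>Inv. p \<in> alg (space V) (H Inv n)" unfolding GC_def H_Inv by (auto simp: Inv_def pf_polyfun)
next
 assume a: "\<forall>p\<in>Inv. p \<in> alg (space V) (H Inv n)"
 show "GC G V n" unfolding GC_def H_Inv[symmetric]
 proof (intro allI impI)
  fix f assume "pf V f" "invf G V f"
  then have "restrict f (space V) \<in> Inv" by (simp add: Inv_def pf_def invf_def)
  with a have "restrict f (space V) \<in> alg (space V) (H Inv n)" by blast
  then show "f \<in> alg (space V) (H Inv n)" by (rule alg.cong) simp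
 qed
qed

lemma beta_fixed_pr: "beta_fixed G (P (polyfun V)) (\<lambda>d. \<iota> ` poly_comp V d) (pract G V \<iota> \<rho>) = Inf {enat n | n. GC G V n}"
proof -
 have "\<iota> ` poly_comp V d \<inter> carrier (P Inv) = \<iota> ` (poly_comp V d \<inter> Inv)" for d
 proof -
  have "carrier (P Inv) = \<iota> ` Inv" by (simp add: pr_def)
  moreover have "p \<in> poly_comp V d \<Longrightarrow> q \<in> Inv \<Longrightarrow> \<iota> p = \<iota> q \<Longrightarrow> p = q" for p q
   using iota_inj poly_compD(2) by (simp add: Inv_def)
  ultimately show ?thesis by blast
 qed
 then show ?thesis unfolding beta_fixed_def fixed_eq beta_def using generate_pr[OF pclosed_Inv] GC_alt by simp
qed

lemma beta_pr: "beta (P (polyfun V)) (\<lambda>d. \<iota> ` poly_comp V d) \<le> 1"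
proof -
 have e: "poly_comp V d = poly_comp V d \<inter> polyfun V" for d using poly_compD(2) by blast
 have "p \<in> alg (space V) (H (polyfun V) 1)" if "p \<in> polyfun V" for p
  using that
 proof (induction rule: polyfun.induct)
  case (const c) show ?case by (rule alg.cong[OF alg.const[of c]]) simp
 next
  case (form l)
  have "hle V 1 l" by (rule hp_hle[OF hp_form[OF form]]) simp
  then have "l \<in> alg (space V) (H (polyfun V) 1)" unfolding H_polyfun by (intro alg.incl) simp
  then show ?case by (rule alg.cong) simp
 next
  case (add p q) show ?case by (rule alg.cong[OF alg.add[OF add.IH]]) simp
 next
  case (mult p q) show ?case by (rule alg.cong[OF alg.mult[OF mult.IH]]) simp
 qed
 then have "generate_ring (P (polyfun V)) (comp_upto (P (polyfun V)) (\<lambda>d. \<iota> ` poly_comp V d) 1) = carrier (P (polyfun V))"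
  using generate_pr[OF pclosed_polyfun, of 1] e by simp
 then show ?thesis unfolding beta_def one_enat_def by (intro Inf_lower) blast
qed

lemma graded_action_pr: "graded_G_action G (P (polyfun V)) (\<lambda>d. \<iota> ` poly_comp V d) (pract G V \<iota> \<rho>)"
 unfolding graded_G_action_def
proof (intro conjI ballI allI)
 note C = pclosed_polyfun
 note ops = pr_ops[OF C]
 have car: "carrier (P (polyfun V)) = \<iota> ` polyfun V" by (simp add: pr_def)
 have inv: "inv\<^bsub>G\<^esub> g \<in> carrier G" if "g \<in> carrier G" for g using that by simp
 have ap: "(\<lambda>x\<in>space V. p (act V (inv\<^bsub>G\<^esub> g) x)) \<in> polyfun V" if "g \<in> carrier G" "p \<in> polyfun V" for g p
  by (rule act_polyfun[OF inv that(2)]) (rule that)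
 show "group_action G (carrier (P (polyfun V))) (pract G V \<iota> \<rho>)"
  unfolding car
 proof (rule group_actionI[OF group_G])
  fix g assume g: "g \<in> carrier G"
  show "pract G V \<iota> \<rho> g \<in> extensional (\<iota> ` polyfun V)" unfolding pract_def by (rule restrict_extensional)
  fix a assume "a \<in> \<iota> ` polyfun V"
  then obtain p where p: "p \<in> polyfun V" "a = \<iota> p" by blast
  show "pract G V \<iota> \<rho> g a \<in> \<iota> ` polyfun V" unfolding p(2) pract_iota[OF p(1)] using ap[OF g p(1)] by blast
  fix h assume h: "h \<in> carrier G"
  have "(\<lambda>x\<in>space V. p (act V (inv\<^bsub>G\<^esub> (h \<otimes>\<^bsub>G\<^esub> g)) x)) =
    (\<lambda>x\<in>space V. (\<lambda>x\<in>space V. p (act V (inv\<^bsub>G\<^esub> g) x)) (act V (inv\<^bsub>G\<^esub> h) x))"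
   by (rule restrict_ext) (use g h in \<open>simp add: G.inv_mult_group act_mult\<close>)
  then show "pract G V \<iota> \<rho> (h \<otimes>\<^bsub>G\<^esub> g) a = pract G V \<iota> \<rho> h (pract G V \<iota> \<rho> g a)"
   unfolding p(2) pract_iota[OF p(1)] pract_iota[OF ap[OF g p(1)]] by simp
 next
  fix a assume "a \<in> \<iota> ` polyfun V"
  then obtain p where p: "p \<in> polyfun V" "a = \<iota> p" by blast
  have "(\<lambda>x\<in>space V. p (act V (inv\<^bsub>G\<^esub> \<one>\<^bsub>G\<^esub>) x)) = p"
   by (rule polyfun_eqI[OF act_polyfun p(1)]) (use p in simp_all)
  then show "pract G V \<iota> \<rho> \<one>\<^bsub>G\<^esub> a = a" unfolding p(2) pract_iota[OF p(1)] by simp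
 qed
 fix g assume g: "g \<in> carrier G"
 have ig: "inv\<^bsub>G\<^esub> g \<in> carrier G" using g by simp
 have mem: "act V (inv\<^bsub>G\<^esub> g) x \<in> space V" if "x \<in> space V" for x using that ig by simp
 show "pract G V \<iota> \<rho> g \<in> Ring.ring_hom (P (polyfun V)) (P (polyfun V))"
 proof (rule ring_hom_memI)
  fix a b assume "a \<in> carrier (P (polyfun V))" "b \<in> carrier (P (polyfun V))"
  then obtain p q where p: "p \<in> polyfun V" "a = \<iota> p" "q \<in> polyfun V" "b = \<iota> q" unfolding car by blast
  show "pract G V \<iota> \<rho> g a \<in> carrier (P (polyfun V))" unfolding car p(2) pract_iota[OF p(1)] using ap[OF g p(1)] by blast
  show "pract G V \<iota> \<rho> g (a \<otimes>\<^bsub>P (polyfun V)\<^esub> b) = pract G V \<iota> \<rho> g a \<otimes>\<^bsub>P (polyfun V)\<^esub> pract G V \<iota> \<rho> g b"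
   unfolding p(2,4) ops(2)[OF p(1,3)] pract_iota[OF p(1)] pract_iota[OF p(3)] ops(2)[OF ap[OF g p(1)] ap[OF g p(3)]]
    pract_iota[OF polyfun.mult[OF p(1,3)]] by (rule arg_cong[where f = \<iota>], rule restrict_ext) (simp add: mem)
  show "pract G V \<iota> \<rho> g (a \<oplus>\<^bsub>P (polyfun V)\<^esub> b) = pract G V \<iota> \<rho> g a \<oplus>\<^bsub>P (polyfun V)\<^esub> pract G V \<iota> \<rho> g b"
   unfolding p(2,4) ops(1)[OF p(1,3)] pract_iota[OF p(1)] pract_iota[OF p(3)] ops(1)[OF ap[OF g p(1)] ap[OF g p(3)]]
    pract_iota[OF polyfun.add[OF p(1,3)]] by (rule arg_cong[where f = \<iota>], rule restrict_ext) (simp add: mem)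
 next
  show "pract G V \<iota> \<rho> g \<one>\<^bsub>P (polyfun V)\<^esub> = \<one>\<^bsub>P (polyfun V)\<^esub>"
   unfolding ops(5) pract_iota[OF polyfun.const] by (rule arg_cong[where f = \<iota>], rule restrict_ext) (simp add: mem)
 qed
 fix c a assume "a \<in> carrier (P (polyfun V))"
 then obtain p where p: "p \<in> polyfun V" "a = \<iota> p" unfolding car by blast
 show "pract G V \<iota> \<rho> g (c \<odot>\<^bsub>P (polyfun V)\<^esub> a) = c \<odot>\<^bsub>P (polyfun V)\<^esub> pract G V \<iota> \<rho> g a"
  unfolding p(2) ops(3)[OF p(1)] pract_iota[OF p(1)] ops(3)[OF ap[OF g p(1)]] pract_iota[OF pclosedD(5)[OF C p(1)]]
  by (rule arg_cong[where f = \<iota>], rule restrict_ext) (simp add: mem)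
next
 fix g d a assume g: "g \<in> carrier G" and "a \<in> \<iota> ` poly_comp V d"
 then obtain p where p: "p \<in> poly_comp V d" "a = \<iota> p" by blast
 have "(\<lambda>x\<in>space V. p (act V (inv\<^bsub>G\<^esub> g) x)) \<in> poly_comp V d"
  by (rule restrict_poly_comp[OF hp_comp[OF lin_act poly_compD(1)[OF p(1)]]]) (use g in simp)
 then show "pract G V \<iota> \<rho> g a \<in> \<iota> ` poly_comp V d" unfolding p(2) pract_iota[OF poly_compD(2)[OF p(1)]] by blast
qed

text \<open>Homogeneous components exist by \<open>pf_hle\<close>. Their uniqueness rests on the
  infinite ground field, over which a function determines its homogeneous parts.\<close>

lemma graded_pr: "graded_algebra (P (polyfun V)) (\<lambda>d. \<iota> ` poly_comp V d)"
proof -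
 note C = pclosed_polyfun
 note ops = pr_ops[OF C]
 let ?R = "P (polyfun V)" and ?A = "\<lambda>d. \<iota> ` poly_comp V d"
 let ?N = "\<lambda>x. {d. x d \<noteq> \<zero>\<^bsub>?R\<^esub>}"
 have car: "carrier ?R = \<iota> ` polyfun V" by (simp add: pr_def)
 have 1: "?A d \<subseteq> carrier ?R \<and> \<zero>\<^bsub>?R\<^esub> \<in> ?A d \<and> (\<forall>a\<in>?A d. \<forall>b\<in>?A d. a \<oplus>\<^bsub>?R\<^esub> b \<in> ?A d) \<and>
   (\<forall>c. \<forall>a\<in>?A d. c \<odot>\<^bsub>?R\<^esub> a \<in> ?A d)" for d
 proof (intro conjI allI ballI)
  show "?A d \<subseteq> carrier ?R" unfolding car using poly_compD(2) by blast
  show "\<zero>\<^bsub>?R\<^esub> \<in> ?A d" unfolding ops(4) using zero_comp by blast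
  fix a assume "a \<in> ?A d" then obtain p where p: "p \<in> poly_comp V d" "a = \<iota> p" by blast
  show "c \<odot>\<^bsub>?R\<^esub> a \<in> ?A d" for c unfolding p(2) ops(3)[OF poly_compD(2)[OF p(1)]]
   using restrict_poly_comp[OF hp_cmult[OF poly_compD(1)[OF p(1)]]] by blast
  fix b assume "b \<in> ?A d" then obtain q where q: "q \<in> poly_comp V d" "b = \<iota> q" by blast
  show "a \<oplus>\<^bsub>?R\<^esub> b \<in> ?A d" unfolding p(2) q(2) ops(1)[OF poly_compD(2)[OF p(1)] poly_compD(2)[OF q(1)]]
   using restrict_poly_comp[OF hp_add[OF poly_compD(1)[OF p(1)] poly_compD(1)[OF q(1)]]] by blast
 qed
 have 2: "\<one>\<^bsub>?R\<^esub> \<in> ?A 0" unfolding ops(5) using restrict_poly_comp[OF hp_const[of V 1]] by blast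
 have 3: "a \<otimes>\<^bsub>?R\<^esub> b \<in> ?A (d + e)" if ab: "a \<in> ?A d" "b \<in> ?A e" for a b d e
 proof -
  obtain p q where p: "p \<in> poly_comp V d" "a = \<iota> p" and q: "q \<in> poly_comp V e" "b = \<iota> q" using ab by blast
  show ?thesis unfolding p(2) q(2) ops(2)[OF poly_compD(2)[OF p(1)] poly_compD(2)[OF q(1)]]
   using restrict_poly_comp[OF hp_mult[OF poly_compD(1)[OF p(1)] poly_compD(1)[OF q(1)]]] by blast
 qed
 \<comment> \<open>A sum over the support becomes a sum up to n, so that two families with different
   supports can be compared.\<close>
 have eval: "\<rho> a v = (\<Sum>d\<le>n. \<rho> (x d) v)"
  if x: "\<forall>d. x d \<in> ?A d" and S: "(?N x) \<subseteq> {..n}" and a: "a = finsum ?R x (?N x)"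
   and v: "v \<in> space V" for a x n v
 proof -
  let ?S = "(?N x)"
  have xr: "x d = \<iota> (\<rho> (x d))" "\<rho> (x d) \<in> polyfun V" for d
  proof -
   from x obtain p where p: "p \<in> poly_comp V d" "x d = \<iota> p" by blast
   then show "x d = \<iota> (\<rho> (x d))" "\<rho> (x d) \<in> polyfun V" using rho[OF poly_compD(2)[OF p(1)]] poly_compD(2) by simp_all
  qed
  have fS: "finite ?S" using S finite_subset by blast
  have "a = finsum ?R (\<lambda>d. \<iota> (\<rho> (x d))) ?S" unfolding a using xr(1) by (simp only:)
  then have a': "a = \<iota> (\<lambda>v\<in>space V. \<Sum>d\<in>?S. \<rho> (x d) v)" and m: "(\<lambda>v\<in>space V. \<Sum>d\<in>?S. \<rho> (x d) v) \<in> polyfun V"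
   using pr_finsum[OF C fS, of "\<lambda>d. \<rho> (x d)"] xr(2) by simp_all
  have "\<rho> a v = (\<Sum>d\<in>?S. \<rho> (x d) v)" unfolding a' rho[OF m] using v by simp
  also have "\<dots> = (\<Sum>d\<le>n. \<rho> (x d) v)"
  proof (rule sum.mono_neutral_left)
   have "\<rho> \<zero>\<^bsub>?R\<^esub> v = 0" unfolding ops(4) using rho[OF polyfun.const[where c = 0]] v by simp
   then show "\<forall>d\<in>{..n} - ?S. \<rho> (x d) v = 0" by auto
  qed (use S in auto)
  finally show ?thesis .
 qed
 have 4: "\<exists>!x. (\<forall>d. x d \<in> ?A d) \<and> finite (?N x) \<and> a = finsum ?R x (?N x)"
  if aR: "a \<in> carrier ?R" for a
 proof (rule ex_ex1I)
  obtain p where p: "p \<in> polyfun V" "a = \<iota> p" using aR unfolding car by blast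
  obtain n where "hle V n p" using pf_hle[OF pf_polyfun[OF p(1)]] by blast
  then obtain F where F: "\<forall>d\<le>n. hp V d (F d)" "\<forall>x\<in>space V. p x = (\<Sum>d\<le>n. F d x)" by (auto simp: hle_def)
  \<comment> \<open>Zero above n, so that the family has finite support.\<close>
  define q where "q d = (\<lambda>x\<in>space V. if d \<le> n then F d x else 0)" for d
  have q: "q d \<in> poly_comp V d" for d
   unfolding q_def by (rule restrict_poly_comp) (use F(1) hp_zero in \<open>cases "d \<le> n"; simp\<close>)
  let ?S = "{d. \<iota> (q d) \<noteq> \<zero>\<^bsub>?R\<^esub>}"
  have S: "?S \<subseteq> {..n}"
  proof
   fix d assume "d \<in> ?S"
   then have "\<iota> (q d) \<noteq> \<iota> (\<lambda>x\<in>space V. 0)" unfolding ops(4) by simp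
   then show "d \<in> {..n}" by (cases "d \<le> n") (simp_all add: q_def)
  qed
  have fS: "finite ?S" using S finite_subset by blast
  have q0: "q d x = 0" if "d \<notin> ?S" "x \<in> space V" for d x
  proof -
   have "q d = (\<lambda>x\<in>space V. 0)" by (rule iota_inj[OF poly_compD(2)[OF q] polyfun.const]) (use that ops(4) in simp)
   then show ?thesis using that by simp
  qed
  have "p = (\<lambda>x\<in>space V. \<Sum>d\<in>?S. q d x)"
  proof (rule polyfun_eqI[OF p(1)])
   show "(\<lambda>x\<in>space V. \<Sum>d\<in>?S. q d x) \<in> polyfun V" using pr_finsum[OF C fS, of q] poly_compD(2)[OF q] by blast
   fix x assume x: "x \<in> space V"
   have "(\<Sum>d\<in>?S. q d x) = (\<Sum>d\<le>n. q d x)" by (rule sum.mono_neutral_left) (use S q0[OF _ x] in auto)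
   also have "\<dots> = (\<Sum>d\<le>n. F d x)" by (rule sum.cong) (use x in \<open>auto simp: q_def\<close>)
   finally show "p x = (\<lambda>x\<in>space V. \<Sum>d\<in>?S. q d x) x" using F(2) x by simp
  qed
  note e = this
  have "finsum ?R (\<lambda>d. \<iota> (q d)) ?S = \<iota> (\<lambda>x\<in>space V. \<Sum>d\<in>?S. q d x)"
   by (rule conjunct1[OF pr_finsum[OF C fS]]) (rule poly_compD(2)[OF q])
  then have "a = finsum ?R (\<lambda>d. \<iota> (q d)) ?S"
   unfolding p(2) by (simp only: arg_cong[OF e, of \<iota>])
  then show "\<exists>x. (\<forall>d. x d \<in> ?A d) \<and> finite (?N x) \<and> a = finsum ?R x (?N x)"
   by (intro exI[of _ "\<lambda>d. \<iota> (q d)"] conjI allI imageI q fS)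
 next
  fix x y assume
   x: "(\<forall>d. x d \<in> ?A d) \<and> finite (?N x) \<and> a = finsum ?R x (?N x)" and
   y: "(\<forall>d. y d \<in> ?A d) \<and> finite (?N y) \<and> a = finsum ?R y (?N y)"
  have xA: "\<exists>p. p \<in> poly_comp V d \<and> x d = \<iota> p" and yA: "\<exists>p. p \<in> poly_comp V d \<and> y d = \<iota> p" for d
   using conjunct1[OF x, rule_format, of d] conjunct1[OF y, rule_format, of d] by blast+
  show "x = y"
  proof
   fix d
   obtain n where n: "(?N x) \<union> (?N y) \<union> {d} \<subseteq> {..n}"
    using finite_nat_set_iff_bounded_le[of "(?N x) \<union> (?N y) \<union> {d}"] x y by blast
   obtain p q where p: "p \<in> poly_comp V d" "x d = \<iota> p" and q: "q \<in> poly_comp V d" "y d = \<iota> q" using xA yA by blast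
   have hx: "hp V e (\<rho> (x e))" and hy: "hp V e (\<rho> (y e))" for e
   proof -
    from xA obtain p where "p \<in> poly_comp V e" "x e = \<iota> p" by blast
    then show "hp V e (\<rho> (x e))" using rho poly_compD by simp
    from yA obtain p where "p \<in> poly_comp V e" "y e = \<iota> p" by blast
    then show "hp V e (\<rho> (y e))" using rho poly_compD by simp
   qed
   have "\<rho> (x d) v + - 1 * \<rho> (y d) v = 0" if v: "v \<in> space V" for v
   proof (rule homogeneous_components_zero[OF infinite_alg_closed, where n = n and F = "\<lambda>e v. \<rho> (x e) v + - 1 * \<rho> (y e) v"])
    show "hp V e (\<lambda>v. \<rho> (x e) v + - 1 * \<rho> (y e) v)" for e by (intro hp_add hp_cmult hx hy)
    fix u assume u: "u \<in> space V"
    have "(\<Sum>e\<le>n. \<rho> (x e) u) = (\<Sum>e\<le>n. \<rho> (y e) u)" using eval[of x n a u] eval[of y n a u] x y n u by simp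
    then show "(\<Sum>e\<le>n. \<rho> (x e) u + - 1 * \<rho> (y e) u) = 0" by (simp add: sum_subtractf)
   qed (use n v in auto)
   then have "p = q" using p q rho poly_compD(2) by (intro polyfun_eqI) auto
   then show "x d = y d" using p q by simp
  qed
 qed
 show ?thesis unfolding graded_algebra_def
 proof (rule conjI[OF pr_algebra[OF C] conjI[OF pr_cring[OF C] conjI[OF allI[OF 1] conjI[OF 2 conjI]]]])
  show "\<forall>d e. \<forall>a\<in>?A d. \<forall>b\<in>?A e. a \<otimes>\<^bsub>?R\<^esub> b \<in> ?A (d + e)" by (intro allI ballI 3)
  show "\<forall>a\<in>carrier ?R. \<exists>!x. (\<forall>d. x d \<in> ?A d) \<and> finite (?N x) \<and> a = finsum ?R x (?N x)" by (intro ballI 4)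
 qed
qed

end

lemma alg_mono: "S \<subseteq> T \<Longrightarrow> f \<in> alg Y S \<Longrightarrow> f \<in> alg Y T"
 by (rule alg_comp[of f Y S Y "\<lambda>x. x" T]) (auto intro: alg.incl)

lemma GC_mono: "GC G V n \<Longrightarrow> n \<le> m \<Longrightarrow> GC G V m"
proof -
 assume g: "GC G V n" and nm: "n \<le> m"
 have "{f. hle V n f \<and> invf G V f} \<subseteq> {f. hle V m f \<and> invf G V f}" using hle_mono[OF _ nm] by blast
 from alg_mono[OF this] g show "GC G V m" unfolding GC_def by (simp add: subset_iff)
qed

section \<open>Polynomials encoded by elements of the ground field\<close>

definition pe :: "('i \<Rightarrow> 'x \<Rightarrow> 'k::comm_ring_1) \<Rightarrow> ('k \<times> 'i list) list \<Rightarrow> 'x \<Rightarrow> 'k" where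
 "pe e L x = sum_list (map (\<lambda>a. fst a * prod_list (map (\<lambda>i. e i x) (snd a))) L)"

definition pmul :: "('k::comm_ring_1 \<times> 'i list) list \<Rightarrow> ('k \<times> 'i list) list \<Rightarrow> ('k \<times> 'i list) list" where
 "pmul L L' = concat (map (\<lambda>a. map (\<lambda>b. (fst a * fst b, snd a @ snd b)) L') L)"

lemma pe_append: "pe e (L @ L') x = pe e L x + pe e L' x" by (simp add: pe_def)

lemma pe_pmul: "pe e (pmul L L') x = pe e L x * pe e L' x"
proof (induction L)
 case (Cons a L)
 have "pe e (map (\<lambda>b. (fst a * fst b, snd a @ snd b)) L') x = fst a * prod_list (map (\<lambda>i. e i x) (snd a)) * pe e L' x"
  by (induction L') (simp_all add: pe_def algebra_simps)
 then show ?case using Cons by (simp add: pmul_def pe_append) (simp add: pe_def algebra_simps)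
qed (simp add: pe_def pmul_def)

text \<open>Lists over a type encoded in the type itself by means of an injective pairing; the tags
  0 and 1 distinguish the empty list from the others.\<close>

primrec enc :: "('c::zero_neq_one \<times> 'c \<Rightarrow> 'c) \<Rightarrow> 'c list \<Rightarrow> 'c" where
 "enc \<pi> [] = \<pi> (0, 0)"
| "enc \<pi> (a # l) = \<pi> (1, \<pi> (a, enc \<pi> l))"

lemma enc_inj: assumes "inj \<pi>" shows "enc \<pi> l = enc \<pi> l' \<Longrightarrow> l = l'"
proof (induction l arbitrary: l')
 case Nil then show ?case by (cases l') (simp_all add: inj_eq[OF assms])
next
 case (Cons a l) then show ?case by (cases l') (simp_all add: inj_eq[OF assms])
qed

context gm begin

text \<open>The coordinates are indexed by elements of k, of which there are enough as k is
  infinite. A monomial is thus a list over k, and a polynomial a list of such lists with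
  coefficients.\<close>

lemma pe_surj:
 assumes fdM: "fin_dim M" and inf: "infinite (UNIV :: 'k set)"
 shows "\<exists>e :: 'k \<Rightarrow> 'v \<Rightarrow> 'k. \<forall>p. pf M p \<longrightarrow> (\<exists>L. \<forall>x\<in>space M. p x = pe e L x)"
proof -
 obtain B where B: "finite B" "B \<subseteq> space M" "vs.independent B" "vs.span B = space M" "card B = gdim M" by (rule fin_dim_basis[OF fdM])
 obtain T :: "'k set" where T: "finite T" "card T = card B" using infinite_arbitrarily_large[OF inf] by blast
 obtain \<beta> where \<beta>: "bij_betw \<beta> B T" using finite_same_card_bij[OF B(1) T(1)] T(2) by auto
 obtain bl where bl: "set bl = B" "distinct bl" using finite_distinct_list[OF B(1)] by blast
 define e where "e i x = vs.representation B x (inv_into B \<beta> i)" for i x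
 have e: "e (\<beta> b) x = vs.representation B x b" if "b \<in> B" for b x
  unfolding e_def using bij_betw_inv_into_left[OF \<beta> that] by simp
 have "\<exists>L. \<forall>x\<in>space M. p x = pe e L x" if "pf M p" for p
  using that
 proof (induction rule: pf_induct)
  case (cong f g)
  from cong(2) obtain L where "\<forall>x\<in>space M. f x = pe e L x" by blast
  then have "\<forall>x\<in>space M. g x = pe e L x" using cong(1) by simp
  then show ?case by blast
 next
  case (const c)
  have "\<forall>x\<in>space M. c = pe e [(c, [])] x" by (simp add: pe_def)
  then show ?case by blast
 next
  case (form k)
  let ?L = "map (\<lambda>b. (k b, [\<beta> b])) bl"
  have "k x = pe e ?L x" if x: "x \<in> space M" for x
  proof -
   have "k x = k (\<Sum>b\<in>B. scal M (vs.representation B x b) b)" using basis_expand[OF B(1,3,4) x] by simp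
   also have "\<dots> = (\<Sum>b\<in>B. k (scal M (vs.representation B x b) b))" by (rule linear_form_sum[OF form]) (use B(2) scal_mem in blast)
   also have "\<dots> = (\<Sum>b\<in>B. k b * e (\<beta> b) x)"
    by (rule sum.cong[OF refl]) (use form B(2) in \<open>auto simp: linear_form_def e\<close>)
   also have "\<dots> = pe e ?L x" by (simp add: pe_def o_def sum_list_distinct_conv_sum_set[OF bl(2)] bl(1))
   finally show ?thesis .
  qed
  then show ?case by blast
 next
  case (add f g)
  from add.IH obtain L L' where "\<forall>x\<in>space M. f x = pe e L x" "\<forall>x\<in>space M. g x = pe e L' x" by blast
  then have "\<forall>x\<in>space M. f x + g x = pe e (L @ L') x" by (simp add: pe_append)
  then show ?case by blast
 next
  case (mult f g)
  from mult.IH obtain L L' where "\<forall>x\<in>space M. f x = pe e L x" "\<forall>x\<in>space M. g x = pe e L' x" by blast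
  then have "\<forall>x\<in>space M. f x * g x = pe e (pmul L L') x" by (simp add: pe_pmul)
  then show ?case by blast
 qed
 then show ?thesis by (intro exI[of _ e]) blast
qed

text \<open>A polynomial function is determined by a list of coefficients and monomials over k. As k
  is infinite, pairs of elements embed into k; iterating the pairing encodes the list by one element
  of k, which \<open>f0\<close> sends to the universe.\<close>

lemma polyfun_inj:
 fixes f0 :: "'k \<Rightarrow> 'a"
 assumes fdM: "fin_dim M" and inf: "infinite (UNIV :: 'k set)" and f0: "inj f0"
 shows "\<exists>\<iota> :: ('v \<Rightarrow> 'k) \<Rightarrow> 'a. inj_on \<iota> (polyfun M)"
proof -
 have "\<exists>\<pi> :: 'k \<times> 'k \<Rightarrow> 'k. inj_on \<pi> (UNIV \<times> UNIV) \<and> \<pi> ` (UNIV \<times> UNIV) \<subseteq> UNIV"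
  by (rule card_of_ordLeq[THEN iffD2, OF ordIso_imp_ordLeq[OF card_of_Times_same_infinite[OF inf]]])
 then obtain \<pi> :: "'k \<times> 'k \<Rightarrow> 'k" where \<pi>: "inj \<pi>" by auto
 obtain e :: "'k \<Rightarrow> 'v \<Rightarrow> 'k" where e: "\<forall>p. pf M p \<longrightarrow> (\<exists>L. \<forall>x\<in>space M. p x = pe e L x)"
  using pe_surj[OF fdM inf] by (elim exE)
 have "\<forall>p. \<exists>L. pf M p \<longrightarrow> (\<forall>x\<in>space M. p x = pe e L x)" using e by blast
 from choice[OF this] obtain L where L: "\<forall>p. pf M p \<longrightarrow> (\<forall>x\<in>space M. p x = pe e (L p) x)" by blast
 define cd where "cd K = enc \<pi> (map (\<lambda>a. enc \<pi> (fst a # snd a)) K)" for K :: "('k \<times> 'k list) list"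
 have cd: "K = K'" if c: "cd K = cd K'" for K K'
 proof -
  have "map (\<lambda>a. enc \<pi> (fst a # snd a)) K = map (\<lambda>a. enc \<pi> (fst a # snd a)) K'"
   using enc_inj[OF \<pi>] c unfolding cd_def by simp
  moreover have "inj (\<lambda>a :: 'k \<times> 'k list. enc \<pi> (fst a # snd a))"
  proof (rule injI)
   fix a b :: "'k \<times> 'k list" assume "enc \<pi> (fst a # snd a) = enc \<pi> (fst b # snd b)"
   from enc_inj[OF \<pi> this] show "a = b" by (simp add: prod_eq_iff)
  qed
  ultimately show ?thesis using map_injective by blast
 qed
 have "inj_on (\<lambda>p. f0 (cd (L p))) (polyfun M)"
 proof (rule inj_onI)
  fix p q assume p: "p \<in> polyfun M" and q: "q \<in> polyfun M" and eq: "f0 (cd (L p)) = f0 (cd (L q))"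
  have "L p = L q" by (rule cd) (use eq f0 in \<open>simp add: inj_eq\<close>)
  then have "p x = q x" if "x \<in> space M" for x using L[rule_format, OF pf_polyfun[OF p] that] L[rule_format, OF pf_polyfun[OF q] that] by simp
  then show "p = q" by (rule extensionalityI[OF polyfun_extensional[OF p] polyfun_extensional[OF q]])
 qed
 then show ?thesis by blast
qed

text \<open>\<open>ell\<close> ranges over modules with underlying space in
  \<open>nat \<Rightarrow> 'k\<close>; coordinates with respect to a basis carry any finite
  dimensional simple module there.\<close>

lemma simple_transport:
 assumes s: "simple_gmod G M" and fdM: "fin_dim M"
 shows "\<exists>N :: ('k, 'g, nat \<Rightarrow> 'k) gmod. simple_gmod G N \<and> fin_dim N \<and> gdim N = gdim M"
proof -
 obtain B where B: "finite B" "B \<subseteq> space M" "vs.independent B" "vs.span B = space M" "card B = gdim M" by (rule fin_dim_basis[OF fdM])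
 obtain h where h: "bij_betw h B {..<card B}" using ex_bij_betw_finite_nat[OF B(1)] by (auto simp: lessThan_atLeast0)
 define \<kappa> :: "'v \<Rightarrow> nat \<Rightarrow> 'k" where "\<kappa> v = (\<lambda>i. vs.representation B v (inv_into B h i) * (if i < card B then 1 else 0))" for v
 have kadd: "\<kappa> (x + y) = \<kappa> x + \<kappa> y" if "x \<in> space M" "y \<in> space M" for x y
  using that B(3,4) by (auto simp: \<kappa>_def fun_eq_iff vs.representation_add distrib_right)
 have kscal: "\<kappa> (scal M c x) = (\<lambda>i. c * \<kappa> x i)" if "x \<in> space M" for x c
  using that B(3,4) by (auto simp: \<kappa>_def fun_eq_iff vs.representation_scale)
 have k0: "x = 0" if x: "x \<in> space M" and z: "\<kappa> x = 0" for x
 proof -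
  have "vs.representation B x b = 0" if b: "b \<in> B" for b
  proof -
   have "\<kappa> x (h b) = 0" using z by simp
   moreover have "h b < card B" using bij_betwE[OF h] b by auto
   ultimately show ?thesis unfolding \<kappa>_def using bij_betw_inv_into_left[OF h b] by simp
  qed
  then have "(\<Sum>b\<in>B. scal M (vs.representation B x b) b) = 0" by simp
  then show ?thesis using basis_expand[OF B(1,3,4) x] by simp
 qed
 have kinj: "x = y" if xy: "x \<in> space M" "y \<in> space M" "\<kappa> x = \<kappa> y" for x y
 proof -
  have "\<kappa> (x - y + y) = \<kappa> (x - y) + \<kappa> y" by (rule kadd) (use xy in simp_all)
  then have "\<kappa> (x - y) = 0" unfolding diff_add_cancel xy(3) by simp
  then show ?thesis using k0[of "x - y"] xy by simp
 qed
 have io: "inj_on \<kappa> (space M)" using kinj by (intro inj_onI)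
 define \<theta> where "\<theta> = inv_into (space M) \<kappa>"
 have th: "\<theta> (\<kappa> v) = v" if "v \<in> space M" for v unfolding \<theta>_def by (rule inv_into_f_f[OF io that])
 define N :: "('k, 'g, nat \<Rightarrow> 'k) gmod" where
  "N = \<lparr>space = \<kappa> ` space M, scal = (\<lambda>c f i. c * f i), act = (\<lambda>g. \<lambda>y\<in>\<kappa> ` space M. \<kappa> (act M g (\<theta> y)))\<rparr>"
 have N: "space N = \<kappa> ` space M" "scal N = (\<lambda>c f i. c * f i)" by (simp_all add: N_def)
 have Na: "act N g (\<kappa> v) = \<kappa> (act M g v)" if "v \<in> space M" for g v using that by (simp add: N_def th)
 have vsN: "vector_space (scal N)" unfolding N by (auto simp: vector_space_def fun_eq_iff algebra_simps)
 interpret vn: vector_space "scal N" by (rule vsN)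
 have k00: "\<kappa> 0 = 0" using kadd[OF zero_mem zero_mem] by simp
 have subN: "vn.subspace (space N)"
 proof (rule vn.subspaceI)
  show "0 \<in> space N" unfolding N using k00 zero_mem by (intro image_eqI[of _ _ 0]) simp_all
  fix a b assume "a \<in> space N" "b \<in> space N"
  then obtain x y where "x \<in> space M" "y \<in> space M" "a = \<kappa> x" "b = \<kappa> y" unfolding N by blast
  then show "a + b \<in> space N" unfolding N using kadd add_mem by (intro image_eqI[of _ _ "x + y"]) simp_all
 next
  fix c a assume "a \<in> space N"
  then obtain x where "x \<in> space M" "a = \<kappa> x" unfolding N by blast
  then show "scal N c a \<in> space N" unfolding N using kscal scal_mem by (intro image_eqI[of _ _ "scal M c x"]) simp_all
 qed
 have actN: "group_action G (space N) (act N)"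
 proof (rule group_actionI[OF group_G])
  fix g assume g: "g \<in> carrier G"
  show "act N g \<in> extensional (space N)" by (simp add: N_def)
  fix a assume "a \<in> space N"
  then obtain x where x: "x \<in> space M" "a = \<kappa> x" unfolding N by blast
  show "act N g a \<in> space N" unfolding x(2) Na[OF x(1)] unfolding N using g x(1) by simp
  fix h assume h: "h \<in> carrier G"
  show "act N (h \<otimes> g) a = act N h (act N g a)"
   unfolding x(2) Na[OF x(1)] using g h x(1) by (simp add: Na act_mult)
 next
  fix a assume "a \<in> space N"
  then obtain x where x: "x \<in> space M" "a = \<kappa> x" unfolding N by blast
  show "act N \<one> a = a" unfolding x(2) Na[OF x(1)] using x(1) by simp
 qed
 have isN: "is_gmod G N" unfolding is_gmod_def
 proof (intro conjI ballI allI vsN subN actN)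
  fix g a b assume g: "g \<in> carrier G" and "a \<in> space N" "b \<in> space N"
  then obtain x y where x: "x \<in> space M" "y \<in> space M" "a = \<kappa> x" "b = \<kappa> y" unfolding N by blast
  have "act N g (\<kappa> (x + y)) = act N g (\<kappa> x) + act N g (\<kappa> y)"
   unfolding Na[OF add_mem[OF x(1,2)]] Na[OF x(1)] Na[OF x(2)] using g x(1,2) kadd[of "act M g x" "act M g y"] by simp
  then show "act N g (a + b) = act N g a + act N g b" unfolding x(3,4) kadd[OF x(1,2)] .
 next
  fix g c a assume g: "g \<in> carrier G" and "a \<in> space N"
  then obtain x where x: "x \<in> space M" "a = \<kappa> x" unfolding N by blast
  have "act N g (\<kappa> (scal M c x)) = \<kappa> (act M g (scal M c x))" by (rule Na[OF scal_mem[OF x(1)]])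
  also have "act M g (scal M c x) = scal M c (act M g x)" using g x(1) by simp
  also have "\<kappa> \<dots> = scal N c (act N g (\<kappa> x))"
   unfolding Na[OF x(1)] N(2) by (rule kscal) (use g x(1) in simp)
  finally have "act N g (\<kappa> (scal M c x)) = scal N c (act N g (\<kappa> x))" .
  then show "act N g (scal N c a) = scal N c (act N g a)" unfolding x(2) kscal[OF x(1)] N(2) .
 qed
 have ksum: "\<kappa> (\<Sum>b\<in>B. scal M (u b) b) = (\<Sum>b\<in>B. scal N (u b) (\<kappa> b))" for u
 proof -
  have "F \<subseteq> B \<Longrightarrow> \<kappa> (\<Sum>b\<in>F. scal M (u b) b) = (\<Sum>b\<in>F. scal N (u b) (\<kappa> b))" if "finite F" for F
   using that
  proof (induction F rule: finite_induct)
   case (insert b F)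
   have m: "scal M (u b) b \<in> space M" "(\<Sum>b\<in>F. scal M (u b) b) \<in> space M" "b \<in> space M"
    using insert.prems B(2) by (auto intro!: sum_mem scal_mem)
   have IH: "\<kappa> (\<Sum>b\<in>F. scal M (u b) b) = (\<Sum>b\<in>F. scal N (u b) (\<kappa> b))" using insert by simp
   show ?case unfolding sum.insert[OF insert.hyps] kadd[OF m(1,2)] kscal[OF m(3)] IH N(2) ..
  qed (simp add: k00)
  from this[OF B(1)] show ?thesis by simp
 qed
 have ioB: "inj_on \<kappa> B" using io B(2) inj_on_subset by blast
 have ind: "vn.independent (\<kappa> ` B)"
 proof
  assume dep: "vn.dependent (\<kappa> ` B)"
  obtain u where u: "\<exists>v\<in>\<kappa> ` B. u v \<noteq> 0" "(\<Sum>v\<in>\<kappa> ` B. scal N (u v) v) = 0"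
   using iffD1[OF vn.dependent_finite[OF finite_imageI[OF B(1)]] dep] by (elim exE conjE)
  have "\<kappa> (\<Sum>b\<in>B. scal M (u (\<kappa> b)) b) = 0" unfolding ksum using u(2) unfolding sum.reindex[OF ioB] o_def .
  then have "(\<Sum>b\<in>B. scal M (u (\<kappa> b)) b) = 0" by (intro k0) (use B(2) in \<open>auto intro!: sum_mem scal_mem\<close>)
  moreover have "\<exists>b\<in>B. u (\<kappa> b) \<noteq> 0" using u(1) by blast
  ultimately have "vs.dependent B" by (intro iffD2[OF vs.dependent_finite[OF B(1)]] exI[of _ "\<lambda>b. u (\<kappa> b)"] conjI)
  then show False using B(3) by simp
 qed
 have sp: "vn.span (\<kappa> ` B) = space N"
 proof
  have "\<kappa> ` B \<subseteq> space N" unfolding N using B(2) by blast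
  then show "vn.span (\<kappa> ` B) \<subseteq> space N" by (rule vn.span_minimal[OF _ subN])
  show "space N \<subseteq> vn.span (\<kappa> ` B)"
  proof
   fix a assume "a \<in> space N"
   then obtain x where x: "x \<in> space M" "a = \<kappa> x" unfolding N by blast
   have "a = (\<Sum>b\<in>B. scal N (vs.representation B x b) (\<kappa> b))"
    unfolding x(2) ksum[symmetric] using basis_expand[OF B(1,3,4) x(1)] by simp
   then show "a \<in> vn.span (\<kappa> ` B)" by (simp add: vn.span_sum vn.span_scale vn.span_base)
  qed
 qed
 have "gdim N = card (\<kappa> ` B)" unfolding gdim_def by (rule vn.dim_eq_card[OF _ ind]) (simp add: sp vn.span_eq_iff[THEN iffD2, OF subN])
 then have gd: "gdim N = gdim M" using card_image[OF ioB] B(5) by simp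
 have fdN: "fin_dim N" unfolding fin_dim_def using B(1) sp by (intro exI[of _ "\<kappa> ` B"]) simp
 have "simple_gmod G N" unfolding simple_gmod_def
 proof (intro conjI allI impI isN)
  have "\<exists>x\<in>space M. x \<noteq> 0" using s zero_mem by (auto simp: simple_gmod_def)
  then obtain x where x: "x \<in> space M" "x \<noteq> 0" by blast
  then have "\<kappa> x \<noteq> 0" "\<kappa> x \<in> space N" using k0 unfolding N by auto
  then show "space N \<noteq> {0}" by auto
  fix K assume K: "gsubmodule G N K"
  have Ks: "K \<subseteq> space N" using K by (simp add: gsubmodule_def)
  interpret N: gm G N using group_G finite_G isN by (simp add: gm_def)
  have "gmod_iso G M N \<kappa>" unfolding gmod_iso_def using io kadd kscal Na by (auto simp: N bij_betw_def)
  then have "ghom G N M \<theta>" using gmod_iso_inv[OF gm_axioms N.gm_axioms] unfolding \<theta>_def by (simp add: gmod_iso_alt)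
  then have "gsubmodule G M (\<theta> ` K)" by (rule N.gsubmodule_image[OF gm_axioms _ K])
  then have "\<theta> ` K = {0} \<or> \<theta> ` K = space M" using s by (simp add: simple_gmod_def)
  moreover have "\<kappa> ` \<theta> ` K = K" unfolding image_image using Ks by (force simp: N th)
  ultimately show "K = {0} \<or> K = space N" using k00 unfolding N by force
 qed
 then show ?thesis using fdN gd by (intro exI[of _ N] conjI)
qed

end

section \<open>The global degree bound and the admissible degrees\<close>

lemma prl_id: "gm G V \<Longrightarrow> of_nat (card (carrier G)) \<noteq> (0::'k) \<Longrightarrow> prl G (V :: ('k::alg_closed_field, 'g, 'w::ab_group_add) gmod) (\<lambda>p. p) (\<lambda>p. p)"
 by (simp add: prl_def prl_axioms_def)

lemma beta_poly_inv_eq: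
 fixes V :: "('k::alg_closed_field, 'g, 'w::ab_group_add) gmod"
 assumes "gm G V" "of_nat (card (carrier G)) \<noteq> (0::'k)"
 shows "beta_poly_inv G V = Inf {enat n | n. GC G V n}"
proof -
 interpret prl G V "\<lambda>p. p" "\<lambda>p. p" by (rule prl_id[OF assms])
 show ?thesis using beta_fixed_pr unfolding pr_id pract_id beta_poly_inv_def by simp
qed

text \<open>The copy of k[V] in the universe is one of the algebras of the supremum, being generated
  in degree at most 1.\<close>

lemma beta_grp_ge:
 fixes V :: "('k::alg_closed_field, 'g, 'w::ab_group_add) gmod"
 assumes V: "gm G V" "fin_dim V" and c: "of_nat (card (carrier G)) \<noteq> (0::'k)" and u: "large_universe TYPE('k) TYPE('a)"
 shows "Inf {enat n | n. GC G V n} \<le> beta_grp TYPE('k) TYPE('a) G"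
proof -
 obtain f0 :: "'k \<Rightarrow> 'a" where f0: "inj f0" using u unfolding large_universe_def by blast
 obtain \<iota> :: "('w \<Rightarrow> 'k) \<Rightarrow> 'a" where io: "inj_on \<iota> (polyfun V)"
  using gm.polyfun_inj[OF V infinite_alg_closed f0] by blast
 interpret prl G V \<iota> "inv_into (polyfun V) \<iota>" using V c inv_into_f_f[OF io] by (simp add: prl_def prl_axioms_def)
 show ?thesis unfolding beta_fixed_pr[symmetric] beta_grp_def
  by (rule Sup_upper, rule CollectI, intro exI conjI) (rule refl, rule graded_pr, rule graded_action_pr, rule beta_pr)
qed

text \<open>A finite bound excludes the empty set, whose infimum is \<infinity>; so some n <= N
  satisfies Q.\<close>

lemma Inf_enat_attained: "Inf {enat n | n. Q n} \<le> enat N \<Longrightarrow> \<exists>n\<le>N. Q n"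
proof (rule ccontr)
 assume i: "Inf {enat n | n. Q n} \<le> enat N" and "\<not> (\<exists>n\<le>N. Q n)"
 then have q: "Suc N \<le> n" if "Q n" for n using that not_less_eq_eq by blast
 have "enat (Suc N) \<le> Inf {enat n | n. Q n}"
 proof (rule Inf_greatest)
  fix x assume "x \<in> {enat n | n. Q n}"
  then obtain n where "x = enat n" "Q n" by blast
  then show "enat (Suc N) \<le> x" using q by simp
 qed
 from order_trans[OF this i] have "enat (Suc N) \<le> enat N" .
 then show False by simp
qed

lemma GC_of_beta_grp:
 fixes V :: "('k::alg_closed_field, 'g, 'w::ab_group_add) gmod"
 assumes V: "gm G V" "fin_dim V" and c: "of_nat (card (carrier G)) \<noteq> (0::'k)" and u: "large_universe TYPE('k) TYPE('a)"
  and N: "beta_grp TYPE('k) TYPE('a) G = enat N"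
 shows "GC G V N"
proof -
 have "Inf {enat n | n. GC G V n} \<le> enat N" using beta_grp_ge[OF V c u] N by simp
 from Inf_enat_attained[OF this] show ?thesis using GC_mono by blast
qed

context isod begin

text \<open>Degree N is admissible: it satisfies the letter bound with some p for which 1, ..., p -
  1 are invertible. This p need not be the characteristic and can be arbitrarily large in
  characteristic 0.\<close>

definition cnd :: "nat \<Rightarrow> bool" where
 "cnd N \<longleftrightarrow> (\<exists>p>0. (\<forall>j. 1 \<le> j \<longrightarrow> j < p \<longrightarrow> of_nat j \<noteq> (0::'k)) \<and> (\<forall>i<r. gdim (Mi i) = 1 \<or> N \<le> gdim (Mi i) * (p - 1)))"

lemma gdim_pos: "i < r \<Longrightarrow> gdim (Mi i) \<noteq> 0"
proof
 assume i: "i < r" and z: "gdim (Mi i) = 0"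
 interpret Mi: gm G "Mi i" by (rule gm_Mi[OF i])
 obtain B where B: "finite B" "B \<subseteq> space (Mi i)" "Mi.vs.independent B" "Mi.vs.span B = space (Mi i)" "card B = gdim (Mi i)"
  by (rule Mi.fin_dim_basis[OF fd_Mi[OF i]])
 have "B = {}" using B(1,5) z by simp
 then have "space (Mi i) = {0}" using B(4) by simp
 then show False using simple[OF i] unfolding simple_gmod_def by blast
qed

lemma ell_le: assumes i: "i < r" and g: "gdim (Mi i) > 1" shows "ell TYPE('k) G \<le> enat (gdim (Mi i))"
proof -
 obtain N :: "('k, 'g, nat \<Rightarrow> 'k) gmod" where N: "simple_gmod G N" "fin_dim N" "gdim N = gdim (Mi i)"
  using gm.simple_transport[OF gm_Mi[OF i] simple[OF i] fd_Mi[OF i]] by blast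
 show ?thesis unfolding ell_def by (rule Inf_lower, rule CollectI, rule exI[of _ N]) (use N g in simp)
qed

lemma cnd_of_bound:
 assumes b: "ereal_of_enat (char_or_infinity TYPE('k)) \<ge> ereal_of_enat b / ereal_of_enat (ell TYPE('k) G) + 1"
  and N: "enat N \<le> b"
 shows "cnd N"
proof (cases "CHAR('k) = 0")
 case True
 have "of_nat j \<noteq> (0::'k)" if "1 \<le> j" for j using that True by (simp add: of_nat_eq_0_iff_char_dvd)
 moreover have "N \<le> gdim (Mi i) * (N + 1 - 1)" if "i < r" for i using gdim_pos[OF that] by (cases "gdim (Mi i)") simp_all
 \<comment> \<open>In characteristic 0 the choice p = N + 1 gives p - 1 = N, which suffices in every
   dimension.\<close>
 ultimately show ?thesis unfolding cnd_def by (intro exI[of _ "N + 1"]) simp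
next
 case False
 let ?c = "CHAR('k)"
 have 1: "of_nat j \<noteq> (0::'k)" if "1 \<le> j" "j < ?c" for j using that dvd_imp_le[of ?c j] by (auto simp: of_nat_eq_0_iff_char_dvd)
 have 2: "N \<le> gdim (Mi i) * (?c - 1)" if i: "i < r" and g: "gdim (Mi i) > 1" for i
 proof -
  obtain l where l: "ell TYPE('k) G = enat l" "l \<le> gdim (Mi i)" using ell_le[OF i g] by (cases "ell TYPE('k) G") auto
  \<comment> \<open>As \<open>l\<close> is at least 2, the quotient by \<open>l\<close> is an honest
    division of reals, and \<infinity> / l is \<infinity>.\<close>
  have "enat 2 \<le> ell TYPE('k) G" unfolding ell_def
  proof (rule Inf_greatest)
   fix x assume "x \<in> {enat (gdim N) | N :: ('k, 'g, nat \<Rightarrow> 'k) gmod. simple_gmod G N \<and> fin_dim N \<and> gdim N > 1}"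
   then obtain N :: "('k, 'g, nat \<Rightarrow> 'k) gmod" where "x = enat (gdim N)" "gdim N > 1" by blast
   then show "enat 2 \<le> x" by simp
  qed
  then have l2: "2 \<le> l" using l by simp
  have hc: "ereal (real ?c) \<ge> ereal_of_enat b / ereal (real l) + 1" using b False l by (simp add: char_or_infinity_def)
  obtain B where B: "b = enat B"
  proof (cases b)
   case (enat B) then show ?thesis by (rule that)
  next
   \<comment> \<open>The characteristic is positive and \<open>l\<close> is finite, so an infinite
     bound contradicts the hypothesis.\<close>
   case infinity
   have "ereal (real ?c) \<ge> ereal_of_enat \<infinity> / ereal (real l) + 1" using hc unfolding infinity .
   moreover have "ereal_of_enat \<infinity> / ereal (real l) = \<infinity>" using l2 by (simp add: divide_ereal_def)
   ultimately have False by simp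
   then show ?thesis ..
  qed
  obtain c where c: "?c = Suc c" using not0_implies_Suc[OF False] by blast
  have e: "ereal_of_enat (enat B) / ereal (real l) + 1 = ereal (real B / real l + 1)" using l2 by (simp add: one_ereal_def)
  have "ereal (real B / real l + 1) \<le> ereal (real ?c)" using hc unfolding B e .
  then have "real B / real l + 1 \<le> real (Suc c)" unfolding c by (simp only: ereal_less_eq)
  then have "real B / real l \<le> real c" by simp
  moreover have "real l > 0" using l2 by simp
  ultimately have "real B \<le> real c * real l" by (simp only: pos_divide_le_eq)
  then have "B \<le> c * l" by (simp only: of_nat_mult[symmetric] of_nat_le_iff)
  also have "c * l \<le> c * gdim (Mi i)" by (rule mult_le_mono2[OF l(2)])
  finally have "N \<le> c * gdim (Mi i)" using N unfolding B by simp
  then show ?thesis unfolding c by (simp add: mult.commute)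
 qed
 have "gdim (Mi i) = 1 \<or> N \<le> gdim (Mi i) * (?c - 1)" if "i < r" for i using gdim_pos[OF that] 2[OF that] by (cases "gdim (Mi i) > 1") auto
 with 1 False show ?thesis unfolding cnd_def by (intro exI[of _ ?c]) simp
qed

end

section \<open>Generation of the invariants of V\<close>

context regsum begin

lemma Res_alg:
 assumes T: "\<And>h. h \<in> T \<Longrightarrow> h \<in> Res (alg (space W) S)" and f: "f \<in> alg (space V) T"
 shows "f \<in> Res (alg (space W) S)"
 using f
proof (induction rule: alg.induct)
 case (const c) show ?case by (rule ResI[OF alg.const[of c]]) simp
next
 case (incl f) then show ?case by (rule T)
next
 case (add f g)
 then obtain F F' where F: "F \<in> alg (space W) S" "\<forall>v\<in>space V. F (0, v) = f v" "F' \<in> alg (space W) S" "\<forall>v\<in>space V. F' (0, v) = g v"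
  unfolding Res_def by blast
 show ?case by (rule ResI[OF alg.add[OF F(1,3)]]) (simp add: F)
next
 case (mult f g)
 then obtain F F' where F: "F \<in> alg (space W) S" "\<forall>v\<in>space V. F (0, v) = f v" "F' \<in> alg (space W) S" "\<forall>v\<in>space V. F' (0, v) = g v"
  unfolding Res_def by blast
 show ?case by (rule ResI[OF alg.mult[OF F(1,3)]]) (simp add: F)
next
 case (cong f g) show ?case by (rule Res_cong[OF cong.IH cong.hyps(2)])
qed

lemma cnd_mono: "cnd N \<Longrightarrow> d \<le> N \<Longrightarrow> cnd d"
proof -
 assume "cnd N" and d: "d \<le> N"
 then obtain p where p: "p > 0" "\<forall>j. 1 \<le> j \<longrightarrow> j < p \<longrightarrow> of_nat j \<noteq> (0::'k)"
  "\<forall>i<r. gdim (Mi i) = 1 \<or> N \<le> gdim (Mi i) * (p - 1)" unfolding cnd_def by (elim exE conjE)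
 have "gdim (Mi i) = 1 \<or> d \<le> gdim (Mi i) * (p - 1)" if "i < r" for i using p(3) that d by (auto dest: order_trans)
 with p(1,2) show "cnd d" unfolding cnd_def by (intro exI[of _ p] conjI allI impI) simp_all
qed

text \<open>A generator of degree at most N is a sum of homogeneous invariants, whose degrees are
  admissible along with N. Restriction respects sums and products, so it is enough to reach the
  generators.\<close>

lemma all_in_Res:
 assumes S: "qclosed S" and pfS: "\<And>F. F \<in> S \<Longrightarrow> pf W F"
  and ext: "\<And>f. pf U f \<Longrightarrow> invf G U f \<Longrightarrow> (\<lambda>w. f (fst w)) \<in> alg (space W) S"
  and f: "f \<in> alg (space V) {h. hle V N h \<and> invf G V h}" and N: "cnd N"
 shows "f \<in> Res (alg (space W) S)"
proof (rule Res_alg[OF _ f])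
 interpret PV: prl G V "\<lambda>p. p" "\<lambda>p. p" by (rule prl_id[OF V.gm_axioms card_G])
 fix h assume "h \<in> {h. hle V N h \<and> invf G V h}"
 then have "h \<in> PV.H PV.Inv N" unfolding PV.H_Inv .
 then obtain F where F: "\<And>d. d \<le> N \<Longrightarrow> F d \<in> poly_comp V d \<inter> PV.Inv"
  and e: "\<forall>x\<in>space V. h x = (\<Sum>d\<le>N. F d x)" unfolding PV.H_def by blast
 have Fd: "F d \<in> Res (alg (space W) S)" if d: "d \<le> N" for d
 proof -
  from cnd_mono[OF N d] obtain p where p: "p > 0" "\<forall>j. 1 \<le> j \<longrightarrow> j < p \<longrightarrow> of_nat j \<noteq> (0::'k)"
   "\<forall>i<r. gdim (Mi i) = 1 \<or> d \<le> gdim (Mi i) * (p - 1)" unfolding cnd_def by (elim exE conjE)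
  show ?thesis
  proof (rule invariants_in_Res[OF S pfS ext p(1), where d = d])
   show "of_nat j \<noteq> (0::'k)" if "1 \<le> j" "j < p" for j using p(2) that by simp
   show "gdim (Mi i) = 1 \<or> d \<le> gdim (Mi i) * (p - 1)" if "i < r" for i using p(3) that by simp
   show "hp V d (F d)" using F[OF d] PV.poly_compD(1) by blast
   show "invf G V (F d)" using F[OF d] unfolding PV.Inv_def by blast
  qed
 qed
 have "(\<lambda>x. \<Sum>d\<le>n. F d x) \<in> alg (space V) (Res (alg (space W) S))" if "n \<le> N" for n
  using that
 proof (induction n)
  case 0 show ?case using alg.incl[OF Fd[of 0]] by simp
 next
  case (Suc n)
  have "(\<lambda>x. (\<Sum>d\<le>n. F d x) + F (Suc n) x) \<in> alg (space V) (Res (alg (space W) S))"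
   by (rule alg.add[OF Suc.IH alg.incl[OF Fd]]) (use Suc.prems in simp_all)
  then show ?case by simp
 qed
 from Res_alg[OF _ this[OF order_refl]] have "(\<lambda>x. \<Sum>d\<le>N. F d x) \<in> Res (alg (space W) S)" by simp
 then show "h \<in> Res (alg (space W) S)" by (rule Res_cong) (simp add: e)
qed

text \<open>In \<open>all_in_Res\<close> the set S is taken to be \<open>PS E\<close>, the
  polarizations of the extended generators. It generates the pullback of k[R]^G because
  \<open>S0\<close> generates k[R]^G. The rest translates between \<open>alg\<close> and the
  intersection of subrings in \<open>generates_algebra\<close>.\<close>

lemma generates_Res_Pol:
 assumes K: "\<And>f. pf V f \<Longrightarrow> invf G V f \<Longrightarrow> \<exists>N. f \<in> alg (space V) {h. hle V N h \<and> invf G V h} \<and> cnd N"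
  and gen: "generates_algebra (poly_inv G U) S0"
 shows "generates_algebra (poly_inv G V) (Res_sum V (Pol W r M m \<Phi> (Ext_sum U V S0)))"
proof -
 interpret PU: prl G U "\<lambda>p. p" "\<lambda>p. p" by (rule prl_id[OF U.gm_axioms card_G])
 interpret PV: prl G V "\<lambda>p. p" "\<lambda>p. p" by (rule prl_id[OF V.gm_axioms card_G])
 have eqU: "poly_inv G U = PU.P PU.Inv" using PU.fixed_eq unfolding pr_id pract_id .
 have eqV: "poly_inv G V = PV.P PV.Inv" using PV.fixed_eq unfolding pr_id pract_id .
 have carU: "carrier (PU.P PU.Inv) = PU.Inv" and carV: "carrier (PV.P PV.Inv) = PV.Inv" by (simp_all add: palg_def)
 have g0: "S0 \<subseteq> PU.Inv \<and> \<Inter>{B. S0 \<subseteq> B \<and> subring B (PU.P PU.Inv) \<and> (\<forall>c. \<forall>b\<in>B. c \<odot>\<^bsub>PU.P PU.Inv\<^esub> b \<in> B)} = PU.Inv"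
  using gen unfolding generates_algebra_def eqU carU .
 note S0 = conjunct1[OF g0] and gU = conjunct2[OF g0]
 define E where "E = Ext_sum U V S0"
 define L where "L = Pol W r M m \<Phi> E"
 have fl: "lin W U fst" using fst_ghom by (simp add: ghom_def)
 have E: "s \<in> polyfun W \<and> invf G W s" if "s \<in> E" for s
 proof -
  from that obtain p where p: "p \<in> S0" "s = (\<lambda>w\<in>space W. p (fst w))" unfolding E_def Ext_sum_def by blast
  have pI: "p \<in> polyfun U" "invf G U p" using p(1) S0 unfolding PU.Inv_def by blast+
  have "s \<in> polyfun W" unfolding p(2) by (rule restrict_polyfun[OF pf_comp[OF fl pf_polyfun[OF pI(1)]]])
  moreover have "invf G W s" unfolding invf_def
  proof (intro ballI)
   fix g w assume g: "g \<in> carrier G" and w: "w \<in> space W"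
   have "fst (act W g w) = act U g (fst w)" "fst w \<in> space U" using fst_ghom g w by (simp_all add: ghom_def lin_def)
   then show "s (act W g w) = s w" using g w pI(2) unfolding p(2) by (simp add: invf_def)
  qed
  ultimately show ?thesis by blast
 qed
 have Lp: "p \<in> polyfun W \<and> invf G W p" if "p \<in> L" for p by (rule Pol_props[of E]) (use E that in \<open>simp_all add: L_def\<close>)
 have pfPS: "pf W F" if "F \<in> PS E" for F using Lp[of "restrict F (space W)"] that by (simp add: PS_def L_def pf_def)
 have qPS: "qclosed (PS E)" by (rule qclosed_PS) (rule pfPS)
 let ?A = "alg (space W) (PS E)"
 \<comment> \<open>The part of k[R]^G generated by \<open>S0\<close> is one of the subrings in the
   intersection, hence all of k[R]^G.\<close>
 define B where "B = {p \<in> PU.Inv. p \<in> alg (space U) S0}"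
 note B = PU.sub_pr[OF PU.pclosed_Inv PU.pclosed_alg[OF PU.pclosed_Inv, of S0], folded B_def]
 have "subring B (PU.P PU.Inv)" "\<forall>c. \<forall>b\<in>B. c \<odot>\<^bsub>PU.P PU.Inv\<^esub> b \<in> B" using B by (simp_all add: B_def)
 moreover have "S0 \<subseteq> B" unfolding B_def using S0 alg.incl by blast
 ultimately have "B \<in> {B. S0 \<subseteq> B \<and> subring B (PU.P PU.Inv) \<and> (\<forall>c. \<forall>b\<in>B. c \<odot>\<^bsub>PU.P PU.Inv\<^esub> b \<in> B)}"
  by (intro CollectI conjI)
 from Inter_lower[OF this] have IB: "PU.Inv \<subseteq> B" unfolding gU .
 have memU: "fst w \<in> space U" if "w \<in> space W" for w using fl that by (simp add: lin_def)
 have ext: "(\<lambda>w. f (fst w)) \<in> ?A" if f: "pf U f" "invf G U f" for f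
 proof -
  have "restrict f (space U) \<in> PU.Inv" using f by (simp add: PU.Inv_def pf_def invf_def)
  then have "restrict f (space U) \<in> alg (space U) S0" using IB unfolding B_def by blast
  then have "(\<lambda>w. restrict f (space U) (fst w)) \<in> ?A"
  proof (rule alg_comp[OF _ memU])
   fix p assume p: "p \<in> S0"
   have "(\<lambda>w\<in>space W. p (fst w)) \<in> E" unfolding E_def Ext_sum_def using p by blast
   then have "(\<lambda>w. p (fst w)) \<in> PS E" unfolding PS_def Pol_def by (simp add: op_submodule.base)
   then show "(\<lambda>w. p (fst w)) \<in> ?A" by (rule alg.incl)
  qed
  then show ?thesis by (rule alg.cong) (simp add: memU)
 qed
 have zl: "lin V W (\<lambda>v. (0, v))" using zero_ghom by (simp add: ghom_def)
 have ResI': "Res_sum V L \<subseteq> PV.Inv"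
 proof
  fix s assume "s \<in> Res_sum V L"
  then obtain p where p: "p \<in> L" "s = (\<lambda>v\<in>space V. p (0, v))" unfolding Res_sum_def by blast
  have "s \<in> polyfun V" unfolding p(2) by (rule restrict_polyfun[OF pf_comp[OF zl pf_polyfun]]) (use Lp[OF p(1)] in simp)
  moreover have "invf G V s" unfolding invf_def
  proof (intro ballI)
   fix g v assume g: "g \<in> carrier G" and v: "v \<in> space V"
   have "(0, act V g v) = act W g (0, v)" "(0, v) \<in> space W" using zero_ghom g v by (simp_all add: ghom_def lin_def)
   then show "s (act V g v) = s v" using g v Lp[OF p(1)] unfolding p(2) by (simp add: invf_def)
  qed
  ultimately show "s \<in> PV.Inv" unfolding PV.Inv_def by blast
 qed
 have all: "PV.Inv \<subseteq> Q" if Q: "Res_sum V L \<subseteq> Q" "subring Q (PV.P PV.Inv)" "\<forall>c. \<forall>b\<in>Q. c \<odot>\<^bsub>PV.P PV.Inv\<^esub> b \<in> Q" for Q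
 proof
  have QI: "Q \<subseteq> PV.Inv" using subringE(1)[OF Q(2)] unfolding carV .
  have zW: "(0, v) \<in> space W" if "v \<in> space V" for v using that zl by (simp add: lin_def)
  let ?S = "(\<lambda>s v. s (0, v)) ` PS E"
  have S: "restrict s (space V) \<in> Q" if "s \<in> ?S" for s
  proof -
   from that obtain F where F: "s = (\<lambda>v. F (0, v))" "F \<in> PS E" by (rule imageE)
   have "(\<lambda>v\<in>space V. restrict F (space W) (0, v)) \<in> Res_sum V L" using F(2) unfolding PS_def L_def Res_sum_def by blast
   moreover have "(\<lambda>v\<in>space V. restrict F (space W) (0, v)) = restrict s (space V)" unfolding F(1) by (rule restrict_ext) (simp add: zW)
   ultimately show ?thesis using Q(1) by (simp only: subset_iff)
  qed
  \<comment> \<open>The constants belong to Q as multiples of its unit.\<close>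
  have c: "(\<lambda>x\<in>space V. c) \<in> Q" for c
  proof -
   have o: "(\<lambda>x\<in>space V. 1) \<in> PV.Inv" by (rule PV.pclosedD(2)[OF PV.pclosed_Inv])
   have "c \<odot>\<^bsub>PV.P PV.Inv\<^esub> \<one>\<^bsub>PV.P PV.Inv\<^esub> \<in> Q" using Q(3) subringE(3)[OF Q(2)] by blast
   then have "(\<lambda>x\<in>space V. c * (\<lambda>x\<in>space V. 1) x) \<in> Q" unfolding PV.pr_ops(5)[OF PV.pclosed_Inv] PV.pr_ops(3)[OF PV.pclosed_Inv o] .
   moreover have "(\<lambda>x\<in>space V. c * (\<lambda>x\<in>space V. 1) x) = (\<lambda>v\<in>space V. c)" by (rule restrict_ext) simp
   ultimately show ?thesis by (simp only:)
  qed
  have cl: "restrict (\<lambda>v. F (0, v)) (space V) \<in> Q" if "F \<in> ?A" for F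
  proof -
   have "(\<lambda>v. F (0, v)) \<in> alg (space V) ?S" by (rule alg_comp[OF that zW]) (assumption, rule alg.incl[OF imageI[where f = "\<lambda>s v. s (0, v)"]])
   from PV.alg_subring[OF PV.pclosed_Inv Q(2) c _ this] S QI show ?thesis by blast
  qed
  fix f assume f: "f \<in> PV.Inv"
  then have f': "f \<in> polyfun V" "invf G V f" unfolding PV.Inv_def by blast+
  obtain N where N: "f \<in> alg (space V) {h. hle V N h \<and> invf G V h}" "cnd N" using K[OF pf_polyfun[OF f'(1)] f'(2)] by blast
  have "f \<in> Res ?A" by (rule all_in_Res[OF qPS pfPS ext N])
  then obtain F where F: "F \<in> ?A" "\<forall>v\<in>space V. F (0, v) = f v" unfolding Res_def by blast
  have "(\<lambda>v\<in>space V. F (0, v)) = restrict f (space V)" by (rule restrict_ext) (simp add: F(2))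
  with cl[OF F(1)] show "f \<in> Q" unfolding polyfun_restrict[OF f'(1)] by (simp only:)
 qed
 show ?thesis
  unfolding generates_algebra_def eqV carV E_def[symmetric] L_def[symmetric]
 proof (intro conjI ResI' equalityI)
  have "subring PV.Inv (PV.P PV.Inv)" using PV.sub_pr(1)[OF PV.pclosed_Inv PV.pclosed_Inv] by simp
  moreover have "\<forall>c. \<forall>b\<in>PV.Inv. c \<odot>\<^bsub>PV.P PV.Inv\<^esub> b \<in> PV.Inv" using PV.sub_pr(2)[OF PV.pclosed_Inv PV.pclosed_Inv] by simp
  ultimately have "PV.Inv \<in> {B. Res_sum V L \<subseteq> B \<and> subring B (PV.P PV.Inv) \<and> (\<forall>c. \<forall>b\<in>B. c \<odot>\<^bsub>PV.P PV.Inv\<^esub> b \<in> B)}"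
   using ResI' by (intro CollectI conjI)
  then show "\<Inter>{B. Res_sum V L \<subseteq> B \<and> subring B (PV.P PV.Inv) \<and> (\<forall>c. \<forall>b\<in>B. c \<odot>\<^bsub>PV.P PV.Inv\<^esub> b \<in> B)} \<subseteq> PV.Inv"
   by (rule Inter_lower)
  show "PV.Inv \<subseteq> \<Inter>{B. Res_sum V L \<subseteq> B \<and> subring B (PV.P PV.Inv) \<and> (\<forall>c. \<forall>b\<in>B. c \<odot>\<^bsub>PV.P PV.Inv\<^esub> b \<in> B)}"
  proof (rule Inter_greatest)
   fix Q assume "Q \<in> {B. Res_sum V L \<subseteq> B \<and> subring B (PV.P PV.Inv) \<and> (\<forall>c. \<forall>b\<in>B. c \<odot>\<^bsub>PV.P PV.Inv\<^esub> b \<in> B)}"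
   then have "Res_sum V L \<subseteq> Q \<and> subring Q (PV.P PV.Inv) \<and> (\<forall>c. \<forall>b\<in>Q. c \<odot>\<^bsub>PV.P PV.Inv\<^esub> b \<in> Q)" by (rule CollectD)
   then show "PV.Inv \<subseteq> Q" by (elim conjE) (rule all)
  qed
 qed
qed

end

section \<open>Transfer of degree bounds\<close>

text \<open>Homogeneity is asked for s \<noteq> 0 only, which suits arguments that divide by
  s.\<close>

lemma (in gm) hp_of_homogeneous:
 assumes inf: "infinite (UNIV :: 'k set)" and f: "pf M f"
  and h: "\<And>s x. s \<noteq> 0 \<Longrightarrow> x \<in> space M \<Longrightarrow> f (scal M s x) = s ^ d * f x"
 shows "hp M d f"
proof -
 obtain m where "hle M m f" using pf_hle[OF f] by blast
 from hle_mono[OF this, of "max m d"] obtain F where F: "\<And>e. e \<le> max m d \<Longrightarrow> hp M e (F e)"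
  "\<forall>x\<in>space M. f x = (\<Sum>e\<le>max m d. F e x)" unfolding hle_def by auto
 have "F d x = f x" if x: "x \<in> space M" for x
 proof -
  define P where "P = (\<Sum>e\<le>max m d. monom (F e x) e)"
  \<comment> \<open>The additional factor s makes the identity hold at s = 0 as well, so that
    coefficients can be compared, one degree higher.\<close>
  have "s * poly P s = s * (s ^ d * f x)" for s
  proof (cases "s = 0")
   case False
   have "poly P s = (\<Sum>e\<le>max m d. F e (scal M s x))"
    using hp_homogeneous[OF scal_mem F(1)] x by (simp add: P_def poly_sum poly_monom mult.commute)
   also have "\<dots> = s ^ d * f x" using F(2) h[OF False x] x by simp
   finally show ?thesis by simp
  qed simp
  then have "cf (Suc d) (\<lambda>s. s * (s ^ d * f x)) = Polynomial.coeff (pCons 0 P) (Suc d)" by (intro cf_eq[OF inf]) simp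
  moreover have "cf (Suc d) (\<lambda>s. s * (s ^ d * f x)) = Polynomial.coeff (monom (f x) (Suc d)) (Suc d)"
   by (intro cf_eq[OF inf]) (simp add: poly_monom mult_ac)
  ultimately show ?thesis by (simp add: P_def coeff_sum)
 qed
 then have "hp M d (F d) = hp M d f" by (rule hp_cong)
 then show ?thesis using F(1)[of d] by simp
qed

context isod begin

text \<open>Scaling w by s scales the line and replaces t by t / s: the factors s^n from F and s^-d
  from the coefficient meet the factor s^d from the forms.\<close>

lemma qop_hp:
 assumes q: "qpar i \<omega> d l" and F: "hp W n F" shows "hp W n (qop i \<omega> d l F)"
proof (rule hp_of_homogeneous[OF infinite_alg_closed qop_pf[OF q hp_pf[OF F]]])
 fix s w assume s: "s \<noteq> (0::'k)" and w: "w \<in> space W"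
 have om: "\<omega> \<in> space W" "\<And>s. s < d \<Longrightarrow> linear_form W (l s)" using q by (auto simp: qpar_def)
 have "F (scal W s w - pr i (scal W s w) + scal W t \<omega>) = s ^ n * F (w - pr i w + scal W (inverse s * t) \<omega>)" for t
 proof -
  have "scal W s w - pr i (scal W s w) + scal W t \<omega> = scal W s (w - pr i w + scal W (inverse s * t) \<omega>)"
   using s w by (simp add: pr_scal vs.scale_right_distrib vs.scale_right_diff_distrib mult.assoc[symmetric])
  then show ?thesis using hp_homogeneous[OF scal_mem F] line_mem[OF w om(1)] by simp
 qed
 note e = this
 have ex: "\<exists>P. \<forall>t. poly P t = F (shift i \<omega> w t)" by (rule line_poly[OF hp_pf[OF F] w om(1)])
 have ex': "\<exists>P. \<forall>t. poly P t = F (w - pr i w + scal W (inverse s * t) \<omega>)"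
 proof -
  obtain P where "\<forall>t. poly P t = F (shift i \<omega> w t)" using ex by blast
  then show ?thesis by (intro exI[of _ "P \<circ>\<^sub>p [:0, inverse s:]"]) (simp add: poly_pcompose mult.commute)
 qed
 have "cf d (\<lambda>t. F (scal W s w - pr i (scal W s w) + scal W t \<omega>)) = s ^ n * (inverse s ^ d * cf d (\<lambda>t. F (shift i \<omega> w t)))"
  unfolding e cf_cmult[OF infinite_alg_closed ex'] cf_dilate[OF infinite_alg_closed ex] ..
 moreover have "(\<Prod>a<d. l a (scal W s w)) = s ^ d * (\<Prod>a<d. l a w)" using om(2) w by (simp add: linear_form_def prod.distrib)
 ultimately show "qop i \<omega> d l F (scal W s w) = s ^ n * qop i \<omega> d l F w" using s by (simp add: qop_def field_simps)
qed

text \<open>This lets all invariants of degree at most n on W play the part of the polarizations in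
  \<open>all_in_Res\<close>.\<close>

lemma qclosed_hle_inv:
 assumes c: "of_nat (card (carrier G)) \<noteq> (0::'k)"
 shows "qclosed {F. hle W n F \<and> invf G W F}"
 unfolding qclosed_def
proof (intro conjI allI impI)
 fix F F' assume F: "F \<in> {F. hle W n F \<and> invf G W F}" and e: "\<forall>x\<in>space W. F x = F' x"
 then have "hle W n F'" using hle_cong[of W F F'] by simp
 moreover have "invf G W F'" using F e by (simp add: invf_def)
 ultimately show "F' \<in> {F. hle W n F \<and> invf G W F}" by simp
next
 fix \<gamma> F assume g: "gmod_iso G W W \<gamma>" and F: "F \<in> {F. hle W n F \<and> invf G W F}"
 have "ghom G W W \<gamma>" using g by (simp add: gmod_iso_alt)
 then show "(\<lambda>w. F (\<gamma> w)) \<in> {F. hle W n F \<and> invf G W F}" using F hle_comp[of W W \<gamma>] by (simp add: ghom_def lin_def invf_def)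
next
 fix i \<omega> d l F assume q: "qpar i \<omega> d l" and F: "F \<in> {F. hle W n F \<and> invf G W F}"
 have om: "\<omega> \<in> space W" using q by (simp add: qpar_def)
 from F obtain H where H: "\<And>e. e \<le> n \<Longrightarrow> hp W e (H e)" "\<And>x. x \<in> space W \<Longrightarrow> F x = (\<Sum>e\<le>n. H e x)" by (auto simp: hle_def)
 have "qop i \<omega> d l F w = (\<Sum>e\<le>n. qop i \<omega> d l (H e) w)" if w: "w \<in> space W" for w
 proof -
  have "qop i \<omega> d l F w = qop i \<omega> d l (\<lambda>x. \<Sum>e\<le>n. H e x) w" by (rule qop_cong[OF H(2) w om])
  also have "\<dots> = (\<Sum>e\<le>n. qop i \<omega> d l (H e) w)"
   unfolding qop_def sum_distrib_right[symmetric] by (subst cf_sum[OF infinite_alg_closed line_poly[OF hp_pf[OF H(1)] w om]]) simp_all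
  finally show ?thesis .
 qed
 then have "hle W n (qop i \<omega> d l F)" unfolding hle_def by (intro exI[of _ "\<lambda>e. qop i \<omega> d l (H e)"] conjI ballI allI impI qop_hp[OF q H(1)])
 moreover have "invf G W (qop i \<omega> d l F)"
 proof -
  have "qop i \<omega> d l F w = rey G W (qop i \<omega> d l F) w" if w: "w \<in> space W" for w
  proof -
   have "pf W F" "\<And>x. x \<in> space W \<Longrightarrow> rey G W F x = F x" using F hle_pf rey_of_inv[OF c] by blast+
   then show ?thesis using rey_qop[OF q _ w, of F] qop_cong[OF _ w om, of "rey G W F" F] by simp
  qed
  then show ?thesis using rey_inv[of "qop i \<omega> d l F"] by (simp add: invf_def)
 qed
 ultimately show "qop i \<omega> d l F \<in> {F. hle W n F \<and> invf G W F}" by simp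
qed

end

context regsum begin

text \<open>By assumption the invariants of degree at most n on W generate the pullback of k[R]^G,
  so by \<open>all_in_Res\<close> their algebra restricts onto k[V]^G. Restriction to V respects
  degree bound and invariance. The degree N in K only has to be admissible and may exceed n.\<close>

lemma GC_transfer:
 assumes c: "of_nat (card (carrier G)) \<noteq> (0::'k)" and U: "GC G U n"
  and K: "\<And>f. pf V f \<Longrightarrow> invf G V f \<Longrightarrow> \<exists>N. f \<in> alg (space V) {h. hle V N h \<and> invf G V h} \<and> cnd N"
 shows "GC G V n"
 unfolding GC_def
proof (intro allI impI)
 let ?S = "{F. hle W n F \<and> invf G W F}"
 fix f assume f: "pf V f" "invf G V f"
 have fl: "lin W U fst" and zl: "lin V W (\<lambda>v. (0, v))" using fst_ghom zero_ghom by (simp_all add: ghom_def)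
 have ext: "(\<lambda>w. h (fst w)) \<in> alg (space W) ?S" if "pf U h" "invf G U h" for h
 proof -
  have "h \<in> alg (space U) {f. hle U n f \<and> invf G U f}" using U that unfolding GC_def by blast
  then show ?thesis
  proof (rule alg_comp)
   fix s assume "s \<in> {f. hle U n f \<and> invf G U f}"
   then show "(\<lambda>w. s (fst w)) \<in> alg (space W) ?S" using hle_comp[OF fl, of n s] fst_ghom by (intro alg.incl) (simp add: ghom_def lin_def invf_def)
  qed (use fl in \<open>simp add: lin_def\<close>)
 qed
 obtain N where "f \<in> alg (space V) {h. hle V N h \<and> invf G V h}" "cnd N" using K[OF f] by blast
 from all_in_Res[OF qclosed_hle_inv[OF c] _ ext this] have "f \<in> Res (alg (space W) ?S)" using hle_pf by blast
 then obtain F where F: "F \<in> alg (space W) ?S" "\<forall>v\<in>space V. F (0, v) = f v" unfolding Res_def by blast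
 have "(\<lambda>v. F (0, v)) \<in> alg (space V) {h. hle V n h \<and> invf G V h}"
 proof (rule alg_comp[OF F(1)])
  fix s assume s: "s \<in> ?S"
  have "s (0, act V g v) = s (0, v)" if g: "g \<in> carrier G" and v: "v \<in> space V" for g v
  proof -
   have "(0, act V g v) = act W g (0, v)" "(0, v) \<in> space W" using zero_ghom g v by (simp_all add: ghom_def lin_def)
   then show ?thesis using s g by (simp add: invf_def)
  qed
  moreover have "hle V n (\<lambda>v. s (0, v))" using hle_comp[OF zl, of n s] s by blast
  ultimately show "(\<lambda>v. s (0, v)) \<in> alg (space V) {h. hle V n h \<and> invf G V h}" unfolding invf_def by (intro alg.incl CollectI conjI ballI)
 qed (use zl in \<open>simp add: lin_def\<close>)
 then show "f \<in> alg (space V) {h. hle V n h \<and> invf G V h}" by (rule alg.cong) (use F(2) in simp)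
qed

end

section \<open>Graded algebras as images of polynomial rings\<close>

text \<open>
 \<open>rel R y I n f a\<close>: the element \<open>a\<close> of \<open>R\<close> and the function \<open>f\<close> of \<open>x\<close> arise by substituting the family \<open>y\<close>
 and \<open>x\<close>, respectively, in one and the same polynomial of degree at most \<open>n\<close> with variables from \<open>I\<close>.
\<close>

inductive rel :: "('k::field, 'a) module \<Rightarrow> ('i \<Rightarrow> 'a) \<Rightarrow> 'i set \<Rightarrow> nat \<Rightarrow> (('i \<Rightarrow> 'k) \<Rightarrow> 'k) \<Rightarrow> 'a \<Rightarrow> bool" for R y I where
 const: "rel R y I n (\<lambda>_. c) (c \<odot>\<^bsub>R\<^esub> \<one>\<^bsub>R\<^esub>)"
| add: "rel R y I n f a \<Longrightarrow> rel R y I n g b \<Longrightarrow> rel R y I n (\<lambda>x. f x + g x) (a \<oplus>\<^bsub>R\<^esub> b)"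
| var: "i \<in> I \<Longrightarrow> rel R y I n f a \<Longrightarrow> rel R y I (Suc n) (\<lambda>x. x i * f x) (y i \<otimes>\<^bsub>R\<^esub> a)"

text \<open>Horner form with respect to the variable \<open>i\<close>.\<close>

inductive hor :: "('k::field, 'a) module \<Rightarrow> ('i \<Rightarrow> 'a) \<Rightarrow> 'i set \<Rightarrow> 'i \<Rightarrow> (('i \<Rightarrow> 'k) \<Rightarrow> 'k) \<Rightarrow> 'a \<Rightarrow> bool" for R y I i where
 zero: "hor R y I i (\<lambda>_. 0) \<zero>\<^bsub>R\<^esub>"
| step: "rel R y I n g b \<Longrightarrow> hor R y I i f a \<Longrightarrow> hor R y I i (\<lambda>x. g x + x i * f x) (b \<oplus>\<^bsub>R\<^esub> y i \<otimes>\<^bsub>R\<^esub> a)"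

lemma rel_mono: "rel R y I n f a \<Longrightarrow> n \<le> m \<Longrightarrow> rel R y I m f a"
proof (induction arbitrary: m rule: rel.induct)
 case (const n c) show ?case by (rule rel.const)
next
 case (add n f a g b) then show ?case by (intro rel.add) blast+
next
 case (var i n f a)
 then obtain m' where "m = Suc m'" "n \<le> m'" by (cases m) auto
 then show ?case using var.hyps(1) var.IH by (simp add: rel.var)
qed

lemma rel_finite: "rel R y I n f a \<Longrightarrow> \<exists>J. finite J \<and> J \<subseteq> I \<and> (\<forall>K. J \<subseteq> K \<longrightarrow> rel R y K n f a)"
proof (induction rule: rel.induct)
 case (const n c) show ?case by (rule exI[of _ "{}"]) (simp add: rel.const)
next
 case (add n f a g b)
 then obtain J J' where J: "finite J" "J \<subseteq> I" "\<forall>K. J \<subseteq> K \<longrightarrow> rel R y K n f a" "finite J'" "J' \<subseteq> I" "\<forall>K. J' \<subseteq> K \<longrightarrow> rel R y K n g b"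
  by blast
 have "\<forall>K. J \<union> J' \<subseteq> K \<longrightarrow> rel R y K n (\<lambda>x. f x + g x) (a \<oplus>\<^bsub>R\<^esub> b)" using J(3,6) by (intro allI impI rel.add) blast+
 then show ?case using J(1,2,4,5) by (intro exI[of _ "J \<union> J'"] conjI) blast+
next
 case (var i n f a)
 then obtain J where J: "finite J" "J \<subseteq> I" "\<forall>K. J \<subseteq> K \<longrightarrow> rel R y K n f a" by blast
 have "\<forall>K. insert i J \<subseteq> K \<longrightarrow> rel R y K (Suc n) (\<lambda>x. x i * f x) (y i \<otimes>\<^bsub>R\<^esub> a)" using J(3) by (intro allI impI rel.var) blast+
 then show ?case using J(1,2) var.hyps(1) by (intro exI[of _ "insert i J"] conjI) blast+
qed

lemma rel_dep: "rel R y I n f a \<Longrightarrow> (\<And>i. i \<in> I \<Longrightarrow> x i = x' i) \<Longrightarrow> f x = f x'"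
 by (induction rule: rel.induct) simp_all

section \<open>Substitution of elements of an algebra into polynomials\<close>

locale kalg =
 fixes R :: "('k::field, 'a) module" (structure)
 assumes alg: "algebra base_field R" and inf: "infinite (UNIV :: 'k set)"
begin

sublocale cring R using alg by (simp add: algebra_def)
sublocale R: algebra base_field R by (rule alg)

lemma smult_closed [simp]: "a \<in> carrier R \<Longrightarrow> c \<odot> a \<in> carrier R"
 using R.smult_closed[of c a] by (simp add: ring_of_type_algebra_def)
lemma smult_l: "a \<in> carrier R \<Longrightarrow> (c + d) \<odot> a = c \<odot> a \<oplus> d \<odot> a"
 using R.smult_l_distr[of c d a] by (simp add: ring_of_type_algebra_def)
lemma smult_r: "a \<in> carrier R \<Longrightarrow> b \<in> carrier R \<Longrightarrow> c \<odot> (a \<oplus> b) = c \<odot> a \<oplus> c \<odot> b"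
 using R.smult_r_distr[of c a b] by (simp add: ring_of_type_algebra_def)
lemma smult_smult: "a \<in> carrier R \<Longrightarrow> c \<odot> (d \<odot> a) = (c * d) \<odot> a"
 using R.smult_assoc1[of c d a] by (simp add: ring_of_type_algebra_def)
lemma smult_1 [simp]: "a \<in> carrier R \<Longrightarrow> 1 \<odot> a = a" using R.smult_one[of a] by (simp add: ring_of_type_algebra_def)
lemma smult_mult: "a \<in> carrier R \<Longrightarrow> b \<in> carrier R \<Longrightarrow> (c \<odot> a) \<otimes> b = c \<odot> (a \<otimes> b)"
 using R.smult_assoc2[of c a b] by (simp add: ring_of_type_algebra_def)
lemma mult_smult: "a \<in> carrier R \<Longrightarrow> b \<in> carrier R \<Longrightarrow> a \<otimes> (c \<odot> b) = c \<odot> (a \<otimes> b)"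
 using smult_mult[of b a c] by (simp add: m_comm)
lemma smult_0 [simp]: "a \<in> carrier R \<Longrightarrow> 0 \<odot> a = \<zero>" using smult_l[of a 0 0] by (simp add: add.r_cancel_one)
lemma smult_neg: "a \<in> carrier R \<Longrightarrow> (- 1) \<odot> a = \<ominus> a"
 using smult_l[of a "- 1" 1] by (intro minus_equality[symmetric]) simp_all

context
 fixes y :: "'i \<Rightarrow> 'a"
begin

lemma rel_carrier: "rel R y I n f a \<Longrightarrow> y ` I \<subseteq> carrier R \<Longrightarrow> a \<in> carrier R"
 by (induction rule: rel.induct) auto

lemma rel_smult: "rel R y I n f a \<Longrightarrow> y ` I \<subseteq> carrier R \<Longrightarrow> rel R y I n (\<lambda>x. c * f x) (c \<odot> a)"
proof (induction rule: rel.induct)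
 case (const n d) then show ?case using rel.const[of R y I n "c * d"] by (simp add: smult_smult)
next
 case (add n f a g b)
 then show ?case using rel.add[OF add.IH] rel_carrier by (simp add: smult_r distrib_left)
next
 case (var i n f a)
 then have "a \<in> carrier R" "y i \<in> carrier R" using rel_carrier by blast+
 then show ?case using rel.var[OF var.hyps(1) var.IH[OF var.prems]] by (simp add: mult_smult mult.left_commute)
qed

lemma rel_mult:
 assumes "rel R y I n f a" and y: "y ` I \<subseteq> carrier R" and g: "rel R y I m g b"
 shows "rel R y I (n + m) (\<lambda>x. f x * g x) (a \<otimes> b)"
 using assms(1)
proof (induction rule: rel.induct)
 case (const n c)
 then show ?case using rel_mono[OF rel_smult[OF g y, of c], of "n + m"] rel_carrier[OF g y] by (simp add: smult_mult)
next
 case (add n f a f' a')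
 then show ?case using rel.add[OF add.IH] rel_carrier[OF _ y] rel_carrier[OF g y] by (simp add: l_distr distrib_right)
next
 case (var i n f a)
 then have "a \<in> carrier R" "y i \<in> carrier R" using rel_carrier y by blast+
 then show ?case using rel.var[OF var.hyps(1) var.IH] rel_carrier[OF g y] by (simp add: m_assoc mult.assoc)
qed

context
 fixes I i assumes y: "y ` I \<subseteq> carrier R" "y i \<in> carrier R" and i: "i \<notin> I"
begin

lemma hor_carrier: "hor R y I i f a \<Longrightarrow> a \<in> carrier R" by (induction rule: hor.induct) (auto simp: y intro: rel_carrier[OF _ y(1)])

lemma hor_add: "hor R y I i f a \<Longrightarrow> hor R y I i g b \<Longrightarrow> hor R y I i (\<lambda>x. f x + g x) (a \<oplus> b)"
proof (induction arbitrary: g b rule: hor.induct)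
 case zero then show ?case using hor_carrier by simp
next
 case (step n h c f a)
 have cc: "c \<in> carrier R" "a \<in> carrier R" using step.hyps hor_carrier rel_carrier[OF _ y(1)] by blast+
 from step.prems show ?case
 proof cases
  case zero then show ?thesis using hor.step[OF step.hyps] cc y(2) by simp
 next
  case (step m h' c' f' a')
  have c': "c' \<in> carrier R" "a' \<in> carrier R" using step(3,4) hor_carrier rel_carrier[OF _ y(1)] by blast+
  have "rel R y I (max n m) (\<lambda>x. h x + h' x) (c \<oplus> c')"
   by (rule rel.add[OF rel_mono[OF \<open>rel R y I n h c\<close>] rel_mono[OF step(3)]]) simp_all
  from hor.step[OF this step.IH[OF step(4)]] show ?thesis using cc c' y(2) unfolding step(1,2) by (simp add: algebra_simps r_distr a_ac)
 qed
qed

lemma hor_var: "hor R y I i f a \<Longrightarrow> j \<in> I \<Longrightarrow> hor R y I i (\<lambda>x. x j * f x) (y j \<otimes> a)"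
proof (induction rule: hor.induct)
 case zero then show ?case using hor.zero[of R y I i] y(1) by (simp add: image_subset_iff)
next
 case (step n h c f a)
 have cc: "c \<in> carrier R" "a \<in> carrier R" "y j \<in> carrier R" using step.hyps step.prems y(1) hor_carrier rel_carrier[OF _ y(1)] by blast+
 show ?case using hor.step[OF rel.var[OF step.prems step.hyps(1)] step.IH[OF step.prems]] cc y(2)
  by (simp add: distrib_left r_distr m_lcomm mult.left_commute)
qed

text \<open>The Horner form isolates the variable i and leaves coefficients in the variables from I,
  which prepares an induction on the number of variables.\<close>

lemma rel_hor: "rel R y (insert i I) n f a \<Longrightarrow> hor R y I i f a"
proof (induction rule: rel.induct)
 case (const n c)
 show ?case using hor.step[OF rel.const[of R y I 0 c] hor.zero[of R y I i]] y(2) by simp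
next
 case (add n f a g b) show ?case by (rule hor_add[OF add.IH])
next
 case (var j n f a)
 show ?case
 proof (cases "j = i")
  case True
  show ?thesis using hor.step[OF rel.const[of R y I 0 0] var.IH] y(2) hor_carrier[OF var.IH] unfolding True by simp
 next
  case False then show ?thesis using hor_var[OF var.IH] var.hyps(1) by simp
 qed
qed

lemma hor_poly: "hor R y I i f a \<Longrightarrow> \<exists>p. \<forall>s. f (x(i := s)) = poly p s"
proof (induction rule: hor.induct)
 case zero show ?case by (rule exI[of _ 0]) simp
next
 case (step n h c f a)
 then obtain p where "\<forall>s. f (x(i := s)) = poly p s" by blast
 moreover have "h (x(i := s)) = h x" for s by (rule rel_dep[OF step.hyps(1)]) (use i in auto)
 ultimately show ?case by (intro exI[of _ "pCons (h x) p"] allI) (simp only: poly_pCons fun_upd_same)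
qed

text \<open>With the other variables fixed, a Horner form is a polynomial in the variable i over an
  infinite field. If it vanishes as a function, so do its constant term and its remaining factor, to
  which the induction hypotheses apply.\<close>

lemma hor_zero:
 assumes I: "\<And>n f a. rel R y I n f a \<Longrightarrow> (\<And>x. f x = 0) \<Longrightarrow> a = \<zero>"
 shows "hor R y I i f a \<Longrightarrow> (\<And>x. f x = 0) \<Longrightarrow> a = \<zero>"
proof (induction rule: hor.induct)
 case (step n h c f a)
 have "h x = 0 \<and> f x = 0" for x
 proof -
  obtain p where p: "\<forall>s. f (x(i := s)) = poly p s" using hor_poly[OF step.hyps(2)] by blast
  have hs: "h (x(i := s)) = h x" for s by (rule rel_dep[OF step.hyps(1)]) (use i in auto)
  have "poly (pCons (h x) p) s = 0" for s using step.prems[of "x(i := s)"] by (simp only: hs p poly_pCons fun_upd_same)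
  then have "{s. poly (pCons (h x) p) s = 0} = UNIV" by blast
  then have "pCons (h x) p = 0" using poly_roots_finite[of "pCons (h x) p"] inf by auto
  then have "h x = 0" "p = 0" by simp_all
  moreover have "f x = poly p (x i)" using p[rule_format, of "x i"] by simp
  ultimately show ?thesis by simp
 qed
 then have "c = \<zero>" "a = \<zero>" using I[OF step.hyps(1)] step.IH by blast+
 then show ?case using y(2) by simp
qed simp

end

lemma rel_empty: "rel R y {} n f a \<Longrightarrow> \<exists>c. f = (\<lambda>_. c) \<and> a = c \<odot>\<^bsub>R\<^esub> \<one>\<^bsub>R\<^esub>"
 by (induction rule: rel.induct) (auto simp: smult_l[symmetric])

text \<open>Over an infinite field a polynomial that vanishes as a function is zero; hence
  substituting the family y is well defined on polynomial functions.\<close>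

lemma rel_zero:
 assumes "finite I" "y ` I \<subseteq> carrier R" "rel R y I n f a" "\<And>x. f x = 0" shows "a = \<zero>\<^bsub>R\<^esub>"
 using assms
proof (induction I arbitrary: n f a rule: finite_induct)
 case empty
 from rel_empty[OF empty(2)] obtain c where "f = (\<lambda>_. c)" "a = c \<odot>\<^bsub>R\<^esub> \<one>\<^bsub>R\<^esub>" by blast
 moreover from this(1) have "c = 0" using empty(3) by metis
 ultimately show ?case by simp
next
 case (insert i I)
 have y: "y ` I \<subseteq> carrier R" "y i \<in> carrier R" using insert.prems(1) by auto
 show ?case by (rule hor_zero[OF y insert.hyps(2) insert.IH[OF y(1)] rel_hor[OF y insert.hyps(2) insert.prems(2)] insert.prems(3)])
qed

lemma rel_functional:
 assumes "finite I" "y ` I \<subseteq> carrier R" "rel R y I n f a" "rel R y I m g b" "\<And>x. f x = g x" shows "a = b"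
proof -
 have c: "a \<in> carrier R" "b \<in> carrier R" using rel_carrier assms by blast+
 have "rel R y I (max n m) (\<lambda>x. f x + (- 1) * g x) (a \<oplus>\<^bsub>R\<^esub> (- 1) \<odot>\<^bsub>R\<^esub> b)"
  by (rule rel.add[OF rel_mono[OF assms(3)] rel_smult[OF rel_mono[OF assms(4)] assms(2)]]) simp_all
 from rel_zero[OF assms(1,2) this] have "a \<ominus>\<^bsub>R\<^esub> b = \<zero>\<^bsub>R\<^esub>" using assms(5) c by (simp add: smult_neg a_minus_def)
 then show ?thesis using c by simp
qed

end
end

section \<open>Graded algebras with group action, generated in degree at most 1\<close>

locale galg =
 fixes G :: "('g, 'b) monoid_scheme" and R :: "('k::alg_closed_field, 'a) module" (structure) and A :: "nat \<Rightarrow> 'a set" and \<phi> :: "'g \<Rightarrow> 'a \<Rightarrow> 'a"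
 assumes group_G: "group G" and finite_G: "finite (carrier G)" and card_G: "of_nat (card (carrier G)) \<noteq> (0::'k)"
  and graded: "graded_algebra R A" and action: "graded_G_action G R A \<phi>" and beta_le: "beta R A \<le> 1"
begin

sublocale kalg R using graded infinite_alg_closed by (simp add: kalg_def graded_algebra_def)

sublocale G: group G by (rule group_G)

sublocale ac: group_action G "carrier R" \<phi> using action by (simp add: graded_G_action_def)

abbreviation "Fix \<equiv> {a \<in> carrier R. \<forall>g\<in>carrier G. \<phi> g a = a}"
abbreviation "Rfix \<equiv> fixed_alg G R \<phi>"
abbreviation "y \<equiv> \<lambda>(u, h). \<phi> h u"

lemma A_props:
 shows A_carrier: "a \<in> A d \<Longrightarrow> a \<in> carrier R" and A_zero: "\<zero> \<in> A d" and A_add: "a \<in> A d \<Longrightarrow> b \<in> A d \<Longrightarrow> a \<oplus> b \<in> A d"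
  and A_smult: "a \<in> A d \<Longrightarrow> c \<odot> a \<in> A d" and A_one: "\<one> \<in> A 0"
  and A_mult: "a \<in> A d \<Longrightarrow> b \<in> A e \<Longrightarrow> a \<otimes> b \<in> A (d + e)"
 using graded unfolding graded_algebra_def by blast+

text \<open>The uniqueness clause of \<open>graded_algebra\<close>, whose sums run over supports,
  for sums with a common bound n.\<close>

lemma A_unique:
 assumes "\<And>d. x d \<in> A d" "\<And>d. x' d \<in> A d" "\<And>d. d > n \<Longrightarrow> x d = \<zero>" "\<And>d. d > n \<Longrightarrow> x' d = \<zero>"
  "finsum R x {..n} = finsum R x' {..n}"
 shows "x = x'"
proof -
 have *: "(\<forall>d. z d \<in> A d) \<and> finite {d. z d \<noteq> \<zero>} \<and> finsum R z {..n} = finsum R z {d. z d \<noteq> \<zero>}"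
  if z: "\<And>d. z d \<in> A d" "\<And>d. d > n \<Longrightarrow> z d = \<zero>" for z
 proof -
  have s: "{d. z d \<noteq> \<zero>} \<subseteq> {..n}" using z(2) not_le_imp_less by blast
  moreover have "finsum R z {..n} = finsum R z {d. z d \<noteq> \<zero>}"
   by (rule add.finprod_mono_neutral_cong_right) (use s A_carrier[OF z(1)] in auto)
  ultimately show ?thesis using z(1) finite_subset[OF s] by blast
 qed
 have "finsum R x {..n} \<in> carrier R" by (rule finsum_closed) (use A_carrier[OF assms(1)] in auto)
 then have "\<exists>!z. (\<forall>d. z d \<in> A d) \<and> finite {d. z d \<noteq> \<zero>} \<and> finsum R x {..n} = finsum R z {d. z d \<noteq> \<zero>}"
  using graded unfolding graded_algebra_def by blast
 moreover note *[of x, OF assms(1,3)] *[of x', OF assms(2,4), folded assms(5)]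
 ultimately show ?thesis by blast
qed

lemma phi_props:
 assumes "g \<in> carrier G"
 shows phi_closed: "a \<in> carrier R \<Longrightarrow> \<phi> g a \<in> carrier R"
  and phi_add: "a \<in> carrier R \<Longrightarrow> b \<in> carrier R \<Longrightarrow> \<phi> g (a \<oplus> b) = \<phi> g a \<oplus> \<phi> g b"
  and phi_mult: "a \<in> carrier R \<Longrightarrow> b \<in> carrier R \<Longrightarrow> \<phi> g (a \<otimes> b) = \<phi> g a \<otimes> \<phi> g b"
  and phi_one: "\<phi> g \<one> = \<one>" and phi_zero: "\<phi> g \<zero> = \<zero>"
  and phi_smult: "a \<in> carrier R \<Longrightarrow> \<phi> g (c \<odot> a) = c \<odot> \<phi> g a"
  and phi_A: "a \<in> A d \<Longrightarrow> \<phi> g a \<in> A d"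
proof -
 have h: "\<phi> g \<in> Ring.ring_hom R R" using action assms unfolding graded_G_action_def by blast
 then interpret h: ring_hom_cring R R "\<phi> g" by unfold_locales
 show "a \<in> carrier R \<Longrightarrow> \<phi> g a \<in> carrier R" "a \<in> carrier R \<Longrightarrow> b \<in> carrier R \<Longrightarrow> \<phi> g (a \<oplus> b) = \<phi> g a \<oplus> \<phi> g b"
  "a \<in> carrier R \<Longrightarrow> b \<in> carrier R \<Longrightarrow> \<phi> g (a \<otimes> b) = \<phi> g a \<otimes> \<phi> g b" "\<phi> g \<one> = \<one>" "\<phi> g \<zero> = \<zero>" by simp_all
 show "a \<in> carrier R \<Longrightarrow> \<phi> g (c \<odot> a) = c \<odot> \<phi> g a" "a \<in> A d \<Longrightarrow> \<phi> g a \<in> A d"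
  using action assms unfolding graded_G_action_def by blast+
qed

lemma phi_finsum: "g \<in> carrier G \<Longrightarrow> x \<in> S \<rightarrow> carrier R \<Longrightarrow> \<phi> g (finsum R x S) = finsum R (\<lambda>d. \<phi> g (x d)) S"
 by (induction S rule: infinite_finite_induct) (auto simp: phi_zero phi_add phi_closed Pi_def)

lemma phi_comp: "g \<in> carrier G \<Longrightarrow> h \<in> carrier G \<Longrightarrow> a \<in> carrier R \<Longrightarrow> \<phi> (g \<otimes>\<^bsub>G\<^esub> h) a = \<phi> g (\<phi> h a)"
 using ac.composition_rule by blast

lemma phi_id: "a \<in> carrier R \<Longrightarrow> \<phi> \<one>\<^bsub>G\<^esub> a = a" using ac.id_eq_one by (metis restrict_apply')

lemma y_carrier: "T \<subseteq> carrier R \<Longrightarrow> y ` (T \<times> carrier G) \<subseteq> carrier R" using phi_closed by auto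

text \<open>Applying g to the homogeneous decomposition of a fixed element gives such a
  decomposition again; by uniqueness each component is fixed.\<close>

lemma fixed_components:
 assumes c: "c \<in> comp_upto R A n" "c \<in> Fix"
 obtains x where "\<And>d. d \<le> n \<Longrightarrow> x d \<in> A d \<inter> Fix" "c = finsum R x {..n}"
proof -
 from c(1) obtain x where x: "\<forall>d\<le>n. x d \<in> A d" "c = finsum R x {..n}" unfolding comp_upto_def by blast
 \<comment> \<open>Cut off above n, since \<open>comp_upto\<close> says nothing about the family
   there.\<close>
 define z where "z d = (if d \<le> n then x d else \<zero>)" for d
 have z: "z d \<in> A d" for d using x(1) A_zero by (simp add: z_def)
 have cz: "c = finsum R z {..n}"
  unfolding x(2) by (rule finsum_cong') (use A_carrier[OF z] in auto, simp add: z_def)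
 have "z = (\<lambda>d. \<phi> g (z d))" if g: "g \<in> carrier G" for g
 proof (rule A_unique[of _ _ n])
  have "\<phi> g c = c" using c(2) g by blast
  then show "finsum R z {..n} = finsum R (\<lambda>d. \<phi> g (z d)) {..n}"
   unfolding cz by (subst (asm) phi_finsum[OF g]) (use z A_carrier in auto)
 qed (use g z phi_A phi_zero in \<open>simp_all add: z_def\<close>)
 then have "\<phi> g (z d) = z d" if "g \<in> carrier G" for g d using that by metis
 then have "z d \<in> A d \<inter> Fix" for d using z A_carrier by blast
 then show ?thesis using cz by (intro that[of z]) auto
qed

lemma subring_Fix: "subring Fix R"
proof (rule subringI)
 fix a b assume "a \<in> Fix" "b \<in> Fix"
 then show "a \<otimes> b \<in> Fix" "a \<oplus> b \<in> Fix" by (simp_all add: phi_mult phi_add)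
next
 fix a assume "a \<in> Fix"
 then show "\<ominus> a \<in> Fix" using smult_neg[symmetric, of a] by (simp add: phi_smult)
qed (auto simp: phi_one)

lemma finsum_Fix:
 assumes "finite S" "x \<in> S \<rightarrow> Fix" shows "finsum Rfix x S = finsum R x S"
proof -
 interpret F: ring Rfix using subring_is_ring[OF subring_Fix] by (simp add: fixed_alg_def)
 have c: "carrier Rfix = Fix" "a \<oplus>\<^bsub>Rfix\<^esub> b = a \<oplus> b" "\<zero>\<^bsub>Rfix\<^esub> = \<zero>" for a b by (simp_all add: fixed_alg_def)
 show ?thesis using assms
 proof (induction S)
  case (insert s S)
  then have "x s \<in> Fix" "x \<in> S \<rightarrow> Fix" by auto
  then have "finsum Rfix x (insert s S) = x s \<oplus>\<^bsub>Rfix\<^esub> finsum Rfix x S" "finsum R x (insert s S) = x s \<oplus> finsum R x S"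
   using insert.hyps by (auto intro!: F.finsum_insert finsum_insert simp: c Pi_def)
  then show ?case using insert by (simp add: c)
 qed (simp add: c)
qed

lemma comp_upto_fixed:
 assumes "c \<in> comp_upto R A n" "c \<in> Fix" shows "c \<in> comp_upto Rfix (\<lambda>d. A d \<inter> carrier Rfix) n"
proof -
 obtain x where x: "\<And>d. d \<le> n \<Longrightarrow> x d \<in> A d \<inter> Fix" "c = finsum R x {..n}" by (rule fixed_components[OF assms]) blast
 then have "c = finsum Rfix x {..n}" using finsum_Fix[of "{..n}" x] by auto
 then show ?thesis using x(1) unfolding comp_upto_def fixed_alg_def by auto
qed

lemma comp_upto_add:
 assumes "a \<in> comp_upto R A n" "b \<in> comp_upto R A n" shows "a \<oplus> b \<in> comp_upto R A n"
proof -
 from assms obtain x x' where x: "\<forall>d\<le>n. x d \<in> A d" "a = finsum R x {..n}" "\<forall>d\<le>n. x' d \<in> A d" "b = finsum R x' {..n}"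
  unfolding comp_upto_def by blast
 have "a \<oplus> b = finsum R (\<lambda>d. x d \<oplus> x' d) {..n}"
  unfolding x(2,4) by (rule finsum_addf[symmetric]) (use x A_carrier in auto)
 then show ?thesis using x(1,3) A_add unfolding comp_upto_def by blast
qed

lemma comp_upto_const: "c \<odot> \<one> \<in> comp_upto R A n"
proof -
 let ?x = "\<lambda>d. if d = 0 then c \<odot> \<one> else \<zero>"
 have "finsum R ?x {..n} = c \<odot> \<one>" using add.finprod_singleton_swap[of 0 "{..n}" "\<lambda>_. c \<odot> \<one>"] by simp
 moreover have "\<forall>d\<le>n. ?x d \<in> A d" using A_smult[OF A_one] A_zero by simp
 ultimately show ?thesis unfolding comp_upto_def by (intro CollectI exI[of _ ?x] conjI) simp_all
qed

text \<open>The number of factors bounds the degree: a factor from degree 0 leaves the degree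
  unchanged, one from degree 1 raises it by one.\<close>

lemma comp_upto_mult:
 assumes u: "u \<in> A 0 \<union> A 1" and a: "a \<in> comp_upto R A n" shows "u \<otimes> a \<in> comp_upto R A (Suc n)"
proof -
 from a obtain x where x: "\<forall>d\<le>n. x d \<in> A d" "a = finsum R x {..n}" unfolding comp_upto_def by blast
 have xc: "x d \<in> carrier R" if "d \<le> n" for d using x(1) that A_carrier by blast
 have uc: "u \<in> carrier R" using u A_carrier by blast
 have ua: "u \<otimes> a = finsum R (\<lambda>d. u \<otimes> x d) {..n}" unfolding x(2) by (rule finsum_rdistr) (use xc uc in auto)
 from u show ?thesis
 proof
  assume u: "u \<in> A 0"
  let ?z = "\<lambda>d. if d \<le> n then u \<otimes> x d else \<zero>"
  have z: "\<forall>d\<le>Suc n. ?z d \<in> A d" using A_mult[OF u] x(1) A_zero by simp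
  have "finsum R ?z {..Suc n} = u \<otimes> a"
   unfolding ua by (rule add.finprod_mono_neutral_cong_right) (use xc uc in auto)
  then show ?thesis using z unfolding comp_upto_def by (intro CollectI exI[of _ ?z] conjI) simp_all
 next
  assume u: "u \<in> A 1"
  let ?z = "\<lambda>d. case d of 0 \<Rightarrow> \<zero> | Suc d \<Rightarrow> u \<otimes> x d"
  have z: "\<forall>d\<le>Suc n. ?z d \<in> A d" using A_mult[OF u] x(1) A_zero by (simp split: nat.split)
  have "finsum R ?z {..Suc n} = u \<otimes> a"
   unfolding ua by (subst finsum_Suc2) (use xc uc in \<open>auto split: nat.split intro!: r_zero finsum_closed\<close>)
  then show ?thesis using z unfolding comp_upto_def by (intro CollectI exI[of _ ?z] conjI) simp_all
 qed
qed

lemma rel_comp_upto: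
 assumes "rel R y (T \<times> carrier G) n f a" "T \<subseteq> A 0 \<union> A 1" shows "a \<in> comp_upto R A n"
 using assms(1)
proof (induction rule: rel.induct)
 case (const n c) show ?case by (rule comp_upto_const)
next
 case (add n f a g b) show ?case by (rule comp_upto_add[OF add.IH])
next
 case (var i n f a)
 obtain u h where i: "i = (u, h)" "u \<in> T" "h \<in> carrier G" using var.hyps(1) by auto
 then have "\<phi> h u \<in> A 0 \<union> A 1" using assms(2) phi_A by blast
 from comp_upto_mult[OF this var.IH] show ?case by (simp add: i)
qed

text \<open>The variable (u, h) stands for the translate of u by h. A generator u is the value of
  the variable with h the identity; the other variables make the substitution equivariant.\<close>

lemma rel_exists: "a \<in> carrier R \<Longrightarrow> \<exists>n f. rel R y ((A 0 \<union> A 1) \<times> carrier G) n f a"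
proof -
 have "Inf {enat n | n. generate_ring R (comp_upto R A n) = carrier R} \<le> enat 1" using beta_le unfolding beta_def by (simp add: one_enat_def)
 from Inf_enat_attained[OF this] obtain m where m: "m \<le> 1" "generate_ring R (comp_upto R A m) = carrier R" by blast
 let ?I = "(A 0 \<union> A 1) \<times> carrier G"
 have yc: "y ` ?I \<subseteq> carrier R" by (rule y_carrier) (use A_carrier in blast)
 have gen: "\<exists>f. rel R y ?I 1 f u" if u: "u \<in> A 0 \<union> A 1" for u
 proof -
  have uc: "u \<in> carrier R" using u A_carrier by blast
  have "rel R y ?I (Suc 0) (\<lambda>x. x (u, \<one>\<^bsub>G\<^esub>) * 1) (y (u, \<one>\<^bsub>G\<^esub>) \<otimes> (1 \<odot> \<one>))"
   by (rule rel.var[OF _ rel.const]) (use u in simp)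
  then show ?thesis using uc by (auto simp: phi_id)
 qed
 assume "a \<in> carrier R"
 then have "a \<in> generate_ring R (comp_upto R A m)" using m(2) by simp
 then show ?thesis
 proof (induction rule: generate_ring.induct)
  case one show ?case using rel.const[of R y ?I 0 1] by auto
 next
  case (incl u)
  then obtain x where x: "\<forall>d\<le>m. x d \<in> A d" "u = finsum R x {..m}" unfolding comp_upto_def by blast
  show ?case
  proof (cases m)
   case 0
   then have "u = x 0" "x 0 \<in> A 0" using x A_carrier by simp_all
   then show ?thesis using gen[of u] by blast
  next
   case (Suc n)
   then have "m = Suc 0" using m(1) by simp
   then have xs: "x 0 \<in> A 0" "x 1 \<in> A 1" using x(1) by auto
   then have "u = x 1 \<oplus> x 0" using x(2) A_carrier \<open>m = Suc 0\<close> by (simp add: finsum_Suc Pi_def le_Suc_eq)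
   moreover obtain f f' where "rel R y ?I 1 f (x 1)" "rel R y ?I 1 f' (x 0)" using gen[of "x 1"] gen[of "x 0"] xs by blast
   note rel.add[OF this]
   ultimately show ?thesis by blast
  qed
 next
  case (a_inv a)
  then obtain n f where r: "rel R y ?I n f a" by blast
  show ?case using rel_smult[OF r yc, of "- 1"] smult_neg[OF rel_carrier[OF r yc]] by auto
 next
  case (eng_add a b)
  then obtain n f m g where "rel R y ?I n f a" "rel R y ?I m g b" by blast
  then have "rel R y ?I (max n m) f a" "rel R y ?I (max n m) g b" by (auto elim: rel_mono)
  from rel.add[OF this] show ?case by blast
 next
  case (eng_mult a b)
  then obtain n f m g where "rel R y ?I n f a" "rel R y ?I m g b" by blast
  from rel_mult[OF this(1) yc this(2)] show ?case by blast
 qed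
qed

end

text \<open>A sum of copies of the regular representation, one for each u in T. Its coordinates are
  indexed like the variables (u, h), and G permutes them in the way it permutes the translates of
  the elements of T.\<close>

definition cofree :: "('g, 'b) monoid_scheme \<Rightarrow> 'a set \<Rightarrow> ('k::field, 'g, 'a \<times> 'g \<Rightarrow> 'k) gmod" where
 "cofree G T =
   \<lparr>space = {v. \<forall>i. i \<notin> T \<times> carrier G \<longrightarrow> v i = 0},
   scal = (\<lambda>c v i. c * v i),
   act = (\<lambda>g. \<lambda>v\<in>{v. \<forall>i. i \<notin> T \<times> carrier G \<longrightarrow> v i = 0}.
         \<lambda>(u, h). if h \<in> carrier G then v (u, inv\<^bsub>G\<^esub> g \<otimes>\<^bsub>G\<^esub> h) else 0)\<rparr>"

lemma cofree_gmod:
 assumes "group G" "finite (carrier G)"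
 shows "gm G (cofree G T :: ('k::field, 'g, 'a \<times> 'g \<Rightarrow> 'k) gmod)"
proof -
 interpret group G by fact
 let ?S = "{v :: 'a \<times> 'g \<Rightarrow> 'k. \<forall>i. i \<notin> T \<times> carrier G \<longrightarrow> v i = 0}"
 have vs: "vector_space (\<lambda>(c::'k) f (h::'a \<times> 'g). c * f h)" by (simp add: vector_space_def fun_eq_iff algebra_simps)
 then interpret v: vector_space "\<lambda>(c::'k) f (h::'a \<times> 'g). c * f h" .
 have "group_action G ?S (\<lambda>g. \<lambda>v\<in>?S. \<lambda>(u, h). if h \<in> carrier G then v (u, inv\<^bsub>G\<^esub> g \<otimes>\<^bsub>G\<^esub> h) else 0)"
  by (rule group_actionI[OF assms(1)]) (auto simp: fun_eq_iff inv_mult_group m_assoc)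
 moreover have "v.subspace ?S" by (simp add: v.subspace_def)
 ultimately show ?thesis using assms vs by (auto simp: gm_def is_gmod_def cofree_def fun_eq_iff)
qed

lemma space_cofree: "v \<in> space (cofree G T) \<longleftrightarrow> (\<forall>i. i \<notin> T \<times> carrier G \<longrightarrow> v i = 0)"
 by (simp add: cofree_def)

lemma if_cancel_zero: "(\<not> P \<Longrightarrow> a = 0) \<Longrightarrow> (if P then a else 0) = a" by simp

lemma cofree_expand:
 fixes G :: "('g, 'b) monoid_scheme" and v :: "'a \<times> 'g \<Rightarrow> 'k::field"
 assumes "finite T" "finite (carrier G)" "v \<in> space (cofree G T)"
 shows "v = (\<Sum>i\<in>T \<times> carrier G. scal (cofree G T) (v i) (\<lambda>j. if j = i then 1 else 0))"
proof (rule ext)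
 fix j
 have app: "(\<Sum>g\<in>S. F g) h = (\<Sum>g\<in>S. F g h)" for F :: "'a \<times> 'g \<Rightarrow> 'a \<times> 'g \<Rightarrow> 'k" and S h
  by (induction S rule: infinite_finite_induct) simp_all
 have e: "scal (cofree G T) c (\<lambda>j. if j = i then 1 else 0) j = (if i = j then c else 0)" for c :: 'k and i by (simp add: cofree_def)
 have f: "finite (T \<times> carrier G)" by (rule finite_cartesian_product[OF assms(1,2)])
 have z: "j \<notin> T \<times> carrier G \<Longrightarrow> v j = 0" by (rule assms(3)[unfolded space_cofree, rule_format])
 show "v j = (\<Sum>i\<in>T \<times> carrier G. scal (cofree G T) (v i) (\<lambda>j. if j = i then 1 else 0)) j"
  by (subst app, subst e, subst sum.delta[OF f]) (rule if_cancel_zero[symmetric], rule z)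
qed

lemma cofree_fin_dim:
 assumes "group G" "finite (carrier G)" "finite T"
 shows "fin_dim (cofree G T :: ('k::field, 'g, 'a \<times> 'g \<Rightarrow> 'k) gmod)"
proof -
 interpret V: gm G "cofree G T :: ('k, 'g, 'a \<times> 'g \<Rightarrow> 'k) gmod" by (rule cofree_gmod[OF assms(1,2)])
 let ?d = "\<lambda>i j. if j = i then (1::'k) else 0"
 have "v \<in> V.vs.span (?d ` (T \<times> carrier G))" if "v \<in> space (cofree G T)" for v :: "'a \<times> 'g \<Rightarrow> 'k"
  by (subst cofree_expand[OF assms(3,2) that]) (intro V.vs.span_sum V.vs.span_scale V.vs.span_base imageI)
 then show ?thesis using assms(2,3) unfolding fin_dim_def by (intro exI[of _ "?d ` (T \<times> carrier G)"]) auto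
qed

section \<open>Equivariant substitution from a cofree module\<close>

locale cogalg = galg G R A \<phi> for G :: "('g, 'b) monoid_scheme" and R :: "('k::alg_closed_field, 'a) module" (structure) and A \<phi> +
 fixes T :: "'a set" assumes fin_T: "finite T" and T_sub: "T \<subseteq> A 0 \<union> A 1"
begin

abbreviation "V \<equiv> cofree G T :: ('k, 'g, 'a \<times> 'g \<Rightarrow> 'k) gmod"
abbreviation "J \<equiv> T \<times> carrier G"

sublocale V: gm G V by (rule cofree_gmod[OF group_G finite_G])

lemma yJ: "y ` J \<subseteq> carrier R" by (rule y_carrier) (use T_sub A_carrier in blast)

lemma fin_J: "finite J" using fin_T finite_G by simp

lemma coord_form: "linear_form V (\<lambda>v. v i)" by (simp add: linear_form_def cofree_def)

text \<open>Polynomials in the variables from J depend on these coordinates only, and all values of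
  them are attained on V; so agreement on V suffices.\<close>

lemma rel_V_functional:
 assumes r: "rel R y J n f a" "rel R y J m g b" and e: "\<And>v. v \<in> space V \<Longrightarrow> f v = g v" shows "a = b"
proof (rule rel_functional[OF fin_J yJ r])
 fix x :: "'a \<times> 'g \<Rightarrow> 'k"
 let ?x = "\<lambda>i. if i \<in> J then x i else 0"
 have "f x = f ?x" by (rule rel_dep[OF r(1)]) simp
 also have "\<dots> = g ?x" by (rule e) (simp add: space_cofree)
 also have "\<dots> = g x" by (rule rel_dep[OF r(2)]) simp
 finally show "f x = g x" .
qed

text \<open>Equivariance of the substitution: composing a function with the action of g on V
  corresponds to applying g^-1 in R. This is checked on the variables, where the translate by h
  becomes the translate by g^-1 h.\<close>

lemma rel_act:
 assumes r: "rel R y J n f a" and g: "g \<in> carrier G"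
 shows "\<exists>f'. rel R y J n f' (\<phi> (inv\<^bsub>G\<^esub> g) a) \<and> (\<forall>v\<in>space V. f' v = f (act V g v))"
proof -
 let ?s = "\<lambda>(x :: 'a \<times> 'g \<Rightarrow> 'k) (u, h). x (u, inv\<^bsub>G\<^esub> g \<otimes>\<^bsub>G\<^esub> h)"
 have ig: "inv\<^bsub>G\<^esub> g \<in> carrier G" using g by simp
 note ig' = phi_smult[OF ig] phi_one[OF ig] phi_add[OF ig] phi_mult[OF ig]
 from r have "rel R y J n (\<lambda>x. f (?s x)) (\<phi> (inv\<^bsub>G\<^esub> g) a)"
 proof (induction rule: rel.induct)
  case (const n c) show ?case using rel.const[of R y J n c] by (simp add: ig')
 next
  case (add n f a f' a')
  show ?case using rel.add[OF add.IH] rel_carrier[OF _ yJ] add.hyps by (simp add: ig')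
 next
  case (var i n f a)
  obtain u h where i: "i = (u, h)" "u \<in> T" "h \<in> carrier G" using var.hyps(1) by auto
  have c: "a \<in> carrier R" "u \<in> carrier R" using rel_carrier[OF _ yJ] var.hyps i(2) T_sub A_carrier by blast+
  have "(u, inv\<^bsub>G\<^esub> g \<otimes>\<^bsub>G\<^esub> h) \<in> J" using i ig by simp
  from rel.var[OF this var.IH] show ?case using c i(3) ig unfolding i(1) by (simp add: ig' phi_closed phi_comp)
 qed
 moreover have "f (?s v) = f (act V g v)" if v: "v \<in> space V" for v by (rule rel_dep[OF r]) (use v in \<open>auto simp: cofree_def\<close>)
 ultimately show ?thesis by blast
qed

lemma rel_pf: "rel R y J n f a \<Longrightarrow> pf V f"
 by (induction rule: rel.induct) (simp_all add: pf_const pf_add pf_mult pf_form[OF coord_form])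

text \<open>On V the function is a polynomial of degree at most n in the coordinates, so that it has
  an image in R.\<close>

definition lift :: "nat \<Rightarrow> (('a \<times> 'g \<Rightarrow> 'k) \<Rightarrow> 'k) \<Rightarrow> bool" where
 "lift n f \<longleftrightarrow> (\<exists>f' a. rel R y J n f' a \<and> (\<forall>v\<in>space V. f' v = f v))"

lemma liftI: "rel R y J n f' a \<Longrightarrow> (\<And>v. v \<in> space V \<Longrightarrow> f' v = f v) \<Longrightarrow> lift n f"
 unfolding lift_def by blast

lemma lift_cong: "lift n f \<Longrightarrow> (\<And>v. v \<in> space V \<Longrightarrow> f v = g v) \<Longrightarrow> lift n g"
 unfolding lift_def by metis

lemma lift_const: "lift n (\<lambda>_. c)"
 unfolding lift_def using rel.const by blast

lemma lift_add: assumes "lift n f" "lift n g" shows "lift n (\<lambda>v. f v + g v)"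
proof -
 from assms obtain f' a g' b where r: "rel R y J n f' a" "\<forall>v\<in>space V. f' v = f v" "rel R y J n g' b" "\<forall>v\<in>space V. g' v = g v"
  unfolding lift_def by blast
 have "rel R y J n (\<lambda>v. f' v + g' v) (a \<oplus> b)" by (rule rel.add[OF r(1,3)])
 then show ?thesis by (rule liftI) (use r in simp)
qed

lemma lift_mult: assumes "lift n f" "lift m g" shows "lift (n + m) (\<lambda>v. f v * g v)"
proof -
 from assms obtain f' a g' b where r: "rel R y J n f' a" "\<forall>v\<in>space V. f' v = f v" "rel R y J m g' b" "\<forall>v\<in>space V. g' v = g v"
  unfolding lift_def by blast
 have "rel R y J (n + m) (\<lambda>v. f' v * g' v) (a \<otimes> b)" by (rule rel_mult[OF r(1) yJ r(3)])
 then show ?thesis by (rule liftI) (use r in simp)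
qed

lemma lift_mono: "lift n f \<Longrightarrow> n \<le> m \<Longrightarrow> lift m f"
 unfolding lift_def by (elim exE conjE) (intro exI conjI, erule rel_mono)

lemma lift_sum: "(\<And>i. i \<in> S \<Longrightarrow> lift n (F i)) \<Longrightarrow> lift n (\<lambda>v. \<Sum>i\<in>S. F i v)"
 by (induction S rule: infinite_finite_induct) (simp_all add: lift_const lift_add)

lemma lift_form: assumes l: "linear_form V l" shows "lift 1 l"
proof -
 let ?d = "\<lambda>i j. if j = i then (1::'k) else 0"
 have "lift (Suc 0) (\<lambda>v. v i)" if "i \<in> J" for i by (rule liftI[OF rel.var[OF that rel.const[of R y J 0 1]]]) simp
 then have "lift (Suc 0 + 0) (\<lambda>v. v i * l (?d i))" if "i \<in> J" for i by (rule lift_mult[OF _ lift_const]) (rule that)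
 then have "lift 1 (\<lambda>v. \<Sum>i\<in>J. v i * l (?d i))" by (intro lift_sum) simp
 then show ?thesis
 proof (rule lift_cong)
  fix v assume v: "v \<in> space V"
  have d: "?d i \<in> space V" if "i \<in> J" for i using that by (auto simp: space_cofree)
  have "l v = l (\<Sum>i\<in>J. scal V (v i) (?d i))" by (rule arg_cong[OF cofree_expand[OF fin_T finite_G v]])
  also have "\<dots> = (\<Sum>i\<in>J. l (scal V (v i) (?d i)))" by (rule V.linear_form_sum[OF l V.scal_mem[OF d]])
  also have "\<dots> = (\<Sum>i\<in>J. v i * l (?d i))" by (rule sum.cong[OF refl]) (use l d in \<open>simp add: linear_form_def\<close>)
  finally show "(\<Sum>i\<in>J. v i * l (?d i)) = l v" by simp
 qed
qed

lemma lift_hp: "hp V n f \<Longrightarrow> lift n f"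
proof (induction rule: hp_induct)
 case (cong f g) show ?case by (rule lift_cong[OF cong(2) cong(1)])
next
 case zero show ?case by (rule lift_const)
next
 case (add f g) show ?case by (rule lift_add[OF add])
next
 case (prod c l)
 have "lift d (\<lambda>v. \<Prod>i<d. l i v)" if "d \<le> n" for d
  using that
 proof (induction d)
  case 0 show ?case using lift_const by simp
 next
  case (Suc d)
  have "lift (d + 1) (\<lambda>v. (\<Prod>i<d. l i v) * l d v)" by (rule lift_mult[OF Suc.IH lift_form[OF prod]]) (use Suc.prems in simp_all)
  then show ?case by simp
 qed
 from lift_mult[OF lift_const[of 0 c] this[OF order_refl]] show ?case by simp
qed

lemma lift_hle: assumes "hle V n f" shows "lift n f"
proof -
 from assms obtain F where F: "\<And>d. d \<le> n \<Longrightarrow> hp V d (F d)" "\<And>v. v \<in> space V \<Longrightarrow> f v = (\<Sum>d\<le>n. F d v)" by (auto simp: hle_def)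
 have "lift n (\<lambda>v. \<Sum>d\<le>n. F d v)" by (rule lift_sum, rule lift_mono[OF lift_hp[OF F(1)]]) simp_all
 then show ?thesis by (rule lift_cong) (simp add: F(2))
qed

text \<open>Each summand f(g v) of the average corresponds to g^-1 a = a, so a partial sum over S
  corresponds to |S| a; finally |G| is divided out.\<close>

lemma rel_rey:
 assumes r: "rel R y J n f a" and a: "a \<in> Fix"
 shows "\<exists>f'. rel R y J n f' a \<and> (\<forall>v\<in>space V. f' v = rey G V f v)"
proof -
 have ac: "a \<in> carrier R" using a by blast
 have "\<exists>f'. rel R y J n f' (of_nat (card S) \<odot> a) \<and> (\<forall>v\<in>space V. f' v = (\<Sum>g\<in>S. f (act V g v)))"
  if "finite S" "S \<subseteq> carrier G" for S
  using that
 proof (induction S)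
  case empty
  show ?case using rel.const[of R y J n 0] ac by (intro exI[of _ "\<lambda>_. 0"]) simp
 next
  case (insert g S)
  then obtain f' where f': "rel R y J n f' (of_nat (card S) \<odot> a)" "\<forall>v\<in>space V. f' v = (\<Sum>g\<in>S. f (act V g v))" by blast
  have g: "g \<in> carrier G" using insert.prems by simp
  obtain h where h: "rel R y J n h (\<phi> (inv\<^bsub>G\<^esub> g) a)" "\<forall>v\<in>space V. h v = f (act V g v)" using rel_act[OF r g] by blast
  have e: "\<phi> (inv\<^bsub>G\<^esub> g) a = 1 \<odot> a" using a g ac by simp
  have "rel R y J n (\<lambda>v. h v + f' v) (of_nat (card (insert g S)) \<odot> a)"
   using rel.add[OF h(1) f'(1)] unfolding e smult_l[OF ac, symmetric] card_insert_disjoint[OF insert.hyps] of_nat_Suc .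
  moreover have "h v + f' v = (\<Sum>g\<in>insert g S. f (act V g v))" if "v \<in> space V" for v
   unfolding sum.insert[OF insert.hyps] using bspec[OF h(2) that] bspec[OF f'(2) that] by (simp only:)
  ultimately show ?case by blast
 qed
 from this[OF finite_G order_refl] obtain F where F: "rel R y J n F (of_nat (card (carrier G)) \<odot> a)"
  "\<forall>v\<in>space V. F v = (\<Sum>g\<in>carrier G. f (act V g v))" by blast
 have "rel R y J n (\<lambda>v. inverse (of_nat (card (carrier G))) * F v) a"
  using rel_smult[OF F(1) yJ, of "inverse (of_nat (card (carrier G)))"]
  unfolding smult_smult[OF ac] left_inverse[OF card_G] smult_1[OF ac] .
 moreover have "inverse (of_nat (card (carrier G))) * F v = rey G V f v" if "v \<in> space V" for v
  unfolding rey_def bspec[OF F(2) that] ..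
 ultimately show ?thesis by blast
qed

text \<open>By \<open>rel_rey\<close> the function f with image a can be averaged without changing
  its image. The average is generated by invariants of degree at most b, whose images are fixed by
  equivariance and lie in degrees at most b.\<close>

lemma fixed_generated:
 assumes b: "GC G V b" and r: "rel R y J n f a" and a: "a \<in> Fix"
 shows "a \<in> generate_ring Rfix (comp_upto Rfix (\<lambda>d. A d \<inter> carrier Rfix) b)"
proof -
 let ?Q = "generate_ring Rfix (comp_upto Rfix (\<lambda>d. A d \<inter> carrier Rfix) b)"
 have fixed_lift: "\<exists>n h' c. rel R y J n h' c \<and> (\<forall>v\<in>space V. h' v = h v) \<and> c \<in> ?Q" if h: "hle V b h" "invf G V h" for h
 proof -
  obtain h' c where c: "rel R y J b h' c" "\<forall>v\<in>space V. h' v = h v" using lift_hle[OF h(1)] unfolding lift_def by blast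
  have "\<phi> g c = c" if g: "g \<in> carrier G" for g
  proof -
   \<comment> \<open>g c is the image of h' composed with the action of g^-1, which is h' itself on
     V.\<close>
   obtain k where k: "rel R y J b k (\<phi> (inv\<^bsub>G\<^esub> (inv\<^bsub>G\<^esub> g)) c)" "\<forall>v\<in>space V. k v = h' (act V (inv\<^bsub>G\<^esub> g) v)"
    using rel_act[OF c(1), of "inv\<^bsub>G\<^esub> g"] g by auto
   have "\<phi> (inv\<^bsub>G\<^esub> (inv\<^bsub>G\<^esub> g)) c = c"
    by (rule rel_V_functional[OF k(1) c(1)]) (use k(2) c(2) h(2) g in \<open>simp add: invf_def\<close>)
   then show ?thesis using g by simp
  qed
  then have "c \<in> Fix" using rel_carrier[OF c(1) yJ] by blast
  from comp_upto_fixed[OF rel_comp_upto[OF c(1) T_sub] this] have "c \<in> ?Q" by (rule generate_ring.incl)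
  then show ?thesis using c by blast
 qed
 have Q: "a \<oplus> c \<in> ?Q" "a \<otimes> c \<in> ?Q" if "a \<in> ?Q" "c \<in> ?Q" for a c
  using generate_ring.eng_add[OF that] generate_ring.eng_mult[OF that] by (simp_all add: fixed_alg_def)
 have "\<exists>n h' c. rel R y J n h' c \<and> (\<forall>v\<in>space V. h' v = h v) \<and> c \<in> ?Q" if "h \<in> alg (space V) {f. hle V b f \<and> invf G V f}" for h
  using that
 proof (induction rule: alg.induct)
  case (const c)
  have "hle V b (\<lambda>_. c)" by (rule hp_hle[OF hp_const]) simp
  then show ?case by (rule fixed_lift) (simp add: invf_def)
 next
  case (incl f) then show ?case using fixed_lift by blast
 next
  case (add f g)
  then obtain n f' c m g' d where s: "rel R y J n f' c" "\<forall>v\<in>space V. f' v = f v" "c \<in> ?Q"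
   "rel R y J m g' d" "\<forall>v\<in>space V. g' v = g v" "d \<in> ?Q" by (elim exE conjE)
  have "rel R y J (max n m) (\<lambda>v. f' v + g' v) (c \<oplus> d)" by (rule rel.add[OF rel_mono[OF s(1)] rel_mono[OF s(4)]]) simp_all
  moreover have "\<forall>v\<in>space V. f' v + g' v = f v + g v" using s(2,5) by simp
  ultimately show ?case using Q(1)[OF s(3,6)] by blast
 next
  case (mult f g)
  then obtain n f' c m g' d where s: "rel R y J n f' c" "\<forall>v\<in>space V. f' v = f v" "c \<in> ?Q"
   "rel R y J m g' d" "\<forall>v\<in>space V. g' v = g v" "d \<in> ?Q" by (elim exE conjE)
  have "rel R y J (n + m) (\<lambda>v. f' v * g' v) (c \<otimes> d)" by (rule rel_mult[OF s(1) yJ s(4)])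
  moreover have "\<forall>v\<in>space V. f' v * g' v = f v * g v" using s(2,5) by simp
  ultimately show ?case using Q(2)[OF s(3,6)] by blast
 next
  case (cong f g)
  then obtain n f' c where s: "rel R y J n f' c" "\<forall>v\<in>space V. f' v = f v" "c \<in> ?Q" by (elim exE conjE)
  have "\<forall>v\<in>space V. f' v = g v" using s(2) cong.hyps(2) by simp
  then show ?case using s(1,3) by blast
 qed
 moreover have "rey G V f \<in> alg (space V) {f. hle V b f \<and> invf G V f}" using b V.rey_pf[OF rel_pf[OF r]] V.rey_inv unfolding GC_def by blast
 ultimately obtain m h' c where s: "rel R y J m h' c" "\<forall>v\<in>space V. h' v = rey G V f v" "c \<in> ?Q" by blast
 obtain f' where f': "rel R y J n f' a" "\<forall>v\<in>space V. f' v = rey G V f v" using rel_rey[OF r a] by blast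
 have "a = c" by (rule rel_V_functional[OF f'(1) s(1)]) (use f'(2) s(2) in simp)
 then show ?thesis using s(3) by simp
qed

end

text \<open>A given fixed element involves only finitely many generators, so it is reached from a
  finite T. This T depends on the element, the bound b does not.\<close>

lemma (in galg) beta_fixed_le:
 assumes gc: "\<And>T :: 'a set. finite T \<Longrightarrow> GC G (cofree G T :: ('k, 'g, 'a \<times> 'g \<Rightarrow> 'k) gmod) b"
 shows "beta_fixed G R A \<phi> \<le> enat b"
proof -
 let ?C = "comp_upto Rfix (\<lambda>d. A d \<inter> carrier Rfix) b"
 interpret F: ring Rfix using subring_is_ring[OF subring_Fix] by (simp add: fixed_alg_def)
 have cF: "carrier Rfix = Fix" by (simp add: fixed_alg_def)
 have "?C \<subseteq> carrier Rfix"
  unfolding comp_upto_def by (auto intro!: F.finsum_closed)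
 then have "generate_ring Rfix ?C \<subseteq> carrier Rfix" using F.generate_ring_in_carrier by blast
 moreover have "a \<in> generate_ring Rfix ?C" if a: "a \<in> Fix" for a
 proof -
  have "a \<in> carrier R" using a by blast
  then obtain n f where "rel R y ((A 0 \<union> A 1) \<times> carrier G) n f a" using rel_exists by blast
  from rel_finite[OF this] obtain J where J: "finite J" "J \<subseteq> (A 0 \<union> A 1) \<times> carrier G" "\<And>K. J \<subseteq> K \<Longrightarrow> rel R y K n f a"
   by blast
  interpret cogalg G R A \<phi> "fst ` J" using J(1,2) by unfold_locales auto
  have "rel R y (fst ` J \<times> carrier G) n f a" by (rule J(3)) (use J(2) in force)
  from fixed_generated[OF gc this a] show ?thesis using J(1) by simp
 qed
 ultimately have "generate_ring Rfix ?C = carrier Rfix" unfolding cF by blast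
 then show ?thesis unfolding beta_fixed_def beta_def by (intro Inf_lower) blast
qed

section \<open>The hypothesis on the characteristic, applied to an arbitrary module\<close>

context
 fixes G :: "('g, 'b) monoid_scheme" and V :: "('k::alg_closed_field, 'g, 'w::ab_group_add) gmod"
 assumes G: "group G" "finite (carrier G)" and c: "of_nat (card (carrier G)) \<noteq> (0 :: 'k)" and V: "gm G V" "fin_dim V"
begin

abbreviation (input) "reg \<equiv> regular_rep G :: ('k, 'g, 'g \<Rightarrow> 'k) gmod"

lemma sum_gm: "gm G (gsum reg V)" "fin_dim (gsum reg V)"
 using regular_gmod[OF G, where 'k = 'k] regular_fin_dim[OF G, where 'k = 'k] V gsum_gmod gsum_fin_dim by blast+

lemma sum_regsum: "isotypic_decomp G (gsum reg V) r M m \<Phi> \<Longrightarrow> regsum G V r M m \<Phi>"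
 using sum_gm c V(1) by (simp add: regsum_def isod_def isod_axioms_def)

text \<open>If \<beta> is a finite N, all invariants are generated in degrees at most N, and N is
  admissible by hypothesis. If \<beta> is infinite, every degree is admissible, and N may depend on
  f: its own degree is taken.\<close>

lemma generated_in_admissible_degree:
 fixes r M m \<Phi>
 assumes "isotypic_decomp G (gsum reg V) r M m \<Phi>" and u: "large_universe TYPE('k) TYPE('a)"
  and b: "ereal_of_enat (char_or_infinity TYPE('k)) \<ge>
      ereal_of_enat (beta_grp TYPE('k) TYPE('a) G) / ereal_of_enat (ell TYPE('k) G) + 1"
  and f: "pf V f" "invf G V f"
 shows "\<exists>N. f \<in> alg (space V) {h. hle V N h \<and> invf G V h} \<and> isod.cnd (gsum reg V) r M N"
proof -
 interpret regsum G V r M m \<Phi> by (rule sum_regsum) fact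
 show ?thesis
 proof (cases "beta_grp TYPE('k) TYPE('a) G")
  case (enat N)
  have "GC G V N" by (rule GC_of_beta_grp[OF V c u enat])
  moreover have "cnd N" by (rule cnd_of_bound[OF b]) (simp add: enat)
  ultimately show ?thesis using f unfolding GC_def by blast
 next
  case infinity
  obtain N where "hle V N f" using pf_hle[OF f(1)] by blast
  then have "f \<in> alg (space V) {h. hle V N h \<and> invf G V h}" using f(2) by (intro alg.incl) simp
  moreover have "cnd N" by (rule cnd_of_bound[OF b]) (simp add: infinity)
  ultimately show ?thesis by blast
 qed
qed

end

theorem corollary7p4:
  fixes G :: "'g monoid"
  assumes "group G" and "finite (carrier G)"
    and "of_nat (card (carrier G)) \<noteq> (0 :: 'k::alg_closed_field)"
    and "large_universe TYPE('k) TYPE('a)"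
    and "ereal_of_enat (char_or_infinity TYPE('k)) \<ge>
           ereal_of_enat (beta_grp TYPE('k) TYPE('a) G) / ereal_of_enat (ell TYPE('k) G) + 1"
  shows "weakly_universal_invariants TYPE('v::ab_group_add) G (regular_rep G :: ('k, 'g, 'g \<Rightarrow> 'k) gmod) \<and>
         beta_grp TYPE('k) TYPE('a) G = beta_poly_inv G (regular_rep G :: ('k, 'g, 'g \<Rightarrow> 'k) gmod)"
proof
 let ?U = "regular_rep G :: ('k, 'g, 'g \<Rightarrow> 'k) gmod"
 have U: "gm G ?U" "fin_dim ?U" by (rule regular_gmod[OF assms(1,2)], rule regular_fin_dim[OF assms(1,2)])
 show "weakly_universal_invariants TYPE('v) G ?U"
  unfolding weakly_universal_invariants_def
 proof (intro conjI allI impI)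
  show "is_gmod G ?U" using U(1) by (simp add: gm_def)
  show "fin_dim ?U" by (rule U(2))
  fix V :: "('k, 'g, 'v) gmod" assume "is_gmod G V \<and> fin_dim V"
  then have V: "gm G V" "fin_dim V" using assms(1,2) by (simp_all add: gm_def)
  show "\<exists>r M m \<Phi>. isotypic_decomp G (gsum ?U V) r M m \<Phi>" by (rule gm.isotypic_decomp_exists[OF sum_gm[OF assms(1-3) V] assms(3)])
  fix r M m \<Phi> S assume d: "isotypic_decomp G (gsum ?U V) r M m \<Phi>" and S: "generates_algebra (poly_inv G ?U) S"
  interpret regsum G V r M m \<Phi> by (rule sum_regsum[OF assms(1-3) V d])
  show "generates_algebra (poly_inv G V) (Res_sum V (Pol (gsum ?U V) r M m \<Phi> (Ext_sum ?U V S)))"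
   by (rule generates_Res_Pol[OF generated_in_admissible_degree[OF assms(1-3) V d assms(4,5)] S])
 qed
 show "beta_grp TYPE('k) TYPE('a) G = beta_poly_inv G ?U"
 proof (rule antisym)
  show "beta_poly_inv G ?U \<le> beta_grp TYPE('k) TYPE('a) G"
   unfolding beta_poly_inv_eq[OF U(1) assms(3)] by (rule beta_grp_ge[OF U assms(3,4)])
  show "beta_grp TYPE('k) TYPE('a) G \<le> beta_poly_inv G ?U"
  proof (cases "beta_poly_inv G ?U")
   case (enat b)
   then have "Inf {enat n | n. GC G ?U n} \<le> enat b" unfolding beta_poly_inv_eq[OF U(1) assms(3)] by simp
   from Inf_enat_attained[OF this] have b: "GC G ?U b" using GC_mono by blast
   show ?thesis unfolding enat beta_grp_def
   proof (rule Sup_least)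
    fix x assume "x \<in> {beta_fixed G R A \<phi> | (R :: ('k, 'a) module) A \<phi>.
      graded_algebra R A \<and> graded_G_action G R A \<phi> \<and> beta R A \<le> 1}"
    then obtain R :: "('k, 'a) module" and A \<phi> where x: "x = beta_fixed G R A \<phi>"
     and R: "graded_algebra R A" "graded_G_action G R A \<phi>" "beta R A \<le> 1" by blast
    interpret galg G R A \<phi> using assms(1-3) R by (simp add: galg_def)
    show "x \<le> enat b" unfolding x
    \<comment> \<open>Each algebra of the supremum is controlled by cofree modules, to which the
      bound b of R is transferred.\<close>
    proof (rule beta_fixed_le)
     fix T :: "'a set" assume T: "finite T"
     let ?V = "cofree G T :: ('k, 'g, 'a \<times> 'g \<Rightarrow> 'k) gmod"
     have V: "gm G ?V" "fin_dim ?V" by (rule cofree_gmod[OF assms(1,2)], rule cofree_fin_dim[OF assms(1,2) T])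
     obtain r M m \<Phi> where d: "isotypic_decomp G (gsum ?U ?V) r M m \<Phi>" using gm.isotypic_decomp_exists[OF sum_gm[OF assms(1-3) V] assms(3)] by (elim exE)
     interpret regsum G ?V r M m \<Phi> by (rule sum_regsum[OF assms(1-3) V d])
     show "GC G ?V b" by (rule GC_transfer[OF assms(3) b generated_in_admissible_degree[OF assms(1-3) V d assms(4,5)]])
    qed
   qed
  qed simp
 qed
qed

end
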